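(* There exists a data structure for the static retrieval problem (with a set $\mathcal{D}\subseteq\mathcal{U}$ of $n$ elements and labels $f:\mathcal{D}\to\{0,1\}^k$) with the following guarantees: (1) Every query, and every update of $f(x)$ for $x\in\mathcal{D}$, can be completed using at most $4\cdot \frac{k}{w} + O(1)$ memory accesses. (2) The time it takes to construct the data structure is $O(n)$ with high probability. (3) The required space is $(1+o(1))\cdot nk + O(n)$ bits, where the $o(1)$ term tends to $0$ as $n\to\infty$.
   Context: Static retrieval problem: the input is a fixed set $\mathcal{D}\subseteq\mathcal{U}$ with $|\mathcal{D}|=n$ and a function $f:\mathcal{D}\to\{0,1\}^k$. A query on $x\in\mathcal{U}$ must return $f(x)$ if $x\in\mathcal{D}$; if $x\notin\mathcal{D}$ any value in $\{0,1\}^k$ may be returned. An update changes $f(x)$ for some $x\in\mathcal{D}$. Model: word RAM with word length $w=\Omega(\log n)$ bits, cost measured in memory accesses; access to perfectly random hash functions with constant evaluation time whose storage is not counted. "With high probability" means with probability at least $1-1/n^{c}$ for a constant $c$.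
   Formalization: Guarantee (2) is proved as O(n·max(1, k/w)) memory accesses with high probability, which is O(n) when k = O(w); for unbounded k/w the stated O(n) is impossible, since writing the n labels of k bits alone takes about nk/w accesses. *)

theory Defs
  imports "HOL-Probability.Probability" "HOL-Library.Log_Nat"
begin

section \<open>A word RAM with random hash functions\<close>

text \<open>
  Programs are finite and therefore mention finitely many registers. They are uniform: the same
  program is used for all input sizes, label lengths and word lengths. The memory consists of two
  arrays of \<open>w\<close>-bit words: \<open>Struct\<close> holds the data structure, \<open>Work\<close> is used for input, output and
  temporary data. Accesses to both arrays are charged.

  Elements of the universe are opaque. A program can only apply hash functions to the elements
  it has been given, the \<open>i\<close>-th of which is designated by the number \<open>i\<close>.
\<close>

datatype binop = Plus | Minus | Times | Divide | Modulo | BAnd | BOr | BXor | ShiftL | ShiftR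
  | Less | Equal

datatype rexp = Const nat | Reg nat | Bin binop rexp rexp

datatype bank = Struct | Work

datatype com =
    Skip
  | Assign nat rexp                \<comment> \<open>register, value\<close>
  | Load nat bank rexp             \<comment> \<open>register, array, address\<close>
  | Store bank rexp rexp           \<comment> \<open>array, address, value\<close>
  | Hash nat rexp rexp rexp        \<comment> \<open>register, index of the function, size of its range, element\<close>
  | Fresh                          \<comment> \<open>switch to a new, independent family of hash functions\<close>
  | Seq com com
  | If rexp com com
  | While rexp com

fun binop_sem :: "binop \<Rightarrow> nat \<Rightarrow> nat \<Rightarrow> nat" where
  "binop_sem Plus a b = a + b"
| "binop_sem Minus a b = a - b"
| "binop_sem Times a b = a * b"
| "binop_sem Divide a b = a div b"
| "binop_sem Modulo a b = a mod b"
| "binop_sem BAnd a b = semiring_bit_operations_class.and a b"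
| "binop_sem BOr a b = semiring_bit_operations_class.or a b"
| "binop_sem BXor a b = semiring_bit_operations_class.xor a b"
| "binop_sem ShiftL a b = push_bit b a"
| "binop_sem ShiftR a b = drop_bit b a"
| "binop_sem Less a b = of_bool (a < b)"
| "binop_sem Equal a b = of_bool (a = b)"

text \<open>Registers have \<open>W\<close> bits; every intermediate result is reduced modulo \<open>2 ^ W\<close>.\<close>

fun eval :: "nat \<Rightarrow> (nat \<Rightarrow> nat) \<Rightarrow> rexp \<Rightarrow> nat" where
  "eval W R (Const a) = take_bit W a"
| "eval W R (Reg r) = take_bit W (R r)"
| "eval W R (Bin b x y) = take_bit W (binop_sem b (eval W R x) (eval W R y))"

text \<open>
  A hash function is determined by the number of the family it belongs to, its index in this
  family, and the size \<open>m\<close> of its range \<open>{..<m}\<close>. All values of all hash functions are independent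
  and uniformly distributed. (The value for \<open>m = 0\<close> is immaterial.)
\<close>

type_synonym 'u hash = "nat \<times> nat \<times> nat \<times> 'u \<Rightarrow> nat"

definition hash_space :: "'u hash measure" where
  "hash_space = (\<Pi>\<^sub>M (e, i, m, x) \<in> UNIV. uniform_count_measure {..<max 1 m})"

lemma prob_space_hash_space: "prob_space (hash_space :: 'u hash measure)"
proof -
  have "prob_space (uniform_count_measure {..<max 1 m})" for m :: nat
  proof (rule prob_space_uniform_count_measure)
    have "0 \<in> {..<max 1 m}" by simp
    then show "{..<max 1 m} \<noteq> {}" by blast
  qed simp
  then show ?thesis
    unfolding hash_space_def by (intro prob_space_PiM) (simp split: prod.split)
qed

record config =
  regs :: "nat \<Rightarrow> nat"
  mem :: "bank \<Rightarrow> nat \<Rightarrow> nat"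
  family :: nat

text \<open>
  \<open>exec w W h xs c \<sigma> t \<sigma>'\<close>: started in \<open>\<sigma>\<close> with the elements \<open>xs\<close>, the program \<open>c\<close> halts in \<open>\<sigma>'\<close>
  at cost \<open>t\<close>. The cost is the number of memory accesses plus the number of uses of the source
  of hash functions. Operations on registers are free.
\<close>

inductive exec ::
    "nat \<Rightarrow> nat \<Rightarrow> 'u hash \<Rightarrow> 'u list \<Rightarrow> com \<Rightarrow> config \<Rightarrow> nat \<Rightarrow> config \<Rightarrow> bool"
  for w W :: nat and h :: "'u hash" and xs :: "'u list" where
  Skip: "exec w W h xs Skip \<sigma> 0 \<sigma>"
| Assign: "exec w W h xs (Assign r a) \<sigma> 0 (\<sigma>\<lparr>regs := (regs \<sigma>)(r := eval W (regs \<sigma>) a)\<rparr>)"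
| Load: "exec w W h xs (Load r b a) \<sigma> 1
    (\<sigma>\<lparr>regs := (regs \<sigma>)(r := take_bit W (mem \<sigma> b (eval W (regs \<sigma>) a)))\<rparr>)"
| Store: "exec w W h xs (Store b a v) \<sigma> 1
    (\<sigma>\<lparr>mem := (mem \<sigma>)(b := (mem \<sigma> b)
        (eval W (regs \<sigma>) a := take_bit w (eval W (regs \<sigma>) v)))\<rparr>)"
| Hash: "exec w W h xs (Hash r i m x) \<sigma> 1
    (\<sigma>\<lparr>regs := (regs \<sigma>)(r :=
        if eval W (regs \<sigma>) x < length xs
        then h (family \<sigma>, eval W (regs \<sigma>) i, eval W (regs \<sigma>) m, xs ! eval W (regs \<sigma>) x)
        else 0)\<rparr>)"
| Fresh: "exec w W h xs Fresh \<sigma> 1 (\<sigma>\<lparr>family := Suc (family \<sigma>)\<rparr>)"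
| Seq: "exec w W h xs c1 \<sigma> t1 \<sigma>1 \<Longrightarrow> exec w W h xs c2 \<sigma>1 t2 \<sigma>2 \<Longrightarrow>
    exec w W h xs (Seq c1 c2) \<sigma> (t1 + t2) \<sigma>2"
| IfTrue: "eval W (regs \<sigma>) b \<noteq> 0 \<Longrightarrow> exec w W h xs c1 \<sigma> t \<sigma>' \<Longrightarrow>
    exec w W h xs (If b c1 c2) \<sigma> t \<sigma>'"
| IfFalse: "eval W (regs \<sigma>) b = 0 \<Longrightarrow> exec w W h xs c2 \<sigma> t \<sigma>' \<Longrightarrow>
    exec w W h xs (If b c1 c2) \<sigma> t \<sigma>'"
| WhileFalse: "eval W (regs \<sigma>) b = 0 \<Longrightarrow> exec w W h xs (While b c) \<sigma> 0 \<sigma>"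
| WhileTrue: "eval W (regs \<sigma>) b \<noteq> 0 \<Longrightarrow> exec w W h xs c \<sigma> t1 \<sigma>1 \<Longrightarrow>
    exec w W h xs (While b c) \<sigma>1 t2 \<sigma>2 \<Longrightarrow>
    exec w W h xs (While b c) \<sigma> (t1 + t2) \<sigma>2"

inductive_cases SeqE: "exec w W h xs (Seq c1 c2) \<sigma> t \<sigma>'"
inductive_cases IfE: "exec w W h xs (If b c1 c2) \<sigma> t \<sigma>'"
inductive_cases WhileE: "exec w W h xs (While b c) \<sigma> t \<sigma>'"

lemma exec_deterministic:
  "exec w W h xs c \<sigma> t \<sigma>' \<Longrightarrow> exec w W h xs c \<sigma> u \<tau> \<Longrightarrow> u = t \<and> \<tau> = \<sigma>'"
proof (induction arbitrary: u \<tau> rule: exec.induct)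
  case (Seq c1 \<sigma> t1 \<sigma>1 c2 t2 \<sigma>2)
  from Seq.prems obtain s1 \<rho> s2 where
    run: "u = s1 + s2" "exec w W h xs c1 \<sigma> s1 \<rho>" "exec w W h xs c2 \<rho> s2 \<tau>"
    by (rule SeqE)
  from Seq.IH(1)[OF run(2)] have "s1 = t1" "\<rho> = \<sigma>1" by simp_all
  with Seq.IH(2) run show ?case by simp
next
  case (IfTrue \<sigma> b c1 t \<sigma>' c2)
  from IfTrue.prems show ?case
  proof (rule IfE)
  qed (use IfTrue.hyps(1) IfTrue.IH in auto)+
next
  case (IfFalse \<sigma> b c2 t \<sigma>' c1)
  from IfFalse.prems show ?case
  proof (rule IfE)
  qed (use IfFalse.hyps(1) IfFalse.IH in auto)+
next
  case (WhileFalse \<sigma> b c)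
  from WhileFalse.prems show ?case
  proof (rule WhileE)
  qed (use WhileFalse.hyps(1) in auto)
next
  case (WhileTrue \<sigma> b c t1 \<sigma>1 t2 \<sigma>2)
  from WhileTrue.prems obtain s1 \<rho> s2 where
    run: "u = s1 + s2" "exec w W h xs c \<sigma> s1 \<rho>" "exec w W h xs (While b c) \<rho> s2 \<tau>"
  proof (rule WhileE)
  qed (use WhileTrue.hyps(1) in blast)+
  from WhileTrue.IH(1)[OF run(2)] have "s1 = t1" "\<rho> = \<sigma>1" by simp_all
  with WhileTrue.IH(2) run show ?case by simp
next
  case Skip then show ?case by cases simp
next
  case Assign then show ?case by cases simp
next
  case Load then show ?case by cases simp
next
  case Store then show ?case by cases simp
next
  case Hash then show ?case by cases simp
next
  case Fresh then show ?case by cases simp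
qed

text \<open>Every program is started with \<open>n\<close>, \<open>k\<close> and \<open>w\<close> in the registers 0, 1 and 2.\<close>

definition start ::
    "nat \<Rightarrow> nat \<Rightarrow> nat \<Rightarrow> nat \<Rightarrow> (nat \<Rightarrow> nat) \<Rightarrow> (nat \<Rightarrow> nat) \<Rightarrow> config" where
  "start n k w e A B =
     \<lparr>regs = (\<lambda>_. 0)(0 := n, 1 := k, 2 := w), mem = case_bank A B, family = e\<rparr>"


section \<open>Retrieval data structures\<close>

text \<open>Labels are bit strings, represented in memory by blocks of \<open>\<lceil>k/w\<rceil>\<close> words.\<close>

definition label_word :: "nat \<Rightarrow> bool list \<Rightarrow> nat \<Rightarrow> nat" where
  "label_word w y j = horner_sum of_bool 2 (take w (drop (j * w) y))"

definition label_array :: "nat \<Rightarrow> nat \<Rightarrow> bool list list \<Rightarrow> nat \<Rightarrow> nat" where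
  "label_array k w ys a =
     (let L = nat \<lceil>real k / real w\<rceil>
      in if a < length ys * L then label_word w (ys ! (a div L)) (a mod L) else 0)"

text \<open>
  \<open>space_bits S n k w\<close> is the number of bits occupied by the data structure. A register consists
  of \<open>reg_words S\<close> many words, so that for \<open>w = \<Omega>(log n)\<close> a register can hold an address; for
  labels so long that \<open>k \<ge> 2 ^ w\<close>, registers grow with \<open>log k\<close> for the same reason.
\<close>

record scheme =
  builder :: com
  querier :: com
  updater :: com
  reg_words :: nat
  space_bits :: "nat \<Rightarrow> nat \<Rightarrow> nat \<Rightarrow> nat"

definition reg_width :: "scheme \<Rightarrow> nat \<Rightarrow> nat \<Rightarrow> nat" where
  "reg_width S k w = reg_words S * (w + floorlog 2 k)"

text \<open>The first \<open>s\<close> bits of an array; everything else is cleared.\<close>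

definition truncate_mem :: "nat \<Rightarrow> nat \<Rightarrow> (nat \<Rightarrow> nat) \<Rightarrow> nat \<Rightarrow> nat" where
  "truncate_mem w s A a = take_bit (min w (s - a * w)) (A a)"

definition build_run :: "scheme \<Rightarrow> nat \<Rightarrow> nat \<Rightarrow> 'u hash \<Rightarrow> 'u list \<Rightarrow> ('u \<Rightarrow> bool list)
    \<Rightarrow> nat \<Rightarrow> config \<Rightarrow> bool" where
  "build_run S k w h xs f t \<sigma> \<longleftrightarrow>
     exec w (reg_width S k w) h xs (builder S)
       (start (length xs) k w 0 (\<lambda>_. 0) (label_array k w (map f xs))) t \<sigma>"

definition query_run :: "scheme \<Rightarrow> nat \<Rightarrow> nat \<Rightarrow> nat \<Rightarrow> 'u hash \<Rightarrow> nat \<Rightarrow> (nat \<Rightarrow> nat) \<Rightarrow> 'u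
    \<Rightarrow> nat \<Rightarrow> config \<Rightarrow> bool" where
  "query_run S n k w h e A x t \<sigma> \<longleftrightarrow>
     exec w (reg_width S k w) h [x] (querier S) (start n k w e A (\<lambda>_. 0)) t \<sigma>"

definition update_run :: "scheme \<Rightarrow> nat \<Rightarrow> nat \<Rightarrow> nat \<Rightarrow> 'u hash \<Rightarrow> nat \<Rightarrow> (nat \<Rightarrow> nat) \<Rightarrow> 'u
    \<Rightarrow> bool list \<Rightarrow> nat \<Rightarrow> config \<Rightarrow> bool" where
  "update_run S n k w h e A x y t \<sigma> \<longleftrightarrow>
     exec w (reg_width S k w) h [x] (updater S) (start n k w e A (label_word w y)) t \<sigma>"

text \<open>
  \<open>represents S k w h xs f e A g\<close>: the memory content \<open>A\<close>, together with the \<open>e\<close>-th family of hash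
  functions, results from building the data structure for the elements \<open>xs\<close> and the labels \<open>f\<close>
  and then performing a sequence of updates which turns \<open>f\<close> into \<open>g\<close>. Only the first
  \<open>space_bits S n k w\<close> bits of \<open>Struct\<close> survive the end of an operation.
\<close>

inductive represents :: "scheme \<Rightarrow> nat \<Rightarrow> nat \<Rightarrow> 'u hash \<Rightarrow> 'u list \<Rightarrow> ('u \<Rightarrow> bool list)
    \<Rightarrow> nat \<Rightarrow> (nat \<Rightarrow> nat) \<Rightarrow> ('u \<Rightarrow> bool list) \<Rightarrow> bool"
  for S :: scheme and k w :: nat and h :: "'u hash" and xs :: "'u list"
    and f :: "'u \<Rightarrow> bool list" where
  built: "build_run S k w h xs f t \<sigma> \<Longrightarrow>
    represents S k w h xs f (family \<sigma>)
      (truncate_mem w (space_bits S (length xs) k w) (mem \<sigma> Struct)) f"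
| updated: "represents S k w h xs f e A g \<Longrightarrow> x \<in> set xs \<Longrightarrow> length y = k \<Longrightarrow>
    update_run S (length xs) k w h e A x y t \<sigma> \<Longrightarrow>
    represents S k w h xs f e
      (truncate_mem w (space_bits S (length xs) k w) (mem \<sigma> Struct)) (g(x := y))"

text \<open>
  A problem instance for the set \<open>D\<close>. The set is presented to the construction algorithm as a list
  in arbitrary order. The real number \<open>\<gamma>\<close> is the constant in \<open>w = \<Omega>(log n)\<close>.
\<close>

definition retrieval_instance ::
    "real \<Rightarrow> nat \<Rightarrow> nat \<Rightarrow> nat \<Rightarrow> 'u set \<Rightarrow> 'u list \<Rightarrow> ('u \<Rightarrow> bool list) \<Rightarrow> bool" where
  "retrieval_instance \<gamma> n k w D xs f \<longleftrightarrow>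
     1 \<le> n \<and> 1 \<le> w \<and> \<gamma> * log 2 (real n) \<le> real w \<and>
     finite D \<and> card D = n \<and> set xs = D \<and> distinct xs \<and> (\<forall>x\<in>D. length (f x) = k)"

end

theory Submission
  imports Defs
begin

text \<open>
  The elements are hashed to about \<open>n / log n\<close> groups. The elements of a group form a binary trie of
  their hash values, and an element is stored at the offset of its group plus the rank of its leaf,
  so that exactly \<open>n\<close> slots of \<open>k\<close> bits are needed. A random trie with \<open>O(log n)\<close> elements has
  \<open>O(log n)\<close> nodes with high probability; hence its shape (together with the offset) is a record of
  \<open>O(log n)\<close> bits, which is read with \<open>O(1)\<close> accesses and decoded in registers for free. All records
  take \<open>O(n)\<close> bits. The tries are built by insertion: to extend the leaf at which
  a new element arrives, one needs the hash value stored there, which is kept in a sparse table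
  indexed by the group and the heap number of the node. If a record overflows, the construction is
  repeated with fresh hash functions; this happens with probability at most \<open>1 / n\<close>.
  Labels are copied one word of the destination at a time, which costs at most four accesses.
\<close>

section \<open>Tries of hash values\<close>

text \<open>All constants come from one Markov estimate. With \<open>l = floorlog 2 n\<close> a
  group receives at most \<open>l\<close> elements on average, and the expected value of
  \<open>(3/2) ^ nodes\<close> for its trie is at most \<open>9 ^ l\<close>. Over at most
  \<open>2 ^ l\<close> groups, having \<open>16 * l\<close> nodes somewhere has probability at most
  \<open>(1/32) ^ l\<close>, because \<open>(3/2) ^ 16\<close> exceeds \<open>18 * 32\<close>. A
  trie with \<open>N\<close> inner nodes needs \<open>2 * N + 1\<close> digits in base 4, so
  \<open>F = 32 * l\<close> digits are granted. The hash value within a group has \<open>F\<close>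
  bits as well. Then two equal hash values force at least \<open>F\<close> nodes, so a collision is
  merely another overflow and a single event covers every failure. A record consists of
  \<open>l\<close> bits for the offset and \<open>2 * F\<close> bits for the code, together
  \<open>65 * l\<close>. The obstacle to linear construction time is the table of leaves: its
  indices run far beyond \<open>n\<close>, so it must never be initialised. The invariants therefore
  constrain only the entries that belong to current leaves.\<close>

datatype trie = Empty | Leaf nat | Node trie trie

text \<open>\<open>r\<close> is the code of whatever follows in preorder, so codes are concatenated
  without reference to lengths, and the next digit is always found by \<open>mod 4\<close>. The
  remainders at the leaves are left out: only the shape is recorded, which keeps the code
  short.\<close>

primrec enc :: "trie \<Rightarrow> nat \<Rightarrow> nat" where
  "enc Empty r = 4 * r + 1"
| "enc (Leaf _) r = 4 * r + 2"
| "enc (Node a b) r = 4 * enc a (enc b r)"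

primrec nodes :: "trie \<Rightarrow> nat" where
  "nodes Empty = 0"
| "nodes (Leaf _) = 0"
| "nodes (Node a b) = Suc (nodes a + nodes b)"

primrec leaves :: "trie \<Rightarrow> nat" where
  "leaves Empty = 0"
| "leaves (Leaf _) = 1"
| "leaves (Node a b) = leaves a + leaves b"

text \<open>A binary tree has one more outer node (\<open>Empty\<close> or \<open>Leaf\<close>) than
  inner nodes, and every node of either kind costs one digit.\<close>

abbreviation digits :: "trie \<Rightarrow> nat" where
  "digits t \<equiv> Suc (2 * nodes t)"

primrec has :: "trie \<Rightarrow> nat \<Rightarrow> bool" where
  "has Empty q = False"
| "has (Leaf r) q = (q = r)"
| "has (Node a b) q = (if even q then has a (q div 2) else has b (q div 2))"

primrec rank :: "trie \<Rightarrow> nat \<Rightarrow> nat" where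
  "rank Empty q = 0"
| "rank (Leaf r) q = 0"
| "rank (Node a b) q = (if even q then rank a (q div 2) else leaves a + rank b (q div 2))"

text \<open>\<open>m\<close> counts the hash bits not yet consumed: it bounds the remaining depth,
  and a remainder at a leaf has only these bits.\<close>

primrec fits :: "nat \<Rightarrow> trie \<Rightarrow> bool" where
  "fits m Empty = True"
| "fits m (Leaf r) = (r < 2 ^ m)"
| "fits m (Node a b) = (0 < m \<and> fits (m - 1) a \<and> fits (m - 1) b)"

text \<open>Besides bounding the recursion, \<open>m\<close> decides what happens to equal
  arguments: the chain of nodes runs through all \<open>m\<close> bits before \<open>Leaf q\<close>
  is returned. A collision thus becomes visible as an oversized trie.\<close>

primrec split :: "nat \<Rightarrow> nat \<Rightarrow> nat \<Rightarrow> trie" where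
  "split 0 q r = Leaf q"
| "split (Suc m) q r =
    (if even q
     then if even r then Node (split m (q div 2) (r div 2)) Empty
          else Node (Leaf (q div 2)) (Leaf (r div 2))
     else if even r then Node (Leaf (r div 2)) (Leaf (q div 2))
          else Node Empty (split m (q div 2) (r div 2)))"

primrec ins :: "trie \<Rightarrow> nat \<Rightarrow> nat \<Rightarrow> trie" where
  "ins Empty m q = Leaf q"
| "ins (Leaf r) m q = split m q r"
| "ins (Node a b) m q =
    (if even q then Node (ins a (m - 1) (q div 2)) b else Node a (ins b (m - 1) (q div 2)))"

section \<open>Codes of tries and the effect of an insertion\<close>

lemma enc_eq: "enc t r = enc t 0 + 4 ^ digits t * r"
proof (induction t arbitrary: r)
  case (Node a b)
  have "enc (Node a b) r = 4 * (enc a 0 + 4 ^ digits a * (enc b 0 + 4 ^ digits b * r))"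
    using Node.IH(1)[of "enc b r"] Node.IH(2)[of r] by simp
  moreover have "enc (Node a b) 0 = 4 * (enc a 0 + 4 ^ digits a * enc b 0)"
    using Node.IH(1)[of "enc b 0"] by simp
  ultimately show ?case by (simp add: algebra_simps power_add)
qed simp_all

lemma enc_less: "enc t 0 < 4 ^ digits t"
proof (induction t)
  case (Node a b)
  have "enc a 0 + 4 ^ digits a * enc b 0 < 4 ^ digits a * Suc (enc b 0)"
    using Node.IH(1) by simp
  also have "\<dots> \<le> 4 ^ digits a * 4 ^ digits b"
    using Node.IH(2) by (intro mult_left_mono) simp_all
  finally show ?case
    using enc_eq[of a "enc b 0"] by (simp add: power_add power_mult algebra_simps)
qed simp_all

text \<open>The last node of \<open>t\<close> in preorder is an outer one, so the digit at position
  \<open>2 * nodes t\<close> is not 0.\<close>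

lemma le_enc: "4 ^ (2 * nodes t) \<le> enc t r"
proof (induction t arbitrary: r)
  case (Node a b)
  have "(4::nat) ^ (2 * nodes (Node a b)) = 4 * (4 ^ digits a * 4 ^ (2 * nodes b))"
    by (simp add: power_add)
  also have "\<dots> \<le> 4 * (4 ^ digits a * enc b r)"
    using Node.IH(2)[of r] by simp
  also have "\<dots> \<le> enc (Node a b) r"
    using enc_eq[of a "enc b r"] by simp
  finally show ?case .
qed simp_all

text \<open>Since the leading digit is never 0, the size of the number reveals how many digits it
  has. An overflow is therefore detected by one comparison with \<open>4 ^ F\<close>.\<close>

lemma enc_less_iff: "enc t 0 < 4 ^ j \<longleftrightarrow> digits t \<le> j"
proof
  assume "enc t 0 < 4 ^ j"
  with le_enc[of t 0] have "(4::nat) ^ (2 * nodes t) < 4 ^ j" by linarith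
  then show "digits t \<le> j" by (simp add: power_strict_increasing_iff Suc_le_eq)
next
  assume "digits t \<le> j"
  then have "(4::nat) ^ digits t \<le> 4 ^ j" by (intro power_increasing) simp_all
  with enc_less[of t] show "enc t 0 < 4 ^ j" by linarith
qed

lemma half_less: "q < 2 ^ m \<Longrightarrow> q div 2 < 2 ^ (m - Suc 0)" for q :: nat
  by (cases m) auto

lemma parity_halves: "q \<noteq> r \<Longrightarrow> even q = even r \<Longrightarrow> q div 2 \<noteq> r div 2" for q r :: nat
  by (metis dvd_mult_div_cancel odd_two_times_div_two_succ)

lemma fits_split: "q < 2 ^ m \<Longrightarrow> r < 2 ^ m \<Longrightarrow> fits m (split m q r)"
  by (induction m arbitrary: q r) auto

lemma fits_ins: "fits m t \<Longrightarrow> q < 2 ^ m \<Longrightarrow> fits m (ins t m q)"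
  by (induction t arbitrary: m q) (auto simp: fits_split half_less)

lemma has_split:
  "q < 2 ^ m \<Longrightarrow> r < 2 ^ m \<Longrightarrow> q \<noteq> r \<Longrightarrow> has (split m q r) x \<longleftrightarrow> x = q \<or> x = r"
proof (induction m arbitrary: q r x)
  case (Suc m)
  have half: "x = q \<longleftrightarrow> even x = even q \<and> x div 2 = q div 2"
    "x = r \<longleftrightarrow> even x = even r \<and> x div 2 = r div 2"
    using parity_halves[of x] by blast+
  have bounds: "q div 2 < 2 ^ m" "r div 2 < 2 ^ m" using Suc.prems by auto
  show ?case
    unfolding half using Suc.IH[OF bounds] parity_halves[of q r] Suc.prems(3) by auto
qed simp

lemma has_ins:
  "fits m t \<Longrightarrow> q < 2 ^ m \<Longrightarrow> \<not> has t q \<Longrightarrow> has (ins t m q) x \<longleftrightarrow> x = q \<or> has t x"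
proof (induction t arbitrary: m q x)
  case (Leaf r)
  then show ?case using has_split[of q m r x] by auto
next
  case (Node a b)
  have half: "x = q \<longleftrightarrow> even x = even q \<and> x div 2 = q div 2"
    using parity_halves[of x q] by blast
  show ?case
    using Node.IH(1)[of "m - 1" "q div 2" "x div 2"] Node.IH(2)[of "m - 1" "q div 2" "x div 2"]
      Node.prems half_less[of q m] half by (auto split: if_splits)
qed simp

lemma leaves_split: "q < 2 ^ m \<Longrightarrow> r < 2 ^ m \<Longrightarrow> q \<noteq> r \<Longrightarrow> leaves (split m q r) = 2"
proof (induction m arbitrary: q r)
  case (Suc m)
  have bounds: "q div 2 < 2 ^ m" "r div 2 < 2 ^ m" using Suc.prems by auto
  show ?case using Suc.IH[OF bounds] parity_halves[of q r] Suc.prems(3) by auto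
qed simp

lemma leaves_ins:
  "fits m t \<Longrightarrow> q < 2 ^ m \<Longrightarrow> \<not> has t q \<Longrightarrow> leaves (ins t m q) = Suc (leaves t)"
  by (induction t arbitrary: m q) (auto simp: half_less leaves_split split: if_splits)

lemma nodes_split_same: "m \<le> nodes (split m q q)"
  by (induction m arbitrary: q) auto

text \<open>Every node passed on the way to the old leaf uses up one bit, and splitting two equal
  remainders creates one node for each bit left. Hence inserting a value twice breaks the size limit
  by itself, and collisions need no estimate of their own.\<close>

lemma nodes_ins_dup: "fits m t \<Longrightarrow> has t q \<Longrightarrow> m \<le> nodes (ins t m q)"
proof (induction t arbitrary: m q)
  case (Node a b)
  have "m - 1 \<le> nodes (ins a (m - 1) (q div 2))" if "even q"
    using Node.IH(1)[of "m - 1" "q div 2"] Node.prems that by simp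
  moreover have "m - 1 \<le> nodes (ins b (m - 1) (q div 2))" if "odd q"
    using Node.IH(2)[of "m - 1" "q div 2"] Node.prems that by simp
  ultimately show ?case by auto
qed (simp_all add: nodes_split_same)

lemma nodes_ins_ge: "nodes t \<le> nodes (ins t m q)"
  by (induction t arbitrary: m q) auto

lemma nodes_split_le: "nodes (split m q r) \<le> m"
  by (induction m arbitrary: q r) auto

text \<open>Bounds the trie that causes an overflow: its code still fits into a register and may be
  computed before its size is tested.\<close>

lemma nodes_ins_le: "nodes (ins t m q) \<le> nodes t + m"
proof (induction t arbitrary: m q)
  case (Node a b)
  have "nodes (ins a (m - 1) (q div 2)) \<le> nodes a + m"
    using Node.IH(1)[of "m - 1" "q div 2"] by simp
  moreover have "nodes (ins b (m - 1) (q div 2)) \<le> nodes b + m"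
    using Node.IH(2)[of "m - 1" "q div 2"] by simp
  ultimately show ?case by simp
qed (simp_all add: nodes_split_le)

lemma rank_le: "rank t q \<le> leaves t"
  by (induction t arbitrary: q) (auto simp: trans_le_add1)

lemma rank_less: "has t q \<Longrightarrow> rank t q < leaves t"
  by (induction t arbitrary: q) (auto simp: trans_less_add1)

lemma rank_inj: "has t p \<Longrightarrow> has t q \<Longrightarrow> rank t p = rank t q \<Longrightarrow> p = q"
proof (induction t arbitrary: p q)
  case (Node a b)
  have half: "p = q \<longleftrightarrow> even p = even q \<and> p div 2 = q div 2"
    using parity_halves[of p q] by blast
  show ?case
    using Node.IH(1)[of "p div 2" "q div 2"] Node.IH(2)[of "p div 2" "q div 2"] Node.prems
      rank_less[of a "p div 2"] rank_less[of a "q div 2"] half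
    by (auto split: if_splits)
qed simp_all

section \<open>Expected size of a random trie\<close>

lemma sum_lessThan_double:
  "(\<Sum>q<2 * k. f q) = (\<Sum>q<k. f (2 * q) + f (2 * q + 1))"
  for f :: "nat \<Rightarrow> 'a :: comm_monoid_add"
  by (induction k) (simp_all add: add.assoc)

text \<open>A node has weight \<open>3/2\<close>, which is less than the factor 2 lost at every level of the trie in the
  probability that two hash values still agree. Hence the expected growth factor is bounded.\<close>

lemma sum_nodes_split: "(\<Sum>q<2 ^ m. (3/2 :: real) ^ nodes (split m q r)) \<le> 3 * 2 ^ m"
proof (induction m arbitrary: r)
  case (Suc m)
  \<comment> \<open>Of the two values \<open>2 * q\<close> and \<open>2 * q + 1\<close>, one differs
    from \<open>r\<close> in the lowest bit and stops after a single node; the other goes on with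
    the halves.\<close>
  have *: "(3/2 :: real) ^ nodes (split (Suc m) (2 * q) r)
        + (3/2) ^ nodes (split (Suc m) (2 * q + 1) r)
      = 3/2 * (3/2) ^ nodes (split m q (r div 2)) + 3/2" for q
    by (cases "even r") simp_all
  have "(\<Sum>q<2 ^ Suc m. (3/2 :: real) ^ nodes (split (Suc m) q r))
      = (\<Sum>q<2 ^ m. 3/2 * (3/2) ^ nodes (split m q (r div 2)) + 3/2)"
    unfolding power_Suc sum_lessThan_double * ..
  also have "\<dots> = 3/2 * (\<Sum>q<2 ^ m. (3/2) ^ nodes (split m q (r div 2))) + 3/2 * 2 ^ m"
    unfolding sum.distrib sum_distrib_left[symmetric] by simp
  \<comment> \<open>The factor 3 is the solution of \<open>3/2 * c + 3/2 = 2 * c\<close>.\<close>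
  also have "\<dots> \<le> 3 * 2 ^ Suc m"
    using Suc.IH[of "r div 2"] by simp
  finally show ?case .
qed simp

text \<open>Half of the values enter each subtrie and leave the weight of the other one untouched.
  So the average growth factor 3 of a split leaf carries over to every trie, whatever its
  shape.\<close>

lemma sum_nodes_ins:
  "(\<Sum>q<2 ^ m. (3/2 :: real) ^ nodes (ins t m q)) \<le> 3 * 2 ^ m * (3/2) ^ nodes t"
proof (induction t arbitrary: m)
  case (Leaf r)
  then show ?case using sum_nodes_split[of m r] by simp
next
  case (Node a b)
  show ?case
  proof (cases m)
    case 0
    \<comment> \<open>Only \<open>q = 0\<close> remains, and it enters the left subtrie.\<close>
    then show ?thesis using mult_left_mono[OF Node.IH(1)[of 0], of "(3/2) ^ Suc (nodes b)"]
      by (simp add: power_add algebra_simps)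
  next
    case (Suc j)
    have "(\<Sum>q<2 ^ m. (3/2 :: real) ^ nodes (ins (Node a b) m q))
        = (\<Sum>q<2 ^ j. (3/2) ^ Suc (nodes b) * (3/2) ^ nodes (ins a j q)
            + (3/2) ^ Suc (nodes a) * (3/2) ^ nodes (ins b j q))"
      unfolding Suc power_Suc sum_lessThan_double by (simp add: power_add mult_ac)
    also have "\<dots> = (3/2) ^ Suc (nodes b) * (\<Sum>q<2 ^ j. (3/2) ^ nodes (ins a j q))
        + (3/2) ^ Suc (nodes a) * (\<Sum>q<2 ^ j. (3/2) ^ nodes (ins b j q))"
      by (simp only: sum.distrib sum_distrib_left)
    also have "\<dots> \<le> (3/2) ^ Suc (nodes b) * (3 * 2 ^ j * (3/2) ^ nodes a)
        + (3/2) ^ Suc (nodes a) * (3 * 2 ^ j * (3/2) ^ nodes b)"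
      using Node.IH(1)[of j] Node.IH(2)[of j] by (intro add_mono mult_left_mono) auto
    also have "\<dots> = 3 * 2 ^ m * (3/2) ^ nodes (Node a b)"
      by (simp add: Suc power_add mult_ac)
    finally show ?thesis .
  qed
qed simp

section \<open>The tries of all groups\<close>

definition insert_value :: "nat \<Rightarrow> nat \<Rightarrow> (nat \<Rightarrow> trie) \<Rightarrow> nat \<Rightarrow> trie" where
  "insert_value F v T = T(v div 2 ^ F := ins (T (v div 2 ^ F)) F (v mod 2 ^ F))"

definition tries :: "nat \<Rightarrow> nat list \<Rightarrow> nat \<Rightarrow> trie" where
  "tries F vs = fold (insert_value F) vs (\<lambda>_. Empty)"

lemma tries_Nil [simp]: "tries F [] g = Empty"
  by (simp add: tries_def)

lemma tries_snoc: "tries F (vs @ [v]) = insert_value F v (tries F vs)"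
  by (simp add: tries_def)

lemma fits_tries: "fits F (tries F vs g)"
  by (induction vs rule: rev_induct) (auto simp: tries_snoc insert_value_def fits_ins)

text \<open>Tries only grow. So an attempt may be abandoned at the first overflow: the complete
  vector of hash values is then bad as well.\<close>

lemma nodes_tries_append: "nodes (tries F vs g) \<le> nodes (tries F (vs @ us) g)"
proof (induction us rule: rev_induct)
  case (snoc u us)
  have "nodes (tries F (vs @ us) g) \<le> nodes (tries F ((vs @ us) @ [u]) g)"
    unfolding tries_snoc insert_value_def by (simp add: nodes_ins_ge)
  with snoc show ?case by simp
qed simp

text \<open>Of the \<open>G\<close> equally likely groups, \<open>G - 1\<close> leave the trie of
  \<open>g\<close> as it is and one multiplies its weight by 3 on average:
  \<open>(G - 1) + 3 = G + 2\<close>.\<close>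

lemma sum_nodes_insert_value:
  assumes "g < G"
  shows "(\<Sum>v<G * 2 ^ F. (3/2 :: real) ^ nodes (insert_value F v T g))
    \<le> (real G + 2) * 2 ^ F * (3/2) ^ nodes (T g)"
proof -
  let ?z = "(3/2 :: real)"
  have 1: "(\<Sum>q<2 ^ F. ?z ^ nodes (insert_value F (q + j * 2 ^ F) T g))
      \<le> (if j = g then 3 else 1) * 2 ^ F * ?z ^ nodes (T g)" for j
  proof -
    have "(\<Sum>q<2 ^ F. ?z ^ nodes (insert_value F (q + j * 2 ^ F) T g))
        = (\<Sum>q<2 ^ F. ?z ^ nodes (if j = g then ins (T g) F q else T g))"
      by (intro sum.cong) (auto simp: insert_value_def)
    then show ?thesis using sum_nodes_ins[of "T g" F] by simp
  qed
  have "(\<Sum>v<G * 2 ^ F. ?z ^ nodes (insert_value F v T g))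
      = (\<Sum>j<G. \<Sum>q<2 ^ F. ?z ^ nodes (insert_value F (q + j * 2 ^ F) T g))"
  proof -
    have "(\<Sum>v\<in>{j * 2 ^ F..<j * 2 ^ F + 2 ^ F}. ?z ^ nodes (insert_value F v T g))
        = (\<Sum>q<2 ^ F. ?z ^ nodes (insert_value F (q + j * 2 ^ F) T g))" for j
      using sum.shift_bounds_nat_ivl[of _ 0 "j * 2 ^ F" "2 ^ F"]
      by (simp add: lessThan_atLeast0 add.commute)
    then show ?thesis
      by (simp flip: sum.nat_group)
  qed
  also have "\<dots> \<le> (\<Sum>j<G. (if j = g then 3 else 1) * 2 ^ F * ?z ^ nodes (T g))"
    by (intro sum_mono 1)
  also have "\<dots> = (\<Sum>j<G. if j = g then 3 else 1) * (2 ^ F * ?z ^ nodes (T g))"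
    by (simp only: sum_distrib_right mult.assoc)
  also have "(\<Sum>j<G. if j = g then 3 else 1 :: real) = (\<Sum>j<G. 1 + (if j = g then 2 else 0))"
    by (intro sum.cong) auto
  also have "\<dots> = real G + 2" using assms by (simp add: sum.distrib)
  finally show ?thesis by (simp add: mult.assoc)
qed

section \<open>Counting the bad vectors of hash values\<close>

definition words_over :: "nat \<Rightarrow> nat \<Rightarrow> nat list set" where
  "words_over M n = {vs. set vs \<subseteq> {..<M} \<and> length vs = n}"

lemma finite_words_over: "finite (words_over M n)"
  unfolding words_over_def using finite_lists_length_eq[of "{..<M}"] by auto

lemma sum_words_over_Suc:
  "(\<Sum>vs\<in>words_over M (Suc n). f vs) = (\<Sum>vs\<in>words_over M n. \<Sum>v<M. f (vs @ [v]))"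
proof -
  have "bij_betw (\<lambda>(vs, v). vs @ [v]) (words_over M n \<times> {..<M}) (words_over M (Suc n))"
  proof (rule bij_betwI[where g = "\<lambda>us. (butlast us, last us)"])
    show "(\<lambda>us. (butlast us, last us)) \<in> words_over M (Suc n) \<rightarrow> words_over M n \<times> {..<M}"
    proof
      fix us assume "us \<in> words_over M (Suc n)"
      then show "(butlast us, last us) \<in> words_over M n \<times> {..<M}"
        unfolding words_over_def by (cases us rule: rev_cases) auto
    qed
  next
    fix us assume "us \<in> words_over M (Suc n)"
    then show "(case (butlast us, last us) of (vs, v) \<Rightarrow> vs @ [v]) = us"
      unfolding words_over_def by (cases us rule: rev_cases) auto
  qed (auto simp: words_over_def)
  from sum.reindex_bij_betw[OF this, of f] show ?thesis
    by (simp add: sum.cartesian_product case_prod_unfold)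
qed

text \<open>To be read as an expectation over a uniformly random word: each of the \<open>n\<close>
  independent values contributes a factor of at most \<open>1 + 2 / G\<close>.\<close>

lemma sum_nodes_tries:
  assumes "g < G"
  shows "(\<Sum>vs\<in>words_over (G * 2 ^ F) n. (3/2 :: real) ^ nodes (tries F vs g))
    \<le> ((real G + 2) * 2 ^ F) ^ n"
proof (induction n)
  case 0
  have "words_over (G * 2 ^ F) 0 = {[]}" by (auto simp: words_over_def)
  then show ?case by simp
next
  case (Suc n)
  let ?c = "(real G + 2) * 2 ^ F"
  have "(\<Sum>vs\<in>words_over (G * 2 ^ F) (Suc n). (3/2 :: real) ^ nodes (tries F vs g))
      \<le> (\<Sum>vs\<in>words_over (G * 2 ^ F) n. ?c * (3/2) ^ nodes (tries F vs g))"
    unfolding sum_words_over_Suc tries_snoc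
    by (intro sum_mono sum_nodes_insert_value assms)
  also have "\<dots> \<le> ?c * ?c ^ n"
    using Suc.IH by (simp flip: sum_distrib_left add: mult_left_mono)
  finally show ?case by simp
qed

definition bad_words :: "nat \<Rightarrow> nat \<Rightarrow> nat \<Rightarrow> nat list set" where
  "bad_words G F n = {vs \<in> words_over (G * 2 ^ F) n. \<exists>g<G. F < digits (tries F vs g)}"

text \<open>Markov's inequality for the weight \<open>(3/2) ^ nodes\<close>, summed over the groups.
  More than \<open>32 * l\<close> digits mean at least \<open>16 * l\<close> nodes. At most
  \<open>2 ^ l\<close> groups with expected weight at most \<open>9 ^ l\<close> give
  \<open>18 ^ l\<close>, which the threshold \<open>(3/2) ^ (16 * l)\<close> exceeds by the factor
  \<open>32 ^ l\<close>.\<close>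

lemma card_bad_words:
  fixes n :: nat
  assumes n: "1 \<le> n" and l: "l = floorlog 2 n" and G: "G = n div l + 1" and F: "F = 32 * l"
  shows "real (card (bad_words G F n)) \<le> (1/32) ^ l * real ((G * 2 ^ F) ^ n)"
proof -
  let ?z = "(3/2 :: real)" and ?U = "words_over (G * 2 ^ F) n"
  have l_pos: "0 < l" using n l by (simp add: zero_less_iff_neq_zero floorlog_eq_zero_iff)
  have "n < 2 ^ l" using floorlog_bounds[of n 2] n l by auto
  have Gl: "G \<le> 2 ^ l"
    using \<open>n < 2 ^ l\<close> div_le_dividend[of n l] G by linarith
  \<comment> \<open>The number of groups is rounded up so that the mean load is at most
    \<open>l\<close>; this bounds the exponent of the growth factor below.\<close>
  have "n < G * l"
    using G l_pos by (metis dividend_less_div_times mult.commute mult_Suc_right Suc_eq_plus1 add.commute)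
  then have nG: "real n / real G \<le> real l"
    using G by (simp add: field_simps flip: of_nat_mult)
  have "real (card (bad_words G F n)) * ?z ^ (16 * l) = (\<Sum>vs\<in>bad_words G F n. ?z ^ (16 * l))"
    by simp
  also have "\<dots> \<le> (\<Sum>vs\<in>bad_words G F n. \<Sum>g<G. ?z ^ nodes (tries F vs g))"
  proof (rule sum_mono)
    fix vs assume "vs \<in> bad_words G F n"
    then obtain g where g: "g < G" "F < digits (tries F vs g)" by (auto simp: bad_words_def)
    then have "16 * l \<le> nodes (tries F vs g)" using F by simp
    then have "?z ^ (16 * l) \<le> ?z ^ nodes (tries F vs g)" by (intro power_increasing) auto
    also have "\<dots> \<le> (\<Sum>g<G. ?z ^ nodes (tries F vs g))"
      using g(1) by (intro member_le_sum) auto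
    finally show "?z ^ (16 * l) \<le> (\<Sum>g<G. ?z ^ nodes (tries F vs g))" .
  qed
  also have "\<dots> \<le> (\<Sum>vs\<in>?U. \<Sum>g<G. ?z ^ nodes (tries F vs g))"
    by (intro sum_mono2 finite_words_over sum_nonneg) (auto simp: bad_words_def)
  also have "\<dots> = (\<Sum>g<G. \<Sum>vs\<in>?U. ?z ^ nodes (tries F vs g))"
    by (rule sum.swap)
  also have "\<dots> \<le> (\<Sum>g<G. ((real G + 2) * 2 ^ F) ^ n)"
    by (intro sum_mono sum_nodes_tries) simp
  also have "\<dots> = real G * ((1 + 2 / real G) ^ n * real ((G * 2 ^ F) ^ n))"
  proof -
    have "real G + 2 = (1 + 2 / real G) * real G" using G by (simp add: field_simps)
    then show ?thesis by (simp add: power_mult_distrib)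
  qed
  also have "\<dots> \<le> 2 ^ l * (9 ^ l * real ((G * 2 ^ F) ^ n))"
  proof (intro mult_mono)
    \<comment> \<open>\<open>1 + x \<le> exp x\<close> turns the \<open>n\<close> factors into
      \<open>exp (2 * n / G)\<close>, which is at most \<open>exp 2 ^ l\<close>, and
      \<open>exp 2\<close> is below 9.\<close>
    have "(1 + 2 / real G) ^ n \<le> exp (2 / real G) ^ n"
      by (intro power_mono exp_ge_add_one_self) simp_all
    also have "\<dots> = exp (2 * (real n / real G))"
      by (simp flip: exp_of_nat_mult add: mult_ac)
    also have "\<dots> \<le> exp (2 * real l)" using nG by simp
    also have "\<dots> = exp 2 ^ l" by (simp flip: exp_of_nat_mult add: mult_ac)
    also have "\<dots> \<le> 9 ^ l"
    proof (rule power_mono)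
      have "exp 1 \<le> (3 :: real)" by (rule exp_le)
      then have "exp 1 ^ 2 \<le> (3 :: real) ^ 2" by (intro power_mono) simp_all
      then show "exp 2 \<le> (9 :: real)" by (simp flip: exp_of_nat_mult)
    qed simp
    finally show "(1 + 2 / real G) ^ n \<le> 9 ^ l" .
  qed (use Gl in \<open>auto simp flip: of_nat_power\<close>)
  finally have "real (card (bad_words G F n)) * ?z ^ (16 * l)
      \<le> 18 ^ l * real ((G * 2 ^ F) ^ n)"
    by (simp flip: power_mult_distrib mult.assoc)
  moreover have "(18 :: real) ^ l \<le> (1/32) ^ l * ?z ^ (16 * l)"
    unfolding power_mult power_mult_distrib[symmetric] by (intro power_mono) (simp_all add: power_divide)
  ultimately have "real (card (bad_words G F n)) * ?z ^ (16 * l)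
      \<le> ((1/32) ^ l * ?z ^ (16 * l)) * real ((G * 2 ^ F) ^ n)"
    by (meson mult_right_mono of_nat_0_le_iff order_trans)
  then have "real (card (bad_words G F n)) * ?z ^ (16 * l)
      \<le> ((1/32) ^ l * real ((G * 2 ^ F) ^ n)) * ?z ^ (16 * l)"
    by (simp only: mult_ac)
  then show ?thesis by (rule mult_right_le_imp_le) simp
qed

text \<open>The arguments, in the order \<open>s m q v lo mul rest rk\<close>: the walk in
  \<open>t\<close> for the hash value \<open>p\<close> has arrived at the subtrie \<open>s\<close>
  with \<open>m\<close> unread bits, forming \<open>q\<close>, at the heap number \<open>v\<close>.
  The code of \<open>t\<close> is \<open>lo + mul * enc s rest\<close>, where \<open>lo\<close>
  holds the digits read so far, \<open>mul\<close> is the power of 4 behind them and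
  \<open>rest\<close> is the code of what follows \<open>s\<close>. \<open>rk\<close> counts the
  leaves passed on the left.\<close>

inductive reach :: "trie \<Rightarrow> nat \<Rightarrow> nat \<Rightarrow> trie \<Rightarrow> nat \<Rightarrow> nat \<Rightarrow> nat \<Rightarrow> nat \<Rightarrow> nat \<Rightarrow> nat \<Rightarrow> nat \<Rightarrow> bool"
  for t F p where
  init: "reach t F p t F p 1 0 1 0 0"
| left: "reach t F p (Node a b) m q v lo mul rest rk \<Longrightarrow> even q \<Longrightarrow>
    reach t F p a (m - 1) (q div 2) (2 * v) lo (4 * mul) (enc b rest) rk"
| right: "reach t F p (Node a b) m q v lo mul rest rk \<Longrightarrow> odd q \<Longrightarrow>
    reach t F p b (m - 1) (q div 2) (Suc (2 * v)) (lo + 4 * mul * enc a 0)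
      (4 * mul * 4 ^ digits a) rest (rk + leaves a)"

text \<open>At depth \<open>F - m\<close> heap numbers lie below \<open>2 ^ (F - m + 1)\<close>; the
  inequality for \<open>Suc v\<close> says this without subtraction. The decomposition of the code
  in the last claim is what allows a subtrie to be exchanged by arithmetic on \<open>lo\<close>,
  \<open>mul\<close> and \<open>rest\<close>.\<close>

lemma reach_invariants:
  assumes "fits F t" "p < 2 ^ F" "reach t F p s m q v lo mul rest rk"
  shows "fits m s \<and> q < 2 ^ m \<and> Suc v * 2 ^ m \<le> 2 ^ Suc F \<and> 1 \<le> v"
    and "has t p = has s q" "rank t p = rk + rank s q"
    and "enc t 0 = lo + mul * enc s rest \<and> lo < mul \<and> mul * 4 ^ digits s \<le> 4 ^ digits t"
  using assms(3)
proof (induction rule: reach.induct)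
  case (left a b m q v lo mul rest rk)
  {
    case 1
    from left.IH(1) have "0 < m" by simp
    then obtain j where j: "m = Suc j" by (cases m) auto
    have "Suc (2 * v) * 2 ^ j \<le> Suc v * 2 ^ Suc j" by (simp add: algebra_simps)
    also have "\<dots> \<le> 2 ^ Suc F" using left.IH(1) j by blast
    finally show ?case using left.IH(1) half_less[of q m] unfolding j by simp
  next
    case 2 show ?case using left.IH(2) left.hyps(2) by simp
  next
    case 3 show ?case using left.IH(3) left.hyps(2) by simp
  next
    case 4
    have "4 * mul * 4 ^ digits a \<le> mul * 4 ^ digits (Node a b)"
      by (simp add: power_add)
    also have "\<dots> \<le> 4 ^ digits t" using left.IH(4) by blast
    finally have "4 * mul * 4 ^ digits a \<le> 4 ^ digits t" .
    moreover have "enc t 0 = lo + 4 * mul * enc a (enc b rest)" using left.IH(4) by simp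
    moreover have "lo < 4 * mul" using left.IH(4) by linarith
    ultimately show ?case by blast
  }
next
  case (right a b m q v lo mul rest rk)
  {
    case 1
    from right.IH(1) have "0 < m" by simp
    then obtain j where j: "m = Suc j" by (cases m) auto
    have "Suc (Suc (2 * v)) * 2 ^ j \<le> Suc v * 2 ^ Suc j" by (simp add: algebra_simps)
    also have "\<dots> \<le> 2 ^ Suc F" using right.IH(1) j by blast
    finally show ?case using right.IH(1) half_less[of q m] unfolding j by simp
  next
    case 2 show ?case using right.IH(2) right.hyps(2) by simp
  next
    case 3 show ?case using right.IH(3) right.hyps(2) by simp
  next
    case 4
    have "lo + 4 * mul * enc a 0 < mul + 4 * mul * enc a 0" using right.IH(4) by linarith
    also have "\<dots> \<le> 4 * mul * Suc (enc a 0)" by simp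
    also have "\<dots> \<le> 4 * mul * 4 ^ digits a"
      using enc_less[of a] by (intro mult_left_mono) simp_all
    finally have "lo + 4 * mul * enc a 0 < 4 * mul * 4 ^ digits a" .
    moreover have "enc t 0 = lo + 4 * mul * enc a 0 + 4 * mul * 4 ^ digits a * enc b rest"
    proof -
      have "enc t 0 = lo + mul * (4 * enc a (enc b rest))" using right.IH(4) by simp
      then show ?thesis unfolding enc_eq[of a "enc b rest"] by (simp only: algebra_simps)
    qed
    moreover have "4 * mul * 4 ^ digits a * 4 ^ digits b \<le> 4 ^ digits t"
    proof -
      have "4 * mul * 4 ^ digits a * 4 ^ digits b = mul * 4 ^ digits (Node a b)"
        by (simp add: power_add)
      also have "\<dots> \<le> 4 ^ digits t" using right.IH(4) by blast
      finally show ?thesis .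
    qed
    ultimately show ?case by blast
  }
next
  case init
  {
    case 1 show ?case using assms(1,2) by simp
  next
    case 2 show ?case ..
  next
    case 3 show ?case by simp
  next
    case 4 show ?case by simp
  }
qed

text \<open>Only the entries at heap numbers of leaves are constrained. The table can therefore be
  used without initialisation, and entries left over from earlier attempts or from former leaves do
  no harm.\<close>

primrec tab :: "(nat \<Rightarrow> nat) \<Rightarrow> nat \<Rightarrow> trie \<Rightarrow> bool" where
  "tab T v Empty = True"
| "tab T v (Leaf r) = (T v = r)"
| "tab T v (Node a b) = (tab T (2 * v) a \<and> tab T (Suc (2 * v)) b)"

text \<open>Dropping the lowest bit of a heap number yields the parent, so iterated halving runs
  through the ancestors of \<open>u\<close>.\<close>

definition below :: "nat \<Rightarrow> nat \<Rightarrow> bool" where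
  "below v u \<longleftrightarrow> (\<exists>j. u div 2 ^ j = v)"

lemma below_refl: "below v v"
  unfolding below_def by (rule exI[of _ 0]) simp

lemma below_half: "below v u \<Longrightarrow> below (v div 2) u"
  unfolding below_def by (metis div_mult2_eq mult.commute power_Suc)

lemma below_left: "below (2 * v) u \<Longrightarrow> below v u"
  and below_right: "below (Suc (2 * v)) u \<Longrightarrow> below v u"
  using below_half[of "2 * v" u] below_half[of "Suc (2 * v)" u] by simp_all

text \<open>Of two numbers obtained from \<open>u\<close> by shifts, the one with the larger shift
  is an iterated half of the other, hence no larger; siblings cannot be related in this way. Heap
  numbers must start at 1, since \<open>below 0 u\<close> holds for every \<open>u\<close>.\<close>

lemma not_below_both:
  assumes "1 \<le> v" "below (2 * v) u" "below (Suc (2 * v)) u"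
  shows False
proof -
  obtain i j where ij: "u div 2 ^ i = 2 * v" "u div 2 ^ j = Suc (2 * v)"
    using assms(2,3) by (auto simp: below_def)
  have split: "u div 2 ^ (a + b) = u div 2 ^ a div 2 ^ b" for a b
    by (simp add: power_add div_mult2_eq)
  consider "i \<le> j" | c where "i = Suc (j + c)"
    by (metis add_Suc_right less_imp_Suc_add linorder_not_le)
  then show False
  proof cases
    case 1
    then obtain c where "j = i + c" by (auto simp: le_iff_add)
    then have "Suc (2 * v) \<le> 2 * v" using ij split[of i c] by (metis div_le_dividend)
    then show False by simp
  next
    case 2
    then have "2 * v = Suc (2 * v) div 2 ^ Suc c" using ij split[of j "Suc c"] by simp
    also have "\<dots> = v div 2 ^ c" by (simp add: div_mult2_eq)
    also have "\<dots> \<le> v" by (rule div_le_dividend)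
    finally have "2 * v \<le> v" .
    then show False using assms(1) by simp
  qed
qed

lemma tab_cong: "(\<And>u. below v u \<Longrightarrow> T u = T' u) \<Longrightarrow> tab T v t = tab T' v t"
proof (induction t arbitrary: v)
  case (Node a b)
  have "tab T (2 * v) a = tab T' (2 * v) a"
    using Node.prems below_left by (intro Node.IH(1)) blast
  moreover have "tab T (Suc (2 * v)) b = tab T' (Suc (2 * v)) b"
    using Node.prems below_right by (intro Node.IH(2)) blast
  ultimately show ?case by simp
qed (simp_all add: below_refl)

text \<open>\<open>focus T U s v lo mul rest\<close>: replacing the subtrie at the node with heap number \<open>v\<close> by \<open>s\<close>
  yields \<open>U\<close>, both in the encoding and in the table of leaves.\<close>

definition focus :: "(nat \<Rightarrow> nat) \<Rightarrow> trie \<Rightarrow> trie \<Rightarrow> nat \<Rightarrow> nat \<Rightarrow> nat \<Rightarrow> nat \<Rightarrow> bool" where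
  "focus T U s v lo mul rest \<longleftrightarrow> enc U 0 = lo + mul * enc s rest \<and>
    (\<forall>T'. (\<forall>u. \<not> below v u \<longrightarrow> T' u = T u) \<longrightarrow> tab T' v s \<longrightarrow> tab T' 1 U)"

text \<open>The sibling \<open>b\<close> is already in the table and lies outside the subtree of
  \<open>2 * v\<close>, so it survives every change made there.\<close>

lemma focus_left:
  assumes "focus T U (Node x b) v lo mul rest" "tab T (Suc (2 * v)) b" "1 \<le> v"
  shows "focus T U x (2 * v) lo (4 * mul) (enc b rest)"
  unfolding focus_def
proof (intro conjI allI impI)
  show "enc U 0 = lo + 4 * mul * enc x (enc b rest)"
    using assms(1) by (simp add: focus_def)
next
  fix T' assume T': "\<forall>u. \<not> below (2 * v) u \<longrightarrow> T' u = T u" "tab T' (2 * v) x"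
  have "tab T' (Suc (2 * v)) b = tab T (Suc (2 * v)) b"
    using T'(1) not_below_both[OF assms(3)] by (intro tab_cong) blast
  moreover have "\<forall>u. \<not> below v u \<longrightarrow> T' u = T u"
    using T'(1) below_left by blast
  ultimately show "tab T' 1 U"
    using assms(1,2) T'(2) by (simp add: focus_def)
qed

lemma focus_right:
  assumes "focus T U (Node a x) v lo mul rest" "tab T (2 * v) a" "1 \<le> v"
  shows "focus T U x (Suc (2 * v)) (lo + 4 * mul * enc a 0) (4 * mul * 4 ^ digits a) rest"
  unfolding focus_def
proof (intro conjI allI impI)
  show "enc U 0 = lo + 4 * mul * enc a 0 + 4 * mul * 4 ^ digits a * enc x rest"
  proof -
    have "enc U 0 = lo + mul * (4 * enc a (enc x rest))" using assms(1) by (simp add: focus_def)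
    then show ?thesis unfolding enc_eq[of a "enc x rest"] by (simp only: algebra_simps)
  qed
next
  fix T' assume T': "\<forall>u. \<not> below (Suc (2 * v)) u \<longrightarrow> T' u = T u" "tab T' (Suc (2 * v)) x"
  have "tab T' (2 * v) a = tab T (2 * v) a"
    using T'(1) not_below_both[OF assms(3)] by (intro tab_cong) blast
  moreover have "\<forall>u. \<not> below v u \<longrightarrow> T' u = T u"
    using T'(1) below_right by blast
  ultimately show "tab T' 1 U"
    using assms(1,2) T'(2) by (simp add: focus_def)
qed

text \<open>Insertion changes nothing off the path of the walk. Hence it is enough to insert into
  the subtrie where the walk ends and to splice the result into code and table.\<close>

lemma focus_reach:
  assumes "fits F t" "p < 2 ^ F" "tab T 1 t" "reach t F p s m q v lo mul rest rk"
  shows "focus T (ins t F p) (ins s m q) v lo mul rest \<and> tab T v s"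
  using assms(4)
proof (induction rule: reach.induct)
  case init
  have "(\<forall>u. \<not> below 1 u \<longrightarrow> T' u = T u) \<longrightarrow> tab T' 1 (ins t F p) \<longrightarrow> tab T' 1 (ins t F p)" for T'
    by simp
  then show ?case using assms(3) by (simp add: focus_def)
next
  case (left a b m q v lo mul rest rk)
  have "1 \<le> v" using reach_invariants(1)[OF assms(1,2) left.hyps(1)] by simp
  moreover have "focus T (ins t F p) (Node (ins a (m - 1) (q div 2)) b) v lo mul rest"
    "tab T (2 * v) a" "tab T (Suc (2 * v)) b"
    using left.IH left.hyps(2) by simp_all
  ultimately show ?case using focus_left by blast
next
  case (right a b m q v lo mul rest rk)
  have "1 \<le> v" using reach_invariants(1)[OF assms(1,2) right.hyps(1)] by simp
  moreover have "focus T (ins t F p) (Node a (ins b (m - 1) (q div 2))) v lo mul rest"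
    "tab T (2 * v) a" "tab T (Suc (2 * v)) b"
    using right.IH right.hyps(2) by simp_all
  ultimately show ?case using focus_right by blast
qed

section \<open>Slots of the elements\<close>

definition offset :: "(nat \<Rightarrow> trie) \<Rightarrow> nat \<Rightarrow> nat" where
  "offset T g = (\<Sum>g'<g. leaves (T g'))"

definition slot :: "nat \<Rightarrow> (nat \<Rightarrow> trie) \<Rightarrow> nat \<Rightarrow> nat" where
  "slot F T v = offset T (v div 2 ^ F) + rank (T (v div 2 ^ F)) (v mod 2 ^ F)"

text \<open>The size limit alone forces the hash values to be distinct, because a repeated one would
  create \<open>F\<close> nodes and thus more than \<open>F\<close> digits. Consequently every
  insertion adds exactly one leaf, and the group sizes add up to the number of elements.\<close>

lemma good_tries:
  assumes "set vs \<subseteq> {..<G * 2 ^ F}" "\<And>g. g < G \<Longrightarrow> digits (tries F vs g) \<le> F"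
  shows "distinct vs \<and> offset (tries F vs) G = length vs \<and>
    (\<forall>v. has (tries F vs (v div 2 ^ F)) (v mod 2 ^ F) \<longleftrightarrow> v \<in> set vs)"
  using assms
proof (induction vs rule: rev_induct)
  case Nil
  then show ?case by (simp add: offset_def)
next
  case (snoc v vs)
  define g p where "g = v div 2 ^ F" and "p = v mod 2 ^ F"
  let ?T = "tries F vs"
  have g: "g < G" using snoc.prems(1) by (simp add: g_def less_mult_imp_div_less)
  have p: "p < 2 ^ F" by (simp add: p_def)
  have new: "tries F (vs @ [v]) = ?T(g := ins (?T g) F p)"
    by (simp add: tries_snoc insert_value_def g_def p_def)
  have IH: "distinct vs" "offset ?T G = length vs"
    "\<And>v. has (?T (v div 2 ^ F)) (v mod 2 ^ F) \<longleftrightarrow> v \<in> set vs"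
  proof -
    have "digits (?T g') \<le> F" if "g' < G" for g'
      using nodes_tries_append[of F vs g' "[v]"] snoc.prems(2)[OF that] by simp
    with snoc.IH snoc.prems(1) show "distinct vs" "offset ?T G = length vs"
      "\<And>v. has (?T (v div 2 ^ F)) (v mod 2 ^ F) \<longleftrightarrow> v \<in> set vs" by simp_all
  qed
  have fits: "fits F (?T g)" by (rule fits_tries)
  have nh: "\<not> has (?T g) p"
  proof
    assume "has (?T g) p"
    then have "F \<le> nodes (ins (?T g) F p)" by (rule nodes_ins_dup[OF fits])
    then show False using snoc.prems(2)[OF g] unfolding new by simp
  qed
  have "v \<notin> set vs" using nh IH(3)[of v] by (simp add: g_def p_def)
  moreover have "offset (tries F (vs @ [v])) G = Suc (offset ?T G)"
  proof -
    have "offset (tries F (vs @ [v])) G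
        = (\<Sum>g'<G. leaves (?T g') + (if g' = g then 1 else 0))"
      unfolding offset_def new by (intro sum.cong) (auto simp: leaves_ins[OF fits p nh])
    then show ?thesis using g by (simp add: sum.distrib offset_def)
  qed
  moreover have "has (tries F (vs @ [v]) (u div 2 ^ F)) (u mod 2 ^ F) \<longleftrightarrow> u \<in> set (vs @ [v])" for u
  proof (cases "u div 2 ^ F = g")
    case True
    have "u = v" if "u mod 2 ^ F = p"
    proof -
      have "u = u div 2 ^ F * 2 ^ F + u mod 2 ^ F" "v = g * 2 ^ F + p"
        unfolding g_def p_def by (rule div_mult_mod_eq[symmetric])+
      then show ?thesis using True that by metis
    qed
    then have "u mod 2 ^ F = p \<longleftrightarrow> u = v" by (auto simp only: p_def)
    then show ?thesis
      using has_ins[OF fits p nh, of "u mod 2 ^ F"] IH(3)[of u] unfolding new True by simp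
  next
    case False
    then show ?thesis using IH(3)[of u] by (auto simp: new g_def)
  qed
  ultimately show ?case using IH(1,2) by simp
qed

lemma offset_mono: "g \<le> g' \<Longrightarrow> offset T g \<le> offset T g'"
  unfolding offset_def by (intro sum_mono2) auto

lemma offset_Suc: "offset T (Suc g) = offset T g + leaves (T g)"
  by (simp add: offset_def)

lemma slot_less:
  assumes "has (T (v div 2 ^ F)) (v mod 2 ^ F)" "v div 2 ^ F < G"
  shows "slot F T v < offset T G"
proof -
  have "slot F T v < offset T (Suc (v div 2 ^ F))"
    using rank_less[OF assms(1)] by (simp add: slot_def offset_Suc)
  also have "\<dots> \<le> offset T G" using assms(2) by (intro offset_mono) simp
  finally show ?thesis .
qed

text \<open>Groups occupy disjoint consecutive intervals of slots, and within a group the rank is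
  injective.\<close>

lemma slot_inj:
  assumes "has (T (u div 2 ^ F)) (u mod 2 ^ F)" "has (T (v div 2 ^ F)) (v mod 2 ^ F)"
    and eq: "slot F T u = slot F T v"
  shows "u = v"
proof -
  have lt: "slot F T u < slot F T v"
    if "has (T (u div 2 ^ F)) (u mod 2 ^ F)" "u div 2 ^ F < v div 2 ^ F" for u v
  proof -
    have "slot F T u < offset T (v div 2 ^ F)" using that by (rule slot_less)
    then show ?thesis by (simp add: slot_def)
  qed
  have g: "u div 2 ^ F = v div 2 ^ F"
    using lt[of u v] lt[of v u] assms
    by (cases "u div 2 ^ F" "v div 2 ^ F" rule: linorder_cases) simp_all
  then have "rank (T (v div 2 ^ F)) (u mod 2 ^ F) = rank (T (v div 2 ^ F)) (v mod 2 ^ F)"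
    using eq by (simp add: slot_def)
  then have "u mod 2 ^ F = v mod 2 ^ F"
    using rank_inj assms(1,2) g by metis
  then show ?thesis using g by (metis div_mult_mod_eq)
qed

section \<open>Random hash values\<close>

type_synonym 'u hash_key = "nat \<times> nat \<times> nat \<times> 'u"

definition hash_range :: "'u hash_key \<Rightarrow> nat" where
  "hash_range = (\<lambda>(e, i, m, x). max 1 m)"

lemma hash_space_eq: "hash_space = Pi\<^sub>M UNIV (\<lambda>j. uniform_count_measure {..<hash_range j})"
  unfolding hash_space_def hash_range_def by (intro arg_cong2[of _ _ _ _ "Pi\<^sub>M"]) auto

lemma hash_range_pos: "0 < hash_range j"
  by (cases j) (simp add: hash_range_def)

lemma prob_space_uniform_hash:
  "prob_space (uniform_count_measure {..<hash_range j})"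
proof (rule prob_space_uniform_count_measure)
  show "{..<hash_range j} \<noteq> {}" using hash_range_pos[of j] by blast
qed simp

lemma space_hash_space: "h \<in> space hash_space \<longleftrightarrow> (\<forall>j. h j < hash_range j)"
  unfolding hash_space_eq space_PiM by (simp add: PiE_def Pi_def space_uniform_count_measure)

section \<open>Runs observe finitely many hash values\<close>

definition cylinder :: "('u hash_key \<times> nat) list \<Rightarrow> 'u hash set" where
  "cylinder l = {h \<in> space hash_space. \<forall>p\<in>set l. h (fst p) = snd p}"

lemma sets_coordinate: "{h \<in> space hash_space. h j = v} \<in> sets hash_space"
proof -
  have "(\<lambda>h. h j) \<in> measurable hash_space (uniform_count_measure {..<hash_range j})"
    unfolding hash_space_eq by (rule measurable_component_singleton) simp
  then have "(\<lambda>h. h j) -` ({v} \<inter> {..<hash_range j}) \<inter> space hash_space \<in> sets hash_space"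
    by (rule measurable_sets) (simp add: sets_uniform_count_measure)
  also have "(\<lambda>h. h j) -` ({v} \<inter> {..<hash_range j}) \<inter> space hash_space
      = {h \<in> space hash_space. h j = v}"
    using space_hash_space by blast
  finally show ?thesis .
qed

lemma sets_cylinder: "cylinder l \<in> sets hash_space"
proof (induction l)
  case Nil
  then show ?case by (simp add: cylinder_def)
next
  case (Cons p l)
  have "cylinder (p # l) = {h \<in> space hash_space. h (fst p) = snd p} \<inter> cylinder l"
    unfolding cylinder_def by auto
  then show ?case using sets.Int[OF sets_coordinate Cons] by simp
qed

lemma cylinder_append: "cylinder (l1 @ l2) = cylinder l1 \<inter> cylinder l2"
  unfolding cylinder_def by auto

text \<open>The inspected keys contain only elements of \<open>xs\<close>. This leaves countably
  many possible observations even for an uncountable universe, as needed for the measurability of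
  halting.\<close>

lemma exec_cylinder:
  assumes "exec w W h xs c \<sigma> t \<sigma>'" "h \<in> space hash_space"
  shows "\<exists>l \<in> lists ((UNIV \<times> UNIV \<times> UNIV \<times> set xs) \<times> UNIV).
    h \<in> cylinder l \<and> (\<forall>h'\<in>cylinder l. exec w W h' xs c \<sigma> t \<sigma>')"
  using assms
proof (induction rule: exec.induct)
  case (Hash r i m x \<sigma>)
  let ?j = "(family \<sigma>, eval W (regs \<sigma>) i, eval W (regs \<sigma>) m, xs ! eval W (regs \<sigma>) x)"
  show ?case
  proof (cases "eval W (regs \<sigma>) x < length xs")
    case True
    have "exec w W h' xs (Hash r i m x) \<sigma> 1
        (\<sigma>\<lparr>regs := (regs \<sigma>)(r := if eval W (regs \<sigma>) x < length xs then h ?j else 0)\<rparr>)"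
      if "h' \<in> cylinder [(?j, h ?j)]" for h'
      using exec.Hash[of w W h' xs r i m x \<sigma>] that True by (simp add: cylinder_def)
    then show ?thesis
      using True Hash by (intro bexI[of _ "[(?j, h ?j)]"]) (auto simp: cylinder_def)
  next
    case False
    have "exec w W h' xs (Hash r i m x) \<sigma> 1
        (\<sigma>\<lparr>regs := (regs \<sigma>)(r := if eval W (regs \<sigma>) x < length xs then h ?j else 0)\<rparr>)" for h'
      using exec.Hash[of w W h' xs r i m x \<sigma>] False by simp
    then show ?thesis
      using Hash by (intro bexI[of _ "[]"]) (auto simp: cylinder_def)
  qed
next
  case (Seq c1 \<sigma> t1 \<sigma>1 c2 t2 \<sigma>2)
  then obtain l1 l2 where
    "l1 \<in> lists ((UNIV \<times> UNIV \<times> UNIV \<times> set xs) \<times> UNIV)" "h \<in> cylinder l1"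
    "\<forall>h'\<in>cylinder l1. exec w W h' xs c1 \<sigma> t1 \<sigma>1"
    "l2 \<in> lists ((UNIV \<times> UNIV \<times> UNIV \<times> set xs) \<times> UNIV)" "h \<in> cylinder l2"
    "\<forall>h'\<in>cylinder l2. exec w W h' xs c2 \<sigma>1 t2 \<sigma>2" by blast
  then show ?case
    by (intro bexI[of _ "l1 @ l2"]) (auto simp: cylinder_append intro: exec.Seq)
next
  case (WhileTrue \<sigma> b c t1 \<sigma>1 t2 \<sigma>2)
  then obtain l1 l2 where
    "l1 \<in> lists ((UNIV \<times> UNIV \<times> UNIV \<times> set xs) \<times> UNIV)" "h \<in> cylinder l1"
    "\<forall>h'\<in>cylinder l1. exec w W h' xs c \<sigma> t1 \<sigma>1"
    "l2 \<in> lists ((UNIV \<times> UNIV \<times> UNIV \<times> set xs) \<times> UNIV)" "h \<in> cylinder l2"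
    "\<forall>h'\<in>cylinder l2. exec w W h' xs (While b c) \<sigma>1 t2 \<sigma>2" by blast
  with WhileTrue.hyps(1) show ?case
    by (intro bexI[of _ "l1 @ l2"]) (auto simp: cylinder_append intro: exec.WhileTrue)
next
  case (IfTrue \<sigma> b c1 t \<sigma>' c2)
  then show ?case by (blast intro: exec.IfTrue)
next
  case (IfFalse \<sigma> b c2 t \<sigma>' c1)
  then show ?case by (blast intro: exec.IfFalse)
next
  case WhileFalse
  then show ?case by (intro bexI[of _ "[]"]) (auto simp: cylinder_def intro: exec.WhileFalse)
qed (rule bexI[of _ "[]"], rule conjI, simp add: cylinder_def, rule ballI, rule exec.intros, simp)+

text \<open>A halting computation has inspected finitely many hash values, and there are only countably
  many possibilities for these; this makes the set below measurable.\<close>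

lemma sets_halting:
  fixes xs :: "'u list"
  shows "{h \<in> space hash_space. \<exists>t \<sigma>'. exec w W h xs c \<sigma> t \<sigma>' \<and> P t} \<in> sets hash_space"
  (is "?S \<in> _")
proof -
  let ?K = "lists ((UNIV \<times> UNIV \<times> UNIV \<times> set xs) \<times> UNIV) :: ('u hash_key \<times> nat) list set"
  let ?L = "{l \<in> ?K. cylinder l \<subseteq> ?S}"
  have "?S = (\<Union>l\<in>?L. cylinder l)"
  proof
    show "?S \<subseteq> (\<Union>l\<in>?L. cylinder l)"
    proof
      fix h assume "h \<in> ?S"
      then obtain t \<sigma>' where run: "exec w W h xs c \<sigma> t \<sigma>'" "P t" "h \<in> space hash_space" by blast
      from exec_cylinder[OF run(1,3)] obtain l where
        l: "l \<in> ?K" "h \<in> cylinder l" "\<forall>h'\<in>cylinder l. exec w W h' xs c \<sigma> t \<sigma>'" by blast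
      have "cylinder l \<subseteq> ?S" using l(3) run(2) by (auto simp: cylinder_def)
      with l show "h \<in> (\<Union>l\<in>?L. cylinder l)" by blast
    qed
  qed blast
  moreover have "countable ?K"
    by (intro countable_lists countable_SIGMA) (simp_all add: countable_finite)
  then have "countable ?L" by (rule countable_subset[rotated]) blast
  then have "(\<Union>l\<in>?L. cylinder l) \<in> sets hash_space"
    by (rule sets.countable_UN') (use sets_cylinder in blast)
  ultimately show ?thesis by simp
qed

section \<open>Distribution of the hash values of the attempts\<close>

definition hash_values :: "'u hash \<Rightarrow> nat \<Rightarrow> nat \<Rightarrow> 'u list \<Rightarrow> nat list" where
  "hash_values h e M xs = map (\<lambda>x. h (e, 0, M, x)) xs"

lemma hash_values_mem:
  assumes "h \<in> space hash_space" "0 < M"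
  shows "hash_values h e M xs \<in> words_over M (length xs)"
proof -
  have "h (e, 0, M, x) < M" for x
    using assms(2) space_hash_space[THEN iffD1, OF assms(1), rule_format, of "(e, 0, M, x)"]
    by (simp add: hash_range_def)
  then show ?thesis by (auto simp: hash_values_def words_over_def)
qed

text \<open>The event prescribes \<open>length xs * E\<close> coordinates of the product. They are
  pairwise different because \<open>xs\<close> is distinct, so the probabilities
  \<open>1 / M\<close> multiply.\<close>

lemma prob_hash_values_eq:
  fixes xs :: "'u list"
  assumes "distinct xs" "0 < M" and \<phi>: "\<phi> \<in> {1..E} \<rightarrow>\<^sub>E words_over M (length xs)"
  shows "{h \<in> space hash_space. \<forall>e\<in>{1..E}. hash_values h e M xs = \<phi> e} \<in> sets hash_space"
    and "measure hash_space {h \<in> space hash_space. \<forall>e\<in>{1..E}. hash_values h e M xs = \<phi> e}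
      = (1 / real M) ^ (length xs * E)"
proof -
  let ?J = "(\<lambda>(e, i). (e, 0, M, xs ! i)) ` ({1..E} \<times> {..<length xs}) :: 'u hash_key set"
  have inj: "inj_on (\<lambda>(e, i). (e, 0 :: nat, M, xs ! i)) ({1..E} \<times> {..<length xs})"
    using assms(1) by (auto simp: inj_on_def nth_eq_iff_index_eq)
  have finite: "finite ?J" by simp
  \<comment> \<open>The value prescribed at a coordinate, found by inverting the map from family and
    position to coordinates.\<close>
  define v where "v = (\<lambda>j. let (e, i) = inv_into ({1..E} \<times> {..<length xs})
    (\<lambda>(e, i). (e, 0 :: nat, M, xs ! i)) j in \<phi> e ! i)"
  have v: "v (e, 0, M, xs ! i) = \<phi> e ! i" if "e \<in> {1..E}" "i < length xs" for e i
    using inv_into_f_f[OF inj, of "(e, i)"] that by (simp add: v_def)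
  have len: "length (\<phi> e) = length xs" "set (\<phi> e) \<subseteq> {..<M}" if "e \<in> {1..E}" for e
    using PiE_mem[OF \<phi> that] by (auto simp: words_over_def)
  have eq: "{h \<in> space hash_space. \<forall>e\<in>{1..E}. hash_values h e M xs = \<phi> e}
      = prod_emb UNIV (\<lambda>j. uniform_count_measure {..<hash_range j}) ?J (\<Pi>\<^sub>E j\<in>?J. {v j})"
    (is "?A = ?B")
  proof -
    have "h \<in> ?A \<longleftrightarrow> h \<in> space hash_space \<and> (\<forall>j\<in>?J. h j = v j)" for h
    proof -
      have "hash_values h e M xs = \<phi> e \<longleftrightarrow> (\<forall>i<length xs. h (e, 0, M, xs ! i) = v (e, 0, M, xs ! i))"
        if "e \<in> {1..E}" for e
        using len[OF that] v[OF that] by (simp add: hash_values_def list_eq_iff_nth_eq)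
      then show ?thesis
        by (simp cong: conj_cong, simp add: Ball_def)
    qed
    moreover have "h \<in> ?B \<longleftrightarrow> h \<in> space hash_space \<and> (\<forall>j\<in>?J. h j = v j)" for h
    proof -
      have "restrict h J \<in> (\<Pi>\<^sub>E j\<in>J. {v j}) \<longleftrightarrow> (\<forall>j\<in>J. h j = v j)" for J
        by (auto simp: PiE_def Pi_def)
      then show ?thesis
        unfolding prod_emb_def hash_space_eq by (simp only: Int_iff vimage_eq conj_commute space_PiM)
    qed
    ultimately show ?thesis by blast
  qed
  have singleton: "{v j} \<in> sets (uniform_count_measure {..<hash_range j})"
    "emeasure (uniform_count_measure {..<hash_range j}) {v j} = ennreal (1 / real M)" if "j \<in> ?J" for j
  proof -
    from that obtain e i where ei: "e \<in> {1..E}" "i < length xs" "j = (e, 0, M, xs ! i)" by auto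
    then have "v j < M" using v[OF ei(1,2)] len[OF ei(1)] nth_mem[of i "\<phi> e"] by (simp add: subset_iff)
    moreover have "hash_range j = M" using ei(3) assms(2) by (simp add: hash_range_def)
    ultimately show "{v j} \<in> sets (uniform_count_measure {..<hash_range j})"
      "emeasure (uniform_count_measure {..<hash_range j}) {v j} = ennreal (1 / real M)"
      by (simp_all add: sets_uniform_count_measure emeasure_uniform_count_measure)
  qed
  show "?A \<in> sets hash_space"
    unfolding eq unfolding hash_space_eq
    by (rule sets_PiM_I) (use singleton finite in auto)
  have "emeasure hash_space ?A = (\<Prod>j\<in>?J. emeasure (uniform_count_measure {..<hash_range j}) {v j})"
    unfolding eq unfolding hash_space_eq
    by (rule emeasure_PiM_emb) (use prob_space_uniform_hash singleton finite in auto)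
  also have "\<dots> = (\<Prod>j\<in>?J. ennreal (1 / real M))"
    using singleton by (intro prod.cong) auto
  also have "\<dots> = ennreal ((1 / real M) ^ (length xs * E))"
    using card_image[OF inj] by (simp add: ennreal_power mult.commute)
  finally show "measure hash_space ?A = (1 / real M) ^ (length xs * E)"
    by (simp add: measure_def)
qed

text \<open>The event is the disjoint union over all \<open>\<phi>\<close> that choose a member of
  \<open>B\<close> for each family; counting them yields the independence of the attempts. Families
  are counted from 1 because every attempt begins with \<open>Fresh\<close>.\<close>

lemma prob_all_hash_values_in:
  fixes xs :: "'u list"
  assumes "distinct xs" "0 < M" and B: "B \<subseteq> words_over M (length xs)"
  shows "{h \<in> space hash_space. \<forall>e\<in>{1..E}. hash_values h e M xs \<in> B} \<in> sets hash_space"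
    and "measure hash_space {h \<in> space hash_space. \<forall>e\<in>{1..E}. hash_values h e M xs \<in> B}
      = (real (card B) / real (M ^ length xs)) ^ E"
proof -
  interpret prob_space "hash_space :: 'u hash measure" by (rule prob_space_hash_space)
  let ?\<Phi> = "{1..E} \<rightarrow>\<^sub>E B"
  let ?C = "\<lambda>\<phi>. {h \<in> space hash_space. \<forall>e\<in>{1..E}. hash_values h e M xs = \<phi> e} :: 'u hash set"
  have "finite B" using B finite_words_over by (rule finite_subset)
  then have fin: "finite ?\<Phi>" by (intro finite_PiE) auto
  have sub: "\<phi> \<in> {1..E} \<rightarrow>\<^sub>E words_over M (length xs)" if "\<phi> \<in> ?\<Phi>" for \<phi>
    using that B by (auto simp: PiE_def Pi_def)
  have eq: "{h \<in> space hash_space. \<forall>e\<in>{1..E}. hash_values h e M xs \<in> B} = (\<Union>\<phi>\<in>?\<Phi>. ?C \<phi>)"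
  proof (intro set_eqI iffI)
    fix h :: "'u hash"
    assume h: "h \<in> {h \<in> space hash_space. \<forall>e\<in>{1..E}. hash_values h e M xs \<in> B}"
    show "h \<in> (\<Union>\<phi>\<in>?\<Phi>. ?C \<phi>)"
      by (rule UN_I[of "\<lambda>e\<in>{1..E}. hash_values h e M xs"]) (use h in auto)
  qed (auto simp: PiE_def Pi_def)
  have C: "?C \<phi> \<in> sets hash_space" "measure hash_space (?C \<phi>) = (1 / real M) ^ (length xs * E)"
    if "\<phi> \<in> ?\<Phi>" for \<phi>
    using prob_hash_values_eq[OF assms(1,2) sub[OF that]] by auto
  show "{h \<in> space hash_space. \<forall>e\<in>{1..E}. hash_values h e M xs \<in> B} \<in> sets hash_space"
    unfolding eq using C(1) fin by (intro sets.finite_UN) auto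
  have disj: "disjoint_family_on ?C ?\<Phi>"
    unfolding disjoint_family_on_def
  proof (intro ballI impI)
    fix \<phi> \<psi> assume *: "\<phi> \<in> ?\<Phi>" "\<psi> \<in> ?\<Phi>" "\<phi> \<noteq> \<psi>"
    then obtain e where "e \<in> {1..E}" "\<phi> e \<noteq> \<psi> e" by (metis PiE_ext)
    then show "?C \<phi> \<inter> ?C \<psi> = {}" by force
  qed
  have "measure hash_space (\<Union>\<phi>\<in>?\<Phi>. ?C \<phi>) = (\<Sum>\<phi>\<in>?\<Phi>. measure hash_space (?C \<phi>))"
    using C(1) fin disj by (intro finite_measure_finite_Union) auto
  also have "\<dots> = (\<Sum>\<phi>\<in>?\<Phi>. (1 / real M) ^ (length xs * E))"
    using C(2) by (intro sum.cong) auto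
  also have "\<dots> = (real (card B) / real (M ^ length xs)) ^ E"
    by (simp add: card_PiE power_mult power_divide power_one_over)
  finally show "measure hash_space {h \<in> space hash_space. \<forall>e\<in>{1..E}. hash_values h e M xs \<in> B}
      = (real (card B) / real (M ^ length xs)) ^ E"
    unfolding eq .
qed

section \<open>Bit fields in memory\<close>

notation Seq (infixr ";;" 60)

abbreviation plus_exp (infixl "[+]" 65) where "x [+] y \<equiv> Bin Plus x y"
abbreviation minus_exp (infixl "[-]" 65) where "x [-] y \<equiv> Bin Minus x y"
abbreviation times_exp (infixl "[*]" 70) where "x [*] y \<equiv> Bin Times x y"
abbreviation div_exp (infixl "[div]" 70) where "x [div] y \<equiv> Bin Divide x y"
abbreviation mod_exp (infixl "[mod]" 70) where "x [mod] y \<equiv> Bin Modulo x y"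
abbreviation less_exp (infix "[<]" 50) where "x [<] y \<equiv> Bin Less x y"
abbreviation equal_exp (infix "[=]" 50) where "x [=] y \<equiv> Bin Equal x y"
abbreviation shiftl_exp (infixl "[<<]" 75) where "x [<<] y \<equiv> Bin ShiftL x y"
abbreviation shiftr_exp (infixl "[>>]" 75) where "x [>>] y \<equiv> Bin ShiftR x y"
abbreviation and_exp (infixr "[and]" 64) where "x [and] y \<equiv> Bin BAnd x y"
abbreviation or_exp (infixr "[or]" 59) where "x [or] y \<equiv> Bin BOr x y"
abbreviation xor_exp (infixr "[xor]" 59) where "x [xor] y \<equiv> Bin BXor x y"

unbundle bit_operations_syntax

section \<open>Register arithmetic without overflow\<close>

lemma eval_bound [simp]: "eval W R e < 2 ^ W"
  by (cases e) simp_all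

lemma take_bit_eval [simp]: "take_bit W (eval W R e) = eval W R e"
  by (simp add: take_bit_nat_eq_self)

lemma eval_ConstI: "a < 2 ^ W \<Longrightarrow> eval W R (Const a) = a"
  by (simp add: take_bit_nat_eq_self)

lemma eval_RegI: "R r < 2 ^ W \<Longrightarrow> eval W R (Reg r) = R r"
  by (simp add: take_bit_nat_eq_self)

text \<open>Sums and products require a proof that nothing wraps at \<open>2 ^ W\<close>;
  differences, quotients, remainders and right shifts cannot grow and come without a condition. Left
  shifts keep their truncation explicit.\<close>

lemma eval_Plus: "eval W R x + eval W R y < 2 ^ W \<Longrightarrow> eval W R (x [+] y) = eval W R x + eval W R y"
  by (simp add: take_bit_nat_eq_self)

lemma eval_Times: "eval W R x * eval W R y < 2 ^ W \<Longrightarrow> eval W R (x [*] y) = eval W R x * eval W R y"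
  by (simp add: take_bit_nat_eq_self)

lemma eval_ShiftL: "eval W R (x [<<] y) = take_bit W (push_bit (eval W R y) (eval W R x))"
  by simp

lemma eval_Minus: "eval W R (x [-] y) = eval W R x - eval W R y"
  by (simp add: take_bit_nat_eq_self order.strict_trans1[OF diff_le_self])

lemma eval_Divide: "eval W R (x [div] y) = eval W R x div eval W R y"
  by (simp add: take_bit_nat_eq_self order.strict_trans1[OF div_le_dividend])

lemma eval_Modulo: "eval W R (x [mod] y) = eval W R x mod eval W R y"
  by (simp add: take_bit_nat_eq_self order.strict_trans1[OF mod_less_eq_dividend])

lemma eval_ShiftR: "eval W R (x [>>] y) = drop_bit (eval W R y) (eval W R x)"
  by (simp add: take_bit_nat_eq_self drop_bit_eq_div order.strict_trans1[OF div_le_dividend])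

lemma eval_And: "eval W R (x [and] y) = eval W R x AND eval W R y"
  by (simp del: eval.simps(1,2) add: eval.simps(3))

lemma eval_Or: "eval W R (x [or] y) = (eval W R x OR eval W R y)"
  by simp

lemma eval_Xor: "eval W R (x [xor] y) = (eval W R x XOR eval W R y)"
  by simp

lemma eval_Less: "0 < W \<Longrightarrow> eval W R (x [<] y) = of_bool (eval W R x < eval W R y)"
  by (cases W) (simp_all add: take_bit_Suc)

lemma eval_Equal: "0 < W \<Longrightarrow> eval W R (x [=] y) = of_bool (eval W R x = eval W R y)"
  by (cases W) (simp_all add: take_bit_Suc)

lemmas eval_rules = eval_ConstI eval_RegI eval_Plus eval_Times eval_ShiftL eval_Minus eval_Divide
  eval_Modulo eval_ShiftR eval_And eval_Or eval_Xor eval_Less eval_Equal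

section \<open>Memory as a string of bits\<close>

definition mbit :: "nat \<Rightarrow> (nat \<Rightarrow> nat) \<Rightarrow> nat \<Rightarrow> bool" where
  "mbit w A p = bit (A (p div w)) (p mod w)"

definition field :: "nat \<Rightarrow> (nat \<Rightarrow> nat) \<Rightarrow> nat \<Rightarrow> nat \<Rightarrow> nat" where
  "field w A p l = horner_sum of_bool 2 (map (\<lambda>i. mbit w A (p + i)) [0..<l])"

lemma bit_field: "bit (field w A p l) i \<longleftrightarrow> i < l \<and> mbit w A (p + i)"
  by (auto simp: field_def bit_horner_sum_bit_iff)

lemma less_exp_if_bits: "(\<And>i. bit x i \<Longrightarrow> i < m) \<Longrightarrow> x < 2 ^ m" for x :: nat
  by (metis bit_eq_iff bit_take_bit_iff take_bit_nat_eq_self_iff)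

lemma bit_less_exp: "x < 2 ^ m \<Longrightarrow> bit x i \<Longrightarrow> i < m" for x :: nat
  by (metis bit_take_bit_iff take_bit_nat_eq_self_iff)

lemma field_less: "field w A p l < 2 ^ l"
  by (rule less_exp_if_bits) (simp add: bit_field)

lemma field_eqI: "x < 2 ^ l \<Longrightarrow> (\<And>i. i < l \<Longrightarrow> mbit w A (p + i) = bit x i) \<Longrightarrow> field w A p l = x"
  by (rule bit_eqI) (auto simp: bit_field dest: bit_less_exp)

lemma field_cong: "(\<And>i. i < l \<Longrightarrow> mbit w A (p + i) = mbit w A' (q + i)) \<Longrightarrow> field w A p l = field w A' q l"
  by (rule bit_eqI) (auto simp: bit_field)

text \<open>Well-formedness of the new words is included so that successive writes can be
  chained.\<close>

definition put :: "nat \<Rightarrow> (nat \<Rightarrow> nat) \<Rightarrow> nat \<Rightarrow> nat \<Rightarrow> (nat \<Rightarrow> bool) \<Rightarrow> (nat \<Rightarrow> nat) \<Rightarrow> bool" where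
  "put w A p l v A' \<longleftrightarrow> (\<forall>a. A' a < 2 ^ w) \<and>
    (\<forall>i. mbit w A' i = (if p \<le> i \<and> i < p + l then v (i - p) else mbit w A i))"

lemma mbit_inside: "i < w \<Longrightarrow> mbit w A (a * w + i) = bit (A a) i"
  by (simp add: mbit_def)

text \<open>A frame condition: \<open>X\<close> lists the registers a program may change, while the
  memory is described separately.\<close>

definition agree :: "nat set \<Rightarrow> config \<Rightarrow> config \<Rightarrow> bool" where
  "agree X \<sigma> \<tau> \<longleftrightarrow> (\<forall>r. r \<notin> X \<longrightarrow> regs \<tau> r = regs \<sigma> r) \<and> family \<tau> = family \<sigma>"

lemma agree_refl: "agree X \<sigma> \<sigma>"
  by (simp add: agree_def)

lemma agree_trans: "agree X \<sigma> \<tau> \<Longrightarrow> agree Y \<tau> \<upsilon> \<Longrightarrow> X \<subseteq> Z \<Longrightarrow> Y \<subseteq> Z \<Longrightarrow> agree Z \<sigma> \<upsilon>"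
  unfolding agree_def by (metis subsetD)

text \<open>Whole words are collected in register 12 and the field is cut out at the end. Bits of
  the last word may be lost beyond the register width, but they lie behind the field.\<close>

definition load_bits :: "bank \<Rightarrow> com" where
  "load_bits b =
    Assign 13 (Const 0) ;; Assign 12 (Const 0) ;;
    While (Reg 13 [*] Reg 2 [<] Reg 10 [mod] Reg 2 [+] Reg 11)
      (Load 14 b (Reg 10 [div] Reg 2 [+] Reg 13) ;;
       Assign 12 (Reg 12 [or] Reg 14 [<<] (Reg 13 [*] Reg 2)) ;;
       Assign 13 (Reg 13 [+] Const 1)) ;;
    Assign 12 (Reg 12 [>>] (Reg 10 [mod] Reg 2) [mod] Const 1 [<<] Reg 11)"

text \<open>Every affected word is read, changed under a mask and written back, which takes two
  accesses; the bits outside the field must survive.\<close>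

definition store_bits :: "bank \<Rightarrow> com" where
  "store_bits b =
    Assign 13 (Const 0) ;;
    While (Reg 13 [*] Reg 2 [<] Reg 10 [mod] Reg 2 [+] Reg 11)
      (Load 14 b (Reg 10 [div] Reg 2 [+] Reg 13) ;;
       Assign 14 (Reg 14 [xor]
         ((Reg 14 [xor] Reg 12 [<<] (Reg 10 [mod] Reg 2) [>>] (Reg 13 [*] Reg 2)) [and]
           (Const 1 [<<] Reg 11 [-] Const 1) [<<] (Reg 10 [mod] Reg 2) [>>] (Reg 13 [*] Reg 2))) ;;
       Store b (Reg 10 [div] Reg 2 [+] Reg 13) (Reg 14) ;;
       Assign 13 (Reg 13 [+] Const 1))"

locale ram =
  fixes w W :: nat and h :: "'u hash" and xs :: "'u list"
begin

text \<open>Total correctness, with the cost passed to the postcondition. The existence of a run is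
  enough because programs are deterministic.\<close>

definition wp :: "com \<Rightarrow> config \<Rightarrow> (nat \<Rightarrow> config \<Rightarrow> bool) \<Rightarrow> bool" where
  "wp c \<sigma> Q \<longleftrightarrow> (\<exists>t \<tau>. exec w W h xs c \<sigma> t \<tau> \<and> Q t \<tau>)"

lemma wp_mono: "wp c \<sigma> P \<Longrightarrow> (\<And>t \<tau>. P t \<tau> \<Longrightarrow> Q t \<tau>) \<Longrightarrow> wp c \<sigma> Q"
  unfolding wp_def by blast

lemma wp_Skip: "Q 0 \<sigma> \<Longrightarrow> wp Skip \<sigma> Q"
  unfolding wp_def by (blast intro: exec.intros)

lemma wp_Assign: "Q 0 (\<sigma>\<lparr>regs := (regs \<sigma>)(r := eval W (regs \<sigma>) a)\<rparr>) \<Longrightarrow> wp (Assign r a) \<sigma> Q"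
  unfolding wp_def by (blast intro: exec.Assign)

lemma wp_Load:
  "Q 1 (\<sigma>\<lparr>regs := (regs \<sigma>)(r := take_bit W (mem \<sigma> b (eval W (regs \<sigma>) a)))\<rparr>) \<Longrightarrow> wp (Load r b a) \<sigma> Q"
  unfolding wp_def by (blast intro: exec.Load)

lemma wp_Store:
  "Q 1 (\<sigma>\<lparr>mem := (mem \<sigma>)(b := (mem \<sigma> b)
        (eval W (regs \<sigma>) a := take_bit w (eval W (regs \<sigma>) v)))\<rparr>) \<Longrightarrow> wp (Store b a v) \<sigma> Q"
  unfolding wp_def by (blast intro: exec.Store)

lemma wp_Hash:
  "Q 1 (\<sigma>\<lparr>regs := (regs \<sigma>)(r :=
        if eval W (regs \<sigma>) x < length xs
        then h (family \<sigma>, eval W (regs \<sigma>) i, eval W (regs \<sigma>) m, xs ! eval W (regs \<sigma>) x)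
        else 0)\<rparr>) \<Longrightarrow> wp (Hash r i m x) \<sigma> Q"
  unfolding wp_def by (blast intro: exec.Hash)

lemma wp_Fresh: "Q 1 (\<sigma>\<lparr>family := Suc (family \<sigma>)\<rparr>) \<Longrightarrow> wp Fresh \<sigma> Q"
  unfolding wp_def by (blast intro: exec.Fresh)

lemma wp_Seq: "wp c1 \<sigma> (\<lambda>t \<tau>. wp c2 \<tau> (\<lambda>u. Q (t + u))) \<Longrightarrow> wp (c1 ;; c2) \<sigma> Q"
  unfolding wp_def by (blast intro: exec.Seq)

lemma wp_If:
  "(eval W (regs \<sigma>) b \<noteq> 0 \<Longrightarrow> wp c1 \<sigma> Q) \<Longrightarrow> (eval W (regs \<sigma>) b = 0 \<Longrightarrow> wp c2 \<sigma> Q) \<Longrightarrow>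
    wp (If b c1 c2) \<sigma> Q"
  unfolding wp_def by (cases "eval W (regs \<sigma>) b = 0") (blast intro: exec.intros)+

lemma wp_WhileI:
  fixes \<mu> :: "config \<Rightarrow> nat"
  assumes "Inv 0 \<sigma>"
    and step: "\<And>t \<tau>. Inv t \<tau> \<Longrightarrow> eval W (regs \<tau>) b \<noteq> 0 \<Longrightarrow>
      wp c \<tau> (\<lambda>u \<upsilon>. Inv (t + u) \<upsilon> \<and> \<mu> \<upsilon> < \<mu> \<tau>)"
    and exit: "\<And>t \<tau>. Inv t \<tau> \<Longrightarrow> eval W (regs \<tau>) b = 0 \<Longrightarrow> Q t \<tau>"
  shows "wp (While b c) \<sigma> Q"
proof -
  have "wp (While b c) \<tau> (\<lambda>u. Q (t + u))" if "Inv t \<tau>" for t \<tau>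
    using that
  proof (induction "\<mu> \<tau>" arbitrary: t \<tau> rule: less_induct)
    case less
    show ?case
    proof (cases "eval W (regs \<tau>) b = 0")
      case True
      then show ?thesis
        using exit[OF less.prems] unfolding wp_def by (force intro: exec.WhileFalse)
    next
      case False
      then obtain u \<upsilon> where "exec w W h xs c \<tau> u \<upsilon>" "Inv (t + u) \<upsilon>" "\<mu> \<upsilon> < \<mu> \<tau>"
        using step[OF less.prems] unfolding wp_def by blast
      moreover from this obtain u' \<upsilon>' where
        "exec w W h xs (While b c) \<upsilon> u' \<upsilon>'" "Q (t + u + u') \<upsilon>'"
        using less.hyps unfolding wp_def by blast
      ultimately show ?thesis
        using exec.WhileTrue[OF False] unfolding wp_def add.assoc by blast
    qed
  qed
  from this[OF assms(1)] show ?thesis by simp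
qed

text \<open>A \<open>j\<close>-th word is touched only if it still begins before the end of the
  field, measured from the word boundary at or below \<open>p\<close>.\<close>

definition spans :: "nat \<Rightarrow> nat \<Rightarrow> nat \<Rightarrow> bool" where
  "spans p l j \<longleftrightarrow> j = 0 \<or> (j - 1) * w < p mod w + l"

lemma wp_load_bits:
  assumes w: "0 < w" and regs: "regs \<sigma> 2 = w" "regs \<sigma> 10 = p" "regs \<sigma> 11 = l"
    and W: "p + l + 2 * w < 2 ^ W" "l + w \<le> W" and mem: "\<And>a. mem \<sigma> b a < 2 ^ w"
  shows "wp (load_bits b) \<sigma> (\<lambda>t \<tau>. spans p l t \<and> regs \<tau> 12 = field w (mem \<sigma> b) p l \<and>
    agree {12, 13, 14} \<sigma> \<tau> \<and> mem \<tau> = mem \<sigma>)"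
proof -
  define A where "A = mem \<sigma> b"
  define a where "a = p div w"
  define d where "d = p mod w"
  have p: "p = a * w + d" "d < w" using w by (simp_all add: a_def d_def)
  have ap: "a \<le> p" by (simp add: a_def)
  have dp: "d \<le> p" by (simp add: d_def)
  have Wpos: "0 < W" using W w by simp
  have one: "1 < (2::nat) ^ W" using Wpos by (rule one_less_power[rotated]) simp
  have A: "A x < 2 ^ w" for x using mem by (simp add: A_def)
  have "w \<le> W" using W by simp
  then have AW: "A x < 2 ^ W" for x
    using A[of x] power_increasing[of w W "2::nat"] by linarith
  \<comment> \<open>Each round costs one access, so register 13 doubles as the cost.\<close>
  let ?Inv = "\<lambda>t \<tau>. regs \<tau> 13 = t \<and> spans p l t \<and> regs \<tau> 12 < 2 ^ W \<and>
    (\<forall>i<W. bit (regs \<tau> 12) i \<longleftrightarrow> i < t * w \<and> mbit w A (a * w + i)) \<and>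
    agree {12, 13, 14} \<sigma> \<tau> \<and> mem \<tau> = mem \<sigma>"
  have cond: "eval W (regs \<tau>) (Reg 13 [*] Reg 2 [<] Reg 10 [mod] Reg 2 [+] Reg 11)
      = of_bool (t * w < d + l)" if "?Inv t \<tau>" for t \<tau>
  proof -
    have "regs \<tau> 2 = w" "regs \<tau> 10 = p" "regs \<tau> 11 = l" "regs \<tau> 13 = t"
      using that regs by (simp_all add: agree_def)
    moreover have "t * w < 2 ^ W"
    proof (cases "t = 0")
      case False
      then have "(t - 1) * w < d + l" using that by (simp add: spans_def d_def)
      then have "t * w < d + l + w" using False by (cases t) simp_all
      then show ?thesis using W p(2) by linarith
    qed simp
    moreover have "t < 2 ^ W" using calculation(5) w by (metis le_less_trans mult.right_neutral mult_le_mono2 Suc_leI One_nat_def)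
    moreover have "p mod w + l < 2 ^ W" using W dp unfolding d_def by linarith
    ultimately show ?thesis
      using W Wpos by (simp add: eval_rules d_def del: eval.simps)
  qed
  have loop: "wp (While (Reg 13 [*] Reg 2 [<] Reg 10 [mod] Reg 2 [+] Reg 11)
      (Load 14 b (Reg 10 [div] Reg 2 [+] Reg 13) ;;
       Assign 12 (Reg 12 [or] Reg 14 [<<] (Reg 13 [*] Reg 2)) ;;
       Assign 13 (Reg 13 [+] Const 1))) (\<sigma>\<lparr>regs := (regs \<sigma>)(13 := 0, 12 := 0)\<rparr>)
    (\<lambda>t \<tau>. ?Inv t \<tau> \<and> eval W (regs \<tau>) (Reg 12 [>>] (Reg 10 [mod] Reg 2) [mod] Const 1 [<<] Reg 11)
      = field w (mem \<sigma> b) p l)"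
  proof (rule wp_WhileI[where Inv = ?Inv and \<mu> = "\<lambda>\<tau>. d + l - regs \<tau> 13 * w"])
    show "?Inv 0 (\<sigma>\<lparr>regs := (regs \<sigma>)(13 := 0, 12 := 0)\<rparr>)"
      by (simp add: spans_def agree_def)
  next
    fix t \<tau>
    assume Inv: "?Inv t \<tau>" and nz: "eval W (regs \<tau>) (Reg 13 [*] Reg 2 [<] Reg 10 [mod] Reg 2 [+] Reg 11) \<noteq> 0"
    have tw: "t * w < d + l" using cond[OF Inv] nz by (simp split: if_splits)
    have r: "regs \<tau> 2 = w" "regs \<tau> 10 = p" "regs \<tau> 11 = l" "regs \<tau> 13 = t"
      using Inv regs by (simp_all add: agree_def)
    have "t \<le> t * w" using w by simp
    then have tW: "t * w < 2 ^ W" "t < 2 ^ W" "a + t < 2 ^ W" "t + 1 < 2 ^ W" "p < 2 ^ W" "w < 2 ^ W"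
      using tw W ap p(2) w by linarith+
    have e1: "eval W (regs \<tau>) (Reg 10 [div] Reg 2 [+] Reg 13) = a + t"
      using r tW by (simp add: eval_rules a_def del: eval.simps)
    have Sp: "spans p l (Suc t)" using tw by (simp add: spans_def d_def)
    let ?v = "regs \<tau> 12 OR take_bit W (push_bit (t * w) (A (a + t)))"
    have bits: "bit ?v i \<longleftrightarrow> i < Suc t * w \<and> mbit w A (a * w + i)" if "i < W" for i
    proof -
      \<comment> \<open>Bit \<open>i\<close> belongs to an earlier word, to the word just loaded, or
        to a word not loaded yet.\<close>
      consider "i < t * w" | j where "i = t * w + j" "j < w" | "Suc t * w \<le> i"
        by (metis add.commute le_Suc_ex less_diff_conv2 linorder_not_le mult_Suc nat_add_left_cancel_less)
      then show ?thesis
      proof cases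
        case 1
        then show ?thesis using Inv that by (simp add: bit_or_iff bit_take_bit_iff bit_push_bit_iff)
      next
        case 2
        then have "mbit w A (a * w + i) = bit (A (a + t)) j"
          using mbit_inside[of j w A "a + t"] by (simp add: algebra_simps)
        then show ?thesis
          using 2 Inv that by (simp add: bit_or_iff bit_take_bit_iff bit_push_bit_iff)
      next
        case 3
        then have "\<not> bit (A (a + t)) (i - t * w)"
          using bit_less_exp[OF A, of "a + t" "i - t * w"] by auto
        then show ?thesis
          using 3 Inv that by (simp add: bit_or_iff bit_take_bit_iff bit_push_bit_iff)
      qed
    qed
    have e2: "eval W ((regs \<tau>)(14 := take_bit W (mem \<tau> b (a + t)))) (Reg 12 [or] Reg 14 [<<] (Reg 13 [*] Reg 2)) = ?v"
      using r tW Inv AW one by (simp add: eval_rules A_def take_bit_nat_eq_self del: eval.simps)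
    have "?v < 2 ^ W"
      using Inv by (simp add: take_bit_nat_eq_self_iff[symmetric] del: take_bit_nat_less_exp)
    then have e3: "eval W ((regs \<tau>)(14 := x, 12 := ?v)) (Reg 13 [+] Const 1) = Suc t" for x
      using r tW one by (simp add: eval_rules del: eval.simps)
    show "wp (Load 14 b (Reg 10 [div] Reg 2 [+] Reg 13) ;;
       Assign 12 (Reg 12 [or] Reg 14 [<<] (Reg 13 [*] Reg 2)) ;;
       Assign 13 (Reg 13 [+] Const 1)) \<tau>
     (\<lambda>u \<upsilon>. ?Inv (t + u) \<upsilon> \<and> d + l - regs \<upsilon> 13 * w < d + l - regs \<tau> 13 * w)"
      apply (intro wp_Seq wp_Assign wp_Load)
      apply (simp del: eval.simps One_nat_def add: e1 e2 e3)
      using bits Sp \<open>?v < 2 ^ W\<close> tw r w Inv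
      apply (auto simp: agree_def)
      done
  next
    fix t \<tau>
    assume Inv: "?Inv t \<tau>" and z: "eval W (regs \<tau>) (Reg 13 [*] Reg 2 [<] Reg 10 [mod] Reg 2 [+] Reg 11) = 0"
    have tw: "d + l \<le> t * w" using cond[OF Inv] z by (simp split: if_splits)
    have r: "regs \<tau> 2 = w" "regs \<tau> 10 = p" "regs \<tau> 11 = l" "regs \<tau> 13 = t"
      using Inv regs by (simp_all add: agree_def)
    have "l < W" using W w by simp
    then have lW: "(2::nat) ^ l < 2 ^ W" by simp
    then have pl: "take_bit W (push_bit l (1::nat)) = 2 ^ l"
      by (simp add: push_bit_eq_mult take_bit_nat_eq_self)
    have e: "eval W (regs \<tau>) (Reg 12 [>>] (Reg 10 [mod] Reg 2) [mod] Const 1 [<<] Reg 11)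
        = take_bit l (drop_bit d (regs \<tau> 12))"
      using r Inv W one lW by (simp add: eval_rules pl take_bit_eq_mod d_def del: eval.simps)
    have "take_bit l (drop_bit d (regs \<tau> 12)) = field w A p l"
    proof (rule bit_eqI)
      fix i
      have "i < l \<Longrightarrow> d + i < W \<and> d + i < t * w" using W p(2) tw by linarith
      then show "bit (take_bit l (drop_bit d (regs \<tau> 12))) i = bit (field w A p l) i"
        using Inv by (auto simp: bit_take_bit_iff bit_drop_bit_eq bit_field p(1) add.assoc)
    qed
    then show "?Inv t \<tau> \<and> eval W (regs \<tau>) (Reg 12 [>>] (Reg 10 [mod] Reg 2) [mod] Const 1 [<<] Reg 11)
      = field w (mem \<sigma> b) p l"
      using e Inv by (simp add: A_def del: eval.simps)
  qed
  show ?thesis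
    unfolding load_bits_def
    apply (intro wp_Seq wp_Assign)
    apply (simp add: eval_ConstI del: eval.simps One_nat_def)
    apply (rule wp_mono[OF loop])
    apply (rule wp_Assign)
    apply (auto simp: agree_def A_def simp del: eval.simps)
    done
qed

lemma wp_store_bits:
  assumes w: "0 < w" and regs: "regs \<sigma> 2 = w" "regs \<sigma> 10 = p" "regs \<sigma> 11 = l" "regs \<sigma> 12 = v"
    and W: "p + l + 2 * w < 2 ^ W" "l + w \<le> W" "v < 2 ^ W" and mem: "\<And>a. mem \<sigma> b a < 2 ^ w"
  shows "wp (store_bits b) \<sigma> (\<lambda>t \<tau>. (\<exists>j. t = 2 * j \<and> spans p l j) \<and> agree {13, 14} \<sigma> \<tau> \<and>
    (\<exists>A. mem \<tau> = (mem \<sigma>)(b := A) \<and> put w (mem \<sigma> b) p l (bit v) A))"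
proof -
  define A where "A = mem \<sigma> b"
  define a where "a = p div w"
  define d where "d = p mod w"
  have p: "p = a * w + d" "d < w" using w by (simp_all add: a_def d_def)
  have ap: "a \<le> p" by (simp add: a_def)
  have dp: "d \<le> p" by (simp add: d_def)
  have Wpos: "0 < W" using W w by simp
  have one: "1 < (2::nat) ^ W" using Wpos by (rule one_less_power[rotated]) simp
  have A: "A x < 2 ^ w" for x using mem by (simp add: A_def)
  have "w \<le> W" using W by simp
  then have wW: "(2::nat) ^ w \<le> 2 ^ W" by (intro power_increasing) simp_all
  \<comment> \<open>After \<open>j\<close> rounds the field is written as far as it lies in the
    first \<open>j\<close> words.\<close>
  define P where "P = (\<lambda>j B. (\<forall>x. B x < 2 ^ w) \<and>
    (\<forall>i. mbit w B i = (if p \<le> i \<and> i < p + l \<and> i < (a + j) * w then bit v (i - p) else mbit w A i)))"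
  let ?Inv = "\<lambda>t \<tau>. t = 2 * regs \<tau> 13 \<and> spans p l (regs \<tau> 13) \<and> agree {13, 14} \<sigma> \<tau> \<and>
    (\<exists>B. mem \<tau> = (mem \<sigma>)(b := B) \<and> P (regs \<tau> 13) B)"
  have bounds: "j * w < 2 ^ W \<and> j < 2 ^ W" if "spans p l j" for j
  proof -
    have "j * w < 2 ^ W"
    proof (cases "j = 0")
      case False
      then have "(j - 1) * w < d + l" using that by (simp add: spans_def d_def)
      then have "j * w < d + l + w" using False by (cases j) simp_all
      then show ?thesis using W p(2) by linarith
    qed simp
    moreover have "j \<le> j * w" using w by simp
    ultimately show ?thesis by linarith
  qed
  have cond: "eval W (regs \<tau>) (Reg 13 [*] Reg 2 [<] Reg 10 [mod] Reg 2 [+] Reg 11)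
      = of_bool (regs \<tau> 13 * w < d + l)" if "?Inv t \<tau>" for t \<tau>
  proof -
    have "regs \<tau> 2 = w" "regs \<tau> 10 = p" "regs \<tau> 11 = l"
      using that regs by (simp_all add: agree_def)
    moreover have "p mod w + l < 2 ^ W" using W dp unfolding d_def by linarith
    ultimately show ?thesis
      using W Wpos bounds[of "regs \<tau> 13"] that by (simp add: eval_rules d_def del: eval.simps)
  qed
  show ?thesis
    unfolding store_bits_def
  proof (intro wp_Seq wp_Assign, simp del: One_nat_def, rule wp_WhileI[where Inv = ?Inv and \<mu> = "\<lambda>\<tau>. d + l - regs \<tau> 13 * w"])
    have "P 0 A"
      using A by (auto simp: P_def p)
    then show "?Inv 0 (\<sigma>\<lparr>regs := (regs \<sigma>)(13 := 0)\<rparr>)"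
      by (auto simp: spans_def agree_def A_def intro!: exI[of _ "mem \<sigma> b"])
  next
    fix t \<tau>
    assume Inv: "?Inv t \<tau>" and nz: "eval W (regs \<tau>) (Reg 13 [*] Reg 2 [<] Reg 10 [mod] Reg 2 [+] Reg 11) \<noteq> 0"
    define j where "j = regs \<tau> 13"
    from Inv obtain B where B: "mem \<tau> = (mem \<sigma>)(b := B)" "P j B" by (auto simp: j_def)
    have jw: "j * w < d + l" using cond[OF Inv] nz by (simp add: j_def split: if_splits)
    have r: "regs \<tau> 2 = w" "regs \<tau> 10 = p" "regs \<tau> 11 = l" "regs \<tau> 12 = v" "regs \<tau> 13 = j"
      using Inv regs by (simp_all add: agree_def j_def)
    have "j \<le> j * w" using w by simp
    then have jW: "j * w < 2 ^ W" "j < 2 ^ W" "a + j < 2 ^ W" "j + 1 < 2 ^ W" "p < 2 ^ W" "w < 2 ^ W"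
      using jw W ap p(2) w by linarith+
    have Sp: "spans p l (Suc j)" using jw by (simp add: spans_def d_def)
    have e1: "eval W (regs \<tau>) (Reg 10 [div] Reg 2 [+] Reg 13) = a + j"
      using r jW by (simp add: eval_rules a_def del: eval.simps)
    have e1': "eval W ((regs \<tau>)(14 := y)) (Reg 10 [div] Reg 2 [+] Reg 13) = a + j" for y
      using r jW by (simp add: eval_rules a_def del: eval.simps)
    define x where "x = B (a + j)"
    \<comment> \<open>Value and mask are moved to the position \<open>d\<close> inside the first
      word, and the part that falls into word \<open>j\<close> is cut out. Then \<open>y\<close>
      takes its bits from \<open>V\<close> under the mask and from \<open>x\<close>
      elsewhere.\<close>
    define V where "V = drop_bit (j * w) (take_bit W (push_bit d v))"
    define M :: nat where "M = drop_bit (j * w) (take_bit W (push_bit d (mask l)))"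
    define y where "y = (x XOR (x XOR V) AND M)"
    have x: "x < 2 ^ w" using B(2) by (simp add: P_def x_def)
    have xW: "x < 2 ^ W" using x wW by linarith
    have "l < W" using W w by simp
    then have pl: "take_bit W (push_bit l (1::nat)) - 1 = mask l"
      by (simp add: push_bit_eq_mult take_bit_nat_eq_self mask_eq_exp_minus_1)
    have e2: "eval W ((regs \<tau>)(14 := x)) (Reg 14 [xor]
         ((Reg 14 [xor] Reg 12 [<<] (Reg 10 [mod] Reg 2) [>>] (Reg 13 [*] Reg 2)) [and]
           (Const 1 [<<] Reg 11 [-] Const 1) [<<] (Reg 10 [mod] Reg 2) [>>] (Reg 13 [*] Reg 2))) = y"
      using r jW one W xW pl
      by (simp add: eval_rules y_def V_def M_def d_def del: eval.simps)
    have yW: "y < 2 ^ W"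
      unfolding e2[symmetric] by (rule eval_bound)
    have e3: "eval W ((regs \<tau>)(14 := y)) (Reg 13 [+] Const 1) = Suc j"
      using r jW one by (simp add: eval_rules del: eval.simps)
    have e4: "eval W ((regs \<tau>)(14 := y)) (Reg 14) = y"
      using yW by (simp add: eval_rules del: eval.simps)
    have "P (Suc j) (B(a + j := take_bit w y))"
      unfolding P_def
    proof (intro conjI allI)
      fix i
      show "(B(a + j := take_bit w y)) i < 2 ^ w"
        using B(2) by (simp add: P_def)
    next
      fix i
      have Bi: "mbit w B i = (if p \<le> i \<and> i < p + l \<and> i < (a + j) * w then bit v (i - p) else mbit w A i)"
        using B(2) by (simp add: P_def)
      show "mbit w (B(a + j := take_bit w y)) i =
        (if p \<le> i \<and> i < p + l \<and> i < (a + Suc j) * w then bit v (i - p) else mbit w A i)"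
      proof (cases "i div w = a + j")
        case True
        define c where "c = i mod w"
        have i: "i = a * w + (j * w + c)" "c < w"
          using div_mult_mod_eq[of i w] True w by (simp_all add: c_def algebra_simps)
        have "bit x c = mbit w A i"
        proof -
          have "\<not> i < (a + j) * w" using i(1) by (simp add: algebra_simps)
          then have "mbit w B i = mbit w A i" using Bi by simp
          then show ?thesis using True by (simp add: mbit_def[of w B] c_def x_def)
        qed
        moreover have "bit M c \<longleftrightarrow> p \<le> i \<and> i < p + l"
          using i(1) p W by (auto simp: M_def bit_drop_bit_eq bit_take_bit_iff bit_push_bit_iff bit_mask_iff)
        moreover have "bit V c \<longleftrightarrow> bit v (i - p)" if "p \<le> i" "i < p + l"
          using that i(1) p W by (auto simp: V_def bit_drop_bit_eq bit_take_bit_iff bit_push_bit_iff)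
        moreover have "i < (a + Suc j) * w" using i by (simp add: algebra_simps)
        moreover have "mbit w (B(a + j := take_bit w y)) i = bit y c"
          using True i(2) by (simp add: mbit_def c_def bit_take_bit_iff)
        moreover have "bit y c = (if bit M c then bit V c else bit x c)"
          by (auto simp: y_def bit_xor_iff bit_and_iff)
        ultimately show ?thesis by auto
      next
        case False
        have "i < (a + Suc j) * w \<longleftrightarrow> i div w < a + Suc j" "i < (a + j) * w \<longleftrightarrow> i div w < a + j"
          using w by (simp_all add: div_less_iff_less_mult)
        then have "i < (a + Suc j) * w \<longleftrightarrow> i < (a + j) * w" using False by auto
        then show ?thesis using Bi False by (simp add: mbit_def)
      qed
    qed
    moreover have "take_bit W x = x" using xW by (simp add: take_bit_nat_eq_self)
    ultimately show "wp (Load 14 b (Reg 10 [div] Reg 2 [+] Reg 13) ;;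
       Assign 14 (Reg 14 [xor]
         ((Reg 14 [xor] Reg 12 [<<] (Reg 10 [mod] Reg 2) [>>] (Reg 13 [*] Reg 2)) [and]
           (Const 1 [<<] Reg 11 [-] Const 1) [<<] (Reg 10 [mod] Reg 2) [>>] (Reg 13 [*] Reg 2))) ;;
       Store b (Reg 10 [div] Reg 2 [+] Reg 13) (Reg 14) ;;
       Assign 13 (Reg 13 [+] Const 1)) \<tau>
     (\<lambda>u \<upsilon>. ?Inv (t + u) \<upsilon> \<and> d + l - regs \<upsilon> 13 * w < d + l - regs \<tau> 13 * w)"
      using Inv Sp jw r w B(1)
      apply (intro wp_Seq wp_Assign wp_Load wp_Store)
      apply (simp del: eval.simps One_nat_def add: e1 e1' e2 e3 e4 x_def[symmetric])
      apply (intro conjI exI[of _ "B(a + j := take_bit w y)"])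
         apply (simp add: agree_def)
        apply simp_all
      done
  next
    fix t \<tau>
    assume Inv: "?Inv t \<tau>" and z: "eval W (regs \<tau>) (Reg 13 [*] Reg 2 [<] Reg 10 [mod] Reg 2 [+] Reg 11) = 0"
    have tw: "d + l \<le> regs \<tau> 13 * w" using cond[OF Inv] z by (simp split: if_splits)
    have "put w A p l (bit v) B" if "P (regs \<tau> 13) B" for B
    proof -
      have "i < (a + regs \<tau> 13) * w" if "i < p + l" for i
        using that tw p(1) by (simp add: algebra_simps)
      then show ?thesis using that by (auto simp: put_def P_def)
    qed
    then show "(\<exists>j. t = 2 * j \<and> spans p l j) \<and> agree {13, 14} \<sigma> \<tau> \<and>
        (\<exists>A. mem \<tau> = (mem \<sigma>)(b := A) \<and> put w (mem \<sigma> b) p l (bit v) A)"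
      using Inv by (auto simp: A_def)
  qed
qed

end

text \<open>Chunks end at word boundaries of the destination. So a chunk lies in one destination
  word and, being no longer than a word, in at most two source words: two loads plus one read and
  one write.\<close>

definition copy_bits :: "bank \<Rightarrow> bank \<Rightarrow> com" where
  "copy_bits b1 b2 =
    Assign 17 (Const 0) ;;
    While (Reg 17 [<] Reg 1)
      (Assign 10 (Reg 16 [+] Reg 17) ;;
       Assign 11 (Reg 2 [-] Reg 10 [mod] Reg 2) ;;
       If (Reg 1 [-] Reg 17 [<] Reg 11) (Assign 11 (Reg 1 [-] Reg 17)) Skip ;;
       Assign 10 (Reg 15 [+] Reg 17) ;;
       load_bits b1 ;;
       Assign 10 (Reg 16 [+] Reg 17) ;;
       store_bits b2 ;;
       Assign 17 (Reg 17 [+] Reg 11))"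

lemma put_append:
  assumes "put w A p l v B" "put w B (p + l) l' (\<lambda>i. v (l + i)) C"
  shows "put w A p (l + l') v C"
proof -
  have "mbit w C i = (if p \<le> i \<and> i < p + (l + l') then v (i - p) else mbit w A i)" for i
  proof (cases "p + l \<le> i \<and> i < p + l + l'")
    case True
    then have "mbit w C i = v (l + (i - (p + l)))" using assms(2) by (simp add: put_def)
    then show ?thesis using True by simp
  next
    case False
    then have "mbit w C i = mbit w B i" using assms(2) by (auto simp: put_def)
    then show ?thesis using assms(1) False by (auto simp: put_def)
  qed
  then show ?thesis using assms(2) by (simp add: put_def)
qed

context ram
begin

lemma wp_copy_bits:
  assumes w: "0 < w" and b: "b1 \<noteq> b2"
    and regs: "regs \<sigma> 1 = k" "regs \<sigma> 2 = w" "regs \<sigma> 15 = p1" "regs \<sigma> 16 = p2"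
    and W: "p1 + k + 3 * w < 2 ^ W" "p2 + k + 3 * w < 2 ^ W" "2 * w \<le> W"
    and mem: "\<And>b a. mem \<sigma> b a < 2 ^ w"
  shows "wp (copy_bits b1 b2) \<sigma> (\<lambda>t \<tau>. t \<le> 4 * (k div w) + 8 \<and>
    agree {10, 11, 12, 13, 14, 17} \<sigma> \<tau> \<and>
    (\<exists>A. mem \<tau> = (mem \<sigma>)(b2 := A) \<and>
      put w (mem \<sigma> b2) p2 k (\<lambda>i. mbit w (mem \<sigma> b1) (p1 + i)) A))"
proof -
  define d where "d = p2 mod w"
  have d: "d < w" using w by (simp add: d_def)
  have Wpos: "0 < W" using W w by simp
  define v where "v = (\<lambda>i. mbit w (mem \<sigma> b1) (p1 + i))"
  let ?X = "{10, 11, 12, 13, 14, 17} :: nat set"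
  \<comment> \<open>\<open>c\<close> counts the chunks. The first one is shortened by
    \<open>d\<close>, so the position after \<open>c\<close> chunks is \<open>c * w - d\<close>;
    truncated subtraction covers \<open>c = 0\<close>.\<close>
  let ?Inv = "\<lambda>t \<tau>. (\<exists>c. t \<le> 4 * c \<and> regs \<tau> 17 = min k (c * w - d) \<and> (c = 0 \<or> (c - 1) * w - d < k)) \<and>
    agree ?X \<sigma> \<tau> \<and> (\<exists>A. mem \<tau> = (mem \<sigma>)(b2 := A) \<and> put w (mem \<sigma> b2) p2 (regs \<tau> 17) v A)"
  have cond: "eval W (regs \<tau>) (Reg 17 [<] Reg 1) = of_bool (regs \<tau> 17 < k)" if "?Inv t \<tau>" for t \<tau>
  proof -
    have "regs \<tau> 1 = k" "regs \<tau> 17 \<le> k" using that regs by (auto simp: agree_def)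
    moreover have "k < 2 ^ W" using W by linarith
    ultimately show ?thesis
      using Wpos by (simp add: eval_rules del: eval.simps)
  qed
  have loop: "wp (While (Reg 17 [<] Reg 1)
      (Assign 10 (Reg 16 [+] Reg 17) ;;
       Assign 11 (Reg 2 [-] Reg 10 [mod] Reg 2) ;;
       If (Reg 1 [-] Reg 17 [<] Reg 11) (Assign 11 (Reg 1 [-] Reg 17)) Skip ;;
       Assign 10 (Reg 15 [+] Reg 17) ;;
       load_bits b1 ;;
       Assign 10 (Reg 16 [+] Reg 17) ;;
       store_bits b2 ;;
       Assign 17 (Reg 17 [+] Reg 11))) (\<sigma>\<lparr>regs := (regs \<sigma>)(17 := 0)\<rparr>)
    (\<lambda>t \<tau>. t \<le> 4 * (k div w) + 8 \<and> agree ?X \<sigma> \<tau> \<and>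
      (\<exists>A. mem \<tau> = (mem \<sigma>)(b2 := A) \<and> put w (mem \<sigma> b2) p2 k v A))"
  proof (rule wp_WhileI[where Inv = ?Inv and \<mu> = "\<lambda>\<tau>. k - regs \<tau> 17"])
    have "put w (mem \<sigma> b2) p2 0 v (mem \<sigma> b2)" using mem by (auto simp: put_def)
    then show "?Inv 0 (\<sigma>\<lparr>regs := (regs \<sigma>)(17 := 0)\<rparr>)"
      by (intro conjI exI[of _ 0] exI[of _ "mem \<sigma> b2"]) (simp_all add: agree_def)
  next
    fix t \<tau>
    assume Inv: "?Inv t \<tau>" and nz: "eval W (regs \<tau>) (Reg 17 [<] Reg 1) \<noteq> 0"
    from Inv obtain c A where c: "t \<le> 4 * c" "regs \<tau> 17 = min k (c * w - d)"
      and A: "mem \<tau> = (mem \<sigma>)(b2 := A)" "put w (mem \<sigma> b2) p2 (regs \<tau> 17) v A" by blast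
    have agr: "agree ?X \<sigma> \<tau>" using Inv by blast
    define s where "s = regs \<tau> 17"
    have s: "s < k" "s = c * w - d" using cond[OF Inv] nz c(2) by (auto simp: s_def split: if_splits)
    have r: "regs \<tau> 1 = k" "regs \<tau> 2 = w" "regs \<tau> 15 = p1" "regs \<tau> 16 = p2" "regs \<tau> 17 = s"
      using agr regs by (simp_all add: agree_def s_def)
    define d' where "d' = (p2 + s) mod w"
    have d': "d' < w" using w by (simp add: d'_def)
    \<comment> \<open>After the first chunk the destination position is a multiple of
      \<open>w\<close>, so the space up to the next boundary is a whole word.\<close>
    have next_s: "s + (w - d') = Suc c * w - d"
    proof (cases c)
      case 0
      then show ?thesis using s by (simp add: d'_def d_def)
    next
      case (Suc c')
      then have "d \<le> c * w" using d by simp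
      then have "p2 + s = p2 div w * w + c * w" using s(2) by (metis add.assoc add_diff_inverse_nat
          d_def div_mult_mod_eq group_cancel.add2 linorder_not_le)
      then have "d' = 0" by (simp add: d'_def flip: add_mult_distrib)
      then show ?thesis using s \<open>d \<le> c * w\<close> by simp
    qed
    define l where "l = min (w - d') (k - s)"
    have l: "l \<le> w" "s + l \<le> k" "d' + l \<le> w" "0 < l" using d' s(1) by (simp_all add: l_def)
    have s_l: "s + l = min k (Suc c * w - d)" 
    proof -
      have "s + l = min (s + (k - s)) (s + (w - d'))" by (simp add: l_def min_def)
      then show ?thesis using next_s s(1) by simp
    qed
    have bnd: "p1 + s + l + 2 * w < 2 ^ W" "p2 + s + l + 2 * w < 2 ^ W" "l + w \<le> W"
      "p1 + s < 2 ^ W" "p2 + s < 2 ^ W" "k < 2 ^ W" "w < 2 ^ W" "s < 2 ^ W" "s + l < 2 ^ W" "l < 2 ^ W"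
      "p1 < 2 ^ W" "p2 < 2 ^ W"
      using W l s(1) by linarith+
    have b1mem: "mem \<tau> b1 = mem \<sigma> b1" using A(1) b by simp
    define x where "x = field w (mem \<sigma> b1) (p1 + s) l"
    have "x < 2 ^ l" by (simp add: x_def field_less)
    moreover have "(2::nat) ^ l \<le> 2 ^ W" using bnd by (intro power_increasing) simp_all
    ultimately have xW: "x < 2 ^ W" by linarith
    have wf: "mem \<tau> b a < 2 ^ w" for b a
      using mem A by (simp add: put_def)
    have put: "put w (mem \<sigma> b2) p2 (s + l) v B" if "put w A (p2 + s) l (bit x) B" for B
    proof (rule put_append)
      show "put w (mem \<sigma> b2) p2 s v A" using A(2) by (simp add: s_def)
      show "put w A (p2 + s) l (\<lambda>i. v (s + i)) B"
        using that by (auto simp: put_def x_def bit_field v_def add.assoc)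
    qed
    have two: "j \<le> 2" if "spans (p1 + s) l j" for j
    proof (rule ccontr)
      assume "\<not> j \<le> 2"
      then have "2 * w \<le> (j - 1) * w" by (intro mult_le_mono1) simp
      moreover have "(j - 1) * w < (p1 + s) mod w + l"
        using that \<open>\<not> j \<le> 2\<close> by (auto simp: spans_def)
      moreover have "(p1 + s) mod w < w" using w by simp
      ultimately show False using l by linarith
    qed
    have one: "j \<le> 1" if "spans (p2 + s) l j" for j
    proof (rule ccontr)
      assume "\<not> j \<le> 1"
      then have "1 * w \<le> (j - 1) * w" by (intro mult_le_mono1) simp
      moreover have "(j - 1) * w < (p2 + s) mod w + l"
        using that \<open>\<not> j \<le> 1\<close> by (auto simp: spans_def)
      ultimately show False using l(3) unfolding d'_def by linarith
    qed
    let ?\<tau>1 = "\<lambda>q. \<tau>\<lparr>regs := (regs \<tau>)(10 := q, 11 := l)\<rparr>"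
    have load: "wp (load_bits b1) \<upsilon> (\<lambda>u \<upsilon>'. u \<le> 2 \<and> regs \<upsilon>' 12 = x \<and> regs \<upsilon>' 11 = l \<and>
        agree ?X \<sigma> \<upsilon>' \<and> mem \<upsilon>' = mem \<tau> \<and> regs \<upsilon>' 17 = s)"
      if st: "agree ?X \<sigma> \<upsilon>" "mem \<upsilon> = mem \<tau>" "regs \<upsilon> 10 = p1 + s" "regs \<upsilon> 11 = l" "regs \<upsilon> 17 = s" for \<upsilon>
    proof (rule wp_mono, rule wp_load_bits[OF w _ st(3,4) bnd(1,3)])
      show "regs \<upsilon> 2 = w" using st(1) regs by (simp add: agree_def)
      show "mem \<upsilon> b1 a < 2 ^ w" for a using wf st(2) by simp
    qed (use st two b1mem in \<open>auto simp: agree_def x_def\<close>)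
    have store: "wp (store_bits b2) \<upsilon> (\<lambda>u \<upsilon>'. u \<le> 2 \<and> regs \<upsilon>' 17 = s \<and> regs \<upsilon>' 11 = l \<and>
        agree ?X \<sigma> \<upsilon>' \<and> (\<exists>B. mem \<upsilon>' = (mem \<sigma>)(b2 := B) \<and> put w (mem \<sigma> b2) p2 (s + l) v B))"
      if st: "agree ?X \<sigma> \<upsilon>" "mem \<upsilon> = mem \<tau>" "regs \<upsilon> 10 = p2 + s" "regs \<upsilon> 11 = l" "regs \<upsilon> 12 = x" "regs \<upsilon> 17 = s" for \<upsilon>
    proof (rule wp_mono, rule wp_store_bits[OF w _ st(3,4,5) bnd(2,3) xW])
      show "regs \<upsilon> 2 = w" using st(1) regs by (simp add: agree_def)
      show "mem \<upsilon> b2 a < 2 ^ w" for a using wf st(2) by simp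
      fix u \<upsilon>'
      assume *: "(\<exists>j. u = 2 * j \<and> spans (p2 + s) l j) \<and> agree {13, 14} \<upsilon> \<upsilon>' \<and>
        (\<exists>B. mem \<upsilon>' = (mem \<upsilon>)(b2 := B) \<and> put w (mem \<upsilon> b2) (p2 + s) l (bit x) B)"
      then obtain B where "mem \<upsilon>' = (mem \<sigma>)(b2 := B)" "put w A (p2 + s) l (bit x) B"
        using st(2) A(1) by auto
      moreover have "agree ?X \<sigma> \<upsilon>'" "regs \<upsilon>' 17 = s" "regs \<upsilon>' 11 = l"
        using * st by (simp_all add: agree_def)
      ultimately show "u \<le> 2 \<and> regs \<upsilon>' 17 = s \<and> regs \<upsilon>' 11 = l \<and>
        agree ?X \<sigma> \<upsilon>' \<and> (\<exists>B. mem \<upsilon>' = (mem \<sigma>)(b2 := B) \<and> put w (mem \<sigma> b2) p2 (s + l) v B)"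
        using * one put by auto
    qed
    have e1: "eval W (regs \<tau>) (Reg 16 [+] Reg 17) = p2 + s"
      using r bnd by (simp add: eval_rules del: eval.simps)
    have e2: "eval W ((regs \<tau>)(10 := p2 + s)) (Reg 2 [-] Reg 10 [mod] Reg 2) = w - d'"
      using r bnd by (simp add: eval_rules d'_def del: eval.simps)
    have e3: "eval W ((regs \<tau>)(10 := p2 + s, 11 := w - d')) (Reg 1 [-] Reg 17 [<] Reg 11)
      = of_bool (k - s < w - d')"
      using r bnd Wpos by (simp add: eval_rules del: eval.simps)
    have e4: "eval W ((regs \<tau>)(10 := p2 + s, 11 := w - d')) (Reg 1 [-] Reg 17) = k - s"
      using r bnd by (simp add: eval_rules del: eval.simps)
    have e5: "eval W ((regs \<tau>)(10 := p2 + s, 11 := l)) (Reg 15 [+] Reg 17) = p1 + s"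
      using r bnd by (simp add: eval_rules del: eval.simps)
    have e6: "eval W (regs \<upsilon>) (Reg 16 [+] Reg 17) = p2 + s" if "agree ?X \<sigma> \<upsilon>" "regs \<upsilon> 17 = s" for \<upsilon>
      using that bnd regs by (simp add: eval_rules agree_def del: eval.simps)
    have e7: "eval W (regs \<upsilon>) (Reg 17 [+] Reg 11) = s + l" if "regs \<upsilon> 11 = l" "regs \<upsilon> 17 = s" for \<upsilon>
      using that bnd by (simp add: eval_rules del: eval.simps)
    have rest: "wp (Assign 10 (Reg 15 [+] Reg 17) ;; load_bits b1 ;; Assign 10 (Reg 16 [+] Reg 17) ;;
         store_bits b2 ;; Assign 17 (Reg 17 [+] Reg 11)) (?\<tau>1 (p2 + s))
        (\<lambda>u \<upsilon>. ?Inv (t + u) \<upsilon> \<and> k - regs \<upsilon> 17 < k - regs \<tau> 17)"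
      apply (intro wp_Seq wp_Assign)
      apply (rule wp_mono[OF load])
      subgoal using agr by (simp add: agree_def)
      subgoal by simp
      subgoal by (simp add: e5 del: eval.simps)
      subgoal by simp
      subgoal using r by simp
      apply (intro wp_Seq wp_Assign)
      apply (rule wp_mono[OF store])
      subgoal by (simp add: agree_def)
      subgoal by simp
      subgoal by (simp add: e6 del: eval.simps)
      subgoal by simp
      subgoal by simp
      subgoal by simp
      apply (rule wp_Assign)
      apply (elim conjE)
      apply (simp add: e7 del: eval.simps)
      apply (intro conjI exI[of _ "Suc c"])
      subgoal using c(1) by simp
      subgoal using s_l by simp
      subgoal using s by simp
      subgoal by (simp add: agree_def)
      subgoal using l s r by linarith
      done
    have choose: "wp (If (Reg 1 [-] Reg 17 [<] Reg 11) (Assign 11 (Reg 1 [-] Reg 17)) Skip)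
        (\<tau>\<lparr>regs := (regs \<tau>)(10 := p2 + s, 11 := w - d')\<rparr>) (\<lambda>u \<upsilon>. u = 0 \<and> \<upsilon> = ?\<tau>1 (p2 + s))"
    proof (rule wp_If)
      assume "eval W (regs (\<tau>\<lparr>regs := (regs \<tau>)(10 := p2 + s, 11 := w - d')\<rparr>)) (Reg 1 [-] Reg 17 [<] Reg 11) \<noteq> 0"
      then have "k - s < w - d'" using e3 by (simp del: eval.simps split: if_splits)
      then show "wp (Assign 11 (Reg 1 [-] Reg 17)) (\<tau>\<lparr>regs := (regs \<tau>)(10 := p2 + s, 11 := w - d')\<rparr>)
          (\<lambda>u \<upsilon>. u = 0 \<and> \<upsilon> = ?\<tau>1 (p2 + s))"
        using e4 by (intro wp_Assign) (simp add: l_def min_def del: eval.simps)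
    next
      assume "eval W (regs (\<tau>\<lparr>regs := (regs \<tau>)(10 := p2 + s, 11 := w - d')\<rparr>)) (Reg 1 [-] Reg 17 [<] Reg 11) = 0"
      then have "\<not> k - s < w - d'" using e3 by (simp del: eval.simps split: if_splits)
      then show "wp Skip (\<tau>\<lparr>regs := (regs \<tau>)(10 := p2 + s, 11 := w - d')\<rparr>)
          (\<lambda>u \<upsilon>. u = 0 \<and> \<upsilon> = ?\<tau>1 (p2 + s))"
        by (intro wp_Skip) (simp add: l_def min_def)
    qed
    show "wp (Assign 10 (Reg 16 [+] Reg 17) ;;
       Assign 11 (Reg 2 [-] Reg 10 [mod] Reg 2) ;;
       If (Reg 1 [-] Reg 17 [<] Reg 11) (Assign 11 (Reg 1 [-] Reg 17)) Skip ;;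
       Assign 10 (Reg 15 [+] Reg 17) ;;
       load_bits b1 ;;
       Assign 10 (Reg 16 [+] Reg 17) ;;
       store_bits b2 ;;
       Assign 17 (Reg 17 [+] Reg 11)) \<tau>
        (\<lambda>u \<upsilon>. ?Inv (t + u) \<upsilon> \<and> k - regs \<upsilon> 17 < k - regs \<tau> 17)"
      apply (intro wp_Seq wp_Assign)
      apply (rule wp_mono[where P = "\<lambda>u \<upsilon>. u = 0 \<and> \<upsilon> = ?\<tau>1 (p2 + s)"])
      subgoal using choose by (simp add: e1 e2 del: eval.simps One_nat_def)
      apply (elim conjE, hypsubst)
      apply (simp only: add_0)
      apply (rule rest)
      done
  next
    fix t \<tau>
    assume Inv: "?Inv t \<tau>" and z: "eval W (regs \<tau>) (Reg 17 [<] Reg 1) = 0"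
    from Inv obtain c A where c: "t \<le> 4 * c" "regs \<tau> 17 = min k (c * w - d)" "c = 0 \<or> (c - 1) * w - d < k"
      and A: "mem \<tau> = (mem \<sigma>)(b2 := A)" "put w (mem \<sigma> b2) p2 (regs \<tau> 17) v A" by blast
    have "regs \<tau> 17 = k" using cond[OF Inv] z c(2) by (auto split: if_splits)
    \<comment> \<open>Only the first and the last chunk can be shorter than a word. Hence there are
      at most \<open>k div w + 2\<close> chunks, which explains the summand 8.\<close>
    moreover have "c - 2 \<le> k div w"
    proof (cases "c \<le> 2")
      case False
      then obtain c' where "c = c' + 2" by (metis add.commute le_add_diff_inverse nat_le_linear)
      then have "c' * w \<le> k" using c(3) d by (auto simp: algebra_simps)
      then show ?thesis using w \<open>c = c' + 2\<close> by (simp add: less_eq_div_iff_mult_less_eq)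
    qed simp
    ultimately show "t \<le> 4 * (k div w) + 8 \<and> agree ?X \<sigma> \<tau> \<and>
      (\<exists>A. mem \<tau> = (mem \<sigma>)(b2 := A) \<and> put w (mem \<sigma> b2) p2 k v A)"
      using Inv c(1) by auto
  qed
  show ?thesis
    unfolding copy_bits_def
    apply (intro wp_Seq wp_Assign)
    apply (simp add: eval_ConstI del: eval.simps One_nat_def)
    apply (rule wp_mono[OF loop])
    apply (simp add: v_def)
    done
qed

end

section \<open>Looking up a slot\<close>

text \<open>
  Registers: 0--2 hold \<open>n\<close>, \<open>k\<close>, \<open>w\<close>; 3--9 and 18 the parameters fixed by \<open>ready\<close>; 10--12 position, length
  and value of a bit field; 15 and 16 source and destination of a copy; 19 the index of an element,
  21 its group, 22 its hash value within the group; 23 and 24 the code of the trie and the offset of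
  the group. During a walk, 25 is the rest of the code, 26 the rest of the hash value, 27 the heap
  number of the current node, 28 the power of 4 that corresponds to the digits read and 29 the rank.
  The digits of the code are 0 for \<open>Node\<close>, 1 for \<open>Empty\<close> and 2 for \<open>Leaf\<close>, in preorder.
\<close>

definition init_prog :: com where
  "init_prog =
    Assign 3 (Const 0) ;; Assign 10 (Reg 0) ;;
    While (Reg 10) (Assign 10 (Reg 10 [div] Const 2) ;; Assign 3 (Reg 3 [+] Const 1)) ;;
    Assign 4 (Const 32 [*] Reg 3) ;; Assign 5 (Const 65 [*] Reg 3) ;;
    Assign 6 (Reg 0 [div] Reg 3 [+] Const 1) ;;
    Assign 7 (Const 1 [<<] Reg 4) ;; Assign 8 (Reg 6 [*] Reg 7) ;; Assign 9 (Reg 6 [*] Reg 5) ;;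
    Assign 18 ((Reg 1 [+] Reg 2 [-] Const 1) [div] Reg 2 [*] Reg 2)"

definition lookup_prog :: com where
  "lookup_prog =
    Hash 20 (Const 0) (Reg 8) (Reg 19) ;;
    Assign 21 (Reg 20 [div] Reg 7) ;; Assign 22 (Reg 20 [mod] Reg 7) ;;
    Assign 10 (Reg 21 [*] Reg 5) ;; Assign 11 (Reg 5) ;; load_bits Struct ;;
    Assign 23 (Reg 12 [>>] Reg 3) ;; Assign 24 (Reg 12 [mod] Const 1 [<<] Reg 3)"

text \<open>Register 30 holds the number of subtries still to be skipped: a \<open>Node\<close>
  replaces one by two, an outer node removes one. No memory is touched, so this costs
  nothing.\<close>

definition skip_prog :: com where
  "skip_prog =
    Assign 30 (Const 1) ;;
    While (Reg 30)
      (Assign 29 (Reg 29 [+] (Reg 25 [mod] Const 4 [=] Const 2)) ;;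
       Assign 30 (Reg 30 [+] Const 2 [*] (Reg 25 [mod] Const 4 [=] Const 0) [-] Const 1) ;;
       Assign 25 (Reg 25 [div] Const 4) ;; Assign 28 (Reg 28 [*] Const 4))"

text \<open>Going left requires no further work on the code, since the right subtrie simply becomes
  part of what follows. Going right skips the left subtrie first, which also adds its leaves to the
  rank.\<close>

definition walk_prog :: com where
  "walk_prog =
    Assign 25 (Reg 23) ;; Assign 26 (Reg 22) ;; Assign 27 (Const 1) ;; Assign 28 (Const 1) ;;
    Assign 29 (Const 0) ;;
    While (Reg 25 [mod] Const 4 [=] Const 0)
      (Assign 25 (Reg 25 [div] Const 4) ;; Assign 28 (Reg 28 [*] Const 4) ;;
       If (Reg 26 [mod] Const 2) skip_prog Skip ;;
       Assign 27 (Reg 27 [*] Const 2 [+] Reg 26 [mod] Const 2) ;;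
       Assign 26 (Reg 26 [div] Const 2))"

section \<open>Decoding a trie in registers\<close>

lemma enc_digit:
  "enc Empty r mod 4 = 1" "enc (Leaf x) r mod 4 = 2" "enc (Node a b) r mod 4 = 0"
  "enc Empty r div 4 = r" "enc (Leaf x) r div 4 = r" "enc (Node a b) r div 4 = enc a (enc b r)"
  unfolding enc.simps by presburger+

lemma (in ram) wp_skip:
  assumes start: "regs \<sigma> 25 = enc a r" "0 < regs \<sigma> 28" "regs \<sigma> 29 + leaves a < 2 ^ W"
    and W: "enc a r < 2 ^ W" "4 * (regs \<sigma> 28 * 4 ^ digits a) < 2 ^ W"
  shows "wp skip_prog \<sigma> (\<lambda>t \<tau>. t = 0 \<and> regs \<tau> 25 = r \<and> regs \<tau> 28 = regs \<sigma> 28 * 4 ^ digits a \<and>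
    regs \<tau> 29 = regs \<sigma> 29 + leaves a \<and> agree {25, 28, 29, 30} \<sigma> \<tau> \<and> mem \<tau> = mem \<sigma>)"
proof -
  let ?sum = "\<lambda>ts. \<Sum>t\<leftarrow>ts. digits t"
  \<comment> \<open>\<open>ts\<close> is the list of subtries still to be skipped; the remaining
    code is their concatenation followed by \<open>r\<close>.\<close>
  let ?Inv = "\<lambda>(t :: nat) \<tau>. t = 0 \<and> (\<exists>ts. regs \<tau> 25 = foldr enc ts r \<and> regs \<tau> 30 = length ts \<and>
    regs \<tau> 28 * 4 ^ ?sum ts = regs \<sigma> 28 * 4 ^ digits a \<and>
    regs \<tau> 29 + (\<Sum>t\<leftarrow>ts. leaves t) = regs \<sigma> 29 + leaves a) \<and> ?sum [] = 0 \<and>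
    0 < regs \<tau> 28 \<and> regs \<tau> 25 < 2 ^ W \<and> agree {25, 28, 29, 30} \<sigma> \<tau> \<and> mem \<tau> = mem \<sigma>"
  have len: "length ts \<le> ?sum ts" for ts by (induction ts) auto
  have small: "16 \<le> (2::nat) ^ W"
  proof -
    have "1 * 4 ^ 1 \<le> regs \<sigma> 28 * 4 ^ digits a"
      using start(2) by (intro mult_mono power_increasing) auto
    then have "4 * (1 * 4 ^ 1) < (2::nat) ^ W" using W(2) by (meson le_less_trans mult_le_mono2)
    then show ?thesis by simp
  qed
  have "0 < W" using small by (cases W) auto
  have numbers: "1 < (2::nat) ^ W" "2 < (2::nat) ^ W" "4 < (2::nat) ^ W"
    using small by linarith+
  \<comment> \<open>Each pending subtrie owns at least one digit, so the counter stays below the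
    power of 4 that bounds the skipped code.\<close>
  have len_less: "length ts + 2 < 2 ^ W" "m * 4 < 2 ^ W"
    if "m * 4 ^ ?sum ts = regs \<sigma> 28 * 4 ^ digits a" "0 < m" for ts m
  proof -
    have "j < 4 ^ j" for j :: nat by (induction j) auto
    then have "?sum ts < 4 ^ ?sum ts" .
    also have "\<dots> \<le> m * 4 ^ ?sum ts" using that(2) by simp
    finally have "length ts < m * 4 ^ ?sum ts" using len[of ts] by simp
    then have "length ts + 2 < 4 * (m * 4 ^ ?sum ts)" by simp
    then show "length ts + 2 < 2 ^ W" using W(2) that(1) by simp
    have "m * 4 \<le> m * 4 ^ ?sum ts * 4" by simp
    then show "m * 4 < 2 ^ W" using W(2) that(1) by linarith
  qed
  have loop: "wp (While (Reg 30)
      (Assign 29 (Reg 29 [+] (Reg 25 [mod] Const 4 [=] Const 2)) ;;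
       Assign 30 (Reg 30 [+] Const 2 [*] (Reg 25 [mod] Const 4 [=] Const 0) [-] Const 1) ;;
       Assign 25 (Reg 25 [div] Const 4) ;; Assign 28 (Reg 28 [*] Const 4)))
      (\<sigma>\<lparr>regs := (regs \<sigma>)(30 := 1)\<rparr>)
    (\<lambda>t \<tau>. t = 0 \<and> regs \<tau> 25 = r \<and> regs \<tau> 28 = regs \<sigma> 28 * 4 ^ digits a \<and>
    regs \<tau> 29 = regs \<sigma> 29 + leaves a \<and> agree {25, 28, 29, 30} \<sigma> \<tau> \<and> mem \<tau> = mem \<sigma>)"
  proof (rule wp_WhileI[where Inv = ?Inv and \<mu> = "\<lambda>\<tau>. regs \<tau> 25"])
    show "?Inv 0 (\<sigma>\<lparr>regs := (regs \<sigma>)(30 := 1)\<rparr>)"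
      using start W(1) by (auto simp: agree_def intro!: exI[of _ "[a]"])
  next
    fix t \<tau>
    assume Inv: "?Inv t \<tau>" and nz: "eval W (regs \<tau>) (Reg 30) \<noteq> 0"
    then obtain ts where ts: "regs \<tau> 25 = foldr enc ts r" "regs \<tau> 30 = length ts"
      "regs \<tau> 28 * 4 ^ ?sum ts = regs \<sigma> 28 * 4 ^ digits a"
      "regs \<tau> 29 + (\<Sum>t\<leftarrow>ts. leaves t) = regs \<sigma> 29 + leaves a" by blast
    have pos: "0 < regs \<tau> 28" and c: "regs \<tau> 25 < 2 ^ W" using Inv by auto
    note bnd = len_less[OF ts(3) pos]
    have "ts \<noteq> []" using nz ts(2) by auto
    then obtain x us where xs: "ts = x # us" by (cases ts) auto
    define c where "c = foldr enc us r"
    have c': "regs \<tau> 25 = enc x c" by (simp add: ts(1) xs c_def)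
    \<comment> \<open>Register 29 is increased only for a leaf, and such a leaf is still included in
      the final count, which is known to fit.\<close>
    have rk: "regs \<tau> 29 + 1 < 2 ^ W \<or> leaves x = 0 \<and> regs \<tau> 29 < 2 ^ W"
    proof (cases "leaves x")
      case (Suc y)
      show ?thesis
      proof (cases "regs \<tau> 29 + 1 < 2 ^ W")
        case False
        then show ?thesis using ts(4) xs Suc start(3) by simp
      qed simp
    qed (use ts(4) start(3) in auto)
    have e1: "eval W (regs \<tau>) (Reg 29 [+] (Reg 25 [mod] Const 4 [=] Const 2))
        = regs \<tau> 29 + of_bool (enc x c mod 4 = 2)"
    proof -
      have "enc x c mod 4 = 2 \<Longrightarrow> leaves x \<noteq> 0" by (cases x) auto
      moreover have "regs \<tau> 29 < 2 ^ W" using rk by auto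
      ultimately show ?thesis
        using c \<open>0 < W\<close> numbers rk by (auto simp: eval_rules c' simp del: eval.simps)
    qed
    have e2: "eval W ((regs \<tau>)(29 := y)) (Reg 30 [+] Const 2 [*] (Reg 25 [mod] Const 4 [=] Const 0) [-] Const 1)
        = length ts + 2 * of_bool (enc x c mod 4 = 0) - 1" for y
      using c \<open>0 < W\<close> numbers bnd ts(2) by (simp add: eval_rules c' del: eval.simps One_nat_def)
    have e3: "eval W ((regs \<tau>)(29 := y, 30 := z)) (Reg 25 [div] Const 4) = enc x c div 4" for y z
      using c numbers by (simp add: eval_rules c' del: eval.simps)
    have e4: "eval W ((regs \<tau>)(29 := y, 30 := z, 25 := u)) (Reg 28 [*] Const 4) = regs \<tau> 28 * 4" for y z u
      using bnd numbers by (simp add: eval_rules del: eval.simps)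
    \<comment> \<open>Codes are positive even if nothing follows, so removing a digit makes the
      number strictly smaller; this is the termination measure.\<close>
    have "0 < enc x c" by (rule less_le_trans[OF _ le_enc]) simp
    then have dec: "enc x c div 4 < enc x c" by simp
    have "\<exists>vs. enc x c div 4 = foldr enc vs r \<and> length ts + 2 * of_bool (enc x c mod 4 = 0) - 1 = length vs \<and>
      regs \<tau> 28 * 4 * 4 ^ ?sum vs = regs \<sigma> 28 * 4 ^ digits a \<and>
      regs \<tau> 29 + of_bool (enc x c mod 4 = 2) + (\<Sum>t\<leftarrow>vs. leaves t) = regs \<sigma> 29 + leaves a"
    proof (cases x)
      case Empty
      then show ?thesis using ts xs c_def by (intro exI[of _ us]) (simp add: enc_digit del: enc.simps)
    next
      case (Leaf y)
      then show ?thesis using ts xs c_def by (intro exI[of _ us]) (simp add: enc_digit del: enc.simps)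
    next
      case (Node y z)
      then show ?thesis
        using ts xs c_def by (intro exI[of _ "y # z # us"]) (simp add: enc_digit power_add mult.assoc del: enc.simps)
    qed
    then show "wp (Assign 29 (Reg 29 [+] (Reg 25 [mod] Const 4 [=] Const 2)) ;;
       Assign 30 (Reg 30 [+] Const 2 [*] (Reg 25 [mod] Const 4 [=] Const 0) [-] Const 1) ;;
       Assign 25 (Reg 25 [div] Const 4) ;; Assign 28 (Reg 28 [*] Const 4)) \<tau>
     (\<lambda>u \<upsilon>. ?Inv (t + u) \<upsilon> \<and> regs \<upsilon> 25 < regs \<tau> 25)"
      using Inv dec c pos
      apply (intro wp_Seq wp_Assign)
      apply (simp only: config.simps config.update_convs e1 e2 e3 e4)
      apply (simp add: e1 e2 e3 e4 c' agree_def del: eval.simps One_nat_def)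
      done
  next
    fix t \<tau>
    assume Inv: "?Inv t \<tau>" and z: "eval W (regs \<tau>) (Reg 30) = 0"
    then obtain ts where ts: "regs \<tau> 25 = foldr enc ts r" "regs \<tau> 30 = length ts"
      "regs \<tau> 28 * 4 ^ ?sum ts = regs \<sigma> 28 * 4 ^ digits a"
      "regs \<tau> 29 + (\<Sum>t\<leftarrow>ts. leaves t) = regs \<sigma> 29 + leaves a" by blast
    have "0 < regs \<tau> 28" using Inv by blast
    then have "length ts < 2 ^ W" using len_less(1)[OF ts(3)] by simp
    then have "ts = []" using z ts(2) by (simp add: take_bit_nat_eq_self)
    then show "t = 0 \<and> regs \<tau> 25 = r \<and> regs \<tau> 28 = regs \<sigma> 28 * 4 ^ digits a \<and>
      regs \<tau> 29 = regs \<sigma> 29 + leaves a \<and> agree {25, 28, 29, 30} \<sigma> \<tau> \<and> mem \<tau> = mem \<sigma>"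
      using Inv ts by simp
  qed
  show ?thesis
    unfolding skip_prog_def
    apply (intro wp_Seq wp_Assign)
    apply (simp add: eval_ConstI numbers del: eval.simps One_nat_def)
    apply (rule wp_mono[OF loop])
    apply simp
    done
qed

lemma leaves_le: "leaves t \<le> Suc (nodes t)"
  by (induction t) auto

lemma leaves_less: "leaves t < 4 ^ digits t"
proof -
  have "j < 4 ^ j" for j :: nat by (induction j) auto
  then have "digits t < 4 ^ digits t" .
  then show ?thesis using leaves_le[of t] by simp
qed

text \<open>The registers mirror the arguments of \<open>reach\<close>. \<open>lo\<close> is not
  kept, because it can be recovered as the whole code modulo \<open>mul\<close>.\<close>

lemma (in ram) wp_walk:
  assumes start: "regs \<sigma> 23 = enc t 0" "regs \<sigma> 22 = p"
    and t: "fits F t" "p < 2 ^ F" and W: "4 * 4 ^ digits t < (2 :: nat) ^ W" "F + 1 < W"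
  shows "wp walk_prog \<sigma> (\<lambda>u \<tau>. u = 0 \<and> (\<exists>s m lo rest.
    reach t F p s m (regs \<tau> 26) (regs \<tau> 27) lo (regs \<tau> 28) rest (regs \<tau> 29) \<and>
    regs \<tau> 25 = enc s rest \<and> (\<forall>a b. s \<noteq> Node a b)) \<and>
    agree {25, 26, 27, 28, 29, 30} \<sigma> \<tau> \<and> mem \<tau> = mem \<sigma>)"
proof -
  let ?Inv = "\<lambda>(u :: nat) \<tau>. u = 0 \<and> (\<exists>s m lo rest.
    reach t F p s m (regs \<tau> 26) (regs \<tau> 27) lo (regs \<tau> 28) rest (regs \<tau> 29) \<and>
    regs \<tau> 25 = enc s rest) \<and> agree {25, 26, 27, 28, 29, 30} \<sigma> \<tau> \<and> mem \<tau> = mem \<sigma>"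
  have small: "16 < (2::nat) ^ W" using W(1)
  proof -
    have "(4::nat) ^ 1 \<le> 4 ^ digits t" by (intro power_increasing) auto
    then have "4 * (4::nat) ^ 1 \<le> 4 * 4 ^ digits t" by (rule mult_le_mono2)
    then have "4 * (4::nat) ^ 1 < 2 ^ W" using W(1) by (rule le_less_trans)
    then show ?thesis by simp
  qed
  have "0 < W" using small by (cases W) auto
  have numbers: "1 < (2::nat) ^ W" "2 < (2::nat) ^ W" "4 < (2::nat) ^ W" "0 < (2::nat) ^ W"
    using small by linarith+
  have encW: "enc t 0 < 2 ^ W" using enc_less[of t] W(1) by linarith
  have F2: "(2::nat) ^ (F + 2) \<le> 2 ^ W" using W(2) by (intro power_increasing) auto
  then have pW: "p < 2 ^ W" using t(2) by simp
  have bounds: "enc s rest < 2 ^ W" "q < 2 ^ W" "2 * v + 1 < 2 ^ W" "v < 2 ^ W" "v * 2 < 2 ^ W"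
    "mul * 4 ^ digits s * 4 < 2 ^ W" "0 < mul" "rk + leaves s < 2 ^ W"
    if "reach t F p s m q v lo mul rest rk" for s m q v lo mul rest rk
  proof -
    note inv = reach_invariants[OF t that]
    show "0 < mul" using inv(4) by simp
    then have "enc s rest \<le> mul * enc s rest" by simp
    then show "enc s rest < 2 ^ W" using inv(4) encW by linarith
    show "mul * 4 ^ digits s * 4 < 2 ^ W" using inv(4) W(1) by linarith
    have "Suc v * 1 \<le> Suc v * 2 ^ m" by (intro mult_le_mono2) simp
    then have "Suc v * 1 \<le> 2 ^ Suc F" using inv(1) by (meson order_trans)
    then show "2 * v + 1 < 2 ^ W" "v < 2 ^ W" "v * 2 < 2 ^ W" using F2 by simp_all
    have "q < 2 ^ m" using inv(1) by simp
    also have "\<dots> \<le> Suc v * 2 ^ m" by simp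
    also have "\<dots> \<le> 2 ^ Suc F" using inv(1) by blast
    finally show "q < 2 ^ W" using F2 by simp
    have "rk \<le> leaves t" using inv(3) rank_le[of t p] by simp
    moreover have "leaves s < 4 ^ digits s" by (rule leaves_less)
    moreover have "4 ^ digits s \<le> mul * 4 ^ digits s" using \<open>0 < mul\<close> by simp
    ultimately show "rk + leaves s < 2 ^ W"
      using inv(4) W(1) leaves_less[of t] by linarith
  qed
  have cond: "eval W (regs \<tau>) (Reg 25 [mod] Const 4 [=] Const 0) = of_bool (\<exists>a b. s = Node a b)"
    if "regs \<tau> 25 = enc s rest" "enc s rest < 2 ^ W" for \<tau> s rest
    using that numbers \<open>0 < W\<close> enc_digit
    by (cases s) (simp_all add: eval_rules del: eval.simps enc.simps One_nat_def)
  let ?\<sigma> = "\<sigma>\<lparr>regs := (regs \<sigma>)(25 := enc t 0, 26 := p, 27 := 1, 28 := 1, 29 := 0)\<rparr>"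
  let ?body = "Assign 25 (Reg 25 [div] Const 4) ;; Assign 28 (Reg 28 [*] Const 4) ;;
       If (Reg 26 [mod] Const 2) skip_prog Skip ;;
       Assign 27 (Reg 27 [*] Const 2 [+] Reg 26 [mod] Const 2) ;;
       Assign 26 (Reg 26 [div] Const 2)"
  have loop: "wp (While (Reg 25 [mod] Const 4 [=] Const 0) ?body) ?\<sigma> (\<lambda>u \<tau>. u = 0 \<and> (\<exists>s m lo rest.
    reach t F p s m (regs \<tau> 26) (regs \<tau> 27) lo (regs \<tau> 28) rest (regs \<tau> 29) \<and>
    regs \<tau> 25 = enc s rest \<and> (\<forall>a b. s \<noteq> Node a b)) \<and>
    agree {25, 26, 27, 28, 29, 30} \<sigma> \<tau> \<and> mem \<tau> = mem \<sigma>)"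
  proof (rule wp_WhileI[where Inv = ?Inv and \<mu> = "\<lambda>\<tau>. regs \<tau> 25"])
    show "?Inv 0 ?\<sigma>"
      using reach.init[of t F p] by (auto simp: agree_def simp del: One_nat_def)
  next
    fix u \<tau>
    assume Inv: "?Inv u \<tau>" and nz: "eval W (regs \<tau>) (Reg 25 [mod] Const 4 [=] Const 0) \<noteq> 0"
    define q v mul rk where "q = regs \<tau> 26" and "v = regs \<tau> 27" and "mul = regs \<tau> 28" and "rk = regs \<tau> 29"
    note defs = q_def[symmetric] v_def[symmetric] mul_def[symmetric] rk_def[symmetric]
    from Inv obtain s m lo rest where re: "reach t F p s m q v lo mul rest rk"
      and c: "regs \<tau> 25 = enc s rest" unfolding defs by blast
    note b = bounds[OF re]
    obtain x y where s: "s = Node x y" using cond[OF c b(1)] nz by (auto split: if_splits)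
    define c' where "c' = enc x (enc y rest)"
    have c'W: "c' < 2 ^ W" using b(1) by (simp add: s c'_def)
    have mulW: "mul * 4 ^ digits x * 4 ^ digits y * 16 < 2 ^ W"
      using b(6) by (simp add: s power_add mult.assoc)
    have "mul * 4 * (1 * 1) \<le> mul * 16 * (4 ^ digits x * 4 ^ digits y)"
      by (intro mult_le_mono) auto
    also have "mul * 16 * (4 ^ digits x * 4 ^ digits y) = mul * 4 ^ digits x * 4 ^ digits y * 16"
      by (simp only: mult_ac)
    finally have mul4: "mul * 4 < 2 ^ W" using mulW by linarith
    have e1: "eval W (regs \<tau>) (Reg 25 [div] Const 4) = c'"
      using b(1) c numbers by (simp add: eval_rules s c'_def enc_digit(6) del: eval.simps enc.simps)
    have mulW': "mul < 2 ^ W" using mul4 by simp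
    have e2: "eval W ((regs \<tau>)(25 := z)) (Reg 28 [*] Const 4) = mul * 4" for z
      using mul4 mulW' numbers by (simp add: eval_rules defs del: eval.simps)
    have e3: "eval W ((regs \<tau>)(25 := z, 28 := z')) (Reg 26 [mod] Const 2) = q mod 2" for z z'
      using b(2) numbers by (simp add: eval_rules defs del: eval.simps)
    have e4: "eval W R (Reg 27 [*] Const 2 [+] Reg 26 [mod] Const 2) = v * 2 + q mod 2"
      if "R 26 = q" "R 27 = v" for R
    proof -
      have "v * 2 + q mod 2 \<le> 2 * v + 1" by simp
      then have "v * 2 + q mod 2 < 2 ^ W" using b(3) by linarith
      then show ?thesis
        using that b numbers by (simp add: eval_rules del: eval.simps One_nat_def)
    qed
    have e5: "eval W R (Reg 26 [div] Const 2) = q div 2" if "R 26 = q" for R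
      using that b(2) numbers by (simp add: eval_rules del: eval.simps)
    let ?\<tau> = "\<tau>\<lparr>regs := (regs \<tau>)(25 := c', 28 := mul * 4)\<rparr>"
    have dec: "c' < enc s rest"
    proof -
      have "0 < c'" unfolding c'_def by (rule less_le_trans[OF _ le_enc]) simp
      then show ?thesis by (simp add: s c'_def)
    qed
    let ?P = "\<lambda>(u :: nat) \<upsilon>. u = 0 \<and> (\<exists>s m lo rest.
      reach t F p s m (q div 2) (v * 2 + q mod 2) lo (regs \<upsilon> 28) rest (regs \<upsilon> 29) \<and>
      regs \<upsilon> 25 = enc s rest \<and> regs \<upsilon> 25 \<le> c') \<and> agree {25, 28, 29, 30} \<tau> \<upsilon> \<and> mem \<upsilon> = mem \<tau>"
    have branch: "wp (If (Reg 26 [mod] Const 2) skip_prog Skip) ?\<tau> ?P"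
    proof (rule wp_If)
      assume "eval W (regs ?\<tau>) (Reg 26 [mod] Const 2) \<noteq> 0"
      then have odd: "odd q" by (simp add: e3 odd_iff_mod_2_eq_one del: eval.simps)
      have re': "reach t F p y (m - 1) (q div 2) (v * 2 + q mod 2) (lo + 4 * mul * enc x 0)
          (mul * 4 * 4 ^ digits x) rest (rk + leaves x)"
      proof -
        have "v * 2 + q mod 2 = Suc (2 * v)" using odd by (simp add: odd_iff_mod_2_eq_one)
        moreover have "mul * 4 * 4 ^ digits x = 4 * mul * 4 ^ digits x" by simp
        ultimately show ?thesis using reach.right[OF re[unfolded s] odd] by (simp only:)
      qed
      have le: "enc y rest \<le> c'"
      proof -
        have "enc y rest \<le> 4 ^ digits x * enc y rest" by simp
        then show ?thesis using enc_eq[of x "enc y rest"] unfolding c'_def by linarith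
      qed
      have rkW: "rk + leaves x < 2 ^ W" using b(8) by (simp add: s)
      have "mul * 16 * 4 ^ digits x * 1 \<le> mul * 16 * 4 ^ digits x * 4 ^ digits y"
        by (intro mult_le_mono2) simp
      also have "mul * 16 * 4 ^ digits x * 4 ^ digits y = mul * 4 ^ digits x * 4 ^ digits y * 16"
        by (simp only: mult_ac)
      finally have mW: "4 * (mul * 4 * 4 ^ digits x) < 2 ^ W" using mulW by linarith
      show "wp skip_prog ?\<tau> ?P"
      proof (rule wp_mono, rule wp_skip[of ?\<tau> x "enc y rest"])
        show "regs ?\<tau> 25 = enc x (enc y rest)" by (simp add: c'_def)
        show "0 < regs ?\<tau> 28" using b(7) by simp
        show "regs ?\<tau> 29 + leaves x < 2 ^ W" using rkW by (simp add: rk_def)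
        show "enc x (enc y rest) < 2 ^ W" using c'W by (simp add: c'_def)
        show "4 * (regs ?\<tau> 28 * 4 ^ digits x) < 2 ^ W" using mW by simp
        fix t' :: nat and \<upsilon>
        assume *: "t' = 0 \<and> regs \<upsilon> 25 = enc y rest \<and> regs \<upsilon> 28 = regs ?\<tau> 28 * 4 ^ digits x \<and>
          regs \<upsilon> 29 = regs ?\<tau> 29 + leaves x \<and> agree {25, 28, 29, 30} ?\<tau> \<upsilon> \<and> mem \<upsilon> = mem ?\<tau>"
        then have "regs \<upsilon> 28 = mul * 4 * 4 ^ digits x" "regs \<upsilon> 29 = rk + leaves x"
          by (simp_all add: rk_def)
        with re' * le show "?P t' \<upsilon>" by (auto simp: agree_def)
      qed
    next
      assume "eval W (regs ?\<tau>) (Reg 26 [mod] Const 2) = 0"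
      then have even: "q mod 2 = 0" by (simp add: e3 del: eval.simps)
      then have "even q" by (simp add: even_iff_mod_2_eq_zero)
      have "reach t F p x (m - 1) (q div 2) (v * 2 + q mod 2) lo (mul * 4) (enc y rest) rk"
        using reach.left[OF re[unfolded s] \<open>even q\<close>] even by (simp add: mult.commute)
      then show "wp Skip ?\<tau> ?P"
        by (intro wp_Skip) (auto simp: agree_def c'_def rk_def)
    qed
    show "wp ?body \<tau> (\<lambda>u' \<upsilon>. ?Inv (u + u') \<upsilon> \<and> regs \<upsilon> 25 < regs \<tau> 25)"
      apply (intro wp_Seq wp_Assign)
      apply (rule wp_mono[where P = ?P])
      subgoal using branch by (simp add: e1 e2 del: eval.simps One_nat_def)
      apply (elim conjE)
      apply (intro wp_Seq wp_Assign)
      subgoal premises prems for u' \<upsilon>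
      proof -
        have r: "regs \<upsilon> 26 = q" "regs \<upsilon> 27 = v" using prems by (simp_all add: agree_def q_def v_def)
        have ag: "agree {25, 26, 27, 28, 29, 30} \<sigma> \<upsilon>"
          by (rule agree_trans[of _ \<sigma> \<tau> _ \<upsilon>]) (use Inv prems in auto)
        show ?thesis
          using prems Inv r dec ag c by (auto simp: e4 e5 agree_def simp del: eval.simps One_nat_def)
      qed
      done
  next
    fix u \<tau>
    assume Inv: "?Inv u \<tau>" and z: "eval W (regs \<tau>) (Reg 25 [mod] Const 4 [=] Const 0) = 0"
    then obtain s m lo rest where
      *: "reach t F p s m (regs \<tau> 26) (regs \<tau> 27) lo (regs \<tau> 28) rest (regs \<tau> 29)"
        "regs \<tau> 25 = enc s rest" by blast
    have "\<forall>a b. s \<noteq> Node a b"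
      using z cond[OF *(2) bounds(1)[OF *(1)]] by (auto simp del: eval.simps split: if_splits)
    then show "u = 0 \<and> (\<exists>s m lo rest.
      reach t F p s m (regs \<tau> 26) (regs \<tau> 27) lo (regs \<tau> 28) rest (regs \<tau> 29) \<and>
      regs \<tau> 25 = enc s rest \<and> (\<forall>a b. s \<noteq> Node a b)) \<and>
      agree {25, 26, 27, 28, 29, 30} \<sigma> \<tau> \<and> mem \<tau> = mem \<sigma>"
      using Inv * by blast
  qed
  show ?thesis
    unfolding walk_prog_def
    apply (intro wp_Seq wp_Assign)
    apply (simp add: eval_rules numbers start encW pW del: eval.simps One_nat_def)
    apply (rule wp_mono[OF loop])
    apply simp
    done
qed

definition find_prog :: com where
  "find_prog = lookup_prog ;; walk_prog"

text \<open>The records come first, followed by slots of exactly \<open>k\<close> bits that are not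
  aligned to words; so no space is lost to padding.\<close>

definition slot_exp :: rexp where
  "slot_exp = Reg 9 [+] (Reg 24 [+] Reg 29) [*] Reg 1"

text \<open>Serves both construction and update: register 19 is initially 0, so an update takes its
  label from the front of \<open>Work\<close>.\<close>

definition place_prog :: com where
  "place_prog = find_prog ;; Assign 15 (Reg 19 [*] Reg 18) ;; Assign 16 slot_exp ;;
    copy_bits Work Struct"

definition fetch_prog :: com where
  "fetch_prog = find_prog ;; Assign 15 slot_exp ;; Assign 16 (Const 0) ;; copy_bits Struct Work"

text \<open>\<open>R = l + 2 * F\<close> is room for an offset below \<open>2 ^ l\<close> and for
  \<open>F\<close> digits of two bits; \<open>s\<close> is the length of a label padded to whole
  words. The width \<open>W\<close> accommodates addresses and the code of an overfull trie, which
  has at most \<open>3 * F\<close> digits, that is \<open>192 * l\<close> bits.\<close>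

locale retrieval = ram w W h xs
  for w W :: nat and h :: "'u hash" and xs :: "'u list" +
  fixes n k l F R G s :: nat
  assumes n: "1 \<le> n" and w: "1 \<le> w" and l: "l = floorlog 2 n" and F: "F = 32 * l"
    and R: "R = 65 * l" and G: "G = n div l + 1" and s: "s = (k + w - 1) div w * w"
    and W: "250 * l + 4 * w + 4 * floorlog 2 k + 10 \<le> W"
begin

section \<open>Size of the parameters\<close>

lemma l_pos: "1 \<le> l"
proof -
  have "l \<noteq> 0" unfolding l floorlog_eq_zero_iff using n by simp
  then show ?thesis by simp
qed

lemma n_less: "n < 2 ^ l"
  using floorlog_bounds[of n 2] n unfolding l by simp

lemma G_le: "G \<le> 2 ^ l"
  using n_less div_le_dividend[of n l] G by linarith

lemma G_pos: "0 < G"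
  by (simp add: G)

lemma s_le: "s \<le> k + w - 1" and k_le_s: "k \<le> s"
proof -
  show "s \<le> k + w - 1" by (simp add: s)
  have "k + w - 1 < s + w"
    using w div_mult_mod_eq[of "k + w - 1" w] mod_less_divisor[of w "k + w - 1"] unfolding s by linarith
  then show "k \<le> s" by simp
qed

text \<open>One common yardstick for the numbers that occur, so that the overflow conditions reduce
  to linear arithmetic. The exponent covers the \<open>192 * l\<close> bits of an overfull code with
  some room; the other factors serve products with label and word lengths.\<close>

definition B :: nat where
  "B = 2 ^ (200 * l) * ((w + 1) * (k + 1))"

lemma B_less: "1000000 * B < 2 ^ W"
proof -
  have "w + 1 \<le> 2 ^ w" by (induction w) auto
  moreover have "k + 1 \<le> 2 ^ floorlog 2 k"
  proof (cases "k = 0")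
    case False
    then show ?thesis using floorlog_bounds[of k 2] by simp
  qed simp
  ultimately have "B \<le> 2 ^ (200 * l) * (2 ^ w * 2 ^ floorlog 2 k)"
    unfolding B_def by (intro mult_mono) auto
  also have "\<dots> = 2 ^ (200 * l + (w + floorlog 2 k))" by (simp add: power_add)
  finally have "2 ^ 20 * B \<le> 2 ^ 20 * 2 ^ (200 * l + (w + floorlog 2 k))" by (rule mult_le_mono2)
  also have "\<dots> = 2 ^ (20 + (200 * l + (w + floorlog 2 k)))" by (simp only: power_add)
  also have "\<dots> \<le> 2 ^ W" using W l_pos by (intro power_increasing) auto
  finally have "2 ^ 20 * B \<le> 2 ^ W" .
  moreover have "0 < B" by (simp add: B_def)
  ultimately show ?thesis by simp
qed

lemma le_B: "x \<le> 2 ^ (200 * l) \<Longrightarrow> x \<le> B"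
  unfolding B_def using mult_le_mono[of x "2 ^ (200 * l)" 1 "(w + 1) * (k + 1)"] by simp

lemma times_le_B: "x \<le> 2 ^ (200 * l) \<Longrightarrow> y \<le> k + w \<Longrightarrow> x * y \<le> B"
  unfolding B_def by (intro mult_le_mono) auto

lemma power_l: "j \<le> 200 * l \<Longrightarrow> (2::nat) ^ j \<le> 2 ^ (200 * l)"
  by (intro power_increasing) auto

lemma l_less: "l < 2 ^ l"
  by (rule less_exp)

lemma basic_le_B: "w \<le> B" "k \<le> B" "n \<le> B" "l \<le> B" "F \<le> B" "R \<le> B" "G \<le> B" "2 ^ F \<le> B"
  "G * 2 ^ F \<le> B" "G * R \<le> B" "s \<le> B" "1 \<le> B" "8 * (2 ^ F * 2 ^ F * 2 ^ F) * (2 ^ F * 2 ^ F * 2 ^ F) \<le> B"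
proof -
  have one: "1 \<le> (2::nat) ^ (200 * l)" by simp
  show "w \<le> B" "k \<le> B" "s \<le> B"
    using times_le_B[OF one, of w] times_le_B[OF one, of k] times_le_B[OF one, of s] s_le by auto
  have pl: "2 ^ l \<le> (2::nat) ^ (200 * l)" by (intro power_l) simp
  show "n \<le> B" "l \<le> B" "G \<le> B" using pl n_less l_less G_le by (intro le_B; linarith)+
  have "65 * l \<le> 128 * 2 ^ l" using l_less by linarith
  also have "\<dots> = 2 ^ 7 * 2 ^ l" by simp
  also have "\<dots> = 2 ^ (7 + l)" by (simp only: power_add)
  finally have Rl: "R \<le> 2 ^ (7 + l)" by (simp add: R)
  also have "\<dots> \<le> 2 ^ (200 * l)" using l_pos by (intro power_l) simp
  finally have "R \<le> 2 ^ (200 * l)" .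
  then show "R \<le> B" "F \<le> B" by (auto intro!: le_B simp: F R)
  show "2 ^ F \<le> B" by (intro le_B power_l) (simp add: F)
  have "G * 2 ^ F \<le> 2 ^ (l + F)" using G_le by (simp add: power_add)
  also have "\<dots> \<le> 2 ^ (200 * l)" by (intro power_l) (simp add: F)
  finally show "G * 2 ^ F \<le> B" by (rule le_B)
  have "G * R \<le> 2 ^ l * 2 ^ (7 + l)" using G_le Rl by (intro mult_le_mono)
  also have "\<dots> = 2 ^ (l + (7 + l))" by (simp only: power_add)
  also have "\<dots> \<le> 2 ^ (200 * l)" using l_pos by (intro power_l) simp
  finally show "G * R \<le> B" by (rule le_B)
  show "1 \<le> B" using one by (rule le_B)
  have "8 * (2 ^ F * 2 ^ F * 2 ^ F) * (2 ^ F * 2 ^ F * 2 ^ F) = (2::nat) ^ (3 + (F + F + F) + (F + F + F))"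
    by (simp only: power_add) simp
  also have "\<dots> \<le> 2 ^ (200 * l)" using l_pos by (intro power_l) (simp add: F)
  finally show "8 * (2 ^ F * 2 ^ F * 2 ^ F) * (2 ^ F * 2 ^ F * 2 ^ F) \<le> B" by (rule le_B)
qed

lemma less_W: "x \<le> 1000000 * B \<Longrightarrow> x < 2 ^ W"
  using B_less by linarith

lemma le_B_less: "x \<le> B \<Longrightarrow> x < 2 ^ W"
  using B_less by linarith

lemma numbers: "0 < W" "(a :: nat) \<le> 1000000 \<Longrightarrow> a < 2 ^ W"
proof -
  show "0 < W" using W by simp
  show "a < 2 ^ W" if "a \<le> 1000000" by (rule less_W) (use that basic_le_B(12) in linarith)
qed

lemma widths: "R + w \<le> W" "F + w \<le> W" "2 * w \<le> W" "F + 1 < W" "l < W"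
  using W l_pos by (simp_all add: F R)

lemma mult_le_B: "j \<le> n \<Longrightarrow> j * s \<le> B" "j \<le> G \<Longrightarrow> j * R \<le> B" "j \<le> 2 ^ (100 * l) \<Longrightarrow> j * k \<le> B"
proof -
  have "(2::nat) ^ l \<le> 2 ^ (200 * l)" "(2::nat) ^ (100 * l) \<le> 2 ^ (200 * l)" by (intro power_l; simp)+
  then show "j \<le> n \<Longrightarrow> j * s \<le> B" "j \<le> 2 ^ (100 * l) \<Longrightarrow> j * k \<le> B"
    using n_less s_le by (intro times_le_B; linarith)+
  show "j \<le> G \<Longrightarrow> j * R \<le> B"
    using basic_le_B(10) by (meson le_trans mult_le_mono1)
qed

definition ready :: "config \<Rightarrow> bool" where
  "ready \<sigma> \<longleftrightarrow> regs \<sigma> 0 = n \<and> regs \<sigma> 1 = k \<and> regs \<sigma> 2 = w \<and> regs \<sigma> 3 = l \<and> regs \<sigma> 4 = F \<and>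
    regs \<sigma> 5 = R \<and> regs \<sigma> 6 = G \<and> regs \<sigma> 7 = 2 ^ F \<and> regs \<sigma> 8 = G * 2 ^ F \<and>
    regs \<sigma> 9 = G * R \<and> regs \<sigma> 18 = s"

lemma ready_agree:
  "ready \<sigma> \<Longrightarrow> agree X \<sigma> \<tau> \<Longrightarrow> X \<inter> {0, 1, 2, 3, 4, 5, 6, 7, 8, 9, 18} = {} \<Longrightarrow> ready \<tau>"
  unfolding ready_def agree_def disjoint_iff by (metis insertCI)

lemma ready_bounds:
  assumes "ready \<sigma>"
  shows "regs \<sigma> 0 < 2 ^ W" "regs \<sigma> 1 < 2 ^ W" "regs \<sigma> 2 < 2 ^ W" "regs \<sigma> 3 < 2 ^ W" "regs \<sigma> 4 < 2 ^ W"
    "regs \<sigma> 5 < 2 ^ W" "regs \<sigma> 6 < 2 ^ W" "regs \<sigma> 7 < 2 ^ W" "regs \<sigma> 8 < 2 ^ W" "regs \<sigma> 9 < 2 ^ W"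
    "regs \<sigma> 18 < 2 ^ W"
  using assms basic_le_B widths unfolding ready_def by (simp_all add: le_B_less)

text \<open>The parameters are recomputed at the start of every operation instead of being stored;
  as only registers are involved, this is free.\<close>

lemma wp_init:
  assumes regs: "regs \<sigma> 0 = n" "regs \<sigma> 1 = k" "regs \<sigma> 2 = w"
  shows "wp init_prog \<sigma> (\<lambda>t \<tau>. t = 0 \<and> ready \<tau> \<and> agree {3, 4, 5, 6, 7, 8, 9, 10, 18} \<sigma> \<tau> \<and> mem \<tau> = mem \<sigma>)"
proof -
  let ?Inv = "\<lambda>(t :: nat) \<tau>. t = 0 \<and> regs \<tau> 3 + floorlog 2 (regs \<tau> 10) = l \<and> regs \<tau> 10 \<le> n \<and>
    agree {3, 10} \<sigma> \<tau> \<and> mem \<tau> = mem \<sigma>"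
  let ?body = "Assign 10 (Reg 10 [div] Const 2) ;; Assign 3 (Reg 3 [+] Const 1)"
  have nW: "n < 2 ^ W" using basic_le_B by (intro less_W) simp
  have loop: "wp (While (Reg 10) ?body) (\<sigma>\<lparr>regs := (regs \<sigma>)(3 := 0, 10 := n)\<rparr>)
    (\<lambda>t \<tau>. t = 0 \<and> regs \<tau> 3 = l \<and> agree {3, 10} \<sigma> \<tau> \<and> mem \<tau> = mem \<sigma>)"
  proof (rule wp_WhileI[where Inv = ?Inv and \<mu> = "\<lambda>\<tau>. regs \<tau> 10"])
    show "?Inv 0 (\<sigma>\<lparr>regs := (regs \<sigma>)(3 := 0, 10 := n)\<rparr>)" by (simp add: agree_def l)
  next
    fix t \<tau>
    assume Inv: "?Inv t \<tau>" and nz: "eval W (regs \<tau>) (Reg 10) \<noteq> 0"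
    have pos: "0 < regs \<tau> 10" using nz by (cases "regs \<tau> 10") auto
    have fl: "floorlog 2 (regs \<tau> 10) = floorlog 2 (regs \<tau> 10 div 2) + 1"
      using pos by (subst compute_floorlog) simp
    have r10: "regs \<tau> 10 < 2 ^ W" using Inv nW by linarith
    have "regs \<tau> 3 + 1 \<le> l" using Inv fl by linarith
    then have r3: "regs \<tau> 3 < 2 ^ W" "regs \<tau> 3 + 1 < 2 ^ W" using basic_le_B(4) by (auto intro!: less_W)
    have e1: "eval W (regs \<tau>) (Reg 10 [div] Const 2) = regs \<tau> 10 div 2"
      using r10 numbers by (simp add: eval_rules del: eval.simps)
    have e2: "eval W ((regs \<tau>)(10 := y)) (Reg 3 [+] Const 1) = regs \<tau> 3 + 1" for y
      using r3 numbers by (simp add: eval_rules del: eval.simps One_nat_def)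
    show "wp ?body \<tau> (\<lambda>u \<upsilon>. ?Inv (t + u) \<upsilon> \<and> regs \<upsilon> 10 < regs \<tau> 10)"
      apply (intro wp_Seq wp_Assign)
      apply (simp add: e1 e2 del: eval.simps One_nat_def)
      using Inv fl pos by (simp add: agree_def le_trans[OF div_le_dividend])
  next
    fix t \<tau>
    assume Inv: "?Inv t \<tau>" and z: "eval W (regs \<tau>) (Reg 10) = 0"
    have "regs \<tau> 10 < 2 ^ W" using Inv nW by linarith
    then have "regs \<tau> 10 = 0" using z by (simp add: take_bit_nat_eq_self)
    then show "t = 0 \<and> regs \<tau> 3 = l \<and> agree {3, 10} \<sigma> \<tau> \<and> mem \<tau> = mem \<sigma>"
      using Inv by (simp add: floorlog_def)
  qed
  have FW: "take_bit W (push_bit F (Suc 0)) = 2 ^ F"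
    using widths(4) by (simp add: push_bit_eq_mult take_bit_nat_eq_self)
  have bnd: "n < 2 ^ W" "k < 2 ^ W" "w < 2 ^ W" "l < 2 ^ W" "F < 2 ^ W" "R < 2 ^ W" "n div l < 2 ^ W" "Suc (n div l) < 2 ^ W"
    "2 ^ F < (2::nat) ^ W" "G < 2 ^ W" "G * 2 ^ F < 2 ^ W" "G * R < 2 ^ W" "k + w < 2 ^ W"
    "(k + w - Suc 0) div w * w < 2 ^ W" "s < 2 ^ W" "32 * l < 2 ^ W" "65 * l < 2 ^ W"
  proof -
    have "n div l \<le> n" by simp
    moreover have "(k + w - Suc 0) div w * w \<le> k + w" by (meson add_leD1 diff_le_self div_times_less_eq_dividend le_trans)
    ultimately show "n < 2 ^ W" "k < 2 ^ W" "w < 2 ^ W" "l < 2 ^ W" "F < 2 ^ W" "R < 2 ^ W" "n div l < 2 ^ W" "Suc (n div l) < 2 ^ W"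
      "2 ^ F < (2::nat) ^ W" "G < 2 ^ W" "G * 2 ^ F < 2 ^ W" "G * R < 2 ^ W" "k + w < 2 ^ W"
      "(k + w - Suc 0) div w * w < 2 ^ W" "s < 2 ^ W" "32 * l < 2 ^ W" "65 * l < 2 ^ W"
      using basic_le_B by (intro less_W; linarith)+
  qed
  have e: "\<And>Q. Q 3 = l \<Longrightarrow> eval W Q (Const 32 [*] Reg 3) = F"
    "\<And>Q. Q 3 = l \<Longrightarrow> eval W Q (Const 65 [*] Reg 3) = R"
    "\<And>Q. Q 0 = n \<Longrightarrow> Q 3 = l \<Longrightarrow> eval W Q (Reg 0 [div] Reg 3 [+] Const 1) = G"
    "\<And>Q. Q 4 = F \<Longrightarrow> eval W Q (Const 1 [<<] Reg 4) = 2 ^ F"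
    "\<And>Q. Q 6 = G \<Longrightarrow> Q 7 = 2 ^ F \<Longrightarrow> eval W Q (Reg 6 [*] Reg 7) = G * 2 ^ F"
    "\<And>Q. Q 6 = G \<Longrightarrow> Q 5 = R \<Longrightarrow> eval W Q (Reg 6 [*] Reg 5) = G * R"
    "\<And>Q. Q 1 = k \<Longrightarrow> Q 2 = w \<Longrightarrow> eval W Q ((Reg 1 [+] Reg 2 [-] Const 1) [div] Reg 2 [*] Reg 2) = s"
    using widths(4)
    by (simp_all add: eval_rules bnd numbers FW F[symmetric] R[symmetric] G[simplified, symmetric] s[simplified, symmetric] del: eval.simps)
  show ?thesis
    unfolding init_prog_def
    apply (intro wp_Seq wp_Assign)
    apply (simp add: regs eval_rules bnd numbers del: eval.simps One_nat_def)
    apply (rule wp_mono[OF loop])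
    apply (intro wp_Seq wp_Assign)
    subgoal for t \<tau>
    proof -
      assume "t = 0 \<and> regs \<tau> 3 = l \<and> agree {3, 10} \<sigma> \<tau> \<and> mem \<tau> = mem \<sigma>"
      then have \<tau>: "t = 0" "regs \<tau> 3 = l" "regs \<tau> 0 = n" "regs \<tau> 1 = k" "regs \<tau> 2 = w"
        "agree {3, 10} \<sigma> \<tau>" "mem \<tau> = mem \<sigma>"
        using regs by (simp_all add: agree_def)
      show ?thesis
        using \<tau> by (simp add: e agree_def ready_def del: eval.simps One_nat_def)
    qed
    done
qed

lemma spans_le: "spans p j t \<Longrightarrow> t \<le> j div w + 2"
proof (cases "t \<le> 2")
  case False
  assume "spans p j t"
  moreover obtain t' where t': "t = t' + 2" using False by (metis add.commute le_add_diff_inverse nat_le_linear)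
  moreover have "p mod w < w" using w by simp
  ultimately have "t' * w \<le> j" by (simp add: spans_def)
  then show ?thesis using w t' by (simp add: less_eq_div_iff_mult_less_eq)
qed simp

abbreviation key :: "config \<Rightarrow> nat \<Rightarrow> nat" where
  "key \<sigma> i \<equiv> h (family \<sigma>, 0, G * 2 ^ F, xs ! i)"

section \<open>Finding, writing and reading a slot\<close>

lemma wp_lookup:
  assumes ready: "ready \<sigma>" and i: "regs \<sigma> 19 = i" "i < length xs" "i \<le> n"
    and v: "key \<sigma> i < G * 2 ^ F" and mem: "\<And>a. mem \<sigma> Struct a < 2 ^ w"
  shows "wp lookup_prog \<sigma> (\<lambda>t \<tau>. t \<le> R div w + 3 \<and>
    regs \<tau> 21 = key \<sigma> i div 2 ^ F \<and> regs \<tau> 22 = key \<sigma> i mod 2 ^ F \<and>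
    regs \<tau> 23 = field w (mem \<sigma> Struct) (key \<sigma> i div 2 ^ F * R) R div 2 ^ l \<and>
    regs \<tau> 24 = field w (mem \<sigma> Struct) (key \<sigma> i div 2 ^ F * R) R mod 2 ^ l \<and>
    agree {10, 11, 12, 13, 14, 20, 21, 22, 23, 24} \<sigma> \<tau> \<and> mem \<tau> = mem \<sigma>)"
proof -
  define g p where "g = key \<sigma> i div 2 ^ F" and "p = key \<sigma> i mod 2 ^ F"
  have g: "g < G" using v by (simp add: g_def less_mult_imp_div_less)
  define c where "c = field w (mem \<sigma> Struct) (g * R) R"
  have cR: "c < 2 ^ R" unfolding c_def by (rule field_less)
  have "(2::nat) ^ R \<le> 2 ^ W" using widths(1) by (intro power_increasing) auto
  then have cW: "c < 2 ^ W" using cR by linarith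
  have gR: "g * R \<le> B" using g by (intro mult_le_B) simp
  note rb = ready_bounds[OF ready]
  have r: "regs \<sigma> 2 = w" "regs \<sigma> 3 = l" "regs \<sigma> 5 = R" "regs \<sigma> 7 = 2 ^ F" "regs \<sigma> 8 = G * 2 ^ F"
    using ready by (simp_all add: ready_def)
  have bnd: "key \<sigma> i < 2 ^ W" "i < 2 ^ W" "g < 2 ^ W" "p < 2 ^ W" "g * R < 2 ^ W" "g * R + R + 2 * w < 2 ^ W"
    "R < 2 ^ W" "2 ^ F < (2::nat) ^ W" "G * 2 ^ F < 2 ^ W" "l < 2 ^ W"
  proof -
    have "p \<le> 2 ^ F" by (simp add: p_def)
    then show "key \<sigma> i < 2 ^ W" "i < 2 ^ W" "g < 2 ^ W" "p < 2 ^ W" "g * R < 2 ^ W" "g * R + R + 2 * w < 2 ^ W"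
      "R < 2 ^ W" "2 ^ F < (2::nat) ^ W" "G * 2 ^ F < 2 ^ W" "l < 2 ^ W"
      using v g i(3) gR basic_le_B by (auto intro!: less_W simp del: power_strict_increasing_iff)
  qed
  have e0: "(if eval W (regs \<sigma>) (Reg 19) < length xs then
      h (family \<sigma>, eval W (regs \<sigma>) (Const 0), eval W (regs \<sigma>) (Reg 8), xs ! eval W (regs \<sigma>) (Reg 19)) else 0)
    = key \<sigma> i"
    using r i bnd by (simp add: eval_rules del: eval.simps)
  have lW: "(2::nat) ^ l < 2 ^ W" using widths(5) by simp
  let ?\<sigma> = "\<sigma>\<lparr>regs := (regs \<sigma>)(20 := key \<sigma> i, 21 := g, 22 := p, 10 := g * R, 11 := R)\<rparr>"
  have load: "wp (load_bits Struct) ?\<sigma> (\<lambda>t \<tau>. spans (g * R) R t \<and> regs \<tau> 12 = field w (mem ?\<sigma> Struct) (g * R) R \<and>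
    agree {12, 13, 14} ?\<sigma> \<tau> \<and> mem \<tau> = mem ?\<sigma>)"
    by (rule wp_load_bits) (use w r bnd widths mem in simp_all)
  show ?thesis
    unfolding lookup_prog_def g_def[symmetric] p_def[symmetric] c_def[symmetric]
    apply (intro wp_Seq wp_Assign wp_Hash)
    apply (simp only: e0)
    apply (rule wp_mono[where P = "\<lambda>t \<tau>. spans (g * R) R t \<and> regs \<tau> 12 = c \<and> agree {12, 13, 14} ?\<sigma> \<tau> \<and> mem \<tau> = mem ?\<sigma>"])
    subgoal
      using load r bnd by (simp add: eval_rules c_def g_def p_def del: eval.simps power_strict_increasing_iff)
    apply (intro wp_Seq wp_Assign)
    subgoal for t \<tau>
      using r bnd cW lW numbers widths(5) spans_le[of "g * R" R t]
      by (simp add: eval_rules agree_def take_bit_nat_eq_self push_bit_eq_mult drop_bit_eq_div del: eval.simps power_strict_increasing_iff)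
    done
qed


text \<open>A record holds the offset in its low \<open>l\<close> bits and the code above them.
  \<open>off\<close> is a parameter because it is zero while the tries are built; the prefix sums
  are added afterwards.\<close>

definition coded :: "(nat \<Rightarrow> nat) \<Rightarrow> (nat \<Rightarrow> trie) \<Rightarrow> (nat \<Rightarrow> nat) \<Rightarrow> bool" where
  "coded A T off \<longleftrightarrow> (\<forall>g<G. field w A (g * R) R = off g + 2 ^ l * enc (T g) 0 \<and> off g < 2 ^ l \<and>
    digits (T g) \<le> F \<and> fits F (T g))"

lemma four_power: "(4::nat) ^ j = 2 ^ j * 2 ^ j"
  by (simp flip: power_mult_distrib)

lemma digits_bounds:
  assumes "digits t \<le> F"
  shows "4 * (4::nat) ^ digits t < 2 ^ W" "enc t 0 < 2 ^ W" "leaves t \<le> F" "enc t 0 \<le> B"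
proof -
  have "(4::nat) ^ digits t \<le> 4 ^ F" using assms by (intro power_increasing) auto
  moreover have "4 ^ F \<le> B"
  proof -
    have "1 * (2 ^ F * 2 ^ F) \<le> (8 * (2 ^ F * 2 ^ F * 2 ^ F) * 2 ^ F) * (2 ^ F * 2 ^ F :: nat)"
      by (intro mult_le_mono1) simp
    also have "\<dots> = 8 * (2 ^ F * 2 ^ F * 2 ^ F) * (2 ^ F * 2 ^ F * 2 ^ F)" by (simp only: mult_ac)
    finally show ?thesis using basic_le_B(13) unfolding four_power mult_1 by (rule le_trans)
  qed
  ultimately have le: "4 ^ digits t \<le> B" by linarith
  then show "4 * (4::nat) ^ digits t < 2 ^ W" by (intro less_W) linarith
  show "enc t 0 < 2 ^ W" "enc t 0 \<le> B"
    using le enc_less[of t] B_less by linarith+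
  show "leaves t \<le> F" using leaves_le[of t] assms by simp
qed

text \<open>Elements outside the set are covered too: the walk then ends at some outer node, and the
  rank is still bounded by the number of leaves.\<close>

lemma wp_find:
  assumes ready: "ready \<sigma>" and i: "regs \<sigma> 19 = i" "i < length xs" "i \<le> n"
    and v: "key \<sigma> i < G * 2 ^ F" and mem: "\<And>a. mem \<sigma> Struct a < 2 ^ w"
    and coded: "coded (mem \<sigma> Struct) T off"
  defines "g \<equiv> key \<sigma> i div 2 ^ F" and "p \<equiv> key \<sigma> i mod 2 ^ F"
  shows "wp find_prog \<sigma> (\<lambda>t \<tau>. t \<le> R div w + 3 \<and>
    regs \<tau> 21 = g \<and> regs \<tau> 22 = p \<and> regs \<tau> 23 = enc (T g) 0 \<and> regs \<tau> 24 = off g \<and>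
    regs \<tau> 29 = rank (T g) p \<and> (\<exists>y m lo rest.
      reach (T g) F p y m (regs \<tau> 26) (regs \<tau> 27) lo (regs \<tau> 28) rest (regs \<tau> 29) \<and>
      regs \<tau> 25 = enc y rest \<and> (\<forall>a b. y \<noteq> Node a b)) \<and>
    agree {10, 11, 12, 13, 14, 20, 21, 22, 23, 24, 25, 26, 27, 28, 29, 30} \<sigma> \<tau> \<and> mem \<tau> = mem \<sigma>)"
proof -
  have g: "g < G" using v by (simp add: g_def less_mult_imp_div_less)
  have p: "p < 2 ^ F" by (simp add: p_def)
  have T: "field w (mem \<sigma> Struct) (g * R) R = off g + 2 ^ l * enc (T g) 0" "off g < 2 ^ l"
    "digits (T g) \<le> F" "fits F (T g)"
    using coded g by (auto simp: coded_def)
  note look = wp_lookup[OF ready i v mem, folded g_def p_def, unfolded T(1)]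
  have code: "(off g + 2 ^ l * enc (T g) 0) div 2 ^ l = enc (T g) 0"
    "(off g + 2 ^ l * enc (T g) 0) mod 2 ^ l = off g"
    using T(2) by simp_all
  show ?thesis
    unfolding find_prog_def
    apply (rule wp_Seq)
    apply (rule wp_mono[OF look])
    apply (elim conjE)
    subgoal premises pr for t \<tau>
    proof (rule wp_mono, rule wp_walk[of \<tau> "T g" p F])
      show "regs \<tau> 23 = enc (T g) 0" using pr code by simp
      show "regs \<tau> 22 = p" by (rule pr)
      show "fits F (T g)" "p < 2 ^ F" by fact+
      show "4 * 4 ^ digits (T g) < (2::nat) ^ W" by (rule digits_bounds(1)[OF T(3)])
      show "F + 1 < W" by (rule widths)
      fix u :: nat and \<upsilon>
      assume *: "u = 0 \<and> (\<exists>s m lo rest.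
        reach (T g) F p s m (regs \<upsilon> 26) (regs \<upsilon> 27) lo (regs \<upsilon> 28) rest (regs \<upsilon> 29) \<and>
        regs \<upsilon> 25 = enc s rest \<and> (\<forall>a b. s \<noteq> Node a b)) \<and>
        agree {25, 26, 27, 28, 29, 30} \<tau> \<upsilon> \<and> mem \<upsilon> = mem \<tau>"
      then obtain y m lo rest where
        re: "reach (T g) F p y m (regs \<upsilon> 26) (regs \<upsilon> 27) lo (regs \<upsilon> 28) rest (regs \<upsilon> 29)"
          "\<forall>a b. y \<noteq> Node a b" by blast
      have "rank y (regs \<upsilon> 26) = 0" using re(2) by (cases y) auto
      then have "regs \<upsilon> 29 = rank (T g) p"
        using reach_invariants(3)[OF T(4) p re(1)] by simp
      moreover have "agree {10, 11, 12, 13, 14, 20, 21, 22, 23, 24, 25, 26, 27, 28, 29, 30} \<sigma> \<upsilon>"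
        by (rule agree_trans[of _ \<sigma> \<tau> _ \<upsilon>]) (use * pr in auto)
      moreover have "regs \<upsilon> r = regs \<tau> r" if "r \<notin> {25, 26, 27, 28, 29, 30}" for r
        using * that by (simp add: agree_def)
      ultimately show "t + u \<le> R div w + 3 \<and>
        regs \<upsilon> 21 = g \<and> regs \<upsilon> 22 = p \<and> regs \<upsilon> 23 = enc (T g) 0 \<and> regs \<upsilon> 24 = off g \<and>
        regs \<upsilon> 29 = rank (T g) p \<and> (\<exists>y m lo rest.
          reach (T g) F p y m (regs \<upsilon> 26) (regs \<upsilon> 27) lo (regs \<upsilon> 28) rest (regs \<upsilon> 29) \<and>
          regs \<upsilon> 25 = enc y rest \<and> (\<forall>a b. y \<noteq> Node a b)) \<and>
        agree {10, 11, 12, 13, 14, 20, 21, 22, 23, 24, 25, 26, 27, 28, 29, 30} \<sigma> \<upsilon> \<and> mem \<upsilon> = mem \<sigma>"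
        using * pr code by simp
    qed
    done
qed

lemma slot_bounds:
  assumes "o' < 2 ^ l" "digits t \<le> F"
  shows "(o' + rank t p) * k \<le> B" "o' + rank t p \<le> B"
proof -
  have "rank t p \<le> F" using rank_le[of t p] digits_bounds(3)[OF assms(2)] by simp
  then have "o' + rank t p \<le> 2 ^ l + 32 * 2 ^ l" using assms(1) l_less unfolding F by linarith
  also have "\<dots> \<le> 2 ^ 6 * 2 ^ l" by simp
  also have "\<dots> = 2 ^ (6 + l)" by (simp only: power_add)
  also have "\<dots> \<le> 2 ^ (100 * l)" using l_pos by (intro power_increasing) auto
  finally have le: "o' + rank t p \<le> 2 ^ (100 * l)" .
  then show "(o' + rank t p) * k \<le> B" by (rule mult_le_B)
  have "(2::nat) ^ (100 * l) \<le> 2 ^ (200 * l)" by (intro power_l) simp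
  then show "o' + rank t p \<le> B" using le by (intro le_B) linarith
qed

lemma eval_slot:
  assumes "Q 9 = G * R" "Q 24 = o'" "Q 29 = rank t p" "Q 1 = k" "o' < 2 ^ l" "digits t \<le> F"
  shows "eval W Q slot_exp = G * R + (o' + rank t p) * k"
proof -
  note b = slot_bounds[OF assms(5,6), of p]
  have "G * R < 2 ^ W" "k < 2 ^ W" "o' < 2 ^ W" "rank t p < 2 ^ W" "o' + rank t p < 2 ^ W"
    "(o' + rank t p) * k < 2 ^ W" "G * R + (o' + rank t p) * k < 2 ^ W"
    using b basic_le_B(2,10) by (intro less_W; linarith)+
  then show ?thesis
    using assms(1-4) by (simp add: slot_exp_def eval_rules del: eval.simps)
qed

lemma wp_place:
  assumes ready: "ready \<sigma>" and i: "regs \<sigma> 19 = i" "i < length xs" "i \<le> n"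
    and v: "key \<sigma> i < G * 2 ^ F" and mem: "\<And>b a. mem \<sigma> b a < 2 ^ w"
    and coded: "coded (mem \<sigma> Struct) T off"
  defines "g \<equiv> key \<sigma> i div 2 ^ F" and "p \<equiv> key \<sigma> i mod 2 ^ F"
  shows "wp place_prog \<sigma> (\<lambda>t \<tau>. t \<le> R div w + 11 + 4 * (k div w) \<and>
    agree {10, 11, 12, 13, 14, 15, 16, 17, 20, 21, 22, 23, 24, 25, 26, 27, 28, 29, 30} \<sigma> \<tau> \<and>
    (\<exists>A. mem \<tau> = (mem \<sigma>)(Struct := A) \<and> put w (mem \<sigma> Struct) (G * R + (off g + rank (T g) p) * k) k
      (\<lambda>j. mbit w (mem \<sigma> Work) (i * s + j)) A))"
proof -
  have g: "g < G" using v by (simp add: g_def less_mult_imp_div_less)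
  have T: "off g < 2 ^ l" "digits (T g) \<le> F"
    using coded g by (auto simp: coded_def)
  define q where "q = G * R + (off g + rank (T g) p) * k"
  have is_B: "i * s \<le> B" using i(3) by (rule mult_le_B)
  have isW: "i * s < 2 ^ W" "i < 2 ^ W" "s < 2 ^ W" "i * s + k + 3 * w < 2 ^ W" "q + k + 3 * w < 2 ^ W"
    using is_B i(3) basic_le_B(1,2,3,10,11) slot_bounds(1)[OF T, of p] unfolding q_def by (intro less_W; linarith)+
  note find = wp_find[OF ready i v mem coded, folded g_def p_def]
  show ?thesis
    unfolding place_prog_def
    apply (intro wp_Seq)
    apply (rule wp_mono[OF find])
    apply (elim conjE)
    apply (intro wp_Seq wp_Assign)
    subgoal premises pr for t \<tau>
    proof -
      have r: "regs \<tau> 0 = n" "regs \<tau> 1 = k" "regs \<tau> 2 = w" "regs \<tau> 9 = G * R" "regs \<tau> 18 = s" "regs \<tau> 19 = i"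
        using pr ready i by (simp_all add: agree_def ready_def)
      have e1: "eval W (regs \<tau>) (Reg 19 [*] Reg 18) = i * s"
        using r isW by (simp add: eval_rules del: eval.simps)
      have e2: "eval W ((regs \<tau>)(15 := y)) slot_exp = q" for y
        unfolding q_def by (rule eval_slot) (use r pr T in simp_all)
      let ?\<tau> = "\<tau>\<lparr>regs := (regs \<tau>)(15 := i * s, 16 := q)\<rparr>"
      have copy: "wp (copy_bits Work Struct) ?\<tau> (\<lambda>t \<upsilon>. t \<le> 4 * (k div w) + 8 \<and>
        agree {10, 11, 12, 13, 14, 17} ?\<tau> \<upsilon> \<and>
        (\<exists>A. mem \<upsilon> = (mem ?\<tau>)(Struct := A) \<and>
          put w (mem ?\<tau> Struct) q k (\<lambda>j. mbit w (mem ?\<tau> Work) (i * s + j)) A))"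
        by (rule wp_copy_bits) (use r w isW widths mem pr in simp_all)
      show ?thesis
        apply (simp add: e1 e2 del: eval.simps One_nat_def)
        apply (rule wp_mono[OF copy])
        using pr by (auto simp: q_def agree_def)
    qed
    done
qed

lemma wp_fetch:
  assumes ready: "ready \<sigma>" and i: "regs \<sigma> 19 = i" "i < length xs" "i \<le> n"
    and v: "key \<sigma> i < G * 2 ^ F" and mem: "\<And>b a. mem \<sigma> b a < 2 ^ w"
    and coded: "coded (mem \<sigma> Struct) T off"
  defines "g \<equiv> key \<sigma> i div 2 ^ F" and "p \<equiv> key \<sigma> i mod 2 ^ F"
  shows "wp fetch_prog \<sigma> (\<lambda>t \<tau>. t \<le> R div w + 11 + 4 * (k div w) \<and>
    (\<exists>A. mem \<tau> = (mem \<sigma>)(Work := A) \<and> put w (mem \<sigma> Work) 0 k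
      (\<lambda>j. mbit w (mem \<sigma> Struct) (G * R + (off g + rank (T g) p) * k + j)) A))"
proof -
  have g: "g < G" using v by (simp add: g_def less_mult_imp_div_less)
  have T: "off g < 2 ^ l" "digits (T g) \<le> F"
    using coded g by (auto simp: coded_def)
  define q where "q = G * R + (off g + rank (T g) p) * k"
  have qW: "q + k + 3 * w < 2 ^ W" "0 + k + 3 * w < 2 ^ W"
    using basic_le_B(1,2,10) slot_bounds(1)[OF T, of p] unfolding q_def by (intro less_W; linarith)+
  note find = wp_find[OF ready i v mem coded, folded g_def p_def]
  show ?thesis
    unfolding fetch_prog_def
    apply (intro wp_Seq)
    apply (rule wp_mono[OF find])
    apply (elim conjE)
    apply (intro wp_Seq wp_Assign)
    subgoal premises pr for t \<tau>
    proof -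
      have r: "regs \<tau> 1 = k" "regs \<tau> 2 = w" "regs \<tau> 9 = G * R"
        using pr ready by (simp_all add: agree_def ready_def)
      have e1: "eval W (regs \<tau>) slot_exp = q"
        unfolding q_def by (rule eval_slot) (use r pr T in simp_all)
      have e2: "eval W Q (Const 0) = 0" for Q by simp
      let ?\<tau> = "\<tau>\<lparr>regs := (regs \<tau>)(15 := q, 16 := 0)\<rparr>"
      have copy: "wp (copy_bits Struct Work) ?\<tau> (\<lambda>t \<upsilon>. t \<le> 4 * (k div w) + 8 \<and>
        agree {10, 11, 12, 13, 14, 17} ?\<tau> \<upsilon> \<and>
        (\<exists>A. mem \<upsilon> = (mem ?\<tau>)(Work := A) \<and>
          put w (mem ?\<tau> Work) 0 k (\<lambda>j. mbit w (mem ?\<tau> Struct) (q + j)) A))"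
        by (rule wp_copy_bits) (use r w qW widths mem pr in simp_all)
      show ?thesis
        apply (simp add: e1 e2 del: eval.simps One_nat_def)
        apply (rule wp_mono[OF copy])
        using pr by (auto simp: q_def)
    qed
    done
qed

end

section \<open>Inserting an element\<close>

text \<open>The table lies in \<open>Work\<close> behind the \<open>n\<close> padded labels and
  interleaves the groups: heap number \<open>e\<close> of group \<open>g\<close> has index
  \<open>e * G + g\<close>. \<open>Work\<close> is temporary, so its extent does not enter the space
  bound.\<close>

abbreviation entry_exp :: "rexp \<Rightarrow> rexp" where
  "entry_exp e \<equiv> Reg 0 [*] Reg 18 [+] (e [*] Reg 6 [+] Reg 21) [*] Reg 4"

text \<open>The digits of \<open>Empty\<close> and \<open>Leaf\<close> are 1 and 2, so the code
  grows by one unit at the position of the node.\<close>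

definition empty_prog :: com where
  "empty_prog =
    Assign 10 (entry_exp (Reg 27)) ;; Assign 11 (Reg 4) ;; Assign 12 (Reg 26) ;; store_bits Work ;;
    Assign 31 (Reg 23 [+] Reg 28)"

text \<open>A common bit 1 puts the digits of \<open>Node\<close> and \<open>Empty\<close> before
  the focus. A common bit 0 puts the digit of \<open>Node\<close> before it and that of
  \<open>Empty\<close> behind it, at the front of \<open>rest\<close>.\<close>

definition split_prog :: com where
  "split_prog =
    While (Reg 26 [mod] Const 2 [=] Reg 32 [mod] Const 2)
      (If (Reg 26 [mod] Const 2)
        (Assign 33 (Reg 33 [+] Reg 28 [*] Const 4) ;; Assign 28 (Reg 28 [*] Const 16))
        (Assign 34 (Reg 34 [*] Const 4 [+] Const 1) ;; Assign 28 (Reg 28 [*] Const 4)) ;;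
       Assign 27 (Reg 27 [*] Const 2 [+] Reg 26 [mod] Const 2) ;;
       Assign 26 (Reg 26 [div] Const 2) ;; Assign 32 (Reg 32 [div] Const 2))"

text \<open>Where the remainders first differ, a \<open>Node\<close> with two leaves has the digits
  0, 2, 2, that is \<open>64 * rest + 40\<close>, in whichever order the leaves occur. Equal
  remainders yield the sentinel \<open>4 ^ F\<close>, the least number treated as an
  overflow.\<close>

definition leaf_prog :: com where
  "leaf_prog =
    Assign 10 (entry_exp (Reg 27)) ;; Assign 11 (Reg 4) ;; load_bits Work ;;
    Assign 32 (Reg 12) ;;
    If (Reg 26 [=] Reg 32) (Assign 31 (Reg 7 [*] Reg 7))
      (Assign 33 (Reg 23 [mod] Reg 28) ;; Assign 34 (Reg 25 [div] Const 4) ;;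
       split_prog ;;
       Assign 31 (Reg 33 [+] Reg 28 [*] (Const 64 [*] Reg 34 [+] Const 40)) ;;
       Assign 10 (entry_exp (Reg 27 [*] Const 2 [+] Reg 26 [mod] Const 2)) ;;
       Assign 12 (Reg 26 [div] Const 2) ;; store_bits Work ;;
       Assign 10 (entry_exp (Reg 27 [*] Const 2 [+] Reg 32 [mod] Const 2)) ;;
       Assign 12 (Reg 32 [div] Const 2) ;; store_bits Work)"

text \<open>The value \<open>n + 1\<close> in register 19 ends the loop over the elements and marks
  the attempt as failed; a successful attempt ends with \<open>n\<close>.\<close>

definition insert_prog :: com where
  "insert_prog =
    find_prog ;;
    If (Reg 25 [mod] Const 4 [=] Const 1) empty_prog leaf_prog ;;
    If (Reg 31 [<] Reg 7 [*] Reg 7)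
      (Assign 10 (Reg 21 [*] Reg 5) ;; Assign 11 (Reg 5) ;; Assign 12 (Reg 31 [<<] Reg 3) ;;
       store_bits Struct ;; Assign 19 (Reg 19 [+] Const 1))
      (Assign 19 (Reg 0 [+] Const 1))"

section \<open>Editing the code and the table\<close>

lemma field_put:
  assumes "put w A (b + a * j) j (bit x) A'" "x < 2 ^ j"
  shows "field w A' (b + c * j) j = (if c = a then x else field w A (b + c * j) j)"
proof (cases "c = a")
  case True
  then show ?thesis using assms by (auto simp: put_def intro!: field_eqI)
next
  case False
  have "mbit w A' (b + c * j + i) = mbit w A (b + c * j + i)" if "i < j" for i
  proof -
    have "\<not> (b + a * j \<le> b + c * j + i \<and> b + c * j + i < b + a * j + j)"
    proof
      assume *: "b + a * j \<le> b + c * j + i \<and> b + c * j + i < b + a * j + j"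
      then have "c * j + i < Suc a * j" "a * j < Suc c * j" using that by auto
      then have "c < Suc a" "a < Suc c"
        by (metis le_add1 le_less_trans mult_less_cancel2, metis mult_less_cancel2)
      then show False using False by simp
    qed
    then show ?thesis using assms(1) by (auto simp: put_def)
  qed
  then show ?thesis using False by (auto intro: field_cong)
qed

context retrieval
begin

definition entry :: "nat \<Rightarrow> nat \<Rightarrow> nat" where
  "entry g u = n * s + (u * G + g) * F"

definition entries :: "(nat \<Rightarrow> nat) \<Rightarrow> nat \<Rightarrow> nat \<Rightarrow> nat" where
  "entries A g u = field w A (entry g u) F"

definition tables :: "(nat \<Rightarrow> nat) \<Rightarrow> (nat \<Rightarrow> trie) \<Rightarrow> bool" where
  "tables A T \<longleftrightarrow> (\<forall>g<G. tab (entries A g) 1 (T g))"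

lemma entries_put:
  assumes "put w A (entry g u) F (bit x) A'" "x < 2 ^ F" "g < G" "g' < G"
  shows "entries A' g' u' = (if g' = g \<and> u' = u then x else entries A g' u')"
proof -
  have "u' * G + g' = u * G + g \<longleftrightarrow> g' = g \<and> u' = u"
  proof
    assume *: "u' * G + g' = u * G + g"
    have "(u' * G + g') mod G = g'" "(u * G + g) mod G = g" using assms by simp_all
    with * G_pos show "g' = g \<and> u' = u" by simp
  qed simp
  then show ?thesis
    using field_put[OF assms(1)[unfolded entry_def] assms(2), of "u' * G + g'"]
    by (simp add: entries_def entry_def)
qed

lemma entry_bound: "g < G \<Longrightarrow> u < 2 ^ (F + 2) \<Longrightarrow> (u * G + g) * F \<le> B"
proof -
  assume "g < G" "u < 2 ^ (F + 2)"
  then have "u * G + g \<le> Suc u * G" by simp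
  also have "\<dots> \<le> 2 ^ (F + 2) * 2 ^ l" using \<open>u < 2 ^ (F + 2)\<close> G_le by (intro mult_mono) auto
  finally have "(u * G + g) * F \<le> (2 ^ (F + 2) * 2 ^ l) * (2 ^ 5 * 2 ^ l)"
    using l_less F by (intro mult_mono) simp_all
  also have "\<dots> = 2 ^ (F + 2 + l + (5 + l))" by (simp only: power_add)
  also have "\<dots> \<le> 2 ^ (200 * l)" using l_pos by (intro power_l) (simp add: F)
  finally show ?thesis by (rule le_B)
qed

lemma eval_entry:
  assumes "Q 0 = n" "Q 18 = s" "Q 6 = G" "Q 21 = g" "Q 4 = F" "eval W Q e = u" "g < G" "u < 2 ^ (F + 2)"
  shows "eval W Q (entry_exp e) = entry g u"
proof -
  have ns: "n * s \<le> B" by (rule mult_le_B(1)) simp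
  note eb = entry_bound[OF assms(7,8)]
  have "1 \<le> F" using l_pos by (simp add: F)
  then have le: "u * G + g \<le> (u * G + g) * F" by simp
  have "n < 2 ^ W" "s < 2 ^ W" "G < 2 ^ W" "g < 2 ^ W" "F < 2 ^ W" "n * s < 2 ^ W" "u * G < 2 ^ W"
    "u * G + g < 2 ^ W" "(u * G + g) * F < 2 ^ W" "n * s + (u * G + g) * F < 2 ^ W"
    using ns eb le basic_le_B assms(7) by (intro less_W; linarith)+
  then show ?thesis
    using assms(1-6) by (simp add: eval_rules entry_def del: eval.simps)
qed

text \<open>There are at most \<open>F\<close> digits before the insertion, and at most
  \<open>F\<close> new nodes add \<open>2 * F\<close> digits. So the new code is representable even
  when it is going to be rejected.\<close>

lemma code_bound:
  assumes "digits t \<le> F"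
  shows "8 * enc (ins t F p) 0 \<le> B" "8 * 4 ^ F \<le> B"
proof -
  have "digits (ins t F p) \<le> F + F + F" using nodes_ins_le[of t F p] assms by simp
  then have "enc (ins t F p) 0 < 4 ^ (F + F + F)" by (simp only: enc_less_iff)
  moreover have B3: "8 * 4 ^ (F + F + F) \<le> B"
  proof -
    have "8 * (4::nat) ^ (F + F + F) = 8 * (2 ^ F * 2 ^ F * 2 ^ F) * (2 ^ F * 2 ^ F * 2 ^ F)"
      by (simp only: power_add four_power mult_ac)
    then show ?thesis using basic_le_B(13) by simp
  qed
  ultimately show "8 * enc (ins t F p) 0 \<le> B" by linarith
  have "(4::nat) ^ F \<le> 4 ^ (F + F + F)" by (intro power_increasing) auto
  then show "8 * 4 ^ F \<le> B" using B3 by linarith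
qed

text \<open>The finished trie \<open>U\<close> stays fixed; each round moves the focus one level
  down towards the place where the two remainders differ, and shortens the \<open>split\<close> that
  is still missing there.\<close>

lemma wp_split:
  assumes U: "8 * enc U 0 \<le> B" and m: "q < 2 ^ m" "r < 2 ^ m" "q \<noteq> r"
    and v: "1 \<le> v" "Suc v * 2 ^ m \<le> 2 ^ Suc F"
    and fo: "focus T U (split m q r) v lo mul rest" and mul: "0 < mul"
    and regs: "regs \<sigma> 26 = q" "regs \<sigma> 32 = r" "regs \<sigma> 27 = v" "regs \<sigma> 33 = lo" "regs \<sigma> 28 = mul" "regs \<sigma> 34 = rest"
  shows "wp split_prog \<sigma> (\<lambda>t \<tau>. t = 0 \<and> (\<exists>j.
    focus T U (split (Suc j) (regs \<tau> 26) (regs \<tau> 32)) (regs \<tau> 27) (regs \<tau> 33) (regs \<tau> 28) (regs \<tau> 34) \<and>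
    regs \<tau> 26 < 2 ^ Suc j \<and> regs \<tau> 32 < 2 ^ Suc j \<and> even (regs \<tau> 26) \<noteq> even (regs \<tau> 32) \<and>
    1 \<le> regs \<tau> 27 \<and> Suc (regs \<tau> 27) * 2 ^ Suc j \<le> 2 ^ Suc F \<and> 0 < regs \<tau> 28) \<and>
    agree {26, 27, 28, 32, 33, 34} \<sigma> \<tau> \<and> mem \<tau> = mem \<sigma>)"
proof -
  let ?Inv = "\<lambda>(t :: nat) \<tau>. t = 0 \<and> (\<exists>m.
    focus T U (split m (regs \<tau> 26) (regs \<tau> 32)) (regs \<tau> 27) (regs \<tau> 33) (regs \<tau> 28) (regs \<tau> 34) \<and>
    regs \<tau> 26 < 2 ^ m \<and> regs \<tau> 32 < 2 ^ m \<and> regs \<tau> 26 \<noteq> regs \<tau> 32 \<and>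
    1 \<le> regs \<tau> 27 \<and> Suc (regs \<tau> 27) * 2 ^ m \<le> 2 ^ Suc F \<and> 0 < regs \<tau> 28) \<and>
    agree {26, 27, 28, 32, 33, 34} \<sigma> \<tau> \<and> mem \<tau> = mem \<sigma>"
  have bounds: "q < 2 ^ W" "r < 2 ^ W" "v < 2 ^ W" "v * 2 < 2 ^ W" "v * 2 + q mod 2 < 2 ^ W"
    "lo < 2 ^ W" "mul < 2 ^ W" "mul * 4 < 2 ^ W" "mul * 16 < 2 ^ W" "lo + mul * 4 < 2 ^ W"
    "rest < 2 ^ W" "rest * 4 < 2 ^ W" "rest * 4 + 1 < 2 ^ W"
    if "focus T U t v lo mul rest" "q < 2 ^ m" "r < 2 ^ m" "Suc v * 2 ^ m \<le> 2 ^ Suc F" "0 < mul"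
    for t and m q r v lo mul rest :: nat
  proof -
    have FB: "2 ^ Suc F \<le> 2 * B" using basic_le_B(8) by simp
    note le_2B = le_trans[OF _ le_trans[OF that(4) FB]]
    have "Suc v * 1 \<le> 2 * B" by (rule le_2B, intro mult_le_mono2) simp
    then have vB: "v \<le> 2 * B" by simp
    have "1 * 2 ^ m \<le> 2 * B" by (rule le_2B, intro mult_le_mono1) simp
    then have mB: "2 ^ m \<le> 2 * B" by simp
    \<comment> \<open>All components are parts of the fixed number \<open>enc U 0\<close>, whose
      bound therefore applies to each of them.\<close>
    have U': "enc U 0 = lo + mul * enc t rest" using that(1) by (simp add: focus_def)
    have "1 * rest \<le> enc t rest"
      using enc_eq[of t rest] by (metis le_add2 mult_le_mono1 one_le_numeral one_le_power order_trans)
    moreover have "1 \<le> enc t rest" using le_enc[of t rest] by (metis one_le_numeral one_le_power order_trans)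
    then have "mul * 1 \<le> mul * enc t rest" by (rule mult_le_mono2)
    moreover have "1 * enc t rest \<le> mul * enc t rest" using that(5) by (intro mult_le_mono1) simp
    ultimately have le: "lo \<le> B" "mul \<le> B" "rest \<le> B" using U U' by linarith+
    have one: "1 \<le> B" by (rule basic_le_B)
    have "q mod 2 \<le> 1" by simp
    then show "q < 2 ^ W" "r < 2 ^ W" "v < 2 ^ W" "v * 2 < 2 ^ W" "v * 2 + q mod 2 < 2 ^ W"
      "lo < 2 ^ W" "mul < 2 ^ W" "mul * 4 < 2 ^ W" "mul * 16 < 2 ^ W" "lo + mul * 4 < 2 ^ W"
      "rest < 2 ^ W" "rest * 4 < 2 ^ W" "rest * 4 + 1 < 2 ^ W"
      using le vB mB one that(2,3) by (intro less_W; linarith)+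
  qed
  have cond: "eval W (regs \<tau>) (Reg 26 [mod] Const 2 [=] Reg 32 [mod] Const 2)
      = of_bool (even (regs \<tau> 26) = even (regs \<tau> 32))" if Inv: "?Inv t \<tau>" for t \<tau>
  proof -
    from Inv obtain m where m: "focus T U (split m (regs \<tau> 26) (regs \<tau> 32)) (regs \<tau> 27) (regs \<tau> 33) (regs \<tau> 28) (regs \<tau> 34)"
      "regs \<tau> 26 < 2 ^ m" "regs \<tau> 32 < 2 ^ m" "Suc (regs \<tau> 27) * 2 ^ m \<le> 2 ^ Suc F" "0 < regs \<tau> 28" by blast
    have "regs \<tau> 26 mod 2 = regs \<tau> 32 mod 2 \<longleftrightarrow> even (regs \<tau> 26) = even (regs \<tau> 32)"
      by (auto simp: even_iff_mod_2_eq_zero)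
    then show ?thesis using bounds(1,2)[OF m] numbers
      by (simp add: eval_rules del: eval.simps)
  qed
  show ?thesis
    unfolding split_prog_def
  proof (rule wp_WhileI[where Inv = ?Inv and \<mu> = "\<lambda>\<tau>. regs \<tau> 26 + regs \<tau> 32"])
    show "?Inv 0 \<sigma>" using m v fo mul regs by (auto simp: agree_refl)
  next
    fix t \<tau>
    assume Inv: "?Inv t \<tau>" and nz: "eval W (regs \<tau>) (Reg 26 [mod] Const 2 [=] Reg 32 [mod] Const 2) \<noteq> 0"
    define q r v lo mul rest where "q = regs \<tau> 26" and "r = regs \<tau> 32" and "v = regs \<tau> 27"
      and "lo = regs \<tau> 33" and "mul = regs \<tau> 28" and "rest = regs \<tau> 34"
    note defs = q_def[symmetric] r_def[symmetric] v_def[symmetric] lo_def[symmetric] mul_def[symmetric] rest_def[symmetric]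
    from Inv obtain m where m: "focus T U (split m q r) v lo mul rest" "q < 2 ^ m" "r < 2 ^ m" "q \<noteq> r"
      "1 \<le> v" "Suc v * 2 ^ m \<le> 2 ^ Suc F" "0 < mul" unfolding defs by blast
    note b = bounds[OF m(1,2,3,6,7)]
    have par: "even q = even r" using cond[OF Inv] nz by (simp add: defs split: if_splits)
    obtain j where j: "m = Suc j" using m(2-4) by (cases m) auto
    have half: "q div 2 < 2 ^ j" "r div 2 < 2 ^ j" "q div 2 \<noteq> r div 2"
      using m(2,3) j parity_halves[OF m(4) par] by auto
    have dec: "q div 2 + r div 2 < q + r" using m(4) by (cases "q = 0"; cases "r = 0") auto
    have vj: "Suc (v * 2 + q mod 2) * 2 ^ j \<le> 2 ^ Suc F"
    proof -
      have "q mod 2 \<le> 1" by simp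
      then have "Suc (v * 2 + q mod 2) \<le> Suc v * 2" by simp
      then have "Suc (v * 2 + q mod 2) * 2 ^ j \<le> Suc v * 2 * 2 ^ j" by (rule mult_le_mono1)
      also have "\<dots> = Suc v * 2 ^ m" by (simp add: j)
      finally show ?thesis using m(6) by linarith
    qed
    let ?P = "\<lambda>(u :: nat) \<upsilon>. u = 0 \<and>
      focus T U (split j (q div 2) (r div 2)) (v * 2 + q mod 2) (regs \<upsilon> 33) (regs \<upsilon> 28) (regs \<upsilon> 34) \<and>
      0 < regs \<upsilon> 28 \<and> agree {28, 33, 34} \<tau> \<upsilon> \<and> mem \<upsilon> = mem \<tau>"
    have branch: "wp (If (Reg 26 [mod] Const 2)
        (Assign 33 (Reg 33 [+] Reg 28 [*] Const 4) ;; Assign 28 (Reg 28 [*] Const 16))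
        (Assign 34 (Reg 34 [*] Const 4 [+] Const 1) ;; Assign 28 (Reg 28 [*] Const 4))) \<tau> ?P"
    proof (rule wp_If)
      assume "eval W (regs \<tau>) (Reg 26 [mod] Const 2) \<noteq> 0"
      then have odd: "odd q" using b(1) numbers
        by (simp add: eval_rules defs odd_iff_mod_2_eq_one del: eval.simps)
      \<comment> \<open>\<open>Empty\<close> is one digit of value 1 after the digit 0 of
        \<open>Node\<close>: \<open>lo\<close> grows by \<open>4 * mul\<close> and
        \<open>mul\<close> by the factor 16.\<close>
      have "focus T U (Node Empty (split j (q div 2) (r div 2))) v lo mul rest"
        using m(1) odd par by (simp add: j)
      from focus_right[OF this _ m(5)]
      have "focus T U (split j (q div 2) (r div 2)) (v * 2 + q mod 2) (lo + mul * 4) (mul * 16) rest"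
        using odd by (simp add: odd_iff_mod_2_eq_one mult.commute)
      moreover have "eval W (regs \<tau>) (Reg 33 [+] Reg 28 [*] Const 4) = lo + mul * 4"
        using b numbers by (simp add: eval_rules defs del: eval.simps)
      moreover have "eval W ((regs \<tau>)(33 := y)) (Reg 28 [*] Const 16) = mul * 16" for y
        using b numbers by (simp add: eval_rules defs del: eval.simps)
      ultimately show "wp (Assign 33 (Reg 33 [+] Reg 28 [*] Const 4) ;; Assign 28 (Reg 28 [*] Const 16)) \<tau> ?P"
        using m(7) by (intro wp_Seq wp_Assign) (simp add: agree_def defs del: eval.simps)
    next
      assume "eval W (regs \<tau>) (Reg 26 [mod] Const 2) = 0"
      then have even: "even q" using b(1) numbers
        by (simp add: eval_rules defs even_iff_mod_2_eq_zero del: eval.simps)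
      \<comment> \<open>Here \<open>Empty\<close> follows the focus, so \<open>rest\<close> becomes
        \<open>enc Empty rest\<close>, which is \<open>4 * rest + 1\<close>.\<close>
      have "focus T U (Node (split j (q div 2) (r div 2)) Empty) v lo mul rest"
        using m(1) even par by (simp add: j)
      from focus_left[OF this _ m(5)]
      have "focus T U (split j (q div 2) (r div 2)) (v * 2 + q mod 2) lo (mul * 4) (rest * 4 + 1)"
        using even by (simp add: even_iff_mod_2_eq_zero mult.commute)
      moreover have "eval W (regs \<tau>) (Reg 34 [*] Const 4 [+] Const 1) = rest * 4 + 1"
        using b numbers by (simp add: eval_rules defs del: eval.simps One_nat_def)
      moreover have "eval W ((regs \<tau>)(34 := y)) (Reg 28 [*] Const 4) = mul * 4" for y
        using b numbers by (simp add: eval_rules defs del: eval.simps)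
      ultimately show "wp (Assign 34 (Reg 34 [*] Const 4 [+] Const 1) ;; Assign 28 (Reg 28 [*] Const 4)) \<tau> ?P"
        using m(7) by (intro wp_Seq wp_Assign) (simp add: agree_def defs del: eval.simps One_nat_def)
    qed
    show "wp (If (Reg 26 [mod] Const 2)
        (Assign 33 (Reg 33 [+] Reg 28 [*] Const 4) ;; Assign 28 (Reg 28 [*] Const 16))
        (Assign 34 (Reg 34 [*] Const 4 [+] Const 1) ;; Assign 28 (Reg 28 [*] Const 4)) ;;
       Assign 27 (Reg 27 [*] Const 2 [+] Reg 26 [mod] Const 2) ;;
       Assign 26 (Reg 26 [div] Const 2) ;; Assign 32 (Reg 32 [div] Const 2)) \<tau>
      (\<lambda>u \<upsilon>. ?Inv (t + u) \<upsilon> \<and> regs \<upsilon> 26 + regs \<upsilon> 32 < regs \<tau> 26 + regs \<tau> 32)"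
      apply (intro wp_Seq)
      apply (rule wp_mono[OF branch])
      apply (elim conjE)
      apply (intro wp_Seq wp_Assign)
      subgoal premises pr for u \<upsilon>
      proof -
        have r: "regs \<upsilon> 26 = q" "regs \<upsilon> 32 = r" "regs \<upsilon> 27 = v" using pr by (simp_all add: agree_def defs)
        have e1: "eval W (regs \<upsilon>) (Reg 27 [*] Const 2 [+] Reg 26 [mod] Const 2) = v * 2 + q mod 2"
          using r b numbers by (simp add: eval_rules del: eval.simps)
        have e2: "eval W ((regs \<upsilon>)(27 := y)) (Reg 26 [div] Const 2) = q div 2" for y
          using r b numbers by (simp add: eval_rules del: eval.simps)
        have e3: "eval W ((regs \<upsilon>)(27 := y, 26 := z)) (Reg 32 [div] Const 2) = r div 2" for y z
          using r b numbers by (simp add: eval_rules del: eval.simps)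
        have ag: "agree {26, 27, 28, 32, 33, 34} \<sigma> \<upsilon>"
          by (rule agree_trans[of _ \<sigma> \<tau> _ \<upsilon>]) (use Inv pr in auto)
        show ?thesis
          apply (simp add: e1 e2 e3 defs del: eval.simps One_nat_def)
          using pr Inv half vj dec ag m(5) by (auto simp: agree_def simp del: One_nat_def)
      qed
      done
  next
    fix t \<tau>
    assume Inv: "?Inv t \<tau>" and z: "eval W (regs \<tau>) (Reg 26 [mod] Const 2 [=] Reg 32 [mod] Const 2) = 0"
    have par: "even (regs \<tau> 26) \<noteq> even (regs \<tau> 32)" using cond[OF Inv] z by (simp split: if_splits)
    from Inv obtain m where m: "focus T U (split m (regs \<tau> 26) (regs \<tau> 32)) (regs \<tau> 27) (regs \<tau> 33) (regs \<tau> 28) (regs \<tau> 34)"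
      "regs \<tau> 26 < 2 ^ m" "regs \<tau> 32 < 2 ^ m" "regs \<tau> 26 \<noteq> regs \<tau> 32"
      "1 \<le> regs \<tau> 27" "Suc (regs \<tau> 27) * 2 ^ m \<le> 2 ^ Suc F" "0 < regs \<tau> 28" by blast
    obtain j where "m = Suc j" using m(2-4) by (cases m) auto
    then show "t = 0 \<and> (\<exists>j.
      focus T U (split (Suc j) (regs \<tau> 26) (regs \<tau> 32)) (regs \<tau> 27) (regs \<tau> 33) (regs \<tau> 28) (regs \<tau> 34) \<and>
      regs \<tau> 26 < 2 ^ Suc j \<and> regs \<tau> 32 < 2 ^ Suc j \<and> even (regs \<tau> 26) \<noteq> even (regs \<tau> 32) \<and>
      1 \<le> regs \<tau> 27 \<and> Suc (regs \<tau> 27) * 2 ^ Suc j \<le> 2 ^ Suc F \<and> 0 < regs \<tau> 28) \<and>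
      agree {26, 27, 28, 32, 33, 34} \<sigma> \<tau> \<and> mem \<tau> = mem \<sigma>"
      using m par Inv by blast
  qed
qed


lemma wp_store_entry:
  assumes regs: "regs \<sigma> 2 = w" "regs \<sigma> 10 = entry g u" "regs \<sigma> 11 = F" "regs \<sigma> 12 = x"
    and b: "g < G" "u < 2 ^ (F + 2)" "x < 2 ^ F" and mem: "\<And>b a. mem \<sigma> b a < 2 ^ w"
  shows "wp (store_bits Work) \<sigma> (\<lambda>t \<tau>. t \<le> 2 * (F div w + 2) \<and> agree {13, 14} \<sigma> \<tau> \<and>
    (\<exists>A. mem \<tau> = (mem \<sigma>)(Work := A) \<and> (\<forall>a. A a < 2 ^ w) \<and>
      (\<forall>i<n * s. mbit w A i = mbit w (mem \<sigma> Work) i) \<and>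
      (\<forall>g'<G. \<forall>u'. entries A g' u' = (if g' = g \<and> u' = u then x else entries (mem \<sigma> Work) g' u'))))"
proof -
  have ns: "n * s \<le> B" by (rule mult_le_B(1)) simp
  have W: "entry g u + F + 2 * w < 2 ^ W" "x < 2 ^ W"
    using ns entry_bound[OF b(1,2)] basic_le_B b(3) unfolding entry_def by (intro less_W; linarith)+
  have "wp (store_bits Work) \<sigma> (\<lambda>t \<tau>. (\<exists>j. t = 2 * j \<and> spans (entry g u) F j) \<and> agree {13, 14} \<sigma> \<tau> \<and>
    (\<exists>A. mem \<tau> = (mem \<sigma>)(Work := A) \<and> put w (mem \<sigma> Work) (entry g u) F (bit x) A))"
    by (rule wp_store_bits) (use regs W w widths mem in simp_all)
  then show ?thesis
  proof (rule wp_mono)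
    fix t \<tau>
    assume *: "(\<exists>j. t = 2 * j \<and> spans (entry g u) F j) \<and> agree {13, 14} \<sigma> \<tau> \<and>
      (\<exists>A. mem \<tau> = (mem \<sigma>)(Work := A) \<and> put w (mem \<sigma> Work) (entry g u) F (bit x) A)"
    then obtain A where A: "mem \<tau> = (mem \<sigma>)(Work := A)" "put w (mem \<sigma> Work) (entry g u) F (bit x) A"
      by blast
    from * obtain j where j: "t = 2 * j" "spans (entry g u) F j" by blast
    have "t \<le> 2 * (F div w + 2)" using spans_le[OF j(2)] j(1) by simp
    moreover have "agree {13, 14} \<sigma> \<tau>" using * by blast
    moreover have "mbit w A i = mbit w (mem \<sigma> Work) i" if "i < n * s" for i
      using A(2) that by (simp add: put_def entry_def)
    moreover have "entries A g' u' = (if g' = g \<and> u' = u then x else entries (mem \<sigma> Work) g' u')"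
      if "g' < G" for g' u'
      by (rule entries_put[OF A(2) b(3,1) that])
    moreover have "A a < 2 ^ w" for a using A(2) by (simp add: put_def)
    ultimately show "t \<le> 2 * (F div w + 2) \<and> agree {13, 14} \<sigma> \<tau> \<and>
    (\<exists>A. mem \<tau> = (mem \<sigma>)(Work := A) \<and> (\<forall>a. A a < 2 ^ w) \<and>
      (\<forall>i<n * s. mbit w A i = mbit w (mem \<sigma> Work) i) \<and>
      (\<forall>g'<G. \<forall>u'. entries A g' u' = (if g' = g \<and> u' = u then x else entries (mem \<sigma> Work) g' u')))"
      using A(1) by blast
  qed
qed

text \<open>Only a collision yields no true code: then register 31 holds \<open>4 ^ F\<close>, in
  accordance with the trie being too large. An oversized trie without collision has its true code,
  which is at least \<open>4 ^ F\<close> as well.\<close>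

definition extended :: "config \<Rightarrow> nat \<Rightarrow> trie \<Rightarrow> config \<Rightarrow> bool" where
  "extended \<sigma> g U \<tau> \<longleftrightarrow> agree {10, 11, 12, 13, 14, 26, 27, 28, 31, 32, 33, 34} \<sigma> \<tau> \<and>
    (\<exists>A. mem \<tau> = (mem \<sigma>)(Work := A) \<and> (\<forall>a. A a < 2 ^ w) \<and>
      (\<forall>i<n * s. mbit w A i = mbit w (mem \<sigma> Work) i) \<and>
      (\<forall>g'<G. g' \<noteq> g \<longrightarrow> entries A g' = entries (mem \<sigma> Work) g') \<and>
      (regs \<tau> 31 = enc U 0 \<and> tab (entries A g) 1 U \<or> regs \<tau> 31 = 4 ^ F \<and> F < digits U))"

lemma reach_bounds:
  assumes "fits F t" "p < 2 ^ F" "reach t F p y m q v lo mul rest rk"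
  shows "v < 2 ^ (F + 2)" "2 * v + 1 < 2 ^ (F + 2)" "q < 2 ^ F" "(2::nat) ^ m \<le> 2 ^ F"
proof -
  note inv = reach_invariants(1)[OF assms]
  have "Suc v * 1 \<le> Suc v * 2 ^ m" by (intro mult_le_mono2) simp
  also have "\<dots> \<le> 2 ^ Suc F" using inv by blast
  finally have "Suc v \<le> 2 ^ Suc F" by simp
  then show "v < 2 ^ (F + 2)" "2 * v + 1 < 2 ^ (F + 2)" by simp_all
  have "2 * 2 ^ m \<le> Suc v * 2 ^ m" using inv by (intro mult_le_mono1) simp
  also have "\<dots> \<le> 2 ^ Suc F" using inv by blast
  finally show "(2::nat) ^ m \<le> 2 ^ F" by simp
  then show "q < 2 ^ F" using inv by linarith
qed

lemma wp_empty:
  assumes ready: "ready \<sigma>" and regs: "regs \<sigma> 21 = g" "regs \<sigma> 23 = enc t 0"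
    and re: "reach t F p Empty m (regs \<sigma> 26) (regs \<sigma> 27) lo (regs \<sigma> 28) rest rk"
    and t: "g < G" "p < 2 ^ F" "fits F t" "digits t \<le> F" "tab (entries (mem \<sigma> Work) g) 1 t"
    and mem: "\<And>b a. mem \<sigma> b a < 2 ^ w"
  shows "wp empty_prog \<sigma> (\<lambda>u \<tau>. u \<le> 5 * (R div w + 2) \<and> extended \<sigma> g (ins t F p) \<tau>)"
proof -
  define q v mul where "q = regs \<sigma> 26" and "v = regs \<sigma> 27" and "mul = regs \<sigma> 28"
  note re' = re[folded q_def v_def mul_def]
  note inv = reach_invariants[OF t(3,2) re']
  note rb = reach_bounds[OF t(3,2) re']
  have fo: "focus (entries (mem \<sigma> Work) g) (ins t F p) (Leaf q) v lo mul rest"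
    using focus_reach[OF t(3,2,5) re'] by simp
  then have U: "enc (ins t F p) 0 = enc t 0 + mul"
    using inv(4) by (simp add: focus_def)
  have UB: "enc (ins t F p) 0 \<le> B" using code_bound(1)[OF t(4), of p] by simp
  have r: "regs \<sigma> 0 = n" "regs \<sigma> 2 = w" "regs \<sigma> 18 = s" "regs \<sigma> 6 = G" "regs \<sigma> 4 = F"
    using ready by (simp_all add: ready_def)
  have F4: "(2::nat) ^ (F + 2) = 4 * 2 ^ F" by (simp add: power_add)
  have bnd: "v < 2 ^ W" "q < 2 ^ W" "mul < 2 ^ W" "enc t 0 < 2 ^ W" "enc t 0 + mul < 2 ^ W" "F < 2 ^ W"
    using rb(1,3) F4 UB U basic_le_B by (intro less_W; linarith)+
  have e1: "eval W (regs \<sigma>) (entry_exp (Reg 27)) = entry g v"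
    by (rule eval_entry) (use r regs t rb bnd in \<open>simp_all add: eval_rules v_def[symmetric] del: eval.simps\<close>)
  let ?\<sigma> = "\<sigma>\<lparr>regs := (regs \<sigma>)(10 := entry g v, 11 := F, 12 := q)\<rparr>"
  note store = wp_store_entry[of ?\<sigma> g v q]
  show ?thesis
    unfolding empty_prog_def
    apply (intro wp_Seq wp_Assign)
    apply (simp add: e1 del: eval.simps)
    apply (simp add: eval_RegI r bnd q_def[symmetric] del: eval.simps)
    apply (rule wp_mono[OF store])
    subgoal using r by simp
    subgoal by simp
    subgoal by simp
    subgoal by simp
    subgoal by (rule t)
    subgoal by (rule rb)
    subgoal by (rule rb)
    subgoal using mem by simp
    apply (elim conjE exE)
    apply (rule wp_Assign)
    subgoal premises pr for u \<tau> A
    proof -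
      have r': "regs \<tau> 23 = enc t 0" "regs \<tau> 28 = mul" using pr regs by (simp_all add: agree_def mul_def)
      have e2: "eval W (regs \<tau>) (Reg 23 [+] Reg 28) = enc (ins t F p) 0"
        using r' bnd U by (simp add: eval_rules del: eval.simps)
      have "tab (entries A g) 1 (ins t F p)"
      proof -
        have "entries A g v = q" using pr t(1) by simp
        moreover have "\<forall>u. \<not> below v u \<longrightarrow> entries A g u = entries (mem \<sigma> Work) g u"
          using pr t(1) below_refl by auto
        ultimately show ?thesis using fo by (simp add: focus_def)
      qed
      moreover have "\<forall>g'<G. g' \<noteq> g \<longrightarrow> entries A g' = entries (mem \<sigma> Work) g'"
        using pr by (auto simp: fun_eq_iff)
      moreover have "F div w \<le> R div w" by (rule div_le_mono) (simp add: F R)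
      ultimately show ?thesis
        using pr unfolding e2 extended_def by (auto simp: agree_def)
    qed
    done
qed

text \<open>One field is read at one access per word and two are written at two accesses per word,
  which gives the factor \<open>1 + 2 * 2 = 5\<close>. The old hash value has to be fetched because
  the code does not contain it.\<close>

lemma wp_leaf:
  assumes ready: "ready \<sigma>" and regs: "regs \<sigma> 21 = g" "regs \<sigma> 23 = enc t 0" "regs \<sigma> 25 = enc (Leaf r) rest"
    and re: "reach t F p (Leaf r) m (regs \<sigma> 26) (regs \<sigma> 27) lo (regs \<sigma> 28) rest rk"
    and t: "g < G" "p < 2 ^ F" "fits F t" "digits t \<le> F" "tab (entries (mem \<sigma> Work) g) 1 t"
    and mem: "\<And>b a. mem \<sigma> b a < 2 ^ w"
  shows "wp leaf_prog \<sigma> (\<lambda>u \<tau>. u \<le> 5 * (R div w + 2) \<and> extended \<sigma> g (ins t F p) \<tau>)"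
proof -
  define q v mul where "q = regs \<sigma> 26" and "v = regs \<sigma> 27" and "mul = regs \<sigma> 28"
  note re' = re[folded q_def v_def mul_def]
  note inv = reach_invariants[OF t(3,2) re']
  note rb = reach_bounds[OF t(3,2) re']
  let ?T = "entries (mem \<sigma> Work) g" and ?U = "ins t F p"
  have fo: "focus ?T ?U (split m q r) v lo mul rest" and Tv: "?T v = r"
    using focus_reach[OF t(3,2,5) re'] by simp_all
  have rm: "r < 2 ^ m" "q < 2 ^ m" "1 \<le> v" "Suc v * 2 ^ m \<le> 2 ^ Suc F" using inv(1) by simp_all
  have rF: "r < 2 ^ F" using rm(1) rb(4) by linarith
  have UB: "8 * enc ?U 0 \<le> B" by (rule code_bound(1)[OF t(4)])
  have rr: "regs \<sigma> 0 = n" "regs \<sigma> 2 = w" "regs \<sigma> 18 = s" "regs \<sigma> 6 = G" "regs \<sigma> 4 = F" "regs \<sigma> 7 = 2 ^ F"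
    using ready by (simp_all add: ready_def)
  have F4: "(2::nat) ^ (F + 2) = 4 * 2 ^ F" by (simp add: power_add)
  have tB: "enc t 0 \<le> B" by (rule digits_bounds(4)[OF t(4)])
  have code: "enc t 0 = lo + mul * enc (Leaf r) rest" "lo < mul" using inv(4) by simp_all
  have "1 * enc (Leaf r) rest \<le> mul * enc (Leaf r) rest" using code(2) by (intro mult_le_mono1) simp
  then have leafB: "enc (Leaf r) rest \<le> B" using code(1) tB by linarith
  have "mul * 1 \<le> mul * enc (Leaf r) rest" by (intro mult_le_mono2) simp
  then have mulB: "mul \<le> B" using code(1) tB by linarith
  have ns: "n * s \<le> B" by (rule mult_le_B(1)) simp
  have F4B: "8 * 4 ^ F \<le> B" by (rule code_bound(2)[OF t(4)])
  have bnd: "v < 2 ^ W" "q < 2 ^ W" "r < 2 ^ W" "mul < 2 ^ W" "enc t 0 < 2 ^ W" "enc (Leaf r) rest < 2 ^ W"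
    "F < 2 ^ W" "entry g v + F + 2 * w < 2 ^ W" "2 ^ F < (2::nat) ^ W" "4 ^ F < (2::nat) ^ W"
    using rb(1,3) F4 tB leafB mulB rF ns F4B entry_bound[OF t(1) rb(1)] basic_le_B unfolding entry_def
    by (intro less_W; linarith)+
  have FR: "F div w \<le> R div w" by (rule div_le_mono) (simp add: F R)
  have e1: "eval W (regs \<sigma>) (entry_exp (Reg 27)) = entry g v"
    by (rule eval_entry) (use rr regs t rb bnd in \<open>simp_all add: eval_rules v_def[symmetric] del: eval.simps\<close>)
  let ?\<sigma> = "\<sigma>\<lparr>regs := (regs \<sigma>)(10 := entry g v, 11 := F)\<rparr>"
  have load: "wp (load_bits Work) ?\<sigma> (\<lambda>u \<tau>. spans (entry g v) F u \<and> regs \<tau> 12 = field w (mem ?\<sigma> Work) (entry g v) F \<and>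
    agree {12, 13, 14} ?\<sigma> \<tau> \<and> mem \<tau> = mem ?\<sigma>)"
    by (rule wp_load_bits) (use rr bnd w widths mem in simp_all)
  show ?thesis
    unfolding leaf_prog_def
    apply (intro wp_Seq wp_Assign)
    apply (simp add: e1 del: eval.simps)
    apply (simp add: eval_RegI rr bnd del: eval.simps)
    apply (rule wp_mono[OF load])
    apply (intro wp_Seq wp_Assign)
    subgoal premises pr for u \<tau>0
    proof -
      let ?\<tau> = "\<tau>0\<lparr>regs := (regs \<tau>0)(32 := r)\<rparr>"
      have r12: "regs \<tau>0 12 = r" using pr Tv by (simp add: entries_def)
      have e2: "eval W (regs \<tau>0) (Reg 12) = r" using r12 bnd by (simp add: eval_rules del: eval.simps)
      have u: "u \<le> R div w + 2" using pr spans_le[of "entry g v" F u] FR by simp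
      have \<tau>: "regs \<tau>0 26 = q" "regs \<tau>0 27 = v" "regs \<tau>0 28 = mul" "regs \<tau>0 23 = enc t 0"
        "regs \<tau>0 25 = enc (Leaf r) rest" "regs \<tau>0 7 = 2 ^ F" "regs \<tau>0 11 = F" "regs \<tau>0 21 = g"
        "regs \<tau>0 0 = n" "regs \<tau>0 2 = w" "regs \<tau>0 18 = s" "regs \<tau>0 6 = G" "regs \<tau>0 4 = F"
        "mem \<tau>0 = mem \<sigma>" "family \<tau>0 = family \<sigma>"
        "agree {10, 11, 12, 13, 14, 26, 27, 28, 31, 32, 33, 34} \<sigma> \<tau>0"
        using pr rr regs by (simp_all add: agree_def q_def v_def mul_def)
      have "wp (If (Reg 26 [=] Reg 32) (Assign 31 (Reg 7 [*] Reg 7))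
        (Assign 33 (Reg 23 [mod] Reg 28) ;; Assign 34 (Reg 25 [div] Const 4) ;;
         split_prog ;;
         Assign 31 (Reg 33 [+] Reg 28 [*] (Const 64 [*] Reg 34 [+] Const 40)) ;;
         Assign 10 (entry_exp (Reg 27 [*] Const 2 [+] Reg 26 [mod] Const 2)) ;;
         Assign 12 (Reg 26 [div] Const 2) ;; store_bits Work ;;
         Assign 10 (entry_exp (Reg 27 [*] Const 2 [+] Reg 32 [mod] Const 2)) ;;
         Assign 12 (Reg 32 [div] Const 2) ;; store_bits Work)) ?\<tau>
        (\<lambda>u' \<upsilon>. u' \<le> 4 * (R div w + 2) \<and> extended \<sigma> g ?U \<upsilon>)"
      proof (rule wp_If)
        assume "eval W (regs ?\<tau>) (Reg 26 [=] Reg 32) \<noteq> 0"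
        then have "q = r" using \<tau> bnd numbers by (simp add: eval_rules del: eval.simps split: if_splits)
        then have "has t p" using inv(2) by simp
        then have "F < digits ?U" using nodes_ins_dup[OF t(3), of p] by simp
        moreover have "eval W (regs ?\<tau>) (Reg 7 [*] Reg 7) = 4 ^ F"
          using \<tau> bnd by (simp add: eval_rules four_power del: eval.simps power_strict_increasing_iff)
        ultimately show "wp (Assign 31 (Reg 7 [*] Reg 7)) ?\<tau> (\<lambda>u' \<upsilon>. u' \<le> 4 * (R div w + 2) \<and> extended \<sigma> g ?U \<upsilon>)"
          using \<tau> mem by (intro wp_Assign) (auto simp: extended_def agree_def simp del: eval.simps intro!: exI[of _ "mem \<sigma> Work"])
      next
        assume "eval W (regs ?\<tau>) (Reg 26 [=] Reg 32) = 0"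
        then have qr: "q \<noteq> r" using \<tau> bnd numbers by (auto simp: eval_rules simp del: eval.simps)
        have e3: "eval W (regs ?\<tau>) (Reg 23 [mod] Reg 28) = lo"
        proof -
          have "enc t 0 mod mul = lo" unfolding code(1) using code(2) by (simp del: enc.simps)
          then show ?thesis using \<tau>(3,4) bnd(4,5) by (simp add: eval_rules del: eval.simps)
        qed
        have e4: "eval W ((regs ?\<tau>)(33 := lo)) (Reg 25 [div] Const 4) = rest"
          using \<tau> bnd numbers enc_digit(5)[of r rest] by (simp add: eval_rules del: eval.simps enc.simps)
        let ?\<tau>1 = "\<tau>0\<lparr>regs := (regs \<tau>0)(32 := r, 33 := lo, 34 := rest)\<rparr>"
        have split: "wp split_prog ?\<tau>1 (\<lambda>t \<tau>. t = 0 \<and> (\<exists>j.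
          focus ?T ?U (split (Suc j) (regs \<tau> 26) (regs \<tau> 32)) (regs \<tau> 27) (regs \<tau> 33) (regs \<tau> 28) (regs \<tau> 34) \<and>
          regs \<tau> 26 < 2 ^ Suc j \<and> regs \<tau> 32 < 2 ^ Suc j \<and> even (regs \<tau> 26) \<noteq> even (regs \<tau> 32) \<and>
          1 \<le> regs \<tau> 27 \<and> Suc (regs \<tau> 27) * 2 ^ Suc j \<le> 2 ^ Suc F \<and> 0 < regs \<tau> 28) \<and>
          agree {26, 27, 28, 32, 33, 34} ?\<tau>1 \<tau> \<and> mem \<tau> = mem ?\<tau>1)"
          by (rule wp_split[OF UB rm(2,1) qr rm(3,4) fo]) (use \<tau> code(2) in simp_all)
        show "wp (Assign 33 (Reg 23 [mod] Reg 28) ;; Assign 34 (Reg 25 [div] Const 4) ;;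
         split_prog ;;
         Assign 31 (Reg 33 [+] Reg 28 [*] (Const 64 [*] Reg 34 [+] Const 40)) ;;
         Assign 10 (entry_exp (Reg 27 [*] Const 2 [+] Reg 26 [mod] Const 2)) ;;
         Assign 12 (Reg 26 [div] Const 2) ;; store_bits Work ;;
         Assign 10 (entry_exp (Reg 27 [*] Const 2 [+] Reg 32 [mod] Const 2)) ;;
         Assign 12 (Reg 32 [div] Const 2) ;; store_bits Work) ?\<tau>
          (\<lambda>u' \<upsilon>. u' \<le> 4 * (R div w + 2) \<and> extended \<sigma> g ?U \<upsilon>)"
          apply (intro wp_Seq wp_Assign)
          apply (rule wp_mono[where P = "\<lambda>t \<tau>. t = 0 \<and> (\<exists>j.
          focus ?T ?U (split (Suc j) (regs \<tau> 26) (regs \<tau> 32)) (regs \<tau> 27) (regs \<tau> 33) (regs \<tau> 28) (regs \<tau> 34) \<and>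
          regs \<tau> 26 < 2 ^ Suc j \<and> regs \<tau> 32 < 2 ^ Suc j \<and> even (regs \<tau> 26) \<noteq> even (regs \<tau> 32) \<and>
          1 \<le> regs \<tau> 27 \<and> Suc (regs \<tau> 27) * 2 ^ Suc j \<le> 2 ^ Suc F \<and> 0 < regs \<tau> 28) \<and>
          agree {26, 27, 28, 32, 33, 34} ?\<tau>1 \<tau> \<and> mem \<tau> = mem ?\<tau>1"])
          subgoal using split e3 e4 by (simp del: eval.simps One_nat_def split.simps)
          apply (intro wp_Seq wp_Assign)
          subgoal premises pr1 for u1 \<tau>2
          proof -
            define q' r' v' lo' mul' rest' where "q' = regs \<tau>2 26" and "r' = regs \<tau>2 32" and "v' = regs \<tau>2 27"
              and "lo' = regs \<tau>2 33" and "mul' = regs \<tau>2 28" and "rest' = regs \<tau>2 34"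
            note defs = q'_def[symmetric] r'_def[symmetric] v'_def[symmetric] lo'_def[symmetric]
              mul'_def[symmetric] rest'_def[symmetric]
            from pr1 obtain j where j: "focus ?T ?U (split (Suc j) q' r') v' lo' mul' rest'"
              "q' < 2 ^ Suc j" "r' < 2 ^ Suc j" "even q' \<noteq> even r'" "1 \<le> v'"
              "Suc v' * 2 ^ Suc j \<le> 2 ^ Suc F" "0 < mul'" unfolding defs by blast
            define X where "X = 64 * rest' + 40"
            have U: "enc ?U 0 = lo' + mul' * X"
              using j(1,4) by (auto simp: focus_def X_def)
            have "1 * X \<le> mul' * X" using j(7) by (intro mult_le_mono1) simp
            then have B': "X \<le> B" "mul' * X \<le> B" "lo' \<le> B" using U UB by linarith+
            have "mul' * 1 \<le> mul' * X" by (intro mult_le_mono2) (simp add: X_def)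
            then have mB': "mul' \<le> B" using B' by linarith
            have XB: "64 * rest' + 40 \<le> B" using B'(1) by (simp add: X_def)
            have "Suc v' * 1 \<le> Suc v' * 2 ^ Suc j" by (intro mult_le_mono2) simp
            also have "\<dots> \<le> 2 ^ Suc F" by (rule j)
            finally have vF: "Suc v' \<le> 2 * 2 ^ F" by simp
            have "2 * 2 ^ Suc j \<le> Suc v' * 2 ^ Suc j" using j(5) by (intro mult_le_mono1) simp
            also have "\<dots> \<le> 2 ^ Suc F" by (rule j)
            finally have jF: "(2::nat) ^ Suc j \<le> 2 ^ F" by simp
            have qF: "q' < 2 ^ F" "r' < 2 ^ F" using j(2,3) jF by linarith+
            have half: "q' div 2 < 2 ^ F" "r' div 2 < 2 ^ F" using qF by (meson div_le_dividend le_less_trans)+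
            have W': "rest' < 2 ^ W" "64 * rest' < 2 ^ W" "64 * rest' + 40 < 2 ^ W" "mul' < 2 ^ W" "lo' < 2 ^ W"
              "mul' * X < 2 ^ W" "lo' + mul' * X < 2 ^ W"
              "v' < 2 ^ W" "v' * 2 < 2 ^ W" "v' * 2 + 1 < 2 ^ W" "q' < 2 ^ W" "r' < 2 ^ W"
              using B' XB mB' vF qF basic_le_B by (intro less_W; linarith)+
            have \<tau>2: "regs \<tau>2 11 = F" "regs \<tau>2 21 = g" "regs \<tau>2 0 = n" "regs \<tau>2 2 = w" "regs \<tau>2 18 = s"
              "regs \<tau>2 6 = G" "regs \<tau>2 4 = F" "mem \<tau>2 = mem \<sigma>" "family \<tau>2 = family \<sigma>"
              using pr1 \<tau> by (simp_all add: agree_def)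
            have ag2: "agree {10, 11, 12, 13, 14, 26, 27, 28, 31, 32, 33, 34} \<sigma> \<tau>2"
              using pr1 \<tau>(16) by (simp add: agree_def)
            have e5: "eval W (regs \<tau>2) (Reg 33 [+] Reg 28 [*] (Const 64 [*] Reg 34 [+] Const 40)) = enc ?U 0"
              using W'[unfolded X_def] numbers by (simp add: eval_rules defs U X_def del: eval.simps)
            have two: "v' * 2 + x mod 2 < 2 ^ W" "v' * 2 + x mod 2 < 2 ^ (F + 2)" for x
            proof -
              have "x mod 2 \<le> 1" by simp
              then have le: "v' * 2 + x mod 2 \<le> v' * 2 + 1" by simp
              show "v' * 2 + x mod 2 < 2 ^ W" using le W'(10) by linarith
              show "v' * 2 + x mod 2 < 2 ^ (F + 2)" using le vF F4 by linarith
            qed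
            have e6: "eval W Q (entry_exp (Reg 27 [*] Const 2 [+] Reg c [mod] Const 2)) = entry g (v' * 2 + x mod 2)"
              if "Q 0 = n" "Q 18 = s" "Q 6 = G" "Q 21 = g" "Q 4 = F" "Q 27 = v'" "Q c = x" "x < 2 ^ W" for Q c x
              by (rule eval_entry[OF that(1-5)])
                (use that W' two[of x] numbers t(1) in \<open>simp_all add: eval_rules del: eval.simps\<close>)
            have e7: "eval W Q (Reg c [div] Const 2) = x div 2" if "Q c = x" "x < 2 ^ W" for Q c x
              using that numbers by (simp add: eval_rules del: eval.simps)
            let ?Q = "(regs \<tau>2)(31 := enc ?U 0, 10 := entry g (v' * 2 + q' mod 2), 12 := q' div 2)"
            note store1 = wp_store_entry[of "\<tau>2\<lparr>regs := ?Q\<rparr>" g "v' * 2 + q' mod 2" "q' div 2"]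
            show ?thesis
              apply (simp add: e5 del: eval.simps)
              apply (simp add: e6[of _ 26 q'] e7[of _ 26 q'] \<tau>2 defs W' del: eval.simps)
              apply (rule wp_mono[OF store1])
              subgoal using \<tau>2 by simp
              subgoal by simp
              subgoal using \<tau>2 by simp
              subgoal by simp
              subgoal by (rule t)
              subgoal by (rule two)
              subgoal by (rule half)
              subgoal using mem \<tau>2 by simp
              apply (elim conjE exE)
              apply (intro wp_Seq wp_Assign)
              subgoal premises pr2 for u2 \<tau>3 A1
              proof -
                have \<tau>3: "regs \<tau>3 11 = F" "regs \<tau>3 21 = g" "regs \<tau>3 0 = n" "regs \<tau>3 2 = w" "regs \<tau>3 18 = s"
                  "regs \<tau>3 6 = G" "regs \<tau>3 4 = F" "family \<tau>3 = family \<sigma>" "regs \<tau>3 27 = v'" "regs \<tau>3 32 = r'"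
                  "regs \<tau>3 31 = enc ?U 0"
                  using pr2 \<tau>2 by (simp_all add: agree_def defs)
                have ag3: "agree {10, 11, 12, 13, 14, 26, 27, 28, 31, 32, 33, 34} \<sigma> \<tau>3"
                  using pr2 ag2 by (simp add: agree_def)
                let ?Q = "(regs \<tau>3)(10 := entry g (v' * 2 + r' mod 2), 12 := r' div 2)"
                note store2 = wp_store_entry[of "\<tau>3\<lparr>regs := ?Q\<rparr>" g "v' * 2 + r' mod 2" "r' div 2"]
                show ?thesis
                  apply (simp add: e6[of _ 32 r'] e7[of _ 32 r'] \<tau>3 W' del: eval.simps)
                  apply (rule wp_mono[OF store2])
                  subgoal using \<tau>3 by simp
                  subgoal by simp
                  subgoal using \<tau>3 by simp
                  subgoal by simp
                  subgoal by (rule t)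
                  subgoal by (rule two)
                  subgoal by (rule half)
                  subgoal for b using mem \<tau>2 pr2 by (cases b) simp_all
                  apply (elim conjE exE)
                  subgoal premises pr3 for u3 \<tau>4 A2
                  proof -
                    have upd: "entries A2 g' u' = (if g' = g \<and> u' = v' * 2 + r' mod 2 then r' div 2
                        else if g' = g \<and> u' = v' * 2 + q' mod 2 then q' div 2 else entries (mem \<sigma> Work) g' u')"
                      if "g' < G" for g' u'
                      using pr2 pr3 that \<tau>2 by simp
                    have "tab (entries A2 g) 1 ?U"
                    proof -
                      have "tab (entries A2 g) v' (split (Suc j) q' r')"
                        using upd[OF t(1)] j(4) by (auto simp: odd_iff_mod_2_eq_one even_iff_mod_2_eq_zero mult.commute)
                      moreover have "\<forall>u. \<not> below v' u \<longrightarrow> entries A2 g u = ?T u"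
                      proof (intro allI impI)
                        fix u assume "\<not> below v' u"
                        moreover have "below v' (v' * 2 + x mod 2)" for x
                          unfolding below_def by (rule exI[of _ 1]) simp
                        ultimately show "entries A2 g u = ?T u" using upd[OF t(1)] by metis
                      qed
                      ultimately show ?thesis using j(1) by (simp add: focus_def del: split.simps)
                    qed
                    moreover have "\<forall>g'<G. g' \<noteq> g \<longrightarrow> entries A2 g' = entries (mem \<sigma> Work) g'"
                      using upd by (auto simp: fun_eq_iff)
                    moreover have "mem \<tau>4 = (mem \<sigma>)(Work := A2)" using pr2 pr3 \<tau>2 by simp
                    moreover have "\<forall>i<n * s. mbit w A2 i = mbit w (mem \<sigma> Work) i" using pr2 pr3 \<tau>2 by simp
                    moreover have "regs \<tau>4 31 = enc ?U 0" using pr3 \<tau>3 by (simp add: agree_def)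
                    moreover have "agree {10, 11, 12, 13, 14, 26, 27, 28, 31, 32, 33, 34} \<sigma> \<tau>4"
                      using pr3 ag3 by (simp add: agree_def)
                    ultimately have "extended \<sigma> g ?U \<tau>4" unfolding extended_def using pr3 by blast
                    then show ?thesis using pr1 pr2 pr3 FR by simp
                  qed
                  done
              qed
              done
          qed
          done
      qed
      from this show ?thesis
        apply (simp only: e2)
        apply (rule wp_mono)
         apply assumption
        using u by simp
    qed
    done
qed


section \<open>Inserting one element\<close>

definition sane :: "(nat \<Rightarrow> nat) \<Rightarrow> config \<Rightarrow> bool" where
  "sane A0 \<sigma> \<longleftrightarrow> ready \<sigma> \<and> (\<forall>b a. mem \<sigma> b a < 2 ^ w) \<and> (\<forall>i<n * s. mbit w (mem \<sigma> Work) i = mbit w A0 i)"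

text \<open>\<open>sane\<close> is what survives a failed attempt, in particular the input labels;
  \<open>inserting\<close> holds only as long as every record fits.\<close>

definition inserting :: "(nat \<Rightarrow> nat) \<Rightarrow> config \<Rightarrow> (nat \<Rightarrow> trie) \<Rightarrow> bool" where
  "inserting A0 \<sigma> T \<longleftrightarrow> sane A0 \<sigma> \<and> coded (mem \<sigma> Struct) T (\<lambda>_. 0) \<and> tables (mem \<sigma> Work) T"

lemma record_bits: "R = l + F + F"
  by (simp add: R F)

lemma record_less:
  fixes x y :: nat
  assumes "x < 4 ^ F" "y < 2 ^ l"
  shows "y + 2 ^ l * x < 2 ^ R"
proof -
  have "y + 2 ^ l * x < 2 ^ l * Suc x" using assms(2) by simp
  also have "\<dots> \<le> 2 ^ l * 4 ^ F" using assms(1) by (intro mult_le_mono2) simp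
  also have "\<dots> = 2 ^ R" by (simp add: record_bits power_add four_power)
  finally show ?thesis .
qed

lemma wp_store_record:
  assumes regs: "regs \<sigma> 2 = w" "regs \<sigma> 10 = g * R" "regs \<sigma> 11 = R" "regs \<sigma> 12 = x"
    and b: "g < G" "x < 2 ^ R" and mem: "\<And>b a. mem \<sigma> b a < 2 ^ w"
  shows "wp (store_bits Struct) \<sigma> (\<lambda>t \<tau>. t \<le> 2 * (R div w + 2) \<and> agree {13, 14} \<sigma> \<tau> \<and>
    (\<exists>A. mem \<tau> = (mem \<sigma>)(Struct := A) \<and> (\<forall>a. A a < 2 ^ w) \<and>
      (\<forall>g'. field w A (g' * R) R = (if g' = g then x else field w (mem \<sigma> Struct) (g' * R) R))))"
proof -
  have gR: "g * R \<le> B" using b(1) by (intro mult_le_B) simp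
  have "(2::nat) ^ R \<le> 2 ^ W" using widths(1) by (intro power_increasing) auto
  then have xW: "x < 2 ^ W" using b(2) by linarith
  have W: "g * R + R + 2 * w < 2 ^ W"
    using gR basic_le_B by (intro less_W) linarith
  have "wp (store_bits Struct) \<sigma> (\<lambda>t \<tau>. (\<exists>j. t = 2 * j \<and> spans (g * R) R j) \<and> agree {13, 14} \<sigma> \<tau> \<and>
    (\<exists>A. mem \<tau> = (mem \<sigma>)(Struct := A) \<and> put w (mem \<sigma> Struct) (g * R) R (bit x) A))"
    by (rule wp_store_bits) (use regs W xW w widths mem in simp_all)
  then show ?thesis
  proof (rule wp_mono)
    fix t \<tau>
    assume *: "(\<exists>j. t = 2 * j \<and> spans (g * R) R j) \<and> agree {13, 14} \<sigma> \<tau> \<and>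
      (\<exists>A. mem \<tau> = (mem \<sigma>)(Struct := A) \<and> put w (mem \<sigma> Struct) (g * R) R (bit x) A)"
    then obtain A where A: "mem \<tau> = (mem \<sigma>)(Struct := A)" "put w (mem \<sigma> Struct) (g * R) R (bit x) A"
      by blast
    from * obtain j where j: "t = 2 * j" "spans (g * R) R j" by blast
    have "t \<le> 2 * (R div w + 2)" using spans_le[OF j(2)] j(1) by simp
    moreover have "field w A (g' * R) R = (if g' = g then x else field w (mem \<sigma> Struct) (g' * R) R)" for g'
      using field_put[of w "mem \<sigma> Struct" 0 g R x A g'] A(2) b(2) by simp
    moreover have "A a < 2 ^ w" for a using A(2) by (simp add: put_def)
    ultimately show "t \<le> 2 * (R div w + 2) \<and> agree {13, 14} \<sigma> \<tau> \<and>
    (\<exists>A. mem \<tau> = (mem \<sigma>)(Struct := A) \<and> (\<forall>a. A a < 2 ^ w) \<and>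
      (\<forall>g'. field w A (g' * R) R = (if g' = g then x else field w (mem \<sigma> Struct) (g' * R) R)))"
      using A(1) * by blast
  qed
qed

text \<open>With \<open>D = R div w + 2\<close>, the search costs at most \<open>2 * D\<close>, the
  change of the trie \<open>5 * D\<close> and writing the record \<open>2 * D\<close>. After an
  overflow only \<open>sane\<close> is promised, since the next attempt starts afresh.\<close>

lemma wp_insert:
  assumes ins: "inserting A0 \<sigma> T" and i: "regs \<sigma> 19 = i" "i < length xs" "i < n"
    and v: "key \<sigma> i < G * 2 ^ F"
  defines "g \<equiv> key \<sigma> i div 2 ^ F" and "T' \<equiv> insert_value F (key \<sigma> i) T"
  shows "wp insert_prog \<sigma> (\<lambda>t \<tau>. t \<le> 9 * (R div w + 2) \<and> family \<tau> = family \<sigma> \<and> sane A0 \<tau> \<and>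
    (if digits (T' g) \<le> F then inserting A0 \<tau> T' \<and> regs \<tau> 19 = i + 1 else regs \<tau> 19 = n + 1))"
proof -
  define p where "p = key \<sigma> i mod 2 ^ F"
  have g: "g < G" using v by (simp add: g_def less_mult_imp_div_less)
  have p: "p < 2 ^ F" by (simp add: p_def)
  have ready: "ready \<sigma>" and mem: "\<And>b a. mem \<sigma> b a < 2 ^ w" and coded: "coded (mem \<sigma> Struct) T (\<lambda>_. 0)"
    and tables: "tables (mem \<sigma> Work) T"
    and labels: "\<And>i. i < n * s \<Longrightarrow> mbit w (mem \<sigma> Work) i = mbit w A0 i"
    using ins by (auto simp: inserting_def sane_def)
  have t: "fits F (T g)" "digits (T g) \<le> F" "tab (entries (mem \<sigma> Work) g) 1 (T g)"
    using coded tables g by (auto simp: coded_def tables_def)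
  define U where "U = ins (T g) F p"
  have T': "T' = T(g := U)" by (simp add: T'_def insert_value_def U_def g_def p_def)
  have U: "fits F U" "8 * enc U 0 \<le> B" using fits_ins[OF t(1) p] code_bound(1)[OF t(2), of p] by (simp_all add: U_def)
  have F4B: "8 * 4 ^ F \<le> B" by (rule code_bound(2)[OF t(2)])
  let ?D = "R div w + 2"
  have find: "wp find_prog \<sigma> (\<lambda>t \<tau>. t \<le> R div w + 3 \<and>
    regs \<tau> 21 = g \<and> regs \<tau> 22 = p \<and> regs \<tau> 23 = enc (T g) 0 \<and> regs \<tau> 24 = 0 \<and>
    regs \<tau> 29 = rank (T g) p \<and> (\<exists>y m lo rest.
      reach (T g) F p y m (regs \<tau> 26) (regs \<tau> 27) lo (regs \<tau> 28) rest (regs \<tau> 29) \<and>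
      regs \<tau> 25 = enc y rest \<and> (\<forall>a b. y \<noteq> Node a b)) \<and>
    agree {10, 11, 12, 13, 14, 20, 21, 22, 23, 24, 25, 26, 27, 28, 29, 30} \<sigma> \<tau> \<and> mem \<tau> = mem \<sigma>)"
    using wp_find[OF ready i(1,2) _ v mem coded] i(3) by (simp add: g_def p_def)
  have main: "wp (If (Reg 25 [mod] Const 4 [=] Const 1) empty_prog leaf_prog) \<tau>
      (\<lambda>u \<upsilon>. u \<le> 5 * ?D \<and> extended \<tau> g U \<upsilon>)"
    if \<tau>: "regs \<tau> 21 = g" "regs \<tau> 23 = enc (T g) 0" "agree {10, 11, 12, 13, 14, 20, 21, 22, 23, 24, 25, 26, 27, 28, 29, 30} \<sigma> \<tau>"
      "mem \<tau> = mem \<sigma>" and re: "reach (T g) F p y m (regs \<tau> 26) (regs \<tau> 27) lo (regs \<tau> 28) rest (regs \<tau> 29)"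
      and y: "regs \<tau> 25 = enc y rest" "\<forall>a b. y \<noteq> Node a b" for \<tau> y m lo rest
  proof -
    have ready\<tau>: "ready \<tau>" by (rule ready_agree[OF ready \<tau>(3)]) simp
    have mem\<tau>: "mem \<tau> b a < 2 ^ w" for b a using mem \<tau>(4) by simp
    have tab\<tau>: "tab (entries (mem \<tau> Work) g) 1 (T g)" using t(3) \<tau>(4) by simp
    have "lo + regs \<tau> 28 * enc y rest < 2 ^ W" "0 < regs \<tau> 28"
      using reach_invariants(4)[OF t(1) p re] digits_bounds(2)[OF t(2)] by simp_all
    moreover from this(2) have "1 * enc y rest \<le> regs \<tau> 28 * enc y rest" by (intro mult_le_mono1) simp
    ultimately have "enc y rest < 2 ^ W" by linarith
    then have "eval W (regs \<tau>) (Reg 25 [mod] Const 4 [=] Const 1) = of_bool (enc y rest mod 4 = 1)"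
      using y numbers by (simp add: eval_rules del: eval.simps One_nat_def)
    then show ?thesis
    proof (cases y)
      case Empty
      show ?thesis
      proof (rule wp_If)
        show "wp empty_prog \<tau> (\<lambda>u \<upsilon>. u \<le> 5 * ?D \<and> extended \<tau> g U \<upsilon>)"
          unfolding U_def by (rule wp_empty[OF ready\<tau> \<tau>(1,2) re[unfolded Empty] g p t(1,2) tab\<tau> mem\<tau>])
      qed (use \<open>eval W (regs \<tau>) (Reg 25 [mod] Const 4 [=] Const 1) = of_bool (enc y rest mod 4 = 1)\<close> Empty
          in \<open>simp add: enc_digit del: eval.simps enc.simps\<close>)
    next
      case (Leaf r)
      show ?thesis
      proof (rule wp_If)
        show "wp leaf_prog \<tau> (\<lambda>u \<upsilon>. u \<le> 5 * ?D \<and> extended \<tau> g U \<upsilon>)"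
          unfolding U_def by (rule wp_leaf[OF ready\<tau> \<tau>(1,2) y(1)[unfolded Leaf] re[unfolded Leaf] g p t(1,2) tab\<tau> mem\<tau>])
      qed (use \<open>eval W (regs \<tau>) (Reg 25 [mod] Const 4 [=] Const 1) = of_bool (enc y rest mod 4 = 1)\<close> Leaf
          in \<open>simp add: enc_digit del: eval.simps enc.simps\<close>)
    next
      case (Node a b)
      then show ?thesis using y(2) by simp
    qed
  qed
  have finish: "wp (If (Reg 31 [<] Reg 7 [*] Reg 7)
      (Assign 10 (Reg 21 [*] Reg 5) ;; Assign 11 (Reg 5) ;; Assign 12 (Reg 31 [<<] Reg 3) ;;
       store_bits Struct ;; Assign 19 (Reg 19 [+] Const 1))
      (Assign 19 (Reg 0 [+] Const 1))) \<upsilon>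
    (\<lambda>u \<upsilon>'. u \<le> 2 * ?D \<and> family \<upsilon>' = family \<sigma> \<and> sane A0 \<upsilon>' \<and>
    (if digits (T' g) \<le> F then inserting A0 \<upsilon>' T' \<and> regs \<upsilon>' 19 = i + 1 else regs \<upsilon>' 19 = n + 1))"
    if \<tau>: "regs \<tau> 21 = g" "agree {10, 11, 12, 13, 14, 20, 21, 22, 23, 24, 25, 26, 27, 28, 29, 30} \<sigma> \<tau>"
      "mem \<tau> = mem \<sigma>" and ext: "extended \<tau> g U \<upsilon>" for \<tau> \<upsilon>
  proof -
    have ag: "agree {10, 11, 12, 13, 14, 26, 27, 28, 31, 32, 33, 34} \<tau> \<upsilon>"
      using ext by (simp add: extended_def)
    from ext obtain A where A: "mem \<upsilon> = (mem \<tau>)(Work := A)" "\<forall>a. A a < 2 ^ w"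
      "\<forall>i<n * s. mbit w A i = mbit w (mem \<tau> Work) i"
      "\<forall>g'<G. g' \<noteq> g \<longrightarrow> entries A g' = entries (mem \<tau> Work) g'"
      and r31: "regs \<upsilon> 31 = enc U 0 \<and> tab (entries A g) 1 U \<or> regs \<upsilon> 31 = 4 ^ F \<and> F < digits U"
      unfolding extended_def by blast
    have ready\<upsilon>: "ready \<upsilon>"
      by (rule ready_agree[OF ready_agree[OF ready \<tau>(2)] ag]) simp_all
    have mem\<upsilon>: "mem \<upsilon> b a < 2 ^ w" for b a using mem A(1,2) \<tau>(3) by (cases b) simp_all
    have sane\<upsilon>: "sane A0 \<upsilon>"
      using ready\<upsilon> mem\<upsilon> A(1,3) labels \<tau>(3) by (simp add: sane_def)
    have fam: "family \<upsilon> = family \<sigma>" using ag \<tau>(2) by (simp add: agree_def)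
    have r: "regs \<upsilon> 0 = n" "regs \<upsilon> 2 = w" "regs \<upsilon> 3 = l" "regs \<upsilon> 5 = R" "regs \<upsilon> 7 = 2 ^ F"
      using ready\<upsilon> by (simp_all add: ready_def)
    have r': "regs \<upsilon> 19 = i" "regs \<upsilon> 21 = g" using ag \<tau> i by (simp_all add: agree_def)
    have W31: "regs \<upsilon> 31 < 2 ^ W" using r31 U(2) F4B by (intro less_W) linarith
    have F4W: "4 ^ F < (2::nat) ^ W" using F4B by (intro less_W) linarith
    have cond: "eval W (regs \<upsilon>) (Reg 31 [<] Reg 7 [*] Reg 7) = of_bool (regs \<upsilon> 31 < 4 ^ F)"
      using W31 F4W r widths(4) numbers
      by (simp add: eval_rules four_power[symmetric] del: eval.simps)
    have Ug: "T' g = U" by (simp add: T')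
    show ?thesis
    proof (rule wp_If)
      assume "eval W (regs \<upsilon>) (Reg 31 [<] Reg 7 [*] Reg 7) \<noteq> 0"
      then have "regs \<upsilon> 31 < 4 ^ F" using cond by (simp split: if_splits)
      then have r31': "regs \<upsilon> 31 = enc U 0" "tab (entries A g) 1 U" and lt: "enc U 0 < 4 ^ F"
        using r31 by auto
      have dU: "digits U \<le> F" using lt by (simp add: enc_less_iff)
      have rec: "0 + 2 ^ l * enc U 0 < 2 ^ R" by (rule record_less[OF lt]) simp
      moreover have "(2::nat) ^ R \<le> 2 ^ W" using widths(1) by (intro power_increasing) auto
      ultimately have recW: "2 ^ l * enc U 0 < 2 ^ W" by linarith
      have gR: "g * R \<le> B" using g by (intro mult_le_B) simp
      have bnd: "g * R < 2 ^ W" "g < 2 ^ W" "R < 2 ^ W" "l < 2 ^ W" "i < 2 ^ W" "i + 1 < 2 ^ W"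
        using gR g i(3) basic_le_B by (intro less_W; linarith)+
      have e1: "eval W (regs \<upsilon>) (Reg 21 [*] Reg 5) = g * R"
        using r r' bnd by (simp add: eval_rules del: eval.simps)
      have e2: "eval W ((regs \<upsilon>)(10 := x)) (Reg 5) = R" for x
        using r bnd by (simp add: eval_rules del: eval.simps)
      have e3: "eval W ((regs \<upsilon>)(10 := x, 11 := y)) (Reg 31 [<<] Reg 3) = 2 ^ l * enc U 0" for x y
        using r r31' bnd W31 recW
        by (simp add: eval_rules push_bit_eq_mult take_bit_nat_eq_self mult.commute del: eval.simps)
      let ?\<upsilon> = "\<upsilon>\<lparr>regs := (regs \<upsilon>)(10 := g * R, 11 := R, 12 := 2 ^ l * enc U 0)\<rparr>"
      note store = wp_store_record[of ?\<upsilon> g "2 ^ l * enc U 0"]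
      show "wp (Assign 10 (Reg 21 [*] Reg 5) ;; Assign 11 (Reg 5) ;; Assign 12 (Reg 31 [<<] Reg 3) ;;
       store_bits Struct ;; Assign 19 (Reg 19 [+] Const 1)) \<upsilon>
        (\<lambda>u \<upsilon>'. u \<le> 2 * ?D \<and> family \<upsilon>' = family \<sigma> \<and> sane A0 \<upsilon>' \<and>
    (if digits (T' g) \<le> F then inserting A0 \<upsilon>' T' \<and> regs \<upsilon>' 19 = i + 1 else regs \<upsilon>' 19 = n + 1))"
        apply (intro wp_Seq wp_Assign)
        apply (simp add: e1 e2 e3 del: eval.simps One_nat_def)
        apply (rule wp_mono[OF store])
        subgoal using r by simp
        subgoal by simp
        subgoal by simp
        subgoal by simp
        subgoal by (rule g)
        subgoal using rec by simp
        subgoal using mem\<upsilon> by simp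
        apply (elim conjE exE)
        apply (rule wp_Assign)
        subgoal premises pr for u \<upsilon>1 A1
        proof -
          have e4: "eval W (regs \<upsilon>1) (Reg 19 [+] Const 1) = i + 1"
            using pr r' bnd numbers by (simp add: eval_rules agree_def del: eval.simps One_nat_def)
          let ?\<rho> = "\<upsilon>1\<lparr>regs := (regs \<upsilon>1)(19 := i + 1)\<rparr>"
          have ag1: "agree {10, 11, 12, 13, 14, 19} \<upsilon> ?\<rho>" using pr by (simp add: agree_def)
          have "ready ?\<rho>" by (rule ready_agree[OF ready\<upsilon> ag1]) simp
          moreover have memW: "mem ?\<rho> Work = A" "mem ?\<rho> Struct = A1" using pr A(1) by simp_all
          moreover have "mem ?\<rho> b a < 2 ^ w" for b a
            using mem\<upsilon> pr by (cases b) simp_all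
          ultimately have sane1: "sane A0 ?\<rho>"
            using A(3) labels \<tau>(3) by (simp add: sane_def)
          have "coded A1 T' (\<lambda>_. 0)"
            using coded pr(4) dU U(1) A(1) \<tau>(3) pr by (auto simp: coded_def T')
          moreover have "tables A T'"
            using tables A(4) r31'(2) \<tau>(3) by (auto simp: tables_def T')
          ultimately have "inserting A0 ?\<rho> T'" using sane1 memW by (simp add: inserting_def)
          then show ?thesis
            using pr fam sane1 dU by (simp add: e4 Ug agree_def del: eval.simps One_nat_def)
        qed
        done
    next
      assume "eval W (regs \<upsilon>) (Reg 31 [<] Reg 7 [*] Reg 7) = 0"
      then have "\<not> regs \<upsilon> 31 < 4 ^ F" using cond by (simp split: if_splits)
      \<comment> \<open>Either the sentinel of a collision, or a true code with more than
        \<open>F\<close> digits.\<close>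
      then have dU: "F < digits U" using r31 enc_less_iff[of U F] by (metis not_le)
      have nW: "n < 2 ^ W" "n + 1 < 2 ^ W" using basic_le_B by (intro less_W; linarith)+
      have e: "eval W (regs \<upsilon>) (Reg 0 [+] Const 1) = n + 1"
        using r nW numbers by (simp add: eval_rules del: eval.simps One_nat_def)
      let ?\<rho> = "\<upsilon>\<lparr>regs := (regs \<upsilon>)(19 := n + 1)\<rparr>"
      have "ready ?\<rho>" by (rule ready_agree[OF ready\<upsilon>, of "{19}"]) (simp_all add: agree_def)
      then have "sane A0 ?\<rho>" using sane\<upsilon> by (simp add: sane_def)
      then show "wp (Assign 19 (Reg 0 [+] Const 1)) \<upsilon>
        (\<lambda>u \<upsilon>'. u \<le> 2 * ?D \<and> family \<upsilon>' = family \<sigma> \<and> sane A0 \<upsilon>' \<and>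
    (if digits (T' g) \<le> F then inserting A0 \<upsilon>' T' \<and> regs \<upsilon>' 19 = i + 1 else regs \<upsilon>' 19 = n + 1))"
        using dU fam by (intro wp_Assign) (simp add: e Ug del: eval.simps One_nat_def)
    qed
  qed
  show ?thesis
    unfolding insert_prog_def
    apply (intro wp_Seq)
    apply (rule wp_mono[OF find])
    apply (elim conjE exE)
    apply (intro wp_Seq)
    subgoal premises pr for t \<tau> y m lo rest
      apply (rule wp_mono[OF main[OF pr(2,4,7,8,9,10,11)]])
      apply (elim conjE)
      subgoal premises pr1 for u \<upsilon>
        apply (rule wp_mono[OF finish[OF pr(2) _ _ pr1(2)]])
        subgoal using pr by simp
        subgoal using pr by simp
        using pr pr1 by simp
      done
    done
qed

end

section \<open>Construction\<close>

text \<open>Shifting 1 by \<open>l\<close> bits gives the record with offset 0 and the code 1 of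
  \<open>Empty\<close>. Only the records are reset; the table is too large and is left
  alone.\<close>

definition clear_prog :: com where
  "clear_prog =
    Assign 35 (Const 0) ;;
    While (Reg 35 [<] Reg 6)
      (Assign 10 (Reg 35 [*] Reg 5) ;; Assign 11 (Reg 5) ;; Assign 12 (Const 1 [<<] Reg 3) ;;
       store_bits Struct ;; Assign 35 (Reg 35 [+] Const 1))"

definition attempt_prog :: com where
  "attempt_prog =
    Fresh ;; clear_prog ;; Assign 19 (Const 0) ;; While (Reg 19 [<] Reg 0) insert_prog"

text \<open>The mark of a failed attempt is set in advance, so that the first attempt is
  made.\<close>

definition attempts_prog :: com where
  "attempts_prog = Assign 19 (Reg 0 [+] Const 1) ;; While (Reg 0 [<] Reg 19) attempt_prog"

context retrieval
begin

lemma F_pos: "1 \<le> F"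
  using l_pos by (simp add: F)

lemma wp_clear:
  assumes sane: "sane A0 \<sigma>"
  shows "wp clear_prog \<sigma> (\<lambda>t \<tau>. t \<le> 2 * (R div w + 2) * G \<and> family \<tau> = family \<sigma> \<and>
    inserting A0 \<tau> (\<lambda>_. Empty))"
proof -
  let ?D = "2 * (R div w + 2)"
  let ?X = "{10, 11, 12, 13, 14, 35} :: nat set"
  let ?Inv = "\<lambda>t \<tau>. t \<le> ?D * regs \<tau> 35 \<and> regs \<tau> 35 \<le> G \<and> agree ?X \<sigma> \<tau> \<and> (\<forall>b a. mem \<tau> b a < 2 ^ w) \<and>
    mem \<tau> Work = mem \<sigma> Work \<and> (\<forall>g<regs \<tau> 35. field w (mem \<tau> Struct) (g * R) R = 2 ^ l)"
  have ready: "ready \<sigma>" and mem: "\<And>b a. mem \<sigma> b a < 2 ^ w" using sane by (auto simp: sane_def)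
  have ready': "ready \<tau>" if "?Inv t \<tau>" for t \<tau>
    by (rule ready_agree[OF ready]) (use that in auto)
  have GW: "G < 2 ^ W" using basic_le_B by (intro less_W) linarith
  have cond: "eval W (regs \<tau>) (Reg 35 [<] Reg 6) = of_bool (regs \<tau> 35 < G)" if Inv: "?Inv t \<tau>" for t \<tau>
  proof -
    have "regs \<tau> 6 = G" using ready'[OF Inv] by (simp add: ready_def)
    moreover have "regs \<tau> 35 < 2 ^ W" using Inv GW by linarith
    ultimately show ?thesis using GW numbers by (simp add: eval_rules del: eval.simps)
  qed
  have loop: "wp (While (Reg 35 [<] Reg 6)
      (Assign 10 (Reg 35 [*] Reg 5) ;; Assign 11 (Reg 5) ;; Assign 12 (Const 1 [<<] Reg 3) ;;
       store_bits Struct ;; Assign 35 (Reg 35 [+] Const 1))) (\<sigma>\<lparr>regs := (regs \<sigma>)(35 := 0)\<rparr>)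
    (\<lambda>t \<tau>. ?Inv t \<tau> \<and> regs \<tau> 35 = G)"
  proof (rule wp_WhileI[where Inv = ?Inv and \<mu> = "\<lambda>\<tau>. G - regs \<tau> 35"])
    show "?Inv 0 (\<sigma>\<lparr>regs := (regs \<sigma>)(35 := 0)\<rparr>)" using mem by (simp add: agree_def)
  next
    fix t \<tau>
    assume Inv: "?Inv t \<tau>" and nz: "eval W (regs \<tau>) (Reg 35 [<] Reg 6) \<noteq> 0"
    define g where "g = regs \<tau> 35"
    have g: "g < G" using cond[OF Inv] nz by (simp add: g_def split: if_splits)
    have r: "regs \<tau> 2 = w" "regs \<tau> 3 = l" "regs \<tau> 5 = R" using ready'[OF Inv] by (simp_all add: ready_def)
    have gR: "g * R \<le> B" using g by (intro mult_le_B) simp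
    have bnd: "g * R < 2 ^ W" "g < 2 ^ W" "g + 1 < 2 ^ W" "R < 2 ^ W" "l < 2 ^ W"
      using gR g basic_le_B by (intro less_W; linarith)+
    have lW: "take_bit W (push_bit l (Suc 0)) = 2 ^ l"
      using widths(5) by (simp add: push_bit_eq_mult take_bit_nat_eq_self)
    have e1: "eval W (regs \<tau>) (Reg 35 [*] Reg 5) = g * R"
      using r bnd by (simp add: eval_rules g_def[symmetric] del: eval.simps)
    have e2: "eval W ((regs \<tau>)(10 := x)) (Reg 5) = R" for x
      using r bnd by (simp add: eval_rules del: eval.simps)
    have e3: "eval W ((regs \<tau>)(10 := x, 11 := y)) (Const 1 [<<] Reg 3) = 2 ^ l" for x y
      using r bnd numbers lW by (simp add: eval_rules del: eval.simps)
    let ?\<tau> = "\<tau>\<lparr>regs := (regs \<tau>)(10 := g * R, 11 := R, 12 := 2 ^ l)\<rparr>"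
    have lR: "(2::nat) ^ l < 2 ^ R" using l_pos by (simp add: R)
    note store = wp_store_record[of ?\<tau> g "2 ^ l"]
    show "wp (Assign 10 (Reg 35 [*] Reg 5) ;; Assign 11 (Reg 5) ;; Assign 12 (Const 1 [<<] Reg 3) ;;
       store_bits Struct ;; Assign 35 (Reg 35 [+] Const 1)) \<tau>
      (\<lambda>u \<upsilon>. ?Inv (t + u) \<upsilon> \<and> G - regs \<upsilon> 35 < G - regs \<tau> 35)"
      apply (intro wp_Seq wp_Assign)
      apply (simp add: e1 e2 e3 del: eval.simps One_nat_def)
      apply (rule wp_mono[OF store])
      subgoal using r by simp
      subgoal by simp
      subgoal by simp
      subgoal by simp
      subgoal by (rule g)
      subgoal by (rule lR)
      subgoal using Inv by simp
      apply (elim conjE exE)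
      apply (rule wp_Assign)
      subgoal premises pr for u \<upsilon> A
      proof -
        have e4: "eval W (regs \<upsilon>) (Reg 35 [+] Const 1) = g + 1"
          using pr bnd numbers by (simp add: eval_rules agree_def g_def[symmetric] del: eval.simps One_nat_def)
        let ?\<rho> = "\<upsilon>\<lparr>regs := (regs \<upsilon>)(35 := g + 1)\<rparr>"
        have "agree ?X \<sigma> ?\<rho>" using Inv pr by (simp add: agree_def)
        moreover have "mem ?\<rho> b a < 2 ^ w" for b a using Inv pr mem by (cases b) simp_all
        moreover have "mem ?\<rho> Work = mem \<sigma> Work" using Inv pr by simp
        moreover have "field w (mem ?\<rho> Struct) (g' * R) R = 2 ^ l" if "g' < g + 1" for g'
        proof (cases "g' = g")
          case False
          then have "field w (mem \<tau> Struct) (g' * R) R = 2 ^ l" using Inv that by (simp add: g_def)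
          then show ?thesis using pr False by simp
        qed (use pr in simp)
        moreover have "t + u \<le> ?D * (g + 1)" using Inv pr by (simp add: g_def[symmetric])
        ultimately show ?thesis
          using g by (simp add: e4 g_def[symmetric] del: eval.simps One_nat_def)
      qed
      done
  next
    fix t \<tau>
    assume Inv: "?Inv t \<tau>" and z: "eval W (regs \<tau>) (Reg 35 [<] Reg 6) = 0"
    have "regs \<tau> 35 = G" using cond[OF Inv] z Inv by (simp del: eval.simps split: if_splits)
    then show "?Inv t \<tau> \<and> regs \<tau> 35 = G" using Inv by blast
  qed
  show ?thesis
    unfolding clear_prog_def
    apply (intro wp_Seq wp_Assign)
    apply (simp add: eval_ConstI numbers del: eval.simps One_nat_def)
    apply (rule wp_mono[OF loop])
    subgoal premises pr for t \<tau>
    proof -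
      from pr have Inv: "?Inv t \<tau>" and G35: "regs \<tau> 35 = G" by blast+
      have "sane A0 \<tau>" using ready'[OF Inv] Inv sane by (simp add: sane_def)
      moreover have "coded (mem \<tau> Struct) (\<lambda>_. Empty) (\<lambda>_. 0)"
        using Inv F_pos unfolding coded_def G35 by simp
      \<comment> \<open>A trie without leaves imposes nothing on the table, so stale entries are
        admissible.\<close>
      moreover have "tables (mem \<tau> Work) (\<lambda>_. Empty)" by (simp add: tables_def)
      ultimately have "inserting A0 \<tau> (\<lambda>_. Empty)" by (simp add: inserting_def)
      moreover have "t \<le> 2 * (R div w + 2) * G" using Inv unfolding G35 by blast
      moreover have "family \<tau> = family \<sigma>" using Inv unfolding agree_def by blast
      ultimately show ?thesis by simp
    qed
    done
qed

definition good :: "nat \<Rightarrow> bool" where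
  "good e \<longleftrightarrow> hash_values h e (G * 2 ^ F) xs \<notin> bad_words G F n"

definition attempt_cost :: nat where
  "attempt_cost = 1 + 2 * (R div w + 2) * G + 9 * (R div w + 2) * n"

text \<open>The program stops at the first overflow, whereas \<open>good\<close> speaks of the
  complete vector of hash values; the monotonicity of trie sizes shows that both agree.\<close>

lemma wp_attempt:
  assumes h: "h \<in> space hash_space" and len: "length xs = n" and sane: "sane A0 \<sigma>"
  defines "vs \<equiv> hash_values h (Suc (family \<sigma>)) (G * 2 ^ F) xs"
  shows "wp attempt_prog \<sigma> (\<lambda>t \<tau>. t \<le> attempt_cost \<and> family \<tau> = Suc (family \<sigma>) \<and> sane A0 \<tau> \<and>
    (if good (family \<tau>) then regs \<tau> 19 = n \<and> inserting A0 \<tau> (tries F vs) else regs \<tau> 19 = n + 1))"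
proof -
  have M: "0 < G * 2 ^ F" using G_pos by simp
  have vs: "vs \<in> words_over (G * 2 ^ F) n"
    using hash_values_mem[OF h M, of "Suc (family \<sigma>)" xs] len by (simp add: vs_def)
  have vs_nth: "vs ! i = h (Suc (family \<sigma>), 0, G * 2 ^ F, xs ! i)" if "i < n" for i
    using that len by (simp add: vs_def hash_values_def)
  have vs_less: "vs ! i < G * 2 ^ F" if "i < n" for i
  proof -
    have "vs ! i \<in> set vs" using vs that by (simp add: words_over_def)
    then show ?thesis using vs unfolding words_over_def by blast
  qed
  have len_vs: "length vs = n" using vs by (simp add: words_over_def)
  let ?e = "Suc (family \<sigma>)"
  let ?Inv = "\<lambda>t \<tau>. family \<tau> = ?e \<and> sane A0 \<tau> \<and> (\<exists>j\<le>n. t \<le> 9 * (R div w + 2) * j \<and>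
    (regs \<tau> 19 = j \<and> inserting A0 \<tau> (tries F (take j vs)) \<or> regs \<tau> 19 = n + 1 \<and> \<not> good ?e))"
  have bad: "\<not> good ?e" if "g < G" "F < digits (tries F (take j vs) g)" for g j
  proof -
    have "digits (tries F (take j vs) g) \<le> digits (tries F vs g)"
      using nodes_tries_append[of F "take j vs" g "drop j vs"] by simp
    then have "vs \<in> bad_words G F n" using vs that by (auto simp: bad_words_def)
    then show ?thesis by (simp add: good_def vs_def)
  qed
  have nW: "n + 1 < 2 ^ W" using basic_le_B by (intro less_W) linarith
  have cond: "eval W (regs \<tau>) (Reg 19 [<] Reg 0) = of_bool (regs \<tau> 19 < n)" if Inv: "?Inv t \<tau>" for t \<tau>
  proof -
    have "regs \<tau> 0 = n" using Inv by (simp add: sane_def ready_def)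
    moreover have "regs \<tau> 19 \<le> n + 1" using Inv by auto
    ultimately show ?thesis using nW numbers by (simp add: eval_rules del: eval.simps)
  qed
  have loop: "wp (While (Reg 19 [<] Reg 0) insert_prog) \<tau> (\<lambda>t \<tau>. t \<le> 9 * (R div w + 2) * n \<and>
    family \<tau> = ?e \<and> sane A0 \<tau> \<and>
    (if good ?e then regs \<tau> 19 = n \<and> inserting A0 \<tau> (tries F vs) else regs \<tau> 19 = n + 1))"
    if start: "?Inv 0 \<tau>" for \<tau>
  proof (rule wp_WhileI[where Inv = ?Inv and \<mu> = "\<lambda>\<tau>. n + 1 - regs \<tau> 19"])
    show "?Inv 0 \<tau>" by (rule start)
  next
    fix t \<tau>
    assume Inv: "?Inv t \<tau>" and nz: "eval W (regs \<tau>) (Reg 19 [<] Reg 0) \<noteq> 0"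
    have lt: "regs \<tau> 19 < n" using cond[OF Inv] nz by (simp split: if_splits)
    from Inv lt obtain j where j: "t \<le> 9 * (R div w + 2) * j" "regs \<tau> 19 = j"
      "inserting A0 \<tau> (tries F (take j vs))" by auto
    have fam: "family \<tau> = ?e" using Inv by simp
    have jn: "j < n" using lt j by simp
    have key: "key \<tau> j = vs ! j" using vs_nth[OF jn] fam by simp
    have step: "insert_value F (key \<tau> j) (tries F (take j vs)) = tries F (take (Suc j) vs)"
      using jn len_vs by (simp add: key take_Suc_conv_app_nth tries_snoc)
    have g: "key \<tau> j div 2 ^ F < G" using vs_less[OF jn] by (simp add: key less_mult_imp_div_less)
    have "key \<tau> j < G * 2 ^ F" using vs_less[OF jn] by (simp add: key)
    note ins = wp_insert[OF j(3,2) _ jn this, unfolded step]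
    show "wp insert_prog \<tau> (\<lambda>u \<upsilon>. ?Inv (t + u) \<upsilon> \<and> n + 1 - regs \<upsilon> 19 < n + 1 - regs \<tau> 19)"
    proof (rule wp_mono, rule ins)
      show "j < length xs" using len jn by simp
      fix u \<upsilon>
      assume *: "u \<le> 9 * (R div w + 2) \<and> family \<upsilon> = family \<tau> \<and> sane A0 \<upsilon> \<and>
        (if digits (tries F (take (Suc j) vs) (key \<tau> j div 2 ^ F)) \<le> F
         then inserting A0 \<upsilon> (tries F (take (Suc j) vs)) \<and> regs \<upsilon> 19 = j + 1 else regs \<upsilon> 19 = n + 1)"
      have "t + u \<le> 9 * (R div w + 2) * Suc j" using * j(1) by simp
      moreover have "regs \<upsilon> 19 = Suc j \<and> inserting A0 \<upsilon> (tries F (take (Suc j) vs)) \<or>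
          regs \<upsilon> 19 = n + 1 \<and> \<not> good ?e"
        using * bad[OF g, of "Suc j"] by (cases "digits (tries F (take (Suc j) vs) (key \<tau> j div 2 ^ F)) \<le> F") simp_all
      moreover have "Suc j \<le> n" using jn by simp
      moreover have "family \<upsilon> = ?e" "sane A0 \<upsilon>" using * fam by simp_all
      moreover from calculation(2) have "n + 1 - regs \<upsilon> 19 < n + 1 - regs \<tau> 19" using j(2) jn by auto
      ultimately show "?Inv (t + u) \<upsilon> \<and> n + 1 - regs \<upsilon> 19 < n + 1 - regs \<tau> 19" by blast
    qed
  next
    fix t \<tau>
    assume Inv: "?Inv t \<tau>" and z: "eval W (regs \<tau>) (Reg 19 [<] Reg 0) = 0"
    have ge: "n \<le> regs \<tau> 19" using cond[OF Inv] z by (simp split: if_splits)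
    from Inv obtain j where j: "j \<le> n" "t \<le> 9 * (R div w + 2) * j"
      "regs \<tau> 19 = j \<and> inserting A0 \<tau> (tries F (take j vs)) \<or> regs \<tau> 19 = n + 1 \<and> \<not> good ?e" by blast
    have "t \<le> 9 * (R div w + 2) * n" using j(1,2) by (meson le_trans mult_le_mono2)
    \<comment> \<open>All elements have been inserted and the invariant bounds every trie, so the
      vector is not bad.\<close>
    moreover have g1: "good ?e" if "regs \<tau> 19 = j" "inserting A0 \<tau> (tries F (take j vs))"
    proof -
      have "j = n" using that ge j(1) by simp
      then have "inserting A0 \<tau> (tries F vs)" using that len_vs by simp
      then have "\<forall>g<G. digits (tries F vs g) \<le> F" by (simp add: inserting_def coded_def)
      then show ?thesis by (force simp: good_def bad_words_def vs_def[symmetric])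
    qed
    moreover have g2: "inserting A0 \<tau> (tries F vs) \<and> regs \<tau> 19 = n"
      if "regs \<tau> 19 = j" "inserting A0 \<tau> (tries F (take j vs))"
      using that ge j(1) len_vs by simp
    moreover from j(3) have "if good ?e then regs \<tau> 19 = n \<and> inserting A0 \<tau> (tries F vs) else regs \<tau> 19 = n + 1"
    proof (elim disjE conjE)
      assume "regs \<tau> 19 = j" "inserting A0 \<tau> (tries F (take j vs))"
      from g1[OF this] g2[OF this] show ?thesis by (simp only: if_True)
    next
      assume "regs \<tau> 19 = n + 1" "\<not> good ?e"
      then show ?thesis by (simp only: if_False)
    qed
    ultimately show "t \<le> 9 * (R div w + 2) * n \<and> family \<tau> = ?e \<and> sane A0 \<tau> \<and>
      (if good ?e then regs \<tau> 19 = n \<and> inserting A0 \<tau> (tries F vs) else regs \<tau> 19 = n + 1)"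
      using Inv by blast
  qed
  have sane1: "sane A0 (\<sigma>\<lparr>family := ?e\<rparr>)" using sane by (simp add: sane_def ready_def)
  show ?thesis
    unfolding attempt_prog_def
    apply (intro wp_Seq wp_Fresh)
    apply (rule wp_mono[OF wp_clear[OF sane1]])
    apply (intro wp_Seq wp_Assign)
    subgoal premises pr for t \<tau>
    proof -
      let ?\<tau> = "\<tau>\<lparr>regs := (regs \<tau>)(19 := 0)\<rparr>"
      have "sane A0 ?\<tau>" "inserting A0 ?\<tau> (tries F [])"
        using pr by (simp_all add: inserting_def sane_def ready_def tries_def)
      then have "?Inv 0 ?\<tau>" using pr by (auto intro!: exI[of _ 0])
      from loop[OF this] show ?thesis
        apply (simp add: eval_ConstI numbers del: eval.simps One_nat_def)
        apply (erule wp_mono)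
        using pr by (auto simp: attempt_cost_def)
    qed
    done
qed

end

text \<open>Skipping a whole trie as a single pending subtrie counts its leaves, so group sizes are
  not stored anywhere. \<open>load_bits\<close> leaves position and length in place for the
  following \<open>store_bits\<close>.\<close>

definition prefix_prog :: com where
  "prefix_prog =
    Assign 35 (Const 0) ;; Assign 36 (Const 0) ;;
    While (Reg 35 [<] Reg 6)
      (Assign 10 (Reg 35 [*] Reg 5) ;; Assign 11 (Reg 5) ;; load_bits Struct ;;
       Assign 25 (Reg 12 [>>] Reg 3) ;; Assign 12 (Reg 12 [+] Reg 36) ;; store_bits Struct ;;
       Assign 28 (Const 1) ;; Assign 29 (Const 0) ;; skip_prog ;;
       Assign 36 (Reg 36 [+] Reg 29) ;; Assign 35 (Reg 35 [+] Const 1))"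

definition place_all_prog :: com where
  "place_all_prog =
    Assign 19 (Const 0) ;; While (Reg 19 [<] Reg 0) (place_prog ;; Assign 19 (Reg 19 [+] Const 1))"

definition builder_prog :: com where
  "builder_prog = init_prog ;; attempts_prog ;; prefix_prog ;; place_all_prog"

lemma (in ram) wp_deterministic:
  "wp c \<sigma> Q \<Longrightarrow> exec w W h xs c \<sigma> t \<tau> \<Longrightarrow> Q t \<tau>"
  unfolding wp_def using exec_deterministic by blast

text \<open>Reasons about a run that is given, without a termination measure. This is required
  because the construction diverges for hash functions without a good family.\<close>

lemma (in ram) while_partial:
  assumes "exec w W h xs (While b c) \<sigma> t \<tau>" "Inv \<sigma>"
    and step: "\<And>\<sigma>. Inv \<sigma> \<Longrightarrow> eval W (regs \<sigma>) b \<noteq> 0 \<Longrightarrow> wp c \<sigma> (\<lambda>_. Inv)"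
  shows "Inv \<tau> \<and> eval W (regs \<tau>) b = 0"
  using assms(1,2)
proof (induction "While b c" \<sigma> t \<tau> rule: exec.induct)
  case (WhileTrue \<sigma> t1 \<sigma>1 t2 \<sigma>2)
  then show ?case using wp_deterministic[OF step] by blast
qed simp

lemma slot_put:
  assumes "put w A (b + a * k) k v A'" "j < k"
  shows "mbit w A' (b + c * k + j) = (if c = a then v j else mbit w A (b + c * k + j))"
proof (cases "c = a")
  case True
  then show ?thesis using assms by (simp add: put_def)
next
  case False
  have "\<not> (b + a * k \<le> b + c * k + j \<and> b + c * k + j < b + a * k + k)"
  proof
    assume "b + a * k \<le> b + c * k + j \<and> b + c * k + j < b + a * k + k"
    then have "c * k < Suc a * k" "a * k < Suc c * k" using assms(2) by auto
    then have "c < Suc a" "a < Suc c" by (metis mult_less_cancel2)+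
    then show False using False by simp
  qed
  then show ?thesis using assms(1) False by (auto simp: put_def)
qed

context retrieval
begin

lemma coded_put:
  assumes "put w A (G * R + x) y v A'" "coded A T off"
  shows "coded A' T off"
proof -
  have "field w A' (g * R) R = field w A (g * R) R" if "g < G" for g
  proof (rule field_cong)
    fix i assume "i < R"
    have "Suc g * R \<le> G * R" using that by (intro mult_le_mono1) simp
    then have "g * R + i < G * R" using \<open>i < R\<close> by simp
    then show "mbit w A' (g * R + i) = mbit w A (g * R + i)"
      using assms(1) by (simp add: put_def)
  qed
  then show ?thesis using assms(2) by (simp add: coded_def)
qed

text \<open>The first good family \<open>e\<close> determines both the number of attempts and the
  family that stays in use.\<close>

lemma wp_attempts:
  assumes h: "h \<in> space hash_space" and len: "length xs = n" and sane: "sane A0 \<sigma>" and fam: "family \<sigma> = 0"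
    and e: "1 \<le> e" "good e" "\<And>i. 1 \<le> i \<Longrightarrow> i < e \<Longrightarrow> \<not> good i"
  shows "wp attempts_prog \<sigma> (\<lambda>t \<tau>. t \<le> e * attempt_cost \<and> family \<tau> = e \<and>
    inserting A0 \<tau> (tries F (hash_values h e (G * 2 ^ F) xs)))"
proof -
  let ?T = "tries F (hash_values h e (G * 2 ^ F) xs)"
  let ?Inv = "\<lambda>t \<tau>. sane A0 \<tau> \<and> t \<le> family \<tau> * attempt_cost \<and>
    (regs \<tau> 19 = n + 1 \<and> family \<tau> < e \<or> regs \<tau> 19 = n \<and> family \<tau> = e \<and> inserting A0 \<tau> ?T)"
  have nW: "n < 2 ^ W" "n + 1 < 2 ^ W" using basic_le_B by (intro less_W; linarith)+
  have cond: "eval W (regs \<tau>) (Reg 0 [<] Reg 19) = of_bool (regs \<tau> 19 = n + 1)" if Inv: "?Inv t \<tau>" for t \<tau>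
  proof -
    have "regs \<tau> 0 = n" using Inv by (simp add: sane_def ready_def)
    moreover have "regs \<tau> 19 = n \<or> regs \<tau> 19 = n + 1" using Inv by blast
    ultimately show ?thesis using nW numbers by (auto simp: eval_rules simp del: eval.simps)
  qed
  let ?\<sigma> = "\<sigma>\<lparr>regs := (regs \<sigma>)(19 := n + 1)\<rparr>"
  have loop: "wp (While (Reg 0 [<] Reg 19) attempt_prog) ?\<sigma> (\<lambda>t \<tau>. t \<le> e * attempt_cost \<and> family \<tau> = e \<and>
    inserting A0 \<tau> ?T)"
  proof (rule wp_WhileI[where Inv = ?Inv and \<mu> = "\<lambda>\<tau>. e - family \<tau>"])
    show "?Inv 0 ?\<sigma>" using sane fam e(1) by (simp add: sane_def ready_def)
  next
    fix t \<tau>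
    assume Inv: "?Inv t \<tau>" and nz: "eval W (regs \<tau>) (Reg 0 [<] Reg 19) \<noteq> 0"
    have "regs \<tau> 19 = n + 1" using cond[OF Inv] nz by (simp del: eval.simps split: if_splits)
    then have lt: "family \<tau> < e" using Inv by auto
    have sane\<tau>: "sane A0 \<tau>" using Inv by blast
    show "wp attempt_prog \<tau> (\<lambda>u \<upsilon>. ?Inv (t + u) \<upsilon> \<and> e - family \<upsilon> < e - family \<tau>)"
    proof (rule wp_mono[OF wp_attempt[OF h len sane\<tau>]])
      fix u \<upsilon>
      assume *: "u \<le> attempt_cost \<and> family \<upsilon> = Suc (family \<tau>) \<and> sane A0 \<upsilon> \<and>
        (if good (family \<upsilon>) then regs \<upsilon> 19 = n \<and>
          inserting A0 \<upsilon> (tries F (hash_values h (Suc (family \<tau>)) (G * 2 ^ F) xs)) else regs \<upsilon> 19 = n + 1)"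
      have cost: "t + u \<le> family \<upsilon> * attempt_cost" using Inv * by simp
      show "?Inv (t + u) \<upsilon> \<and> e - family \<upsilon> < e - family \<tau>"
      proof (cases "good (family \<upsilon>)")
        case True
        then have "family \<upsilon> = e" using e(3)[of "family \<upsilon>"] * lt by fastforce
        then show ?thesis using * True cost lt by simp
      next
        case False
        then have "family \<upsilon> \<noteq> e" using e(2) by auto
        then show ?thesis using * False cost lt by simp
      qed
    qed
  next
    fix t \<tau>
    assume Inv: "?Inv t \<tau>" and z: "eval W (regs \<tau>) (Reg 0 [<] Reg 19) = 0"
    have "regs \<tau> 19 \<noteq> n + 1" using cond[OF Inv] z by (simp del: eval.simps split: if_splits)
    then show "t \<le> e * attempt_cost \<and> family \<tau> = e \<and> inserting A0 \<tau> ?T" using Inv by auto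
  qed
  have r: "regs \<sigma> 0 = n" using sane by (simp add: sane_def ready_def)
  have e0: "eval W (regs \<sigma>) (Reg 0 [+] Const 1) = n + 1"
    using r nW numbers by (simp add: eval_rules del: eval.simps One_nat_def)
  show ?thesis
    unfolding attempts_prog_def
    apply (intro wp_Seq wp_Assign)
    apply (simp add: e0 del: eval.simps One_nat_def)
    using loop by simp
qed

text \<open>The loop is left only after a success. This connects \<open>represents\<close>, which
  presupposes a halting construction, with the total correctness statements, which presuppose a good
  family.\<close>

lemma attempts_halting:
  assumes h: "h \<in> space hash_space" and len: "length xs = n" and sane: "sane A0 \<sigma>"
    and run: "exec w W h xs attempts_prog \<sigma> t \<tau>"
  shows "\<exists>e\<ge>1. good e"
proof -
  have nW: "n < 2 ^ W" "n + 1 < 2 ^ W" using basic_le_B by (intro less_W; linarith)+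
  have r: "regs \<sigma> 0 = n" using sane by (simp add: sane_def ready_def)
  have e0: "eval W (regs \<sigma>) (Reg 0 [+] Const 1) = n + 1"
    using r nW numbers by (simp add: eval_rules del: eval.simps One_nat_def)
  let ?\<sigma> = "\<sigma>\<lparr>regs := (regs \<sigma>)(19 := n + 1)\<rparr>"
  from run[unfolded attempts_prog_def] obtain t1 t2 \<sigma>1 where
    "exec w W h xs (Assign 19 (Reg 0 [+] Const 1)) \<sigma> t1 \<sigma>1"
    and loop: "exec w W h xs (While (Reg 0 [<] Reg 19) attempt_prog) \<sigma>1 t2 \<tau>" by (rule SeqE)
  then have "\<sigma>1 = ?\<sigma>"
    using exec_deterministic[OF exec.Assign[of w W h xs 19 "Reg 0 [+] Const 1" \<sigma>]] unfolding e0 by blast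
  note loop = loop[unfolded this]
  let ?Inv = "\<lambda>\<tau>. sane A0 \<tau> \<and> (regs \<tau> 19 = n + 1 \<or> 1 \<le> family \<tau> \<and> good (family \<tau>))"
  have "?Inv \<tau> \<and> eval W (regs \<tau>) (Reg 0 [<] Reg 19) = 0"
  proof (rule while_partial[OF loop, where Inv = ?Inv])
    show "?Inv ?\<sigma>" using sane by (simp add: sane_def ready_def)
    fix \<tau> assume Inv: "?Inv \<tau>"
    then have sane\<tau>: "sane A0 \<tau>" by blast
    show "wp attempt_prog \<tau> (\<lambda>_. ?Inv)"
      by (rule wp_mono[OF wp_attempt[OF h len sane\<tau>]]) (auto split: if_splits)
  qed
  moreover have "eval W (regs \<tau>) (Reg 0 [<] Reg 19) = 1" if "regs \<tau> 19 = n + 1" "sane A0 \<tau>"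
    using that nW numbers by (simp add: eval_rules sane_def ready_def del: eval.simps)
  ultimately have "1 \<le> family \<tau> \<and> good (family \<tau>)" by fastforce
  then show ?thesis by blast
qed

lemma wp_prefix:
  assumes ins: "inserting A0 \<sigma> T" and total: "offset T G \<le> n"
  shows "wp prefix_prog \<sigma> (\<lambda>t \<tau>. t \<le> 3 * (R div w + 2) * G \<and> family \<tau> = family \<sigma> \<and> sane A0 \<tau> \<and>
    coded (mem \<tau> Struct) T (offset T))"
proof -
  let ?D = "3 * (R div w + 2)"
  let ?X = "{10, 11, 12, 13, 14, 25, 28, 29, 30, 35, 36} :: nat set"
  \<comment> \<open>Groups before \<open>j\<close> have received their offset; the others still
    carry 0.\<close>
  let ?off = "\<lambda>j g. if g < j then offset T g else 0"
  let ?Inv = "\<lambda>t \<tau>. t \<le> ?D * regs \<tau> 35 \<and> regs \<tau> 35 \<le> G \<and> regs \<tau> 36 = offset T (regs \<tau> 35) \<and>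
    agree ?X \<sigma> \<tau> \<and> (\<forall>b a. mem \<tau> b a < 2 ^ w) \<and>
    mem \<tau> Work = mem \<sigma> Work \<and> coded (mem \<tau> Struct) T (?off (regs \<tau> 35))"
  have ready: "ready \<sigma>" and mem: "\<And>b a. mem \<sigma> b a < 2 ^ w" and coded: "coded (mem \<sigma> Struct) T (\<lambda>_. 0)"
    using ins by (auto simp: sane_def inserting_def)
  have ready': "ready \<tau>" if "?Inv t \<tau>" for t \<tau>
  proof (rule ready_agree[OF ready])
    show "agree ?X \<sigma> \<tau>" using that by blast
  qed simp
  have GW: "G < 2 ^ W" using basic_le_B by (intro less_W) linarith
  have cond: "eval W (regs \<tau>) (Reg 35 [<] Reg 6) = of_bool (regs \<tau> 35 < G)" if Inv: "?Inv t \<tau>" for t \<tau>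
  proof -
    have "regs \<tau> 6 = G" using ready'[OF Inv] by (simp add: ready_def)
    moreover have "regs \<tau> 35 \<le> G" using Inv by blast
    ultimately show ?thesis using GW numbers by (simp add: eval_rules del: eval.simps)
  qed
  have loop: "wp (While (Reg 35 [<] Reg 6)
      (Assign 10 (Reg 35 [*] Reg 5) ;; Assign 11 (Reg 5) ;; load_bits Struct ;;
       Assign 25 (Reg 12 [>>] Reg 3) ;; Assign 12 (Reg 12 [+] Reg 36) ;; store_bits Struct ;;
       Assign 28 (Const 1) ;; Assign 29 (Const 0) ;; skip_prog ;;
       Assign 36 (Reg 36 [+] Reg 29) ;; Assign 35 (Reg 35 [+] Const 1)))
      (\<sigma>\<lparr>regs := (regs \<sigma>)(35 := 0, 36 := 0)\<rparr>)
    (\<lambda>t \<tau>. ?Inv t \<tau> \<and> regs \<tau> 35 = G)"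
  proof (rule wp_WhileI[where Inv = ?Inv and \<mu> = "\<lambda>\<tau>. G - regs \<tau> 35"])
    show "?Inv 0 (\<sigma>\<lparr>regs := (regs \<sigma>)(35 := 0, 36 := 0)\<rparr>)"
      using mem coded by (simp add: agree_def offset_def)
  next
    fix t \<tau>
    assume Inv: "?Inv t \<tau>" and nz: "eval W (regs \<tau>) (Reg 35 [<] Reg 6) \<noteq> 0"
    define g where "g = regs \<tau> 35"
    have I: "t \<le> ?D * g" "regs \<tau> 36 = offset T g" "agree ?X \<sigma> \<tau>" "\<And>b a. mem \<tau> b a < 2 ^ w"
      "mem \<tau> Work = mem \<sigma> Work" "coded (mem \<tau> Struct) T (?off g)"
      using Inv unfolding g_def by blast+
    have g: "g < G" using cond[OF Inv] nz by (simp add: g_def del: eval.simps split: if_splits)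
    have r: "regs \<tau> 2 = w" "regs \<tau> 3 = l" "regs \<tau> 5 = R" using ready'[OF Inv] by (simp_all add: ready_def)
    define c where "c = enc (T g) 0"
    have rec: "field w (mem \<tau> Struct) (g * R) R = 2 ^ l * c" and dig: "digits (T g) \<le> F" and fits: "fits F (T g)"
      using I(6) g by (auto simp: coded_def c_def)
    have c4: "c < 4 ^ F" using dig by (simp add: c_def enc_less_iff)
    have offn: "offset T g \<le> n" using offset_mono[of g G T] g total by simp
    have offn': "offset T (Suc g) \<le> n" using offset_mono[of "Suc g" G T] g total by simp
    have off: "offset T g < 2 ^ l" using offn n_less by linarith
    have recR: "offset T g + 2 ^ l * c < 2 ^ R" by (rule record_less[OF c4 off])
    have "(2::nat) ^ R \<le> 2 ^ W" using widths(1) by (intro power_increasing) auto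
    then have recW: "offset T g + 2 ^ l * c < 2 ^ W" "2 ^ l * c < 2 ^ W" using recR by linarith+
    have gR: "g * R \<le> B" using g by (intro mult_le_B) simp
    have bnd: "g * R < 2 ^ W" "g < 2 ^ W" "g + 1 < 2 ^ W" "R < 2 ^ W" "l < 2 ^ W" "g * R + R + 2 * w < 2 ^ W"
      "offset T g < 2 ^ W" "offset T (Suc g) < 2 ^ W" "leaves (T g) < 2 ^ W"
      using gR g offn offn' digits_bounds(3)[OF dig] basic_le_B by (intro less_W; linarith)+
    have cW: "c < 2 ^ W" unfolding c_def by (rule digits_bounds(2)[OF dig])
    have e1: "eval W (regs \<tau>) (Reg 35 [*] Reg 5) = g * R"
      using r bnd by (simp add: eval_rules g_def[symmetric] del: eval.simps)
    have e2: "eval W ((regs \<tau>)(10 := x)) (Reg 5) = R" for x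
      using r bnd by (simp add: eval_rules del: eval.simps)
    let ?\<tau> = "\<tau>\<lparr>regs := (regs \<tau>)(10 := g * R, 11 := R)\<rparr>"
    have load: "wp (load_bits Struct) ?\<tau> (\<lambda>t \<tau>. spans (g * R) R t \<and> regs \<tau> 12 = field w (mem ?\<tau> Struct) (g * R) R \<and>
      agree {12, 13, 14} ?\<tau> \<tau> \<and> mem \<tau> = mem ?\<tau>)"
      by (rule wp_load_bits) (use r bnd w widths I(4) in simp_all)
    show "wp (Assign 10 (Reg 35 [*] Reg 5) ;; Assign 11 (Reg 5) ;; load_bits Struct ;;
       Assign 25 (Reg 12 [>>] Reg 3) ;; Assign 12 (Reg 12 [+] Reg 36) ;; store_bits Struct ;;
       Assign 28 (Const 1) ;; Assign 29 (Const 0) ;; skip_prog ;;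
       Assign 36 (Reg 36 [+] Reg 29) ;; Assign 35 (Reg 35 [+] Const 1)) \<tau>
      (\<lambda>u \<upsilon>. ?Inv (t + u) \<upsilon> \<and> G - regs \<upsilon> 35 < G - regs \<tau> 35)"
      apply (intro wp_Seq wp_Assign)
      apply (simp add: e1 e2 del: eval.simps One_nat_def)
      apply (rule wp_mono[OF load])
      apply (elim conjE)
      apply (intro wp_Seq wp_Assign)
      subgoal premises pr for u1 \<tau>1
      proof -
        have t1: "regs \<tau>1 12 = 2 ^ l * c" "regs \<tau>1 3 = l" "regs \<tau>1 36 = offset T g" "regs \<tau>1 2 = w"
          "regs \<tau>1 10 = g * R" "regs \<tau>1 11 = R" "regs \<tau>1 35 = g" "mem \<tau>1 = mem \<tau>"
          using pr rec r I(2) by (simp_all add: agree_def g_def)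
        have ag1: "agree ?X \<sigma> \<tau>1" using pr I(3) by (simp add: agree_def)
        have e3: "eval W (regs \<tau>1) (Reg 12 [>>] Reg 3) = c"
          using t1 bnd recW by (simp add: eval_rules drop_bit_eq_div del: eval.simps)
        have e4: "eval W ((regs \<tau>1)(25 := x)) (Reg 12 [+] Reg 36) = offset T g + 2 ^ l * c" for x
          using t1 bnd recW by (simp add: eval_rules add.commute del: eval.simps)
        let ?\<tau>2 = "\<tau>1\<lparr>regs := (regs \<tau>1)(25 := c, 12 := offset T g + 2 ^ l * c)\<rparr>"
        note store = wp_store_record[of ?\<tau>2 g "offset T g + 2 ^ l * c"]
        have u1: "u1 \<le> R div w + 2" using pr(1) by (rule spans_le)
        show ?thesis
          apply (simp add: e3 e4 del: eval.simps One_nat_def)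
          apply (rule wp_mono[OF store])
          subgoal using t1 by simp
          subgoal using t1 by simp
          subgoal using t1 by simp
          subgoal by simp
          subgoal by (rule g)
          subgoal by (rule recR)
          subgoal using I(4) t1 by simp
          apply (elim conjE exE)
          apply (intro wp_Seq wp_Assign)
          subgoal premises pr2 for u2 \<tau>3 A
          proof -
            let ?\<tau>4 = "\<tau>3\<lparr>regs := (regs \<tau>3)(28 := 1, 29 := 0)\<rparr>"
            have t3: "regs \<tau>3 25 = c" "regs \<tau>3 36 = offset T g" "regs \<tau>3 35 = g"
              using pr2 t1 by (simp_all add: agree_def)
            have ag3: "agree ?X \<sigma> \<tau>3" using pr2 ag1 by (simp add: agree_def)
            have skip: "wp skip_prog ?\<tau>4 (\<lambda>t \<upsilon>. t = 0 \<and> regs \<upsilon> 25 = 0 \<and>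
              regs \<upsilon> 28 = regs ?\<tau>4 28 * 4 ^ digits (T g) \<and> regs \<upsilon> 29 = regs ?\<tau>4 29 + leaves (T g) \<and>
              agree {25, 28, 29, 30} ?\<tau>4 \<upsilon> \<and> mem \<upsilon> = mem ?\<tau>4)"
            proof (rule wp_skip)
              show "regs ?\<tau>4 25 = enc (T g) 0" using t3 by (simp add: c_def)
              show "0 < regs ?\<tau>4 28" by simp
              show "regs ?\<tau>4 29 + leaves (T g) < 2 ^ W" using bnd by simp
              show "enc (T g) 0 < 2 ^ W" using cW by (simp add: c_def)
              show "4 * (regs ?\<tau>4 28 * 4 ^ digits (T g)) < 2 ^ W"
                using digits_bounds(1)[OF dig] by simp
            qed
            show ?thesis
              apply (simp add: eval_ConstI numbers del: eval.simps One_nat_def)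
              apply (rule wp_mono[OF skip])
              apply (elim conjE)
              apply (intro wp_Seq wp_Assign)
              subgoal premises pr3 for u3 \<tau>5
              proof -
                have t5: "regs \<tau>5 29 = leaves (T g)" "regs \<tau>5 36 = offset T g" "regs \<tau>5 35 = g"
                  using pr3 t3 by (simp_all add: agree_def)
                have e5: "eval W (regs \<tau>5) (Reg 36 [+] Reg 29) = offset T (Suc g)"
                  using t5 bnd offset_Suc[of T g] by (simp add: eval_rules del: eval.simps)
                have e6: "eval W ((regs \<tau>5)(36 := x)) (Reg 35 [+] Const 1) = g + 1" for x
                  using t5 bnd numbers by (simp add: eval_rules del: eval.simps One_nat_def)
                let ?\<rho> = "\<tau>5\<lparr>regs := (regs \<tau>5)(36 := offset T (Suc g), 35 := g + 1)\<rparr>"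
                have "agree ?X \<sigma> ?\<rho>" using pr3 ag3 by (simp add: agree_def)
                moreover have memS: "mem ?\<rho> Struct = A" "mem ?\<rho> Work = mem \<sigma> Work"
                  using pr2 pr3 t1 I(5) by simp_all
                moreover have "mem ?\<rho> b a < 2 ^ w" for b a
                  using memS pr2(4) mem by (cases b) simp_all
                moreover have "coded A T (?off (g + 1))"
                  unfolding coded_def
                proof (intro allI impI)
                  fix g' assume g': "g' < G"
                  have old: "field w (mem \<tau> Struct) (g' * R) R = ?off g g' + 2 ^ l * enc (T g') 0"
                    "?off g g' < 2 ^ l" "digits (T g') \<le> F" "fits F (T g')"
                    using I(6) g' unfolding coded_def by blast+
                  have new: "field w A (g' * R) R = (if g' = g then offset T g + 2 ^ l * c
                      else field w (mem \<tau> Struct) (g' * R) R)"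
                    using pr2 t1 by simp
                  show "field w A (g' * R) R = ?off (g + 1) g' + 2 ^ l * enc (T g') 0 \<and>
                    ?off (g + 1) g' < 2 ^ l \<and> digits (T g') \<le> F \<and> fits F (T g')"
                  proof (cases "g' = g")
                    case True
                    then show ?thesis using new off dig fits by (simp add: c_def)
                  next
                    case False
                    then have "?off (g + 1) g' = ?off g g'" by auto
                    then show ?thesis using old new False by (simp only: if_False simp_thms)
                  qed
                qed
                moreover have "t + (u1 + (u2 + u3)) \<le> ?D * (g + 1)"
                  using I(1) u1 pr2(1) pr3(1) by simp
                ultimately show ?thesis
                  using g by (simp add: e5 e6 g_def[symmetric] Suc_eq_plus1 diff_less_mono2 del: eval.simps One_nat_def)
              qed
              done
          qed
          done
      qed
      done
  next
    fix t \<tau>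
    assume Inv: "?Inv t \<tau>" and z: "eval W (regs \<tau>) (Reg 35 [<] Reg 6) = 0"
    have "\<not> regs \<tau> 35 < G" using cond[OF Inv] z by (simp del: eval.simps split: if_splits)
    then have "regs \<tau> 35 = G" using Inv by linarith
    then show "?Inv t \<tau> \<and> regs \<tau> 35 = G" using Inv by blast
  qed
  show ?thesis
    unfolding prefix_prog_def
    apply (intro wp_Seq wp_Assign)
    apply (simp add: eval_ConstI numbers del: eval.simps One_nat_def)
    apply (rule wp_mono[OF loop])
    subgoal premises pr for t \<tau>
    proof -
      from pr have Inv: "?Inv t \<tau>" and G35: "regs \<tau> 35 = G" by blast+
      have "sane A0 \<tau>" using ready'[OF Inv] Inv ins by (simp add: sane_def inserting_def)
      moreover have "coded (mem \<tau> Struct) T (offset T)"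
        using Inv unfolding G35 coded_def by simp
      moreover have "family \<tau> = family \<sigma>" using Inv unfolding agree_def by blast
      moreover have "t \<le> ?D * G" using Inv unfolding G35 by blast
      ultimately show ?thesis by simp
    qed
    done
qed

text \<open>Injectivity of \<open>q\<close> keeps later copies from overwriting earlier ones; the
  records are safe because the slots begin behind them.\<close>

lemma wp_place_all:
  assumes sane: "sane A0 \<sigma>" and len: "length xs = n" and coded: "coded (mem \<sigma> Struct) T off"
    and keys: "\<And>i. i < n \<Longrightarrow> key \<sigma> i < G * 2 ^ F"
  defines "q \<equiv> \<lambda>i. off (key \<sigma> i div 2 ^ F) + rank (T (key \<sigma> i div 2 ^ F)) (key \<sigma> i mod 2 ^ F)"
  assumes inj: "\<And>i j. i < n \<Longrightarrow> j < n \<Longrightarrow> q i = q j \<Longrightarrow> i = j"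
  shows "wp place_all_prog \<sigma> (\<lambda>t \<tau>. t \<le> (R div w + 11 + 4 * (k div w)) * n \<and> family \<tau> = family \<sigma> \<and>
    (\<forall>a. mem \<tau> Struct a < 2 ^ w) \<and> coded (mem \<tau> Struct) T off \<and>
    (\<forall>i<n. \<forall>j<k. mbit w (mem \<tau> Struct) (G * R + q i * k + j) = mbit w A0 (i * s + j)))"
proof -
  let ?D = "R div w + 11 + 4 * (k div w)"
  let ?X = "{10, 11, 12, 13, 14, 15, 16, 17, 19, 20, 21, 22, 23, 24, 25, 26, 27, 28, 29, 30} :: nat set"
  let ?Inv = "\<lambda>t \<tau>. t \<le> ?D * regs \<tau> 19 \<and> regs \<tau> 19 \<le> n \<and> agree ?X \<sigma> \<tau> \<and> (\<forall>b a. mem \<tau> b a < 2 ^ w) \<and>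
    mem \<tau> Work = mem \<sigma> Work \<and> coded (mem \<tau> Struct) T off \<and>
    (\<forall>i<regs \<tau> 19. \<forall>j<k. mbit w (mem \<tau> Struct) (G * R + q i * k + j) = mbit w A0 (i * s + j))"
  have ready: "ready \<sigma>" and mem: "\<And>b a. mem \<sigma> b a < 2 ^ w"
    and labels: "\<And>i. i < n * s \<Longrightarrow> mbit w (mem \<sigma> Work) i = mbit w A0 i" using sane by (auto simp: sane_def)
  have ready': "ready \<tau>" if "?Inv t \<tau>" for t \<tau>
  proof (rule ready_agree[OF ready])
    show "agree ?X \<sigma> \<tau>" using that by blast
  qed simp
  have nW: "n + 1 < 2 ^ W" using basic_le_B by (intro less_W) linarith
  have cond: "eval W (regs \<tau>) (Reg 19 [<] Reg 0) = of_bool (regs \<tau> 19 < n)" if Inv: "?Inv t \<tau>" for t \<tau>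
  proof -
    have "regs \<tau> 0 = n" using ready'[OF Inv] by (simp add: ready_def)
    moreover have "regs \<tau> 19 \<le> n" using Inv by blast
    ultimately show ?thesis using nW numbers by (simp add: eval_rules del: eval.simps)
  qed
  have loop: "wp (While (Reg 19 [<] Reg 0) (place_prog ;; Assign 19 (Reg 19 [+] Const 1)))
      (\<sigma>\<lparr>regs := (regs \<sigma>)(19 := 0)\<rparr>) (\<lambda>t \<tau>. ?Inv t \<tau> \<and> regs \<tau> 19 = n)"
  proof (rule wp_WhileI[where Inv = ?Inv and \<mu> = "\<lambda>\<tau>. n - regs \<tau> 19"])
    show "?Inv 0 (\<sigma>\<lparr>regs := (regs \<sigma>)(19 := 0)\<rparr>)" using mem coded by (simp add: agree_def)
  next
    fix t \<tau>
    assume Inv: "?Inv t \<tau>" and nz: "eval W (regs \<tau>) (Reg 19 [<] Reg 0) \<noteq> 0"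
    define i where "i = regs \<tau> 19"
    have I: "t \<le> ?D * i" "agree ?X \<sigma> \<tau>" "\<And>b a. mem \<tau> b a < 2 ^ w" "mem \<tau> Work = mem \<sigma> Work"
      "coded (mem \<tau> Struct) T off"
      "\<And>i' j. i' < i \<Longrightarrow> j < k \<Longrightarrow> mbit w (mem \<tau> Struct) (G * R + q i' * k + j) = mbit w A0 (i' * s + j)"
      using Inv unfolding i_def by blast+
    have i: "i < n" using cond[OF Inv] nz by (simp add: i_def del: eval.simps split: if_splits)
    have key: "key \<tau> i = key \<sigma> i" using I(2) by (simp add: agree_def)
    have "i < length xs" "i \<le> n" "key \<tau> i < G * 2 ^ F" using i len keys[OF i] by (simp_all add: key)
    note place = wp_place[OF ready'[OF Inv] i_def[symmetric] this I(3,5), unfolded key]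
    show "wp (place_prog ;; Assign 19 (Reg 19 [+] Const 1)) \<tau>
      (\<lambda>u \<upsilon>. ?Inv (t + u) \<upsilon> \<and> n - regs \<upsilon> 19 < n - regs \<tau> 19)"
      apply (intro wp_Seq)
      apply (rule wp_mono[OF place])
      apply (elim conjE exE)
      apply (rule wp_Assign)
      subgoal premises pr for u \<upsilon> A
      proof -
        have put: "put w (mem \<tau> Struct) (G * R + q i * k) k (\<lambda>j. mbit w (mem \<tau> Work) (i * s + j)) A"
          using pr(4) by (simp add: q_def)
        have r: "regs \<upsilon> 19 = i" using pr by (simp add: agree_def i_def)
        have iW: "i < 2 ^ W" "i + 1 < 2 ^ W" using i nW by linarith+
        have e: "eval W (regs \<upsilon>) (Reg 19 [+] Const 1) = i + 1"
          using r iW numbers by (simp add: eval_rules del: eval.simps One_nat_def)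
        let ?\<rho> = "\<upsilon>\<lparr>regs := (regs \<upsilon>)(19 := i + 1)\<rparr>"
        have "agree ?X \<sigma> ?\<rho>" using pr I(2) by (simp add: agree_def)
        moreover have memS: "mem ?\<rho> Struct = A" "mem ?\<rho> Work = mem \<sigma> Work" using pr I(4) by simp_all
        moreover have "mem ?\<rho> b a < 2 ^ w" for b a
          using memS mem put by (cases b) (simp_all add: put_def)
        moreover have "coded A T off" by (rule coded_put[OF put I(5)])
        moreover have "mbit w A (G * R + q i' * k + j) = mbit w A0 (i' * s + j)" if "i' < i + 1" "j < k" for i' j
        proof (cases "i' = i")
          case True
          \<comment> \<open>As \<open>k \<le> s\<close>, label \<open>i\<close> lies within the
            first \<open>n * s\<close> bits of \<open>Work\<close>, which the insertions have
            preserved.\<close>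
          have "Suc i * s \<le> n * s" using i by (intro mult_le_mono1) simp
          then have "i * s + j < n * s" using that k_le_s by simp
          then show ?thesis using slot_put[OF put that(2), of "q i"] labels I(4) True by simp
        next
          case False
          then have "i' < i" using that by simp
          moreover have "q i' \<noteq> q i" using inj[of i' i] False \<open>i' < i\<close> i by auto
          ultimately show ?thesis using slot_put[OF put that(2), of "q i'"] I(6) that(2) by simp
        qed
        moreover have "t + u \<le> ?D * (i + 1)" using I(1) pr(1) by simp
        ultimately show ?thesis
          using i by (simp add: e i_def[symmetric] del: eval.simps One_nat_def)
      qed
      done
  next
    fix t \<tau>
    assume Inv: "?Inv t \<tau>" and z: "eval W (regs \<tau>) (Reg 19 [<] Reg 0) = 0"
    have "\<not> regs \<tau> 19 < n" using cond[OF Inv] z by (simp del: eval.simps split: if_splits)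
    then have "regs \<tau> 19 = n" using Inv by linarith
    then show "?Inv t \<tau> \<and> regs \<tau> 19 = n" using Inv by blast
  qed
  show ?thesis
    unfolding place_all_prog_def
    apply (intro wp_Seq wp_Assign)
    apply (simp add: eval_ConstI numbers del: eval.simps One_nat_def)
    apply (rule wp_mono[OF loop])
    subgoal premises pr for t \<tau>
    proof -
      from pr have Inv: "?Inv t \<tau>" and n19: "regs \<tau> 19 = n" by blast+
      moreover have "family \<tau> = family \<sigma>" using Inv unfolding agree_def by blast
      moreover have "t \<le> ?D * n" using Inv unfolding n19 by blast
      ultimately show ?thesis by simp
    qed
    done
qed

end

section \<open>Correctness and cost\<close>

definition query_prog :: com where
  "query_prog = init_prog ;; fetch_prog"

definition update_prog :: com where
  "update_prog = init_prog ;; place_prog"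

section \<open>Labels in memory and the cut at the space bound\<close>

lemma bit_label_word:
  "bit (label_word w y j) i \<longleftrightarrow> i < w \<and> j * w + i < length y \<and> y ! (j * w + i)"
  by (auto simp: label_word_def bit_horner_sum_bit_iff)

lemma label_word_less: "label_word w y j < 2 ^ w"
  by (rule less_exp_if_bits) (simp add: bit_label_word)

lemma mbit_label_word: "0 < w \<Longrightarrow> mbit w (label_word w y) j \<longleftrightarrow> j < length y \<and> y ! j"
  by (simp add: mbit_def bit_label_word)

lemma nat_ceiling_divide:
  assumes "1 \<le> w"
  shows "nat \<lceil>real k / real w\<rceil> = (k + w - 1) div w"
proof -
  define L where "L = (k + w - 1) div w"
  have "k + w - 1 = L * w + (k + w - 1) mod w" by (simp add: L_def)
  moreover have "(k + w - 1) mod w < w" using assms by simp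
  ultimately have "k \<le> L * w" "L * w < k + w" using assms by linarith+
  then have "real k \<le> real L * real w" "real L * real w < real k + real w"
    by (simp_all flip: of_nat_mult of_nat_add)
  then have "real k / real w \<le> real L" "real L - 1 < real k / real w"
    using assms by (simp_all add: field_simps)
  then have "\<lceil>real k / real w\<rceil> = int L" by (intro ceiling_unique) simp_all
  then show ?thesis by (simp add: L_def)
qed

text \<open>Labels are padded to whole words, so in the memory seen as a bit string label
  \<open>i\<close> begins at \<open>i\<close> times the padded length.\<close>

lemma mbit_label_array:
  assumes "1 \<le> w" "i < length ys" "length (ys ! i) = k" "j < k"
  shows "mbit w (label_array k w ys) (i * ((k + w - 1) div w * w) + j) = ys ! i ! j"
proof -
  define L where "L = (k + w - 1) div w"
  have jL: "j div w < L"
  proof -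
    have "k + w - 1 = L * w + (k + w - 1) mod w" by (simp add: L_def)
    moreover have "(k + w - 1) mod w < w" using assms(1) by simp
    ultimately have "j < L * w" using assms(1,4) by linarith
    then show ?thesis by (rule less_mult_imp_div_less)
  qed
  have "i * (L * w) + j = (i * L) * w + j" by simp
  then have dm: "(i * (L * w) + j) div w = i * L + j div w" "(i * (L * w) + j) mod w = j mod w"
    using assms(1) by (simp_all only: div_mult_self3 mod_mult_self3)
  have "Suc i * L \<le> length ys * L" using assms(2) by (intro mult_le_mono1) simp
  then have "i * L + j div w < length ys * L" using jL by simp
  moreover have "(i * L + j div w) div L = i" "(i * L + j div w) mod L = j div w" using jL by simp_all
  ultimately have "label_array k w ys ((i * (L * w) + j) div w) = label_word w (ys ! i) (j div w)"
    unfolding dm label_array_def nat_ceiling_divide[OF assms(1)] L_def[symmetric] by (simp add: Let_def)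
  then show ?thesis
    using assms unfolding L_def[symmetric] mbit_def dm(2) by (simp add: bit_label_word)
qed

lemma label_array_less: "label_array k w ys a < 2 ^ w"
  by (simp add: label_array_def Let_def label_word_less)

lemma mbit_truncate_mem:
  assumes "0 < w"
  shows "mbit w (truncate_mem w sp A) i \<longleftrightarrow> i < sp \<and> mbit w A i"
proof -
  have "i mod w < sp - i div w * w \<longleftrightarrow> i < sp"
    using div_mult_mod_eq[of i w] by linarith
  moreover have "i mod w < w" using assms by simp
  ultimately show ?thesis
    by (simp add: mbit_def truncate_mem_def bit_take_bit_iff)
qed

lemma truncate_mem_less: "truncate_mem w sp A a < 2 ^ w"
proof -
  have "truncate_mem w sp A a < 2 ^ min w (sp - a * w)" by (simp add: truncate_mem_def)
  also have "\<dots> \<le> (2::nat) ^ w" by (intro power_increasing) auto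
  finally show ?thesis .
qed

text \<open>\<open>Work\<close> is zero before a query, so the bits behind the copied label vanish
  and the words are exactly those of a label.\<close>

lemma put_zero_label_word:
  assumes "put w (\<lambda>_. 0) 0 k v A"
  shows "A j = label_word w (map v [0..<k]) j"
proof (rule bit_eqI)
  fix i
  show "bit (A j) i = bit (label_word w (map v [0..<k]) j) i"
  proof (cases "i < w")
    case True
    have "bit (A j) i = mbit w A (j * w + i)" using mbit_inside[OF True, of A j] by simp
    also have "\<dots> = (j * w + i < k \<and> v (j * w + i))"
    proof -
      have "mbit w (\<lambda>_. 0) (j * w + i) = False" by (simp add: mbit_def)
      then show ?thesis using assms unfolding put_def by simp
    qed
    finally show ?thesis using True by (auto simp: bit_label_word)
  next
    case False
    have "A j < 2 ^ w" using assms by (simp add: put_def)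
    then show ?thesis using False bit_less_exp[of "A j" w i] by (auto simp: bit_label_word)
  qed
qed

context retrieval
begin

lemma key_less:
  assumes "h \<in> space hash_space"
  shows "h (e, 0, G * 2 ^ F, x) < G * 2 ^ F"
proof -
  have "0 < G * 2 ^ F" using G_pos by simp
  then show ?thesis
    using space_hash_space[THEN iffD1, OF assms, rule_format, of "(e, 0, G * 2 ^ F, x)"]
    by (simp add: hash_range_def)
qed

lemma wp_query:
  fixes e :: nat
  assumes h: "h \<in> space hash_space" and xs: "xs = [x]"
    and A: "\<And>a. A a < 2 ^ w" "coded A T (offset T)"
  defines "q \<equiv> slot F T (h (e, 0, G * 2 ^ F, x))"
  shows "wp query_prog (start n k w e A (\<lambda>_. 0)) (\<lambda>t \<tau>. t \<le> R div w + 11 + 4 * (k div w) \<and>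
    mem \<tau> Struct = A \<and>
    (\<forall>j. mem \<tau> Work j = label_word w (map (\<lambda>j. mbit w A (G * R + q * k + j)) [0..<k]) j))"
proof -
  let ?\<sigma> = "start n k w e A (\<lambda>_. 0)"
  have "wp init_prog ?\<sigma> (\<lambda>t \<tau>. t = 0 \<and> ready \<tau> \<and> agree {3, 4, 5, 6, 7, 8, 9, 10, 18} ?\<sigma> \<tau> \<and> mem \<tau> = mem ?\<sigma>)"
    by (rule wp_init) (simp_all add: start_def)
  then show ?thesis
    unfolding query_prog_def
  proof (intro wp_Seq, elim wp_mono)
    fix t :: nat and \<tau>
    assume \<tau>: "t = 0 \<and> ready \<tau> \<and> agree {3, 4, 5, 6, 7, 8, 9, 10, 18} ?\<sigma> \<tau> \<and> mem \<tau> = mem ?\<sigma>"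
    have fam: "family \<tau> = e" and r: "regs \<tau> 19 = 0" using \<tau> by (simp_all add: agree_def start_def)
    have memS: "mem \<tau> Struct = A" "mem \<tau> Work = (\<lambda>_. 0)" using \<tau> by (simp_all add: start_def)
    have ready: "ready \<tau>" using \<tau> by blast
    have key: "key \<tau> 0 = h (e, 0, G * 2 ^ F, x)" by (simp add: fam xs)
    have fetch: "wp fetch_prog \<tau> (\<lambda>t \<upsilon>. t \<le> R div w + 11 + 4 * (k div w) \<and>
      (\<exists>A'. mem \<upsilon> = (mem \<tau>)(Work := A') \<and> put w (mem \<tau> Work) 0 k (\<lambda>j. mbit w (mem \<tau> Struct) (G * R + q * k + j)) A'))"
      unfolding q_def slot_def key[symmetric]
    proof (rule wp_fetch[OF ready r])
      show "0 < length xs" by (simp add: xs)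
      show "key \<tau> 0 < G * 2 ^ F" unfolding key by (rule key_less[OF h])
      show "mem \<tau> b a < 2 ^ w" for b a using A(1) memS by (cases b) simp_all
      show "coded (mem \<tau> Struct) T (offset T)" using A(2) memS by simp
    qed simp
    show "wp fetch_prog \<tau> (\<lambda>u \<tau>'. t + u \<le> R div w + 11 + 4 * (k div w) \<and> mem \<tau>' Struct = A \<and>
      (\<forall>j. mem \<tau>' Work j = label_word w (map (\<lambda>j. mbit w A (G * R + q * k + j)) [0..<k]) j))"
      by (rule wp_mono[OF fetch]) (use \<tau> memS put_zero_label_word in auto)
  qed
qed

lemma wp_update:
  fixes e :: nat
  assumes h: "h \<in> space hash_space" and xs: "xs = [x]"
    and A: "\<And>a. A a < 2 ^ w" "coded A T (offset T)" and y: "length y = k"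
  defines "q \<equiv> slot F T (h (e, 0, G * 2 ^ F, x))"
  shows "wp update_prog (start n k w e A (label_word w y)) (\<lambda>t \<tau>. t \<le> R div w + 11 + 4 * (k div w) \<and>
    put w A (G * R + q * k) k (\<lambda>j. j < k \<and> y ! j) (mem \<tau> Struct))"
proof -
  let ?\<sigma> = "start n k w e A (label_word w y)"
  have "wp init_prog ?\<sigma> (\<lambda>t \<tau>. t = 0 \<and> ready \<tau> \<and> agree {3, 4, 5, 6, 7, 8, 9, 10, 18} ?\<sigma> \<tau> \<and> mem \<tau> = mem ?\<sigma>)"
    by (rule wp_init) (simp_all add: start_def)
  then show ?thesis
    unfolding update_prog_def
  proof (intro wp_Seq, elim wp_mono)
    fix t :: nat and \<tau>
    assume \<tau>: "t = 0 \<and> ready \<tau> \<and> agree {3, 4, 5, 6, 7, 8, 9, 10, 18} ?\<sigma> \<tau> \<and> mem \<tau> = mem ?\<sigma>"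
    have fam: "family \<tau> = e" and r: "regs \<tau> 19 = 0" using \<tau> by (simp_all add: agree_def start_def)
    have memS: "mem \<tau> Struct = A" "mem \<tau> Work = label_word w y" using \<tau> by (simp_all add: start_def)
    have ready: "ready \<tau>" using \<tau> by blast
    have key: "key \<tau> 0 = h (e, 0, G * 2 ^ F, x)" by (simp add: fam xs)
    have "wp place_prog \<tau> (\<lambda>t \<upsilon>. t \<le> R div w + 11 + 4 * (k div w) \<and>
      agree {10, 11, 12, 13, 14, 15, 16, 17, 20, 21, 22, 23, 24, 25, 26, 27, 28, 29, 30} \<tau> \<upsilon> \<and>
      (\<exists>A'. mem \<upsilon> = (mem \<tau>)(Struct := A') \<and> put w (mem \<tau> Struct) (G * R + q * k) k (\<lambda>j. mbit w (mem \<tau> Work) (0 * s + j)) A'))"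
      unfolding q_def slot_def key[symmetric]
    proof (rule wp_place[OF ready r])
      show "0 < length xs" by (simp add: xs)
      show "key \<tau> 0 < G * 2 ^ F" unfolding key by (rule key_less[OF h])
      show "mem \<tau> b a < 2 ^ w" for b a using A(1) memS label_word_less by (cases b) simp_all
      show "coded (mem \<tau> Struct) T (offset T)" using A(2) memS by simp
    qed simp
    moreover have "(\<lambda>j. mbit w (label_word w y) (0 * s + j)) = (\<lambda>j. j < k \<and> y ! j)"
      using w y by (simp add: mbit_label_word)
    ultimately show "wp place_prog \<tau> (\<lambda>u \<tau>'. t + u \<le> R div w + 11 + 4 * (k div w) \<and>
        put w A (G * R + q * k) k (\<lambda>j. j < k \<and> y ! j) (mem \<tau>' Struct))"
      using \<tau> memS by (elim wp_mono) auto
  qed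
qed

text \<open>The invariant under updates. The tries are functions of the hash values and thus fixed
  together with \<open>e\<close>; \<open>good e\<close> is included because it makes the slots of
  different elements distinct.\<close>

definition stored :: "nat \<Rightarrow> (nat \<Rightarrow> nat) \<Rightarrow> ('u \<Rightarrow> bool list) \<Rightarrow> bool" where
  "stored e A f \<longleftrightarrow> (\<forall>a. A a < 2 ^ w) \<and> good e \<and>
    (let T = tries F (hash_values h e (G * 2 ^ F) xs) in coded A T (offset T) \<and>
      (\<forall>x\<in>set xs. \<forall>j<k. mbit w A (G * R + slot F T (h (e, 0, G * 2 ^ F, x)) * k + j) = f x ! j))"

lemma good_slots:
  assumes h: "h \<in> space hash_space" and len: "length xs = n" and dist: "distinct xs" and e: "good e"
  defines "T \<equiv> tries F (hash_values h e (G * 2 ^ F) xs)" and "v \<equiv> \<lambda>x. h (e, 0, G * 2 ^ F, x)"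
  shows "offset T G = n" "\<And>x. x \<in> set xs \<Longrightarrow> slot F T (v x) < n"
    "\<And>x y. x \<in> set xs \<Longrightarrow> y \<in> set xs \<Longrightarrow> slot F T (v x) = slot F T (v y) \<Longrightarrow> x = y"
proof -
  let ?vs = "hash_values h e (G * 2 ^ F) xs"
  have M: "0 < G * 2 ^ F" using G_pos by simp
  have vs: "?vs \<in> words_over (G * 2 ^ F) n" using hash_values_mem[OF h M, of e xs] len by simp
  have dig: "digits (T g) \<le> F" if "g < G" for g
  proof (rule ccontr)
    assume "\<not> digits (T g) \<le> F"
    then have "F < digits (tries F ?vs g)" unfolding T_def by (rule not_le_imp_less)
    then have "?vs \<in> bad_words G F n" unfolding bad_words_def using vs that by blast
    then show False using e unfolding good_def by contradiction
  qed
  have gt: "distinct ?vs \<and> offset T G = length ?vs \<and>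
    (\<forall>v. has (T (v div 2 ^ F)) (v mod 2 ^ F) \<longleftrightarrow> v \<in> set ?vs)"
    unfolding T_def
  proof (rule good_tries)
    show "set ?vs \<subseteq> {..<G * 2 ^ F}" using vs by (simp add: words_over_def)
    show "digits (tries F ?vs g) \<le> F" if "g < G" for g using dig[OF that] by (simp only: T_def)
  qed
  have setvs: "set ?vs = v ` set xs" by (simp add: hash_values_def v_def)
  show off: "offset T G = n" using gt len by (simp add: hash_values_def)
  have has: "has (T (v x div 2 ^ F)) (v x mod 2 ^ F)" if "x \<in> set xs" for x
    using gt setvs that by blast
  show "slot F T (v x) < n" if "x \<in> set xs" for x
  proof -
    have "v x div 2 ^ F < G" using key_less[OF h] by (simp add: v_def less_mult_imp_div_less)
    from slot_less[of T "v x" F G, OF has[OF that] this] show ?thesis by (simp add: off)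
  qed
  show "x = y" if "x \<in> set xs" "y \<in> set xs" "slot F T (v x) = slot F T (v y)" for x y
  proof -
    have "v x = v y" by (rule slot_inj[OF has[OF that(1)] has[OF that(2)] that(3)])
    moreover have "inj_on v (set xs)"
      using gt dist by (simp add: hash_values_def distinct_map v_def)
    ultimately show ?thesis using that by (simp add: inj_on_def)
  qed
qed

text \<open>The records end at bit \<open>G * R\<close> and the slots of all elements are numbered
  below \<open>n\<close>, so nothing relevant is cut off.\<close>

lemma stored_truncate:
  assumes h: "h \<in> space hash_space" and len: "length xs = n" and dist: "distinct xs"
    and st: "stored e A f"
  shows "stored e (truncate_mem w (G * R + n * k) A) f"
proof -
  let ?A = "truncate_mem w (G * R + n * k) A" and ?T = "tries F (hash_values h e (G * 2 ^ F) xs)"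
  have e: "good e" using st by (simp add: stored_def)
  note slots = good_slots[OF h len dist e]
  have mb: "mbit w ?A i = mbit w A i" if "i < G * R + n * k" for i
    using that w by (simp add: mbit_truncate_mem)
  have "field w ?A (g * R) R = field w A (g * R) R" if "g < G" for g
  proof (rule field_cong)
    fix i assume "i < R"
    have "Suc g * R \<le> G * R" using that by (intro mult_le_mono1) simp
    then show "mbit w ?A (g * R + i) = mbit w A (g * R + i)" using \<open>i < R\<close> by (intro mb) simp
  qed
  then have "coded ?A ?T (offset ?T)" using st by (simp add: stored_def coded_def Let_def)
  moreover have "mbit w ?A (G * R + slot F ?T (h (e, 0, G * 2 ^ F, x)) * k + j)
      = mbit w A (G * R + slot F ?T (h (e, 0, G * 2 ^ F, x)) * k + j)" if "x \<in> set xs" "j < k" for x j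
  proof (rule mb)
    have "Suc (slot F ?T (h (e, 0, G * 2 ^ F, x))) * k \<le> n * k"
      using slots(2)[OF that(1)] by (intro mult_le_mono1) simp
    then show "G * R + slot F ?T (h (e, 0, G * 2 ^ F, x)) * k + j < G * R + n * k" using that(2) by simp
  qed
  ultimately show ?thesis
    using st truncate_mem_less by (simp add: stored_def Let_def)
qed

lemma stored_put:
  assumes h: "h \<in> space hash_space" and len: "length xs = n" and dist: "distinct xs"
    and st: "stored e A f" and x: "x \<in> set xs"
    and put: "put w A (G * R + slot F (tries F (hash_values h e (G * 2 ^ F) xs)) (h (e, 0, G * 2 ^ F, x)) * k) k
      (\<lambda>j. j < k \<and> y ! j) A'"
  shows "stored e A' (f(x := y))"
proof -
  let ?T = "tries F (hash_values h e (G * 2 ^ F) xs)"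
  have e: "good e" using st by (simp add: stored_def)
  have "coded A' ?T (offset ?T)"
    using coded_put[OF put] st by (simp add: stored_def Let_def)
  moreover have "mbit w A' (G * R + slot F ?T (h (e, 0, G * 2 ^ F, z)) * k + j) = (f(x := y)) z ! j"
    if "z \<in> set xs" "j < k" for z j
  proof (cases "z = x")
    case True
    then show ?thesis using slot_put[OF put that(2), of "slot F ?T (h (e, 0, G * 2 ^ F, x))"] that(2) by simp
  next
    case False
    then have "slot F ?T (h (e, 0, G * 2 ^ F, z)) \<noteq> slot F ?T (h (e, 0, G * 2 ^ F, x))"
      using good_slots(3)[OF h len dist e that(1) x] by blast
    then show ?thesis
      using slot_put[OF put that(2)] st that False by (simp add: stored_def Let_def)
  qed
  ultimately show ?thesis
    using put e by (simp add: stored_def Let_def put_def)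
qed

definition build_cost :: "nat \<Rightarrow> nat" where
  "build_cost e = e * attempt_cost + 3 * (R div w + 2) * G + (R div w + 11 + 4 * (k div w)) * n"

lemma wp_builder:
  assumes h: "h \<in> space hash_space" and len: "length xs = n" and dist: "distinct xs"
    and f: "\<And>x. x \<in> set xs \<Longrightarrow> length (f x) = k"
    and e: "1 \<le> e" "good e" "\<And>i. 1 \<le> i \<Longrightarrow> i < e \<Longrightarrow> \<not> good i"
  shows "wp builder_prog (start n k w 0 (\<lambda>_. 0) (label_array k w (map f xs)))
    (\<lambda>t \<tau>. t \<le> build_cost e \<and> family \<tau> = e \<and> stored e (mem \<tau> Struct) f)"
proof -
  let ?A0 = "label_array k w (map f xs)"
  let ?\<sigma> = "start n k w 0 (\<lambda>_. 0) ?A0"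
  let ?vs = "hash_values h e (G * 2 ^ F) xs"
  let ?T = "tries F ?vs"
  have init: "wp init_prog ?\<sigma> (\<lambda>t \<tau>. t = 0 \<and> ready \<tau> \<and> agree {3, 4, 5, 6, 7, 8, 9, 10, 18} ?\<sigma> \<tau> \<and> mem \<tau> = mem ?\<sigma>)"
    by (rule wp_init) (simp_all add: start_def)
  note slots = good_slots[OF h len dist e(2)]
  have total: "offset ?T G \<le> n" using slots(1) by simp
  have place: "wp place_all_prog \<tau> (\<lambda>t \<upsilon>. t \<le> (R div w + 11 + 4 * (k div w)) * n \<and> family \<upsilon> = e \<and>
      stored e (mem \<upsilon> Struct) f)"
    if \<tau>: "sane ?A0 \<tau>" "coded (mem \<tau> Struct) ?T (offset ?T)" "family \<tau> = e" for \<tau>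
  proof (rule wp_mono, rule wp_place_all[OF \<tau>(1) len \<tau>(2)])
    show "key \<tau> i < G * 2 ^ F" for i by (rule key_less[OF h])
    show "i = j" if "i < n" "j < n"
      "offset ?T (key \<tau> i div 2 ^ F) + rank (?T (key \<tau> i div 2 ^ F)) (key \<tau> i mod 2 ^ F)
        = offset ?T (key \<tau> j div 2 ^ F) + rank (?T (key \<tau> j div 2 ^ F)) (key \<tau> j mod 2 ^ F)" for i j
    proof -
      have "xs ! i = xs ! j"
        using slots(3)[of "xs ! i" "xs ! j"] that len by (simp add: slot_def \<tau>(3))
      then show ?thesis using dist that len by (simp add: nth_eq_iff_index_eq)
    qed
    fix t \<upsilon>
    assume *: "t \<le> (R div w + 11 + 4 * (k div w)) * n \<and> family \<upsilon> = family \<tau> \<and>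
      (\<forall>a. mem \<upsilon> Struct a < 2 ^ w) \<and> coded (mem \<upsilon> Struct) ?T (offset ?T) \<and>
      (\<forall>i<n. \<forall>j<k. mbit w (mem \<upsilon> Struct) (G * R +
        (offset ?T (key \<tau> i div 2 ^ F) + rank (?T (key \<tau> i div 2 ^ F)) (key \<tau> i mod 2 ^ F)) * k + j)
        = mbit w ?A0 (i * s + j))"
    have "mbit w (mem \<upsilon> Struct) (G * R + slot F ?T (h (e, 0, G * 2 ^ F, x)) * k + j) = f x ! j"
      if xj: "x \<in> set xs" "j < k" for x j
    proof -
      obtain i where i: "i < n" "x = xs ! i" using xj(1) len unfolding in_set_conv_nth by blast
      have "mbit w ?A0 (i * s + j) = map f xs ! i ! j"
        unfolding s by (rule mbit_label_array) (use w i len f xj in auto)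
      then show ?thesis using * i xj(2) len \<tau>(3) by (simp add: slot_def)
    qed
    then show "t \<le> (R div w + 11 + 4 * (k div w)) * n \<and> family \<upsilon> = e \<and> stored e (mem \<upsilon> Struct) f"
      using * \<tau>(3) e(2) by (simp add: stored_def Let_def)
  qed
  show ?thesis
    unfolding builder_prog_def
    apply (intro wp_Seq)
    apply (rule wp_mono[OF init])
    apply (elim conjE)
    apply (intro wp_Seq)
    subgoal premises pr for t1 \<tau>1
    proof -
      have mem1: "mem \<tau>1 b a < 2 ^ w" for b a
        using pr label_array_less by (cases b) (simp_all add: start_def)
      have "sane ?A0 \<tau>1" using pr(2,4) mem1 by (simp add: sane_def start_def)
      moreover have "family \<tau>1 = 0" using pr(3) by (simp add: agree_def start_def)
      ultimately have att: "wp attempts_prog \<tau>1 (\<lambda>t \<tau>. t \<le> e * attempt_cost \<and> family \<tau> = e \<and> inserting ?A0 \<tau> ?T)"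
        by (rule wp_attempts[OF h len _ _ e])
      show ?thesis
        apply (rule wp_mono[OF att])
        apply (elim conjE)
        apply (intro wp_Seq)
        subgoal premises pr2 for t2 \<tau>2
          apply (rule wp_mono[OF wp_prefix[OF pr2(3) total]])
          apply (elim conjE)
          subgoal premises pr3 for t3 \<tau>3
            apply (rule wp_mono[OF place[OF pr3(3,4)]])
            subgoal using pr2 pr3 by simp
            using pr(1) pr2(1) pr3(1) by (auto simp: build_cost_def)
          done
        done
    qed
    done
qed

lemma builder_halting:
  assumes h: "h \<in> space hash_space" and len: "length xs = n"
    and run: "exec w W h xs builder_prog (start n k w 0 (\<lambda>_. 0) (label_array k w (map f xs))) t \<tau>"
  shows "\<exists>e\<ge>1. good e"
proof -
  let ?A0 = "label_array k w (map f xs)"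
  let ?\<sigma> = "start n k w 0 (\<lambda>_. 0) ?A0"
  have init: "wp init_prog ?\<sigma> (\<lambda>t \<tau>. t = 0 \<and> ready \<tau> \<and> agree {3, 4, 5, 6, 7, 8, 9, 10, 18} ?\<sigma> \<tau> \<and> mem \<tau> = mem ?\<sigma>)"
    by (rule wp_init) (simp_all add: start_def)
  from run[unfolded builder_prog_def] obtain t1 \<sigma>1 t2 where
    1: "exec w W h xs init_prog ?\<sigma> t1 \<sigma>1" and
    2: "exec w W h xs (attempts_prog ;; prefix_prog ;; place_all_prog) \<sigma>1 t2 \<tau>" by (rule SeqE)
  from 2 obtain t3 \<sigma>2 where 3: "exec w W h xs attempts_prog \<sigma>1 t3 \<sigma>2" by (rule SeqE)
  have \<sigma>1: "ready \<sigma>1" "mem \<sigma>1 = mem ?\<sigma>" using wp_deterministic[OF init 1] by blast+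
  have "mem \<sigma>1 b a < 2 ^ w" for b a
    using \<sigma>1(2) label_array_less by (cases b) (simp_all add: start_def)
  then have "sane ?A0 \<sigma>1" using \<sigma>1 by (simp add: sane_def start_def)
  then show ?thesis by (rule attempts_halting[OF h len _ 3])
qed

end

text \<open>\<open>\<kappa>\<close> bounds \<open>l / w\<close> and depends only on \<gamma>, so the
  scheme is fixed before \<open>n\<close>, \<open>k\<close> and \<open>w\<close>. The number
  \<open>250 * \<kappa> + 14\<close> turns the width demanded by \<open>retrieval\<close> into a
  multiple of \<open>w + floorlog 2 k\<close>, where 14 absorbs \<open>4 * w + 10\<close>.\<close>

definition retrieval_scheme :: "nat \<Rightarrow> scheme" where
  "retrieval_scheme \<kappa> = \<lparr>builder = builder_prog, querier = query_prog, updater = update_prog,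
    reg_words = 250 * \<kappa> + 14,
    space_bits = (\<lambda>n k w. (n div floorlog 2 n + 1) * (65 * floorlog 2 n) + n * k)\<rparr>"

text \<open>\<open>1 / \<gamma>\<close> words have room for \<open>log 2 n\<close> bits, and one
  more word absorbs the rounding in \<open>floorlog\<close>.\<close>

lemma floorlog_le_words:
  fixes \<gamma> :: real
  assumes "\<gamma> > 0" "1 \<le> n" "1 \<le> w" "\<gamma> * log 2 (real n) \<le> real w"
  shows "floorlog 2 n \<le> (nat \<lceil>1 / \<gamma>\<rceil> + 1) * w"
proof -
  have "real (floorlog 2 n) \<le> log 2 (real n) + 1"
    using assms(2) by (simp add: floorlog_def)
  also have "log 2 (real n) \<le> 1 / \<gamma> * real w"
    using assms(1,4) by (simp add: field_simps)
  also have "1 / \<gamma> * real w \<le> real (nat \<lceil>1 / \<gamma>\<rceil>) * real w"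
    by (intro mult_right_mono) linarith+
  also have "real (nat \<lceil>1 / \<gamma>\<rceil>) * real w + 1 \<le> real ((nat \<lceil>1 / \<gamma>\<rceil> + 1) * w)"
    using assms(3) by (simp add: algebra_simps)
  finally show ?thesis unfolding of_nat_le_iff by simp
qed

lemma retrieval_scheme_params:
  assumes "1 \<le> n" "1 \<le> w" "floorlog 2 n \<le> \<kappa> * w"
  shows "retrieval w (reg_width (retrieval_scheme \<kappa>) k w) n k (floorlog 2 n) (32 * floorlog 2 n)
    (65 * floorlog 2 n) (n div floorlog 2 n + 1) ((k + w - 1) div w * w)"
proof
  have "250 * floorlog 2 n + 4 * w + 4 * floorlog 2 k + 10 \<le> 250 * (\<kappa> * w) + 14 * w + 14 * floorlog 2 k"
    using assms by linarith
  also have "\<dots> \<le> (250 * \<kappa> + 14) * (w + floorlog 2 k)" by (simp add: algebra_simps)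
  finally show "250 * floorlog 2 n + 4 * w + 4 * floorlog 2 k + 10 \<le> reg_width (retrieval_scheme \<kappa>) k w"
    by (simp add: reg_width_def retrieval_scheme_def)
qed (use assms in simp_all)

text \<open>Reading the record costs \<open>R div w + 3\<close> accesses including the hash
  evaluation, copying the label \<open>4 * (k div w) + 8\<close>; since \<open>R = 65 * l\<close>,
  the first part is constant.\<close>

lemma real_access_bound:
  assumes "1 \<le> w" "l \<le> \<kappa> * w" "t \<le> 65 * l div w + 11 + 4 * (k div w)"
  shows "real t \<le> 4 * (real k / real w) + real (65 * \<kappa> + 11)"
proof -
  have "65 * l div w \<le> 65 * (\<kappa> * w) div w" using assms(2) by (intro div_le_mono) simp
  also have "\<dots> = 65 * \<kappa>" using assms(1) by simp
  finally have "real t \<le> real (65 * \<kappa> + 11 + 4 * (k div w))" using assms(3) by linarith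
  also have "\<dots> \<le> 4 * (real k / real w) + real (65 * \<kappa> + 11)"
    using of_nat_div_le_of_nat[of k w, where 'a = real] by simp
  finally show ?thesis .
qed

context retrieval
begin

text \<open>The cost is governed by the first good family, which is at most
  \<open>e\<close>.\<close>

lemma exec_builder:
  assumes "h \<in> space hash_space" "length xs = n" "distinct xs" "\<And>x. x \<in> set xs \<Longrightarrow> length (f x) = k"
    and "1 \<le> e" "good e"
  shows "\<exists>t \<tau>. exec w W h xs builder_prog (start n k w 0 (\<lambda>_. 0) (label_array k w (map f xs))) t \<tau> \<and>
    t \<le> build_cost e"
proof -
  define e' where "e' = (LEAST e. 1 \<le> e \<and> good e)"
  have e': "1 \<le> e'" "good e'" "e' \<le> e"
    using LeastI[of "\<lambda>e. 1 \<le> e \<and> good e" e] Least_le[of "\<lambda>e. 1 \<le> e \<and> good e" e] assms(5,6)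
    by (simp_all add: e'_def)
  have first: "\<not> good i" if "1 \<le> i" "i < e'" for i
    using not_less_Least[of i "\<lambda>e. 1 \<le> e \<and> good e"] that by (auto simp: e'_def)
  have "build_cost e' \<le> build_cost e" using e'(3) by (simp add: build_cost_def)
  then show ?thesis
    using wp_builder[OF assms(1-4) e'(1,2) first] unfolding wp_def by (meson le_trans)
qed

lemma builder_stored:
  assumes "h \<in> space hash_space" "length xs = n" "distinct xs" "\<And>x. x \<in> set xs \<Longrightarrow> length (f x) = k"
    and run: "exec w W h xs builder_prog (start n k w 0 (\<lambda>_. 0) (label_array k w (map f xs))) t \<tau>"
  shows "stored (family \<tau>) (mem \<tau> Struct) f"
proof -
  define e where "e = (LEAST e. 1 \<le> e \<and> good e)"
  have e: "1 \<le> e" "good e"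
    using LeastI_ex[of "\<lambda>e. 1 \<le> e \<and> good e"] builder_halting[OF assms(1,2) run] by (auto simp: e_def)
  have first: "\<not> good i" if "1 \<le> i" "i < e" for i
    using not_less_Least[of i "\<lambda>e. 1 \<le> e \<and> good e"] that by (auto simp: e_def)
  show ?thesis
    using wp_deterministic[OF wp_builder[OF assms(1-4) e first] run] by blast
qed

lemma represents_stored:
  assumes W: "W = reg_width (retrieval_scheme \<kappa>) k w"
    and h: "h \<in> space hash_space" and len: "length xs = n" and dist: "distinct xs"
    and f: "\<And>x. x \<in> set xs \<Longrightarrow> length (f x) = k"
    and rep: "represents (retrieval_scheme \<kappa>) k w h xs f e A g"
  shows "stored e A g \<and> (\<forall>x\<in>set xs. length (g x) = k)"
  using rep
proof (induction rule: represents.induct)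
  have space: "space_bits (retrieval_scheme \<kappa>) (length xs) k w = G * R + n * k"
    by (simp add: retrieval_scheme_def len G R l)
  {
    case (built t \<sigma>)
    then have "exec w W h xs builder_prog (start n k w 0 (\<lambda>_. 0) (label_array k w (map f xs))) t \<sigma>"
      by (simp add: build_run_def W retrieval_scheme_def len)
    from builder_stored[OF h len dist f this] show ?case
      unfolding space using stored_truncate[OF h len dist] f by blast
  next
    case (updated e A g x y t \<sigma>)
    \<comment> \<open>An operation is given the single element \<open>x\<close>, so the locale is
      instantiated anew for the list \<open>[x]\<close> with the same parameters.\<close>
    interpret U: retrieval w W h "[x]" n k l F R G s ..
    let ?T = "tries F (hash_values h e (G * 2 ^ F) xs)"
    have st: "stored e A g" using updated.IH by blast
    then have A: "A a < 2 ^ w" "coded A ?T (offset ?T)" for a by (simp_all add: stored_def Let_def)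
    have run: "exec w W h [x] update_prog (start n k w e A (label_word w y)) t \<sigma>"
      using updated.hyps(4) by (simp add: update_run_def W retrieval_scheme_def len)
    have "put w A (G * R + slot F ?T (h (e, 0, G * 2 ^ F, x)) * k) k (\<lambda>j. j < k \<and> y ! j) (mem \<sigma> Struct)"
      using U.wp_deterministic[OF U.wp_update[OF h refl A updated.hyps(3)] run] by blast
    note stored_truncate[OF h len dist stored_put[OF h len dist st updated.hyps(2) this]]
    moreover have "\<forall>z\<in>set xs. length ((g(x := y)) z) = k" using updated.IH updated.hyps(3) by simp
    ultimately show ?case unfolding space by (rule conjI)
  }
qed

lemma query_run_ok:
  assumes W: "W = reg_width (retrieval_scheme \<kappa>) k w"
    and h: "h \<in> space hash_space" and st: "stored e A g" and g: "\<forall>x\<in>set xs. length (g x) = k"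
  shows "\<exists>t \<sigma> y. query_run (retrieval_scheme \<kappa>) n k w h e A x t \<sigma> \<and> t \<le> R div w + 11 + 4 * (k div w) \<and>
    mem \<sigma> Struct = A \<and> length y = k \<and> (\<forall>j. mem \<sigma> Work j = label_word w y j) \<and> (x \<in> set xs \<longrightarrow> y = g x)"
proof -
  interpret U: retrieval w W h "[x]" n k l F R G s ..
  let ?T = "tries F (hash_values h e (G * 2 ^ F) xs)"
  let ?y = "map (\<lambda>j. mbit w A (G * R + slot F ?T (h (e, 0, G * 2 ^ F, x)) * k + j)) [0..<k]"
  have A: "A a < 2 ^ w" "coded A ?T (offset ?T)" for a using st by (simp_all add: stored_def Let_def)
  have "?y = g x" if "x \<in> set xs"
    using st g that by (intro nth_equalityI) (simp_all add: stored_def Let_def)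
  moreover obtain t \<sigma> where "exec w W h [x] query_prog (start n k w e A (\<lambda>_. 0)) t \<sigma>"
    "t \<le> R div w + 11 + 4 * (k div w)" "mem \<sigma> Struct = A" "\<forall>j. mem \<sigma> Work j = label_word w ?y j"
    using U.wp_query[OF h refl A] unfolding U.wp_def by blast
  ultimately show ?thesis
    by (intro exI[of _ t] exI[of _ \<sigma>] exI[of _ ?y]) (simp add: query_run_def W retrieval_scheme_def)
qed

lemma update_run_ok:
  assumes W: "W = reg_width (retrieval_scheme \<kappa>) k w"
    and h: "h \<in> space hash_space" and st: "stored e A g" and y: "length y = k"
  shows "\<exists>t \<sigma>. update_run (retrieval_scheme \<kappa>) n k w h e A x y t \<sigma> \<and> t \<le> R div w + 11 + 4 * (k div w)"
proof -
  interpret U: retrieval w W h "[x]" n k l F R G s ..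
  let ?T = "tries F (hash_values h e (G * 2 ^ F) xs)"
  have A: "A a < 2 ^ w" "coded A ?T (offset ?T)" for a using st by (simp_all add: stored_def Let_def)
  obtain t \<sigma> where "exec w W h [x] update_prog (start n k w e A (label_word w y)) t \<sigma>"
    "t \<le> R div w + 11 + 4 * (k div w)"
    using U.wp_update[OF h refl A y, where e = e] unfolding U.wp_def by blast
  then show ?thesis
    by (intro exI[of _ t] exI[of _ \<sigma>]) (simp add: update_run_def W retrieval_scheme_def)
qed

end

section \<open>Probability of success and construction cost\<close>

lemma bad_probability:
  fixes xs :: "'u list"
  assumes ret: "retrieval w W n k l F R G s" and len: "length xs = n" and dist: "distinct xs"
  defines "Z \<equiv> \<lambda>E. {h \<in> space hash_space. \<forall>e\<in>{1..E}. \<not> retrieval.good h xs n F G e} :: 'u hash set"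
  shows "Z E \<in> sets hash_space" "measure hash_space (Z E) \<le> ((1/32) ^ l) ^ E"
proof -
  interpret P: retrieval w W undefined xs n k l F R G s by (rule ret)
  let ?M = "G * 2 ^ F"
  have M: "0 < ?M" using P.G_pos by simp
  have bad: "bad_words G F n \<subseteq> words_over ?M (length xs)" by (auto simp: bad_words_def len)
  have Z: "Z E = {h \<in> space hash_space. \<forall>e\<in>{1..E}. hash_values h e ?M xs \<in> bad_words G F n}"
  proof -
    have "retrieval.good h xs n F G e \<longleftrightarrow> hash_values h e ?M xs \<notin> bad_words G F n" for h e
    proof -
      interpret Q: retrieval w W h xs n k l F R G s by (rule ret)
      show ?thesis by (rule Q.good_def)
    qed
    then show ?thesis by (simp add: Z_def)
  qed
  show "Z E \<in> sets hash_space" unfolding Z by (rule prob_all_hash_values_in[OF dist M bad])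
  have "real (card (bad_words G F n)) \<le> (1/32) ^ l * real (?M ^ n)"
    by (rule card_bad_words[OF P.n P.l P.G P.F])
  moreover have "0 < real (?M ^ n)" using M by simp
  ultimately have "real (card (bad_words G F n)) / real (?M ^ n) \<le> (1/32) ^ l"
    by (simp add: divide_le_eq)
  then show "measure hash_space (Z E) \<le> ((1/32) ^ l) ^ E"
    unfolding Z prob_all_hash_values_in(2)[OF dist M bad] len by (intro power_mono) simp_all
qed

text \<open>The hash functions without a good family lie in the failure event of the first
  \<open>E\<close> attempts for every \<open>E\<close>, and \<open>(1/32) ^ E\<close> tends to
  0.\<close>

lemma AE_good:
  fixes xs :: "'u list"
  assumes ret: "retrieval w W n k l F R G s" and len: "length xs = n" and dist: "distinct xs"
  shows "AE h in hash_space. \<exists>e\<ge>1. retrieval.good h xs n F G e"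
proof -
  interpret prob_space "hash_space :: 'u hash measure" by (rule prob_space_hash_space)
  interpret P: retrieval w W undefined xs n k l F R G s by (rule ret)
  define Z where "Z = (\<lambda>E. {h \<in> space hash_space. \<forall>e\<in>{1..E}. \<not> retrieval.good h xs n F G e} :: 'u hash set)"
  have Z: "Z E \<in> sets hash_space" "measure hash_space (Z E) \<le> ((1/32) ^ l) ^ E" for E
    unfolding Z_def by (rule bad_probability[OF ret len dist])+
  let ?N = "\<Inter>E. Z E"
  have N: "?N \<in> sets hash_space" using Z(1) by (intro sets.countable_INT) auto
  have "(1/32 :: real) ^ l \<le> (1/32) ^ 1" using P.l_pos by (intro power_decreasing) simp_all
  then have "measure hash_space ?N \<le> (1/32) ^ E" for E
  proof -
    have "measure hash_space ?N \<le> measure hash_space (Z E)"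
      using Z(1) by (intro finite_measure_mono) auto
    also have "\<dots> \<le> ((1/32) ^ l) ^ E" by (rule Z(2))
    also have "\<dots> \<le> (1/32) ^ E" using \<open>(1/32 :: real) ^ l \<le> (1/32) ^ 1\<close> by (intro power_mono) simp_all
    finally show ?thesis .
  qed
  moreover have "(\<lambda>E. (1/32 :: real) ^ E) \<longlonglongrightarrow> 0" by (intro LIMSEQ_power_zero) simp
  ultimately have "measure hash_space ?N \<le> 0" by (meson LIMSEQ_le_const)
  then have "emeasure hash_space ?N = 0"
    by (simp add: emeasure_eq_measure measure_le_0_iff)
  then show ?thesis
    using N by (intro AE_I[of _ _ ?N]) (auto simp: Z_def)
qed

text \<open>With \<open>R div w + 2 \<le> d\<close> and \<open>G \<le> 2 * n\<close>, an attempt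
  costs at most \<open>(1 + 4 + 9) * d * n\<close>, the prefix sums \<open>6 * d * n\<close> and the
  placement \<open>10 * d * n\<close> plus four accesses per whole word of a label. The maximum with
  1 accounts for labels shorter than a word.\<close>

lemma (in retrieval) build_cost_bound:
  assumes "l \<le> \<kappa> * w"
  shows "real (build_cost e) \<le> real ((14 * e + 20) * (65 * \<kappa> + 2)) * real n * max 1 (real k / real w)"
proof -
  define d where "d = 65 * \<kappa> + 2"
  have "R div w \<le> 65 * (\<kappa> * w) div w" unfolding R using assms by (intro div_le_mono) simp
  also have "\<dots> = 65 * \<kappa>" using w by simp
  finally have D: "R div w + 2 \<le> d" by (simp add: d_def)
  have "n div l \<le> n" by simp
  then have G2: "G \<le> 2 * n" using n unfolding G by linarith
  have dn: "1 \<le> d" "1 * 1 \<le> d * n" using n by (simp_all add: d_def)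
  have DG: "(R div w + 2) * G \<le> d * (2 * n)" by (intro mult_le_mono D G2)
  have Dn: "(R div w + 2) * n \<le> d * n" by (intro mult_le_mono1 D)
  have "attempt_cost = 1 + 2 * ((R div w + 2) * G) + 9 * ((R div w + 2) * n)"
    unfolding attempt_cost_def by (simp only: mult.assoc)
  then have att: "attempt_cost \<le> 14 * (d * n)" using DG Dn dn(2) by linarith
  have "(R div w + 11 + 4 * (k div w)) * n = (R div w + 2) * n + 9 * n + 4 * ((k div w) * n)"
    by (simp add: algebra_simps)
  moreover have "1 * n \<le> d * n" using dn(1) by (rule mult_le_mono1)
  ultimately have pl: "(R div w + 11 + 4 * (k div w)) * n \<le> 10 * (d * n) + 4 * ((k div w) * n)"
    using Dn by linarith
  have "build_cost e \<le> e * (14 * (d * n)) + 3 * (d * (2 * n)) + (10 * (d * n) + 4 * ((k div w) * n))"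
    unfolding build_cost_def mult.assoc[of 3]
    by (intro add_mono mult_le_mono2 att DG pl)
  also have "\<dots> = (14 * e + 16) * d * n + 4 * ((k div w) * n)" by (simp add: algebra_simps)
  finally have "real (build_cost e) \<le> real ((14 * e + 16) * d * n + 4 * ((k div w) * n))"
    unfolding of_nat_le_iff .
  also have "\<dots> = real ((14 * e + 16) * d) * real n + 4 * (real (k div w) * real n)" by simp
  also have "\<dots> \<le> real ((14 * e + 16) * d) * real n * max 1 (real k / real w)
      + 4 * (real d * real n * max 1 (real k / real w))"
  proof (intro add_mono mult_left_mono)
    have "real ((14 * e + 16) * d) * real n * 1 \<le> real ((14 * e + 16) * d) * real n * max 1 (real k / real w)"
      by (intro mult_left_mono) auto
    then show "real ((14 * e + 16) * d) * real n \<le> real ((14 * e + 16) * d) * real n * max 1 (real k / real w)"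
      by simp
    have "real (k div w) \<le> max 1 (real k / real w)"
      using of_nat_div_le_of_nat[of k w, where 'a = real] by simp
    also have "\<dots> \<le> real d * max 1 (real k / real w)"
      using dn(1) by (simp add: mult_le_cancel_right1)
    finally have "real (k div w) * real n \<le> real d * max 1 (real k / real w) * real n"
      by (intro mult_right_mono) auto
    then show "real (k div w) * real n \<le> real d * real n * max 1 (real k / real w)" by (simp only: mult_ac)
  qed simp
  also have "\<dots> = real ((14 * e + 20) * d) * real n * max 1 (real k / real w)" by (simp add: algebra_simps)
  finally show ?thesis unfolding d_def .
qed

theorem theorem3:
  fixes \<gamma> :: real
  assumes "\<gamma> > 0"
  shows "\<exists>(S :: scheme) (a :: real) (b :: real) (\<epsilon> :: nat \<Rightarrow> real).
    \<epsilon> \<longlonglongrightarrow> 0 \<and>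
    (\<forall>n k w (D :: 'u set) xs f. retrieval_instance \<gamma> n k w D xs f \<longrightarrow>
      (AE h in hash_space. \<exists>t \<sigma>. build_run S k w h xs f t \<sigma>) \<and>
      (\<forall>h\<in>space hash_space. \<forall>e A g. represents S k w h xs f e A g \<longrightarrow>
        (\<forall>x. \<exists>t \<sigma> y. query_run S n k w h e A x t \<sigma> \<and>
          real t \<le> 4 * (real k / real w) + a \<and>
          mem \<sigma> Struct = A \<and>
          length y = k \<and> (\<forall>j. j * w < k \<longrightarrow> mem \<sigma> Work j = label_word w y j) \<and>
          (x \<in> D \<longrightarrow> y = g x)) \<and>
        (\<forall>x\<in>D. \<forall>y. length y = k \<longrightarrow>
          (\<exists>t \<sigma>. update_run S n k w h e A x y t \<sigma> \<and> real t \<le> 4 * (real k / real w) + a)))) \<and>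
    (\<forall>c>0. \<exists>C. \<forall>n k w (D :: 'u set) xs f. retrieval_instance \<gamma> n k w D xs f \<longrightarrow>
      measure hash_space {h \<in> space hash_space. \<exists>t \<sigma>. build_run S k w h xs f t \<sigma> \<and>
          real t \<le> C * real n * max 1 (real k / real w)}
        \<ge> 1 - 1 / real n powr c) \<and>
    (\<forall>n k w. 1 \<le> n \<and> 1 \<le> w \<and> \<gamma> * log 2 (real n) \<le> real w \<longrightarrow>
      real (space_bits S n k w) \<le> (1 + \<epsilon> n) * real n * real k + b * real n)"
proof -
  define \<kappa> where "\<kappa> = nat \<lceil>1 / \<gamma>\<rceil> + 1"
  let ?S = "retrieval_scheme \<kappa>"
  let ?a = "real (65 * \<kappa> + 11)"
  let ?F = "\<lambda>n. 32 * floorlog 2 n" and ?G = "\<lambda>n. n div floorlog 2 n + 1"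
  have small: "floorlog 2 n \<le> \<kappa> * w" if "1 \<le> n" "1 \<le> w" "\<gamma> * log 2 (real n) \<le> real w" for n w
    unfolding \<kappa>_def by (rule floorlog_le_words[OF assms that])
  have inst: "floorlog 2 n \<le> \<kappa> * w" "1 \<le> n" "1 \<le> w"
    "retrieval w (reg_width ?S k w) n k (floorlog 2 n) (?F n) (65 * floorlog 2 n) (?G n) ((k + w - 1) div w * w)"
    "length xs = n" "distinct xs" "set xs = D" "\<And>x. x \<in> set xs \<Longrightarrow> length (f x) = k"
    if "retrieval_instance \<gamma> n k w D xs f" for n k w and D :: "'u set" and xs f
  proof -
    show b: "1 \<le> n" "1 \<le> w" "floorlog 2 n \<le> \<kappa> * w" "distinct xs" "set xs = D"
      "\<And>x. x \<in> set xs \<Longrightarrow> length (f x) = k"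
      using that small[of n w] by (auto simp: retrieval_instance_def)
    show "length xs = n" using that distinct_card[of xs] by (simp add: retrieval_instance_def)
    show "retrieval w (reg_width ?S k w) n k (floorlog 2 n) (?F n) (65 * floorlog 2 n) (?G n) ((k + w - 1) div w * w)"
      by (rule retrieval_scheme_params[OF b(1-3)])
  qed
  have build: "\<exists>t \<sigma>. build_run ?S k w h xs f t \<sigma> \<and>
      real t \<le> real ((14 * e + 20) * (65 * \<kappa> + 2)) * real n * max 1 (real k / real w)"
    if ri: "retrieval_instance \<gamma> n k w D xs f" and h: "h \<in> space hash_space"
      and e: "1 \<le> e" "retrieval.good h xs n (?F n) (?G n) e"
    for n k w and D :: "'u set" and xs f and h :: "'u hash" and e
  proof -
    note I = inst[OF ri]
    interpret P: retrieval w "reg_width ?S k w" h xs n k "floorlog 2 n" "?F n" "65 * floorlog 2 n" "?G n"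
      "(k + w - 1) div w * w" by (rule I(4))
    obtain t \<tau> where "exec w (reg_width ?S k w) h xs builder_prog
        (start n k w 0 (\<lambda>_. 0) (label_array k w (map f xs))) t \<tau>" and t: "t \<le> P.build_cost e"
      using P.exec_builder[where f = f, OF h I(5,6,8) e] by blast
    then have "build_run ?S k w h xs f t \<tau>"
      by (simp add: build_run_def retrieval_scheme_def I(5))
    moreover have "real t \<le> real ((14 * e + 20) * (65 * \<kappa> + 2)) * real n * max 1 (real k / real w)"
      using of_nat_mono[OF t] P.build_cost_bound[OF I(1), of e] by (rule order_trans)
    ultimately show ?thesis by blast
  qed
  show ?thesis
  \<comment> \<open>The slots take exactly \<open>n * k\<close> bits, so the vanishing term is 0 and
    \<open>b = 130\<close> pays for the records. The constant \<open>65 * \<kappa> + 11\<close> pays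
    for the lookup and for the partial words at both ends of a label.\<close>
  proof (rule exI[of _ ?S], rule exI[of _ ?a], rule exI[of _ 130], rule exI[of _ "\<lambda>_. 0"],
      intro conjI allI impI ballI)
    show "(\<lambda>_. 0 :: real) \<longlonglongrightarrow> 0" by simp
  next
    fix n k w and D :: "'u set" and xs f
    assume ri: "retrieval_instance \<gamma> n k w D xs f"
    note I = inst[OF ri]
    show "AE h in hash_space. \<exists>t \<sigma>. build_run ?S k w h xs f t \<sigma>"
      using AE_good[OF I(4-6)]
    proof (rule AE_mp, intro AE_I2 impI)
      fix h :: "'u hash"
      assume "h \<in> space hash_space" "\<exists>e\<ge>1. retrieval.good h xs n (?F n) (?G n) e"
      then show "\<exists>t \<sigma>. build_run ?S k w h xs f t \<sigma>" using build[OF ri] by blast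
    qed
    fix h :: "'u hash" and e A g
    assume h: "h \<in> space hash_space" and rep: "represents ?S k w h xs f e A g"
    interpret P: retrieval w "reg_width ?S k w" h xs n k "floorlog 2 n" "?F n" "65 * floorlog 2 n" "?G n"
      "(k + w - 1) div w * w" by (rule I(4))
    have st: "P.stored e A g" "\<forall>x\<in>set xs. length (g x) = k"
      using P.represents_stored[where f = f, OF refl h I(5,6,8) rep] by blast+
    note bound = real_access_bound[OF I(3,1)]
    show "\<exists>t \<sigma> y. query_run ?S n k w h e A x t \<sigma> \<and> real t \<le> 4 * (real k / real w) + ?a \<and>
      mem \<sigma> Struct = A \<and> length y = k \<and> (\<forall>j. j * w < k \<longrightarrow> mem \<sigma> Work j = label_word w y j) \<and>
      (x \<in> D \<longrightarrow> y = g x)" for x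
    proof -
      obtain t \<sigma> y where "query_run ?S n k w h e A x t \<sigma>" "t \<le> 65 * floorlog 2 n div w + 11 + 4 * (k div w)"
        "mem \<sigma> Struct = A" "length y = k" "\<forall>j. mem \<sigma> Work j = label_word w y j" "x \<in> set xs \<longrightarrow> y = g x"
        using P.query_run_ok[OF refl h st, of x] by blast
      with bound[of t k] I(7) show ?thesis by blast
    qed
    show "\<exists>t \<sigma>. update_run ?S n k w h e A x y t \<sigma> \<and> real t \<le> 4 * (real k / real w) + ?a"
      if "x \<in> D" and y: "length y = k" for x y
    proof -
      obtain t \<sigma> where "update_run ?S n k w h e A x y t \<sigma>" "t \<le> 65 * floorlog 2 n div w + 11 + 4 * (k div w)"
        using P.update_run_ok[OF refl h st(1) y, of x] by blast
      with bound[of t k] show ?thesis by blast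
    qed
  next
    fix c :: real
    assume c: "0 < c"
    \<comment> \<open>One attempt fails with probability at most \<open>1 / n\<close>, so
      \<open>E \<ge> c\<close> independent attempts reach the exponent \<open>c\<close>, at a cost
      still linear in \<open>n\<close>.\<close>
    define E where "E = nat \<lceil>c\<rceil>"
    have E: "1 \<le> E" "c \<le> real E" using c by (simp_all add: E_def Suc_le_eq)
    let ?C = "real ((14 * E + 20) * (65 * \<kappa> + 2))"
    show "\<exists>C. \<forall>n k w (D :: 'u set) xs f. retrieval_instance \<gamma> n k w D xs f \<longrightarrow>
      measure hash_space {h \<in> space hash_space. \<exists>t \<sigma>. build_run ?S k w h xs f t \<sigma> \<and>
          real t \<le> C * real n * max 1 (real k / real w)} \<ge> 1 - 1 / real n powr c"
    proof (intro exI[of _ ?C] allI impI)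
      fix n k w and D :: "'u set" and xs f
      assume ri: "retrieval_instance \<gamma> n k w D xs f"
      note I = inst[OF ri]
      interpret prob_space "hash_space :: 'u hash measure" by (rule prob_space_hash_space)
      let ?Z = "{h \<in> space hash_space. \<forall>e\<in>{1..E}. \<not> retrieval.good h xs n (?F n) (?G n) e} :: 'u hash set"
      let ?Y = "{h \<in> space hash_space. \<exists>t \<sigma>. build_run ?S k w h xs f t \<sigma> \<and>
          real t \<le> ?C * real n * max 1 (real k / real w)} :: 'u hash set"
      note Z = bad_probability[OF I(4-6), of E]
      have Y: "?Y \<in> sets hash_space" unfolding build_run_def by (rule sets_halting)
      have "space hash_space - ?Z \<subseteq> ?Y"
      proof
        fix h :: "'u hash" assume "h \<in> space hash_space - ?Z"
        then obtain e where h: "h \<in> space hash_space" and e: "1 \<le> e" "e \<le> E"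
          "retrieval.good h xs n (?F n) (?G n) e" by auto
        from build[OF ri h e(1,3)] obtain t \<sigma> where t: "build_run ?S k w h xs f t \<sigma>"
          "real t \<le> real ((14 * e + 20) * (65 * \<kappa> + 2)) * real n * max 1 (real k / real w)" by blast
        have "(14 * e + 20) * (65 * \<kappa> + 2) \<le> (14 * E + 20) * (65 * \<kappa> + 2)"
          using e(2) by (intro mult_le_mono1) simp
        then have "real ((14 * e + 20) * (65 * \<kappa> + 2)) \<le> ?C" by (rule of_nat_mono)
        then have "real ((14 * e + 20) * (65 * \<kappa> + 2)) * real n * max 1 (real k / real w)
            \<le> ?C * real n * max 1 (real k / real w)"
          by (intro mult_right_mono) (assumption, rule of_nat_0_le_iff, rule max.coboundedI1, simp)
        with t(2) have "real t \<le> ?C * real n * max 1 (real k / real w)" by (rule order_trans)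
        then show "h \<in> ?Y" using h t(1) by blast
      qed
      from finite_measure_mono[OF this Y] have "1 - measure hash_space ?Z \<le> measure hash_space ?Y"
        unfolding prob_compl[OF Z(1)] .
      moreover have "measure hash_space ?Z \<le> 1 / real n powr c"
      proof -
        have "n < 2 ^ floorlog 2 n" using floorlog_bounds[of n 2] I(2) by simp
        also have "\<dots> \<le> (32::nat) ^ floorlog 2 n" by (intro power_mono) simp_all
        finally have "real n \<le> 32 ^ floorlog 2 n"
          by (metis less_imp_le of_nat_le_iff of_nat_numeral of_nat_power)
        then have "(1/32) ^ floorlog 2 n \<le> 1 / real n"
          using I(2) by (simp add: power_divide frac_le)
        then have "((1/32) ^ floorlog 2 n) ^ E \<le> (1 / real n) ^ E" by (intro power_mono) simp_all
        also have "\<dots> = 1 / real n powr real E" using I(2) by (simp add: power_divide powr_realpow)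
        also have "\<dots> \<le> 1 / real n powr c" using I(2) E(2) by (intro divide_left_mono powr_mono) simp_all
        finally show ?thesis using Z(2) by linarith
      qed
      ultimately show "1 - 1 / real n powr c \<le> measure hash_space ?Y" by linarith
    qed
  next
    fix n k w :: nat
    assume "1 \<le> n \<and> 1 \<le> w \<and> \<gamma> * log 2 (real n) \<le> real w"
    then have n: "1 \<le> n" by blast
    define l where "l = floorlog 2 n"
    have l0: "l \<noteq> 0" unfolding l_def floorlog_eq_zero_iff using n by simp
    have "2 ^ (l - 1) \<le> n" using floorlog_bounds[of n 2] n by (simp add: l_def)
    moreover have "l - 1 < 2 ^ (l - 1)" by (rule less_exp)
    \<comment> \<open>The additional group from rounding up costs \<open>65 * l\<close> bits;
      bounding them by \<open>65 * n\<close> is what raises 65 to 130.\<close>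
    ultimately have ln: "l \<le> n" by linarith
    have "n div l * l \<le> n" by (rule div_times_less_eq_dividend)
    moreover have "(n div l + 1) * (65 * l) = 65 * (n div l * l) + 65 * l" by (simp only: algebra_simps)
    ultimately have "(n div l + 1) * (65 * l) \<le> 130 * n" using ln by linarith
    then have "space_bits ?S n k w \<le> n * k + 130 * n" by (simp add: retrieval_scheme_def l_def)
    then have "real (space_bits ?S n k w) \<le> real (n * k + 130 * n)" by (simp only: of_nat_le_iff)
    then show "real (space_bits ?S n k w) \<le> (1 + 0) * real n * real k + 130 * real n" by simp
  qed
qed

end
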